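(* Let $(\alpha,\beta)\in\mathcal A$, suppose $X\in\mathcal D(\alpha,\beta)$ and suppose that the distribution of $X$ is non-lattice. Let $\Delta>0$ be fixed and let $(\delta_n)$ be a sequence of positive numbers with $\delta_n\to0$ as $n\to\infty$. Then $$c_n\,\mathbf P\big(S_n\in[x,x+\Delta)\,\big|\,\tau^->n\big)\sim g_{\alpha,\beta}(0)\,\frac{\int_x^{x+\Delta}H(u)\,du}{n\,\mathbf P(\tau^->n)}\quad\text{as }n\to\infty,$$ uniformly in $x\in(0,\delta_nc_n]$ (that is, the supremum over $x\in(0,\delta_nc_n]$ of the absolute value of the ratio of the two sides minus $1$ tends to $0$).
   Context: $X,X_1,X_2,\dots$ are i.i.d. real random variables, $S_0=0$, $S_n=X_1+\dots+X_n$, $\tau^-=\min\{n\ge1:S_n\le0\}$, $\tau^+=\min\{n\ge1:S_n>0\}$, $\chi^+=S_{\tau^+}$, and $\chi_1^+,\chi_2^+,\dots$ are independent copies of $\chi^+$. The renewal function is $$H(u)=\mathrm I\{u>0\}+\sum_{k=1}^\infty\mathbf P(\chi_1^++\dots+\chi_k^+<u).$$ $\mathcal A=\{0<\alpha<1,|\beta|<1\}\cup\{1<\alpha<2,|\beta|\le1\}\cup\{(1,0)\}\cup\{(2,0)\}$. Let $\mu(u)=u^{-2}\int_{[-u,u]}x^2\,\mathbf P(X\in dx)$, $u>0$, and let $(c_n)_{n\ge1}$ be a non-decreasing sequence of positive real numbers with $c_n=\sup\{u>0:\mu(u)>1/n\}$ for all sufficiently large $n$. For $(\alpha,\beta)\in\mathcal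 A$, $X\in\mathcal D(\alpha,\beta)$ means that $\mathbf EX=0$ if this moment exists and that $X$ lies in the domain of attraction of the stable law with characteristic function $$G_{\alpha,\beta}(t)=\exp\Big\{-c|t|^{\alpha}\Big(1-i\beta\frac{t}{|t|}\tan\frac{\pi\alpha}{2}\Big)\Big\}$$ (the $\beta\tan$ term being $0$ when $\beta=0$), with the convention that $c>0$ is the constant for which $S_n/c_n$ converges in distribution to this law (no centering needed). $g_{\alpha,\beta}$ is the (continuous) density of this stable law. Lattice: the distribution of $X$ is lattice if its support is contained in $\{a+kh:k\in\mathbb Z\}$ for some $h>0$, $a\in[0,h)$; non-lattice otherwise. *)

theory Defs
  imports "HOL-Probability.Probability"
begin

section \<open>Random walk, first passage times and the renewal function\<close>

text \<open>The generic variable is \<open>X 0\<close>; the steps of the walk are \<open>X 1, X 2, \<dots>\<close>.\<close>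

definition walk :: "(nat \<Rightarrow> 'a \<Rightarrow> real) \<Rightarrow> nat \<Rightarrow> 'a \<Rightarrow> real" where
  "walk X n \<omega> = (\<Sum>i = 1..n. X i \<omega>)"

text \<open>In \<^typ>\<open>enat\<close>, the infimum of the empty set is \<open>\<infinity>\<close>.\<close>

definition tau_minus :: "(nat \<Rightarrow> 'a \<Rightarrow> real) \<Rightarrow> 'a \<Rightarrow> enat" where
  "tau_minus X \<omega> = Inf (enat ` {n. 1 \<le> n \<and> walk X n \<omega> \<le> 0})"

definition tau_plus :: "(nat \<Rightarrow> 'a \<Rightarrow> real) \<Rightarrow> 'a \<Rightarrow> enat" where
  "tau_plus X \<omega> = Inf (enat ` {n. 1 \<le> n \<and> walk X n \<omega> > 0})"

text \<open>The value on \<open>{tau_plus X = \<infinity>}\<close> is arbitrary; this event is null for the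
  oscillating walks considered here.\<close>

definition chi_plus :: "(nat \<Rightarrow> 'a \<Rightarrow> real) \<Rightarrow> 'a \<Rightarrow> real" where
  "chi_plus X \<omega> = walk X (the_enat (tau_plus X \<omega>)) \<omega>"

text \<open>Here \<open>\<nu>\<close> is the law of the ladder height; independent copies of the ladder height are
  the coordinates of the product space. The series starts at one summand.\<close>

definition renewal_function :: "real measure \<Rightarrow> real \<Rightarrow> real" where
  "renewal_function \<nu> u =
     (if u > 0 then 1 else 0) +
     (\<Sum>k. \<P>(y in (\<Pi>\<^sub>M i\<in>{1..Suc k}. \<nu>). (\<Sum>i = 1..Suc k. y i) < u))"


section \<open>Stable laws and domains of attraction\<close>

definition stable_params :: "(real \<times> real) set" where
  "stable_params =
     {(\<alpha>, \<beta>). 0 < \<alpha> \<and> \<alpha> < 1 \<and> \<bar>\<beta>\<bar> < 1} \<union>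
     {(\<alpha>, \<beta>). 1 < \<alpha> \<and> \<alpha> < 2 \<and> \<bar>\<beta>\<bar> \<le> 1} \<union> {(1, 0)} \<union> {(2, 0)}"

text \<open>For \<open>\<beta> = 0\<close> the skewness term vanishes, also at \<open>\<alpha> = 1\<close>.\<close>

definition stable_cf :: "real \<Rightarrow> real \<Rightarrow> real \<Rightarrow> real \<Rightarrow> complex" where
  "stable_cf \<alpha> \<beta> \<kappa> t =
     exp (- (of_real (\<kappa> * \<bar>t\<bar> powr \<alpha>) *
             (1 - \<i> * of_real (\<beta> * (t / \<bar>t\<bar>) * tan (pi * \<alpha> / 2)))))"

definition is_stable_law :: "real \<Rightarrow> real \<Rightarrow> real \<Rightarrow> real measure \<Rightarrow> bool" where
  "is_stable_law \<alpha> \<beta> \<kappa> L \<longleftrightarrow> real_distribution L \<and> char L = stable_cf \<alpha> \<beta> \<kappa>"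

definition in_domain_of_attraction ::
    "'a measure \<Rightarrow> (nat \<Rightarrow> 'a \<Rightarrow> real) \<Rightarrow> real measure \<Rightarrow> bool" where
  "in_domain_of_attraction M X L \<longleftrightarrow>
     (\<exists>a b. (\<forall>n\<ge>1. a n > 0) \<and>
        weak_conv_m (\<lambda>n. distr M borel (\<lambda>\<omega>. (walk X n \<omega> - b n) / a n)) L)"

definition truncated_moment :: "real measure \<Rightarrow> real \<Rightarrow> real" where
  "truncated_moment \<mu> u = (LINT x:{-u..u}|\<mu>. x\<^sup>2) / u\<^sup>2"

definition norming_sequence :: "real measure \<Rightarrow> (nat \<Rightarrow> real) \<Rightarrow> bool" where
  "norming_sequence \<mu> c \<longleftrightarrow>
     (\<forall>n\<ge>1. c n > 0) \<and> mono_on {1..} c \<and>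
     (\<forall>\<^sub>F n in sequentially. c n = Sup {u. u > 0 \<and> truncated_moment \<mu> u > 1 / real n})"

text \<open>The scale \<open>\<kappa>\<close> of the limit law is tied to the norming sequence \<open>c\<close> by the last
  conjunct.\<close>

definition in_class_D ::
    "'a measure \<Rightarrow> (nat \<Rightarrow> 'a \<Rightarrow> real) \<Rightarrow> (nat \<Rightarrow> real) \<Rightarrow>
     real \<Rightarrow> real \<Rightarrow> real \<Rightarrow> real measure \<Rightarrow> bool" where
  "in_class_D M X c \<alpha> \<beta> \<kappa> L \<longleftrightarrow>
     (integrable M (X 0) \<longrightarrow> integral\<^sup>L M (X 0) = 0) \<and>
     \<kappa> > 0 \<and> is_stable_law \<alpha> \<beta> \<kappa> L \<and> in_domain_of_attraction M X L \<and>
     weak_conv_m (\<lambda>n. distr M borel (\<lambda>\<omega>. walk X n \<omega> / c n)) L"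

definition is_continuous_density :: "real measure \<Rightarrow> (real \<Rightarrow> real) \<Rightarrow> bool" where
  "is_continuous_density L g \<longleftrightarrow>
     continuous_on UNIV g \<and> (\<forall>y. g y \<ge> 0) \<and> L = density lborel (\<lambda>y. ennreal (g y))"


section \<open>Lattice distributions\<close>

definition measure_support :: "real measure \<Rightarrow> real set" where
  "measure_support \<mu> = {x. \<forall>U. open U \<and> x \<in> U \<longrightarrow> emeasure \<mu> U > 0}"

definition lattice_distribution :: "real measure \<Rightarrow> bool" where
  "lattice_distribution \<mu> \<longleftrightarrow>
     (\<exists>h>0. \<exists>a\<in>{0..<h}. measure_support \<mu> \<subseteq> {a + of_int k * h | k :: int. True})"

end

theory Submission
  imports Defs
begin

text \<open>Let \<open>u\<^sub>n(B) = P(S\<^sub>n \<in> B, \<tau>\<^sup>- > n)\<close>, which by time reversal is the probability that \<open>n\<close> is a strict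
  ascending ladder epoch with height in \<open>B\<close>; hence \<open>H(z) = \<Sum>\<^sub>n u\<^sub>n((-\<infinity>, z))\<close>. Differentiating the Wiener--Hopf
  factorisation of \<open>1 / (1 - s f)\<close> in \<open>s\<close> gives
  \<open>n u\<^sub>n(B) = \<Sum>\<^sub>j\<^sub><\<^sub>n \<integral> P(S\<^sub>n\<^sub>-\<^sub>j > 0, y + S\<^sub>n\<^sub>-\<^sub>j \<in> B) u\<^sub>j(dy)\<close>.
  For \<open>B = [x, x + \<Delta>)\<close> and \<open>x = o(c\<^sub>n)\<close>, the terms with \<open>j \<le> \<epsilon> n\<close> are evaluated by the local limit theorem: the
  inner probability is close to \<open>g(0) / c\<^sub>n\<close> times the length of \<open>(y, \<infinity>) \<inter> [x, x + \<Delta>)\<close>, and summing over all \<open>j\<close>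
  turns these lengths into the integral of \<open>H\<close>. The terms with \<open>j > \<epsilon> n\<close> are negligible because of the a priori bound
  \<open>u\<^sub>n([z, z + h)) \<le> C (1 + h) H(z + h) / (n c\<^sub>n)\<close>. That bound follows by cutting a path of length \<open>n\<close> into three pieces:
  the middle one is controlled by the concentration function, the outer ones of length \<open>m\<close> contribute \<open>P(\<tau>\<^sup>- > m)\<close> and
  \<open>P(max\<^sub>k\<^sub>\<le>\<^sub>m S\<^sub>k < z + h)\<close>, and their product is at most \<open>H(z + h) / (m + 1)\<close> by the factorisation.
  The local limit theorem itself comes from convergence of characteristic functions, tested against Fejer kernels.\<close>

section \<open>Norming sequences and characteristic functions\<close>

text \<open>Two growth bounds on \<open>c\<close> replace regular variation: square-root growth from
  below, read off truncated second moments, and doubling from above, read off characteristic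
  functions. With the first, the a priori bound is summable over the time index like j^(-3/2), so
  the late part of the series for \<open>H\<close> has order (1 + z) H(z) / c n; this is where z =
  o(c n) enters. Errors must be relative to \<open>H\<close>, since the main term is an integral of
  \<open>H\<close> and x may range up to o(c n); hence the factor H(z + h) in the a priori bound and
  the use of subadditivity to compare H(x + \<Delta>) with that integral. Dividing by the main term
  requires g(0) > 0. The integral of the stable characteristic function is a half-line integral of
  Gamma type along a rotated direction, and its real part is positive because \<alpha> < 1 with
  |\<beta>| = 1 is excluded. The series over times and the series over numbers of ladder steps agree
  by iterating the renewal equation, which rests on the walk becoming positive almost
  surely.\<close>

lemma measure_abs_gt_tendsto_0:
  assumes "real_distribution F"
  shows "(\<lambda>k. measure F {x. \<bar>x\<bar> > real k}) \<longlonglongrightarrow> 0"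
proof -
  interpret real_distribution F by fact
  have "(\<lambda>k. measure F {x. \<bar>x\<bar> > real k}) \<longlonglongrightarrow> measure F (\<Inter>k. {x. \<bar>x\<bar> > real k})"
  proof (rule finite_Lim_measure_decseq)
    have "{x. \<bar>x\<bar> > real k} \<in> sets borel" for k by measurable
    then show "range (\<lambda>k. {x. \<bar>x\<bar> > real k}) \<subseteq> events" by auto
  qed (auto simp: decseq_def)
  also have "(\<Inter>k. {x. \<bar>x\<bar> > real k}) = ({} :: real set)"
  proof -
    have "\<not> (\<forall>k. \<bar>x\<bar> > real k)" for x :: real by (meson not_less real_arch_simple)
    then show ?thesis by auto
  qed
  finally show ?thesis by simp
qed

text \<open>Since \<open>c n\<close> is the last point where the truncated moment exceeds \<open>1 / n\<close>, the truncated second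
  moment at \<open>c n\<close> is exactly \<open>(c n)\<^sup>2 / n\<close>; monotonicity of the latter forces \<open>c\<close> to grow like a square root.\<close>

lemma norming_sequence_growth:
  assumes F: "real_distribution F" and norm: "norming_sequence F c"
    and nz: "\<exists>u>0. truncated_moment F u > 0"
  shows "\<exists>N. \<forall>m\<ge>N. \<forall>n\<ge>m. c m * sqrt (real n) \<le> c n * sqrt (real m)"
proof -
  interpret real_distribution F by (rule F)
  define V where "V u = (LINT x:{-u..u}|F. x\<^sup>2)" for u
  have V: "V u = (\<integral>x. indicator {-u..u} x * x\<^sup>2 \<partial>F)" for u
    by (simp add: V_def set_lebesgue_integral_def)
  have int: "integrable F (\<lambda>x. indicator {-u..u} x * x\<^sup>2)" for u :: real
  proof (rule integrable_const_bound[of _ "u\<^sup>2"])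
    show "AE x in F. norm (indicator {-u..u} x * x\<^sup>2) \<le> u\<^sup>2"
      by (auto simp: indicator_def abs_le_square_iff[symmetric])
  qed simp
  have Vmono: "V u \<le> V v" if "u \<le> v" for u v
    unfolding V using that by (intro integral_mono int) (auto simp: indicator_def)
  have tm: "truncated_moment F u = V u / u\<^sup>2" for u by (simp add: truncated_moment_def V_def)
  \<comment> \<open>Cutting at a level k beyond which \<open>F\<close> has mass below e / 2 bounds
    \<open>V u\<close> by k^2 + u^2 e / 2, and k^2 is absorbed for large u. Hence the set whose
    supremum is \<open>c n\<close> is bounded.\<close>
  have small: "\<exists>U>0. \<forall>u\<ge>U. V u / u\<^sup>2 \<le> e" if "e > 0" for e
  proof -
    have "\<forall>\<^sub>F k in sequentially. measure F {x. \<bar>x\<bar> > real k} < e / 2"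
      using measure_abs_gt_tendsto_0[OF F] that by (intro order_tendstoD) auto
    then obtain k where k: "measure F {x. \<bar>x\<bar> > real k} < e / 2" by (auto simp: eventually_sequentially)
    have ms: "{x. \<bar>x\<bar> > real k} \<in> sets F"
    proof -
      have "{x. \<bar>x\<bar> > real k} \<in> sets borel" by measurable
      then show ?thesis by simp
    qed
    define U where "U = 1 + real k * sqrt (2 / e) "
    have "U > 0" using that by (simp add: U_def add_pos_nonneg)
    moreover have "V u / u\<^sup>2 \<le> e" if "u \<ge> U" for u
    proof -
      have u: "u > 0" using that \<open>U > 0\<close> by linarith
      have "V u \<le> (\<integral>x. (real k)\<^sup>2 + u\<^sup>2 * indicator {x. \<bar>x\<bar> > real k} x \<partial>F)"
        unfolding V
      proof (intro integral_mono int)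
        show "integrable F (\<lambda>x. (real k)\<^sup>2 + u\<^sup>2 * indicator {x. \<bar>x\<bar> > real k} x)"
          using ms by (intro Bochner_Integration.integrable_add integrable_mult_right integrable_const integrable_real_indicator)
            (auto simp: emeasure_eq_measure)
        fix x
        have "x\<^sup>2 \<le> (real k)\<^sup>2" if "\<not> \<bar>x\<bar> > real k" using that by (simp add: abs_le_square_iff[symmetric])
        moreover have "x\<^sup>2 \<le> u\<^sup>2" if "x \<in> {-u..u}" using that by (simp add: abs_le_square_iff[symmetric] abs_le_iff)
        ultimately show "indicator {-u..u} x * x\<^sup>2 \<le> (real k)\<^sup>2 + u\<^sup>2 * indicator {x. \<bar>x\<bar> > real k} x"
          by (auto simp: indicator_def add_increasing2 add_increasing)
      qed
      also have "\<dots> = (real k)\<^sup>2 + u\<^sup>2 * measure F {x. \<bar>x\<bar> > real k}"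
      proof -
        have "integrable F (indicat_real {x. \<bar>x\<bar> > real k})"
          using ms by (auto intro!: integrable_real_indicator simp: emeasure_eq_measure)
        then show ?thesis using ms prob_space by (subst Bochner_Integration.integral_add) (auto simp: Int_absorb2)
      qed
      also have "\<dots> \<le> (real k)\<^sup>2 + u\<^sup>2 * (e / 2)" using k by (intro add_left_mono mult_left_mono) auto
      also have "(real k)\<^sup>2 \<le> u\<^sup>2 * (e / 2)"
      proof -
        have "real k * sqrt (2 / e) \<le> u" using that by (simp add: U_def)
        then have "(real k * sqrt (2 / e))\<^sup>2 \<le> u\<^sup>2" using \<open>e > 0\<close> by (intro power_mono) auto
        then have "(real k)\<^sup>2 * (2 / e) \<le> u\<^sup>2" using \<open>e > 0\<close> by (simp add: power_mult_distrib)
        then show ?thesis using \<open>e > 0\<close> by (simp add: field_simps)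
      qed
      finally have "V u \<le> e * u\<^sup>2" by (simp add: field_simps)
      then show ?thesis using u by (simp add: divide_le_eq)
    qed
    ultimately show ?thesis by blast
  qed
  obtain u0 where u0: "u0 > 0" "V u0 > 0" using nz by (auto simp: tm zero_less_divide_iff)
  obtain N1 where N1: "\<And>n. n \<ge> N1 \<Longrightarrow> c n = Sup {u. u > 0 \<and> truncated_moment F u > 1 / real n}"
    using norm by (auto simp: norming_sequence_def eventually_sequentially)
  \<comment> \<open>From \<open>N2\<close> on, the point \<open>u0\<close> belongs to the set that
    defines \<open>c n\<close>, so this set is nonempty.\<close>
  obtain N2 where N2: "real N2 > u0\<^sup>2 / V u0" using reals_Archimedean2 by blast
  define N where "N = max (max N1 N2) 1"
  have key: "V (c n) = (c n)\<^sup>2 / real n \<and> c n > 0" if "n \<ge> N" for n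
  proof -
    let ?A = "{u. u > 0 \<and> V u / u\<^sup>2 > 1 / real n}"
    have n: "n \<ge> 1" "n \<ge> N1" "n \<ge> N2" using that by (auto simp: N_def)
    have c: "c n = Sup ?A" using N1[OF n(2)] by (simp add: tm)
    have cpos: "c n > 0" using norm n by (simp add: norming_sequence_def)
    have "u0\<^sup>2 / V u0 < real n" using N2 n by linarith
    then have "u0 \<in> ?A" using u0 n by (simp add: field_simps)
    then have ne: "?A \<noteq> {}" by blast
    obtain U where U: "U > 0" "\<And>u. u \<ge> U \<Longrightarrow> V u / u\<^sup>2 \<le> 1 / real n" using small[of "1 / real n"] n by auto
    have bdd: "bdd_above ?A"
    proof (rule bdd_aboveI[of _ U])
      fix u assume "u \<in> ?A"
      then have "\<not> V u / u\<^sup>2 \<le> 1 / real n" by simp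
      then have "\<not> u \<ge> U" using U(2) by blast
      then show "u \<le> U" by simp
    qed
    have upper: "u \<le> c n" if "u \<in> ?A" for u unfolding c by (rule cSup_upper[OF that bdd])
    \<comment> \<open>Points to the right of \<open>c n\<close> lie outside the set. Letting u
      decrease to \<open>c n\<close> in this bound gives one half of the identity from monotonicity
      of \<open>V\<close> alone.\<close>
    have le1: "V (c n) \<le> u\<^sup>2 / real n" if "u > c n" for u
    proof -
      have "u \<notin> ?A" using upper[of u] that by auto
      then have "V u / u\<^sup>2 \<le> 1 / real n" using that cpos by simp
      then have "V u \<le> u\<^sup>2 / real n" using that cpos by (simp add: divide_le_eq)
      then show ?thesis using Vmono[of "c n" u] that by linarith
    qed
    have "V (c n) \<le> (c n)\<^sup>2 / real n"
    proof (rule tendsto_lowerbound)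
      show "((\<lambda>u. u\<^sup>2 / real n) \<longlongrightarrow> (c n)\<^sup>2 / real n) (at_right (c n))"
        by (intro tendsto_intros) (use n in auto)
      show "\<forall>\<^sub>F u in at_right (c n). V (c n) \<le> u\<^sup>2 / real n"
        using le1 by (auto simp: eventually_at_right_field intro: exI[of _ "c n + 1"])
    qed simp
    \<comment> \<open>If \<open>V (c n)\<close> were smaller, every point of the set would be at
      most sqrt (V (c n) n), which is then less than the supremum \<open>c n\<close>.\<close>
    moreover have "(c n)\<^sup>2 / real n \<le> V (c n)"
    proof (rule ccontr)
      assume "\<not> (c n)\<^sup>2 / real n \<le> V (c n)"
      then have lt: "V (c n) * real n < (c n)\<^sup>2" using n by (simp add: field_simps)
      have "c n \<le> sqrt (V (c n) * real n)" unfolding c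
      proof (rule cSup_least[OF ne])
        fix u assume u: "u \<in> ?A"
        then have u': "u > 0" "1 / real n < V u / u\<^sup>2" by auto
        then have "u\<^sup>2 < V u * real n" using n by (simp add: field_simps)
        also have "\<dots> \<le> V (c n) * real n" using Vmono[OF upper[OF u]] by (intro mult_right_mono) auto
        finally have "u \<le> sqrt (V (c n) * real n)" by (intro real_le_rsqrt) simp
        then show "u \<le> sqrt (V (Sup ?A) * real n)" unfolding c .
      qed
      moreover have "0 \<le> V (c n)" unfolding V by (intro integral_nonneg_AE) auto
      ultimately have "(c n)\<^sup>2 \<le> (sqrt (V (c n) * real n))\<^sup>2" using cpos by (intro power_mono) auto
      also have "\<dots> = V (c n) * real n" using \<open>0 \<le> V (c n)\<close> by simp
      finally show False using lt by simp
    qed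
    ultimately show ?thesis using cpos by simp
  qed
  show ?thesis
  proof (intro exI[of _ N] allI impI)
    fix m n assume m: "N \<le> m" and mn: "m \<le> n"
    have N1: "N \<ge> 1" by (simp add: N_def)
    have k: "V (c m) = (c m)\<^sup>2 / real m" "c m > 0" "V (c n) = (c n)\<^sup>2 / real n" "c n > 0"
      using key[of m] key[of n] m mn by auto
    have "c m \<le> c n" using norm m mn N1 unfolding norming_sequence_def mono_on_def by auto
    then have "(c m)\<^sup>2 / real m \<le> (c n)\<^sup>2 / real n" using Vmono k by metis
    then have "(c m)\<^sup>2 * real n \<le> (c n)\<^sup>2 * real m" using m mn N1 by (simp add: field_simps)
    then have "(c m * sqrt (real n))\<^sup>2 \<le> (c n * sqrt (real m))\<^sup>2" by (simp add: power_mult_distrib)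
    then show "c m * sqrt (real n) \<le> c n * sqrt (real m)" by (rule power2_le_imp_le) (use k in auto)
  qed
qed

text \<open>A Skorohod coupling turns weak convergence into pointwise convergence of random
  variables, and dominated convergence then copes with the moving argument. Pointwise convergence of
  characteristic functions by itself would not.\<close>

lemma char_tendsto_moving:
  assumes "\<And>n. real_distribution (\<mu> n)" "real_distribution L" and "weak_conv_m \<mu> L" and "t \<longlonglongrightarrow> t0"
  shows "(\<lambda>n. char (\<mu> n) (t n)) \<longlonglongrightarrow> char L t0"
proof -
  obtain \<Omega> :: "real measure" and Y_seq Y where ps: "prob_space \<Omega>"
    and Ym: "\<And>n. Y_seq n \<in> measurable \<Omega> borel" and Yd: "\<And>n. distr \<Omega> borel (Y_seq n) = \<mu> n"
    and Y: "Y \<in> measurable \<Omega> lborel" and YL: "distr \<Omega> borel Y = L"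
    and conv: "\<And>x. x \<in> space \<Omega> \<Longrightarrow> (\<lambda>n. Y_seq n x) \<longlonglongrightarrow> Y x"
    using Skorohod[OF assms(1-3)] by blast
  interpret prob_space \<Omega> by (rule ps)
  have [measurable]: "Y_seq n \<in> borel_measurable \<Omega>" "Y \<in> borel_measurable \<Omega>" for n using Ym Y by auto
  have "(\<lambda>n. \<integral>x. iexp (t n * Y_seq n x) \<partial>\<Omega>) \<longlonglongrightarrow> (\<integral>x. iexp (t0 * Y x) \<partial>\<Omega>)"
  proof (rule integral_dominated_convergence[where w = "\<lambda>_. 1"])
    show "AE x in \<Omega>. (\<lambda>n. iexp (t n * Y_seq n x)) \<longlonglongrightarrow> iexp (t0 * Y x)"
      by (intro AE_I2 tendsto_intros conv assms)
  qed auto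
  moreover have "char (\<mu> n) s = (\<integral>x. iexp (s * Y_seq n x) \<partial>\<Omega>)" for n s
    unfolding char_def Yd[symmetric] by (subst integral_distr) auto
  moreover have "char L s = (\<integral>x. iexp (s * Y x) \<partial>\<Omega>)" for s
    unfolding char_def YL[symmetric] by (subst integral_distr) auto
  ultimately show ?thesis by simp
qed

text \<open>A violation along indices tending to infinity would, by compactness of [-T, T], have a
  convergent subsequence of arguments, which \<open>char_tendsto_moving\<close> excludes.\<close>

lemma char_uniform_convergence:
  assumes d: "\<And>n. real_distribution (\<mu> n)" "real_distribution L" and w: "weak_conv_m \<mu> L" and "\<epsilon> > 0"
  shows "\<exists>N. \<forall>n\<ge>N. \<forall>t. \<bar>t\<bar> \<le> T \<longrightarrow> cmod (char (\<mu> n) t - char L t) < \<epsilon>"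
proof (rule ccontr)
  assume "\<not> ?thesis"
  then have "\<forall>k. \<exists>n t. n \<ge> k \<and> \<bar>t\<bar> \<le> T \<and> \<not> cmod (char (\<mu> n) t - char L t) < \<epsilon>" by blast
  then obtain n t where n: "\<And>k. n k \<ge> k" and t: "\<And>k::nat. \<bar>t k\<bar> \<le> T"
    and bad: "\<And>k. \<not> cmod (char (\<mu> (n k)) (t k) - char L (t k)) < \<epsilon>" by metis
  have "\<forall>k. t k \<in> cball 0 T" using t by (simp add: dist_real_def)
  then obtain t0 r where r: "strict_mono r" and tr: "(t \<circ> r) \<longlonglongrightarrow> t0"
    using compact_cball[of "0::real" T] unfolding compact_def by blast
  have sub: "filterlim (\<lambda>k. n (r k)) at_top sequentially"
  proof (rule filterlim_at_top_mono[OF filterlim_ident])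
    show "\<forall>\<^sub>F k in sequentially. k \<le> n (r k)"
      using n r seq_suble[OF r] by (intro always_eventually allI) (meson le_trans)
  qed
  have "weak_conv_m (\<lambda>k. \<mu> (n (r k))) L"
    using w unfolding weak_conv_m_def weak_conv_def
    by (auto intro: filterlim_compose[OF _ sub])
  then have 1: "(\<lambda>k. char (\<mu> (n (r k))) (t (r k))) \<longlonglongrightarrow> char L t0"
    using tr d by (intro char_tendsto_moving) (auto simp: o_def)
  have 2: "(\<lambda>k. char L (t (r k))) \<longlonglongrightarrow> char L t0"
    using isCont_tendsto_compose[OF real_distribution.isCont_char[OF d(2)] tr] by (simp add: o_def)
  have "(\<lambda>k. cmod (char (\<mu> (n (r k))) (t (r k)) - char L (t (r k)))) \<longlonglongrightarrow> 0"
    using tendsto_norm[OF tendsto_diff[OF 1 2]] by simp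
  then have "\<forall>\<^sub>F k in sequentially. cmod (char (\<mu> (n (r k))) (t (r k)) - char L (t (r k))) < \<epsilon>"
    using \<open>\<epsilon> > 0\<close> by (rule order_tendstoD)
  then show False using bad by (auto simp: eventually_sequentially)
qed

lemma power_le_fact_exp:
  assumes "x \<ge> (0::real)" shows "x ^ B \<le> fact B * exp x"
proof -
  have "(\<Sum>n\<in>{B}. inverse (fact n) *\<^sub>R x ^ n) \<le> (\<Sum>n. inverse (fact n) *\<^sub>R x ^ n)"
    using assms by (intro sum_le_suminf summable_exp_generic) auto
  then show ?thesis by (simp add: exp_def field_simps)
qed

text \<open>Decay over j blocks beats any power of j. The base 4 (j + 1) is the bound for 2 n / m
  that occurs in \<open>char_power_bound\<close> when the exponent contains j blocks of length
  m.\<close>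

lemma geometric_times_power_bounded:
  assumes "0 < \<rho>" "\<rho> < (1::real)"
  shows "\<exists>C>0. \<forall>j. \<rho> ^ j * (4 * (real j + 1)) ^ B \<le> C"
proof -
  define \<eta> where "\<eta> = - ln \<rho>"
  have \<eta>: "\<eta> > 0" "\<rho> = exp (- \<eta>)" using assms by (auto simp: \<eta>_def)
  have "\<rho> ^ j * (4 * (real j + 1)) ^ B \<le> (4 / \<eta>) ^ B * fact B * exp \<eta>" for j
  proof -
    have "\<rho> ^ j = exp \<eta> * exp (- (\<eta> * (real j + 1)))"
      unfolding \<eta>(2) by (simp add: exp_add[symmetric] exp_of_nat_mult[symmetric] algebra_simps)
    moreover have "(4 * (real j + 1)) ^ B = (4 / \<eta>) ^ B * (\<eta> * (real j + 1)) ^ B"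
    proof -
      have "4 * (real j + 1) = (4 / \<eta>) * (\<eta> * (real j + 1))" using \<eta> by simp
      then show ?thesis by (metis power_mult_distrib)
    qed
    moreover have "(\<eta> * (real j + 1)) ^ B \<le> fact B * exp (\<eta> * (real j + 1))"
      using \<eta> by (intro power_le_fact_exp) auto
    then have "exp (- (\<eta> * (real j + 1))) * (\<eta> * (real j + 1)) ^ B
        \<le> exp (- (\<eta> * (real j + 1))) * (fact B * exp (\<eta> * (real j + 1)))"
      by (intro mult_left_mono) auto
    then have "exp (- (\<eta> * (real j + 1))) * (\<eta> * (real j + 1)) ^ B \<le> fact B"
      by (simp only: mult.left_commute[of "exp (- (\<eta> * (real j + 1)))"] exp_add[symmetric]) simp
    then have "exp \<eta> * (4 / \<eta>) ^ B * (exp (- (\<eta> * (real j + 1))) * (\<eta> * (real j + 1)) ^ B) \<le> exp \<eta> * (4 / \<eta>) ^ B * fact B"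
      using \<eta> by (intro mult_left_mono) auto
    ultimately show ?thesis by (simp add: mult_ac)
  qed
  moreover have "(4 / \<eta>) ^ B * fact B * exp \<eta> > 0" using \<eta> by simp
  ultimately show ?thesis by blast
qed

text \<open>What the Fourier part uses of the stable limit. \<open>c_growth\<close> says that c n /
  sqrt n is eventually nondecreasing. The uniformity in \<open>char_conv\<close> matters because
  frequencies are later rescaled from one norming constant to another.\<close>

locale stable_norming = real_distribution F for F +
  fixes c :: "nat \<Rightarrow> real" and \<psi> :: "real \<Rightarrow> complex" and \<kappa> \<alpha> :: real
  assumes c_pos: "\<And>n. n \<ge> 1 \<Longrightarrow> 0 < c n"
    and c_mono: "\<And>m n. 1 \<le> m \<Longrightarrow> m \<le> n \<Longrightarrow> c m \<le> c n"
    and c_growth: "\<exists>N. \<forall>m\<ge>N. \<forall>n\<ge>m. c m * sqrt (real n) \<le> c n * sqrt (real m)"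
    and char_conv: "\<And>T \<epsilon>. \<epsilon> > 0 \<Longrightarrow> \<exists>N. \<forall>n\<ge>N. \<forall>t. \<bar>t\<bar> \<le> T \<longrightarrow> cmod (char F (t / c n) ^ n - \<psi> t) < \<epsilon>"
    and norm_\<psi>: "\<And>t. cmod (\<psi> t) = exp (- \<kappa> * \<bar>t\<bar> powr \<alpha>)"
    and \<kappa>_pos: "\<kappa> > 0" and \<alpha>_pos: "\<alpha> > 0"
    and \<psi>_cont: "\<And>t. isCont \<psi> t" and \<psi>_0: "\<psi> 0 = 1"
begin

text \<open>Below the threshold of \<open>c_growth\<close> the index m is replaced by max m M, which
  is at most M m; this costs the factor sqrt M. For n < M the factor in front of \<open>c n\<close>
  is at least 1 and monotonicity suffices.\<close>

lemma c_lower: "\<exists>C\<ge>1. \<forall>m n. 1 \<le> m \<longrightarrow> m \<le> n \<longrightarrow> c m \<le> C * sqrt (real m / real n) * c n"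
proof -
  obtain N where N: "\<And>m n. m \<ge> N \<Longrightarrow> n \<ge> m \<Longrightarrow> c m * sqrt (real n) \<le> c n * sqrt (real m)" using c_growth by blast
  define M where "M = max N 1"
  have "c m \<le> sqrt (real M) * sqrt (real m / real n) * c n" if m: "1 \<le> m" "m \<le> n" for m n
  proof -
    have "c (max m M) \<le> sqrt (real M) * sqrt (real m / real n) * c n \<or> n < M"
    proof (cases "n < M")
      case False
      let ?k = "max m M"
      have k: "N \<le> ?k" "?k \<le> n" "1 \<le> ?k" using False m by (auto simp: M_def)
      have "c ?k * sqrt (real n) \<le> c n * sqrt (real ?k)" using N k by auto
      then have "c ?k \<le> c n * sqrt (real ?k) / sqrt (real n)" using m by (simp add: field_simps)
      also have "\<dots> \<le> c n * sqrt (real M * real m) / sqrt (real n)"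
      proof (intro divide_right_mono mult_left_mono real_sqrt_le_mono)
        have "M * 1 \<le> M * m" using m by (intro mult_le_mono2) simp
        moreover have "1 * m \<le> M * m" by (intro mult_le_mono1) (simp add: M_def)
        ultimately have "?k \<le> M * m" by simp
        then show "real ?k \<le> real M * real m" unfolding of_nat_mult[symmetric] of_nat_le_iff .
        show "0 \<le> c n" using c_pos[of n] m by simp
      qed auto
      finally show ?thesis by (simp add: real_sqrt_mult real_sqrt_divide field_simps)
    qed simp
    moreover have "c m \<le> c (max m M)" using m by (intro c_mono) auto
    moreover have "c m \<le> sqrt (real M) * sqrt (real m / real n) * c n" if "n < M"
    proof -
      have "sqrt (real M) * sqrt (real m / real n) = sqrt (real M * real m / real n)" by (simp add: real_sqrt_mult real_sqrt_divide)
      also have "\<dots> \<ge> 1"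
      proof -
        have "real n \<le> real M * real m" using that m by (metis less_or_eq_imp_le mult.right_neutral mult_le_mono of_nat_le_iff of_nat_mult)
        then show ?thesis using m by simp
      qed
      finally have "1 * c n \<le> sqrt (real M) * sqrt (real m / real n) * c n" using c_pos[of n] m by (intro mult_right_mono) auto
      then show ?thesis using c_mono[of m n] m by simp
    qed
    ultimately show ?thesis by linarith
  qed
  moreover have "sqrt (real M) \<ge> 1" by (simp add: M_def)
  ultimately show ?thesis by blast
qed

lemma filterlim_c: "filterlim c at_top sequentially"
proof -
  obtain C where C: "C \<ge> 1" "\<And>m n. 1 \<le> m \<Longrightarrow> m \<le> n \<Longrightarrow> c m \<le> C * sqrt (real m / real n) * c n"
    using c_lower by blast
  have ge: "c n \<ge> c 1 / C * sqrt (real n)" if "n \<ge> 1" for n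
    using C(2)[of 1 n] that C(1) by (simp add: real_sqrt_divide field_simps)
  have lim: "filterlim (\<lambda>n. c 1 / C * sqrt (real n)) at_top sequentially"
  proof (rule filterlim_tendsto_pos_mult_at_top[OF tendsto_const])
    show "0 < c 1 / C" using c_pos[of 1] C by simp
    show "filterlim (\<lambda>n. sqrt (real n)) at_top sequentially"
      by (rule filterlim_compose[OF sqrt_at_top filterlim_real_sequentially])
  qed
  show ?thesis
  proof (rule filterlim_at_top_mono[OF lim])
    show "\<forall>\<^sub>F n in sequentially. c 1 / C * sqrt (real n) \<le> c n"
      using eventually_ge_at_top[of 1] by eventually_elim (rule ge)
  qed
qed

text \<open>If c (2 n) were much larger than c n, the n-th power of the characteristic function at 1
  / c (2 n) would be close to 1, being close to \<psi> at a small argument. Its square is close to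
  \<psi> 1, whose modulus is less than 1.\<close>

lemma c_doubling: "\<exists>K\<ge>1. \<forall>n\<ge>1. c (2 * n) \<le> K * c n"
proof -
  define q where "q = exp (- \<kappa>)"
  have q: "0 < q" "q < 1" using \<kappa>_pos by (auto simp: q_def)
  \<comment> \<open>The contradiction below reads 1 - q < 5 \<epsilon>, so any \<epsilon> up to (1 -
    q) / 5 would do.\<close>
  define \<epsilon> where "\<epsilon> = (1 - q) / 10"
  have \<epsilon>: "0 < \<epsilon>" "\<epsilon> < 1/10" using q by (auto simp: \<epsilon>_def)
  obtain N where N: "\<And>n t. n \<ge> N \<Longrightarrow> \<bar>t\<bar> \<le> 1 \<Longrightarrow> cmod (char F (t / c n) ^ n - \<psi> t) < \<epsilon>"
    using char_conv[OF \<epsilon>(1), of 1] by blast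
  have "\<psi> \<midarrow>0\<rightarrow> 1" using \<psi>_cont[of 0] \<psi>_0 by (simp add: isCont_def)
  then obtain d where d: "d > 0" "\<And>t. t \<noteq> 0 \<Longrightarrow> \<bar>t\<bar> < d \<Longrightarrow> cmod (\<psi> t - 1) < \<epsilon>"
    using \<epsilon>(1) by (fastforce dest!: LIM_D[where r = \<epsilon>])
  define \<delta> where "\<delta> = min (d / 2) 1"
  have \<delta>: "0 < \<delta>" "\<delta> \<le> 1" "\<delta> < d" using d by (auto simp: \<delta>_def)
  have big: "c (2 * n) \<le> c n / \<delta>" if n: "n \<ge> max N 1" for n
  proof (rule ccontr)
    assume neg: "\<not> c (2 * n) \<le> c n / \<delta>"
    have pos: "c n > 0" "c (2 * n) > 0" using n c_pos by auto
    define t where "t = c n / c (2 * n)"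
    have t: "0 < t" "t < \<delta>" using pos neg \<delta> by (auto simp: t_def field_simps)
    define z where "z = char F (1 / c (2 * n)) ^ n"
    have z: "z = char F (t / c n) ^ n" using pos by (simp add: z_def t_def)
    have "cmod (z - \<psi> t) < \<epsilon>" unfolding z using N[of n t] n t \<delta> by auto
    moreover have "cmod (\<psi> t - 1) < \<epsilon>" using d(2)[of t] t \<delta> by auto
    ultimately have z1: "cmod (z - 1) < 2 * \<epsilon>"
      using norm_triangle_ineq[of "z - \<psi> t" "\<psi> t - 1"] by simp
    have zle: "cmod z \<le> 1" unfolding z_def norm_power by (intro power_le_one cmod_char_le_1) auto
    have "cmod (z\<^sup>2 - 1) = cmod (z - 1) * cmod (z + 1)"
      by (simp add: norm_mult[symmetric] power2_eq_square algebra_simps)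
    also have "\<dots> \<le> (2 * \<epsilon>) * 2"
      using z1 zle \<epsilon> norm_triangle_ineq[of z 1] by (intro mult_mono) auto
    finally have "1 - cmod (z\<^sup>2) \<le> 4 * \<epsilon>"
      using norm_triangle_ineq2[of 1 "z\<^sup>2"] by (simp add: norm_minus_commute)
    moreover have "cmod (z\<^sup>2) < q + \<epsilon>"
    proof -
      have "z\<^sup>2 = char F (1 / c (2 * n)) ^ (2 * n)" by (simp add: z_def power_mult[symmetric] mult.commute)
      then have "cmod (z\<^sup>2 - \<psi> 1) < \<epsilon>" using N[of "2 * n" 1] n by auto
      moreover have "cmod (\<psi> 1) = q" by (simp add: norm_\<psi> q_def)
      ultimately show ?thesis using norm_triangle_ineq2[of "z\<^sup>2" "\<psi> 1"] by linarith
    qed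
    ultimately show False using q by (simp add: \<epsilon>_def field_simps)
  qed
  define B where "B = Max ((\<lambda>n. c (2 * n) / c n) ` {1..max N 1})"
  define K where "K = max 1 (max (1 / \<delta>) B)"
  have "c (2 * n) \<le> K * c n" if n: "n \<ge> 1" for n
  proof (cases "n \<ge> max N 1")
    case True
    have "c (2 * n) \<le> (1 / \<delta>) * c n" using big[OF True] by simp
    also have "\<dots> \<le> K * c n" using c_pos[OF n] by (intro mult_right_mono) (auto simp: K_def)
    finally show ?thesis .
  next
    case False
    then have "c (2 * n) / c n \<le> B" unfolding B_def using n by (intro Max_ge) auto
    also have "\<dots> \<le> K" by (simp add: K_def)
    finally show ?thesis using c_pos[OF n] by (simp add: field_simps)
  qed
  moreover have "K \<ge> 1" by (simp add: K_def)
  ultimately show ?thesis by blast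
qed

text \<open>Iterated doubling, in the place of a Potter bound. With K \<le> 2^A, the least i such
  that n \<le> 2^i m satisfies 2^i \<le> 2 n / m, and K^i is at most (2^i)^A.\<close>

lemma c_upper: "\<exists>A. \<forall>m n. 1 \<le> m \<longrightarrow> m \<le> n \<longrightarrow> c n \<le> (2 * real n / real m) ^ A * c m"
proof -
  obtain K where K: "K \<ge> 1" "\<And>n. n \<ge> 1 \<Longrightarrow> c (2 * n) \<le> K * c n" using c_doubling by blast
  obtain A :: nat where A: "K \<le> 2 ^ A" using real_arch_pow[of 2 K] by (auto intro: less_imp_le)
  have pow: "c (2 ^ i * m) \<le> K ^ i * c m" if "m \<ge> 1" for i m
  proof (induction i)
    case (Suc i)
    have "c (2 ^ Suc i * m) = c (2 * (2 ^ i * m))" by (simp add: mult.assoc)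
    also have "\<dots> \<le> K * c (2 ^ i * m)" using that by (intro K) auto
    also have "\<dots> \<le> K * (K ^ i * c m)" using Suc K by (intro mult_left_mono) auto
    finally show ?case by (simp add: mult_ac)
  qed simp
  have "c n \<le> (2 * real n / real m) ^ A * c m" if m: "1 \<le> m" "m \<le> n" for m n
  proof -
    have ex: "\<exists>i. n \<le> 2 ^ i * m"
    proof -
      have "n \<le> 2 ^ n" by (simp add: less_imp_le)
      also have "\<dots> \<le> 2 ^ n * m" using m by simp
      finally show ?thesis by blast
    qed
    define i where "i = (LEAST i. n \<le> 2 ^ i * m)"
    have i: "n \<le> 2 ^ i * m" unfolding i_def using ex by (rule LeastI_ex)
    have le: "2 ^ i * m \<le> 2 * n"
    proof (cases i)
      case 0 then show ?thesis using m by simp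
    next
      case (Suc j)
      then have "\<not> n \<le> 2 ^ j * m" using not_less_Least[of j "\<lambda>i. n \<le> 2 ^ i * m"] by (simp add: i_def)
      then show ?thesis using Suc by simp
    qed
    then have "real (2 ^ i * m) \<le> real (2 * n)" by (rule of_nat_mono)
    then have le': "2 ^ i \<le> 2 * real n / real m" using m by (simp add: field_simps)
    have "c n \<le> c (2 ^ i * m)" using i m by (intro c_mono) auto
    also have "\<dots> \<le> K ^ i * c m" by (rule pow) (use m in simp)
    also have "\<dots> \<le> (2 ^ A) ^ i * c m" using A K c_pos[OF m(1)] by (intro mult_right_mono power_mono) auto
    also have "(2 ^ A) ^ i = ((2::real) ^ i) ^ A" by (simp add: power_mult[symmetric] mult.commute)
    also have "\<dots> * c m \<le> (2 * real n / real m) ^ A * c m"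
      using le' c_pos[OF m(1)] by (intro mult_right_mono power_mono) auto
    finally show ?thesis .
  qed
  then show ?thesis by blast
qed

text \<open>A frequency \<open>s\<close> is compared with the scale \<open>m\<close> for which \<open>c m \<le> 1 / s < c (m + 1)\<close>: there
  \<open>|\<phi>(s)|\<^sup>m\<close> stays away from 1 by the convergence of characteristic functions, so no regular variation is needed.\<close>

lemma char_power_bound:
  "\<exists>C>0. \<exists>N\<ge>1. \<exists>s0>0. \<forall>n\<ge>N. \<forall>m. \<forall>s. n \<le> 2 * m \<longrightarrow> \<bar>s\<bar> \<le> s0 \<longrightarrow> cmod (char F s) ^ m \<le> C / (1 + (s * c n)\<^sup>2)"
proof -
  obtain K where K: "K \<ge> 1" "\<And>n. n \<ge> 1 \<Longrightarrow> c (2 * n) \<le> K * c n" using c_doubling by blast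
  obtain A where A: "\<And>m n. 1 \<le> m \<Longrightarrow> m \<le> n \<Longrightarrow> c n \<le> (2 * real n / real m) ^ A * c m" using c_upper by blast
  obtain N1 where N1: "\<And>m n. m \<ge> N1 \<Longrightarrow> n \<ge> m \<Longrightarrow> c m * sqrt (real n) \<le> c n * sqrt (real m)" using c_growth by blast
  \<comment> \<open>\<open>q\<close> bounds the modulus of \<psi> on [1/K, 1], the range into which
    s c m will fall. Half of the gap 1 - q is reserved for the convergence error.\<close>
  define q where "q = exp (- \<kappa> * (1 / K) powr \<alpha>)"
  have q: "0 < q" "q < 1" using \<kappa>_pos K by (auto simp: q_def)
  define \<rho> where "\<rho> = (1 + q) / 2"
  have \<rho>: "0 < \<rho>" "\<rho> < 1" using q by (auto simp: \<rho>_def)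
  obtain N2 where N2: "\<And>n t. n \<ge> N2 \<Longrightarrow> \<bar>t\<bar> \<le> 1 \<Longrightarrow> cmod (char F (t / c n) ^ n - \<psi> t) < (1 - q) / 2"
    using char_conv[of "(1 - q) / 2" 1] q by auto
  define N where "N = max 1 (max N1 N2)"
  have near: "cmod (char F (t / c m)) ^ m \<le> \<rho>" if "m \<ge> N" "1 / K \<le> t" "t \<le> 1" for m t
  proof -
    have t: "t > 0" using that K by (meson less_le_trans zero_less_divide_1_iff zero_less_one)
    have "cmod (char F (t / c m) ^ m - \<psi> t) < (1 - q) / 2" using N2[of m t] that t by (auto simp: N_def)
    then have "cmod (char F (t / c m) ^ m) < cmod (\<psi> t) + (1 - q) / 2"
      using norm_triangle_ineq2[of "char F (t / c m) ^ m" "\<psi> t"] by linarith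
    also have "cmod (\<psi> t) \<le> q"
      unfolding norm_\<psi> q_def using that t \<kappa>_pos \<alpha>_pos K by (auto intro!: powr_mono2)
    finally show ?thesis by (simp add: norm_power \<rho>_def field_simps)
  qed
  obtain C1 where C1: "C1 > 0" "\<And>j. \<rho> ^ j * (4 * (real j + 1)) ^ (2 * A) \<le> C1"
    using geometric_times_power_bounded[OF \<rho>, of "2 * A"] by blast
  have tail: "cmod (char F s) ^ m' * (s * c n)\<^sup>2 \<le> C1"
    if s: "0 < s" "s \<le> 1 / c N" and n: "n \<ge> N" "n \<le> 2 * m'" and sc: "1 \<le> s * c n" for s n m'
  proof -
    have cN: "c N > 0" using c_pos by (simp add: N_def)
    let ?S = "{k. k \<ge> N \<and> c k \<le> 1 / s}"
    have "\<forall>\<^sub>F k in sequentially. c k > 1 / s" using filterlim_c by (simp add: filterlim_at_top_dense)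
    then obtain k0 where k0: "\<And>k. k \<ge> k0 \<Longrightarrow> c k > 1 / s" by (auto simp: eventually_sequentially)
    have fin: "finite ?S"
    proof (rule finite_subset)
      show "?S \<subseteq> {..<k0}" using k0 by (auto simp: not_le[symmetric])
    qed simp
    have NS: "N \<in> ?S" using s cN by (simp add: field_simps)
    define m where "m = Max ?S"
    have mS: "m \<in> ?S" unfolding m_def using fin NS by (intro Max_in) auto
    then have m: "m \<ge> N" "c m \<le> 1 / s" by auto
    have m1: "m \<ge> 1" using m by (simp add: N_def)
    have "Suc m \<notin> ?S" using Max_ge[OF fin, of "Suc m"] unfolding m_def[symmetric] by auto
    \<comment> \<open>Doubling bridges the step from m to m + 1: the product s c m lies in (1/K, 1],
      where \<open>near\<close> applies.\<close>
    then have "1 / s < c (Suc m)" using m by auto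
    also have "\<dots> \<le> c (2 * m)" using m1 by (intro c_mono) auto
    also have "\<dots> \<le> K * c m" by (rule K(2)[OF m1])
    finally have sK: "1 / s < K * c m" .
    have cm: "c m > 0" using c_pos m1 by simp
    have r: "cmod (char F s) ^ m \<le> \<rho>"
      using near[of m "s * c m"] m s sK K cm by (simp add: field_simps)
    \<comment> \<open>Monotonicity alone would allow c n = c m with n < m; the square-root growth
      rules this out.\<close>
    have mn: "m \<le> n"
    proof (rule ccontr)
      assume "\<not> m \<le> n"
      then have nm: "n < m" by simp
      have n1: "n \<ge> N1" "n \<ge> 1" using n by (auto simp: N_def)
      have "c m \<le> c n"
      proof -
        have "1 / s \<le> c n" using sc s by (simp add: field_simps)
        then show ?thesis using m(2) by linarith
      qed
      moreover have "c n * sqrt (real m) \<le> c m * sqrt (real n)" using N1 n1 nm by simp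
      moreover have "c m * sqrt (real n) \<le> c n * sqrt (real n)" using \<open>c m \<le> c n\<close> by (intro mult_right_mono) auto
      ultimately have "c n * sqrt (real m) \<le> c n * sqrt (real n)" by linarith
      then show False using c_pos[OF n1(2)] nm by simp
    qed
    \<comment> \<open>The exponent contains j complete blocks of length m, each of which contributes
      a factor \<rho>.\<close>
    define j where "j = m' div m"
    have jm: "j * m \<le> m'" "m' < (j + 1) * m" using m1 by (auto simp: j_def dividend_less_div_times)
    have "cmod (char F s) ^ m' \<le> cmod (char F s) ^ (m * j)"
      using jm by (intro power_decreasing cmod_char_le_1) (auto simp: mult.commute)
    also have "\<dots> \<le> \<rho> ^ j" unfolding power_mult using r by (intro power_mono) auto
    finally have 1: "cmod (char F s) ^ m' \<le> \<rho> ^ j" .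
    have "n \<le> 2 * ((j + 1) * m)" using n(2) jm(2) by linarith
    then have "real n \<le> real (2 * ((j + 1) * m))" by (rule of_nat_mono)
    then have "2 * real n / real m \<le> 4 * (real j + 1)" using m1 by (simp add: field_simps)
    moreover have "s * c n \<le> (2 * real n / real m) ^ A"
    proof -
      have "c n \<le> (2 * real n / real m) ^ A * c m" by (rule A[OF m1 mn])
      also have "\<dots> \<le> (2 * real n / real m) ^ A * (1 / s)" using m by (intro mult_left_mono) auto
      finally have "s * c n \<le> s * ((2 * real n / real m) ^ A * (1 / s))" using s by (intro mult_left_mono) auto
      then show ?thesis using s by simp
    qed
    ultimately have "s * c n \<le> (4 * (real j + 1)) ^ A"
      by (meson order_trans power_mono divide_nonneg_nonneg of_nat_0_le_iff mult_nonneg_nonneg zero_le_numeral)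
    then have "(s * c n)\<^sup>2 \<le> ((4 * (real j + 1)) ^ A)\<^sup>2" using sc by (intro power_mono) auto
    then have 2: "(s * c n)\<^sup>2 \<le> (4 * (real j + 1)) ^ (2 * A)" by (simp add: power_mult[symmetric] mult.commute)
    have "cmod (char F s) ^ m' * (s * c n)\<^sup>2 \<le> \<rho> ^ j * (4 * (real j + 1)) ^ (2 * A)"
      using 1 2 \<rho> by (intro mult_mono) auto
    then show ?thesis using C1(2)[of j] by linarith
  qed
  have cnj: "cmod (char F (- s)) = cmod (char F s)" for s
  proof -
    have "char F (- s) = cnj (char F s)"
      unfolding char_def by (subst Bochner_Integration.integral_cnj[symmetric]) (auto intro!: Bochner_Integration.integral_cong simp: exp_cnj)
    then show ?thesis by simp
  qed
  have main: "cmod (char F s) ^ m' \<le> (2 + C1) / (1 + (s * c n)\<^sup>2)"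
    if s: "0 \<le> s" "s \<le> 1 / c N" and n: "n \<ge> N" "n \<le> 2 * m'" for s n m'
  proof -
    have le1: "cmod (char F s) ^ m' \<le> 1" by (intro power_le_one cmod_char_le_1) auto
    have "cmod (char F s) ^ m' * (1 + (s * c n)\<^sup>2) \<le> 2 + C1"
    proof (cases "1 \<le> s * c n")
      case True
      then have "s \<noteq> 0" by auto
      then show ?thesis using tail[of s n m'] s n True le1 by (simp add: distrib_left)
    next
      case False
      have "0 \<le> s * c n" using s c_pos[of n] n by (simp add: N_def)
      then have "(s * c n)\<^sup>2 \<le> 1" using False by (simp add: power_le_one)
      then have "cmod (char F s) ^ m' * (1 + (s * c n)\<^sup>2) \<le> 1 * 2" using le1 by (intro mult_mono) auto
      then show ?thesis using C1 by simp
    qed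
    then show ?thesis by (simp add: pos_le_divide_eq add_pos_nonneg)
  qed
  show ?thesis
  proof (rule exI[of _ "2 + C1"], rule conjI)
    show "0 < 2 + C1" using C1 by simp
    show "\<exists>N\<ge>1. \<exists>s0>0. \<forall>n\<ge>N. \<forall>m. \<forall>s. n \<le> 2 * m \<longrightarrow> \<bar>s\<bar> \<le> s0 \<longrightarrow> cmod (char F s) ^ m \<le> (2 + C1) / (1 + (s * c n)\<^sup>2)"
    proof (rule exI[of _ N], rule conjI)
      show "1 \<le> N" by (simp add: N_def)
      show "\<exists>s0>0. \<forall>n\<ge>N. \<forall>m. \<forall>s. n \<le> 2 * m \<longrightarrow> \<bar>s\<bar> \<le> s0 \<longrightarrow> cmod (char F s) ^ m \<le> (2 + C1) / (1 + (s * c n)\<^sup>2)"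
      proof (intro exI[of _ "1 / c N"] conjI allI impI)
        show "0 < 1 / c N" using c_pos by (simp add: N_def)
        fix n m s assume a: "N \<le> n" "n \<le> 2 * m" "\<bar>s\<bar> \<le> 1 / c N"
        show "cmod (char F s) ^ m \<le> (2 + C1) / (1 + (s * c n)\<^sup>2)"
          using main[of "\<bar>s\<bar>" n m] a cnj[of s] by (cases "s \<ge> 0") (auto simp: power_mult_distrib)
      qed
    qed
  qed
qed

end

section \<open>The Fejer kernel\<close>

definition tri :: "real \<Rightarrow> real" where
  "tri t = max 0 (1 - \<bar>t\<bar>)"

text \<open>This is the square of sin (x / 2) / (x / 2), the Fourier transform of
  \<open>tri\<close>; the value at 0 is its continuous extension.\<close>

definition fejer :: "real \<Rightarrow> real" where
  "fejer x = (if x = 0 then 1 else 2 * (1 - cos x) / x\<^sup>2)"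

lemma tri_bounds: "0 \<le> tri t" "tri t \<le> 1" "tri t \<le> indicator {-1..1} t" "\<bar>tri t\<bar> \<le> 1"
  by (auto simp: tri_def indicator_def)

lemma tri_outside: "t \<notin> {-1..1} \<Longrightarrow> tri t = 0"
  by (auto simp: tri_def)

lemma isCont_tri: "isCont tri t"
  unfolding tri_def[abs_def] by (intro continuous_intros)

lemma tri_measurable [measurable]: "tri \<in> borel_measurable borel"
  unfolding tri_def[abs_def] by measurable

lemma fejer_measurable [measurable]: "fejer \<in> borel_measurable borel"
  unfolding fejer_def[abs_def] by measurable

lemma fejer_nonneg: "fejer x \<ge> 0"
  by (simp add: fejer_def)

lemma integrable_tri_times:
  fixes f :: "real \<Rightarrow> complex"
  assumes [measurable]: "f \<in> borel_measurable borel" and "\<And>t. cmod (f t) \<le> B"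
  shows "integrable lborel (\<lambda>t. of_real (tri t) * f t)"
proof (rule Bochner_Integration.integrable_bound[of _ "\<lambda>t. B * indicator {-1..1::real} t"])
  show "AE t in lborel. cmod (of_real (tri t) * f t) \<le> norm (B * indicator {-1..1::real} t)"
  proof (rule AE_I2)
    fix t
    have "cmod (of_real (tri t) * f t) \<le> indicator {-1..1} t * B"
      unfolding norm_mult norm_of_real using assms(2)[of t] tri_bounds[of t] by (intro mult_mono) auto
    also have "indicator {-1..1} t * B = B * indicator {-1..1::real} t" by (rule mult.commute)
    also have "\<dots> \<le> norm (B * indicator {-1..1::real} t)" by (simp only: real_norm_def abs_ge_self)
    finally show "cmod (of_real (tri t) * f t) \<le> norm (B * indicator {-1..1::real} t)" .
  qed
qed (auto intro!: integrable_mult_right integrable_real_indicator)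

lemma fejer_has_integral:
  "((\<lambda>t. of_real (tri t) * iexp (t * x)) has_integral of_real (fejer x)) {-1..1}"
proof (cases "x = 0")
  case True
  have 1: "((\<lambda>t. 1 - t) has_integral (1 - 1\<^sup>2 / 2) - (0 - 0\<^sup>2 / 2)) {0..1::real}"
    by (rule fundamental_theorem_of_calculus)
       (auto intro!: derivative_eq_intros simp: has_real_derivative_iff_has_vector_derivative[symmetric])
  have 2: "((\<lambda>t. 1 + t) has_integral (0 + 0\<^sup>2 / 2) - (-1 + (-1)\<^sup>2 / 2)) {-1..0::real}"
    by (rule fundamental_theorem_of_calculus)
       (auto intro!: derivative_eq_intros simp: has_real_derivative_iff_has_vector_derivative[symmetric])
  have 1: "(tri has_integral 1/2) {0..1}" by (rule has_integral_eq[OF _ 1, simplified]) (auto simp: tri_def)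
  have 2: "(tri has_integral 1/2) {-1..0}" by (rule has_integral_eq[OF _ 2, simplified]) (auto simp: tri_def)
  have "(tri has_integral 1/2 + 1/2) {-1..1}" by (rule has_integral_combine[OF _ _ 2 1]) auto
  then have "((\<lambda>t. of_real (tri t)) has_integral (of_real 1 :: complex)) {-1..1}"
    using has_integral_of_real[of tri 1 "{-1..1}", where 'b = complex] by simp
  then show ?thesis using True by (simp add: fejer_def)
next
  case x: False
  let ?E = "\<lambda>t. iexp (t * x)" and ?w = "\<i> * of_real x"
  have E': "(?E has_vector_derivative ?w * ?E t) (at t within S)" for t S
  proof -
    have "((\<lambda>z. exp (?w * z)) has_field_derivative exp (?w * of_real t) * ?w) (at (of_real t))"
      by (auto intro!: derivative_eq_intros)
    then have "((\<lambda>t. exp (?w * of_real t)) has_vector_derivative exp (?w * of_real t) * ?w) (at t)"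
      by (rule has_vector_derivative_real_field)
    then show ?thesis by (auto simp: mult_ac intro: has_vector_derivative_at_within)
  qed
  have w0: "?w \<noteq> 0" using x by simp
  \<comment> \<open>One integration by parts, with w = i x, produces the antiderivative (1 - t) E /
    w + E / w^2. The other half-line has the analogous one with the sign of the last term
    changed.\<close>
  have 1: "((\<lambda>t. (1 - of_real t) * ?E t) has_integral
      ((1 - of_real 1) * ?E 1 / ?w + ?E 1 / ?w\<^sup>2) - ((1 - of_real 0) * ?E 0 / ?w + ?E 0 / ?w\<^sup>2)) {0..1}"
  proof (rule fundamental_theorem_of_calculus)
    fix t :: real
    have "((\<lambda>t. (1 - of_real t) * ?E t / ?w + ?E t / ?w\<^sup>2) has_vector_derivative
       ((1 - of_real t) * (?w * ?E t) + (0 - of_real 1) * ?E t) / ?w + (?w * ?E t) / ?w\<^sup>2) (at t within {0..1})"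
      by (intro derivative_intros E')
    also have "((1 - of_real t) * (?w * ?E t) + (0 - of_real 1) * ?E t) / ?w + (?w * ?E t) / ?w\<^sup>2 = (1 - of_real t) * ?E t"
      using w0 by (simp add: divide_simps power2_eq_square; simp add: algebra_simps)
    finally show "((\<lambda>t. (1 - of_real t) * ?E t / ?w + ?E t / ?w\<^sup>2) has_vector_derivative (1 - of_real t) * ?E t) (at t within {0..1})" .
  qed simp
  have 2: "((\<lambda>t. (1 + of_real t) * ?E t) has_integral
      ((1 + of_real 0) * ?E 0 / ?w - ?E 0 / ?w\<^sup>2) - ((1 + of_real (-1)) * ?E (-1) / ?w - ?E (-1) / ?w\<^sup>2)) {-1..0}"
  proof (rule fundamental_theorem_of_calculus)
    fix t :: real
    have "((\<lambda>t. (1 + of_real t) * ?E t / ?w - ?E t / ?w\<^sup>2) has_vector_derivative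
       ((1 + of_real t) * (?w * ?E t) + (0 + of_real 1) * ?E t) / ?w - (?w * ?E t) / ?w\<^sup>2) (at t within {-1..0})"
      by (intro derivative_intros E')
    also have "((1 + of_real t) * (?w * ?E t) + (0 + of_real 1) * ?E t) / ?w - (?w * ?E t) / ?w\<^sup>2 = (1 + of_real t) * ?E t"
      using w0 by (simp add: divide_simps power2_eq_square; simp add: algebra_simps)
    finally show "((\<lambda>t. (1 + of_real t) * ?E t / ?w - ?E t / ?w\<^sup>2) has_vector_derivative (1 + of_real t) * ?E t) (at t within {-1..0})" .
  qed simp
  have 1: "((\<lambda>t. of_real (tri t) * ?E t) has_integral
      ((1 - of_real 1) * ?E 1 / ?w + ?E 1 / ?w\<^sup>2) - ((1 - of_real 0) * ?E 0 / ?w + ?E 0 / ?w\<^sup>2)) {0..1}"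
    by (rule has_integral_eq[OF _ 1]) (auto simp: tri_def)
  have 2: "((\<lambda>t. of_real (tri t) * ?E t) has_integral
      ((1 + of_real 0) * ?E 0 / ?w - ?E 0 / ?w\<^sup>2) - ((1 + of_real (-1)) * ?E (-1) / ?w - ?E (-1) / ?w\<^sup>2)) {-1..0}"
    by (rule has_integral_eq[OF _ 2]) (auto simp: tri_def)
  have val: "((1 + of_real 0) * ?E 0 / ?w - ?E 0 / ?w\<^sup>2) - ((1 + of_real (-1)) * ?E (-1) / ?w - ?E (-1) / ?w\<^sup>2)
     + (((1 - of_real 1) * ?E 1 / ?w + ?E 1 / ?w\<^sup>2) - ((1 - of_real 0) * ?E 0 / ?w + ?E 0 / ?w\<^sup>2)) = of_real (fejer x)"
  proof -
    have "?E 1 + ?E (-1) = 2 * of_real (cos x)"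
      by (simp add: Re_exp Im_exp complex_eq_iff)
    then have "?E (-1) = 2 * of_real (cos x) - ?E 1" by (simp add: algebra_simps)
    then show ?thesis using x by (simp add: fejer_def power_mult_distrib divide_simps; simp add: algebra_simps)
  qed
  show ?thesis
    using has_integral_combine[OF _ _ 2 1] unfolding val by simp
qed

lemma fejer_eq_integral: "(\<integral>t. of_real (tri t) * iexp (t * x) \<partial>lborel) = of_real (fejer x)"
proof -
  have int: "integrable lborel (\<lambda>t. of_real (tri t) * iexp (t * x))"
    by (rule integrable_tri_times[of _ 1]) auto
  have "((\<lambda>t. of_real (tri t) * iexp (t * x)) has_integral of_real (fejer x)) UNIV"
    by (rule has_integral_on_superset[OF fejer_has_integral]) (auto simp: tri_outside)
  moreover have "((\<lambda>t. of_real (tri t) * iexp (t * x)) has_integral (\<integral>t. of_real (tri t) * iexp (t * x) \<partial>lborel)) UNIV"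
    by (rule has_integral_integral_lborel[OF int])
  ultimately show ?thesis by (rule has_integral_unique[symmetric])
qed

lemma integral_tri: "(\<integral>t. tri t \<partial>lborel) = 1"
proof -
  have "complex_of_real (\<integral>t. tri t \<partial>lborel) = 1"
    using fejer_eq_integral[of 0] by (simp add: fejer_def)
  then show ?thesis using of_real_eq_1_iff by blast
qed

lemma integrable_tri: "integrable lborel tri"
proof (rule Bochner_Integration.integrable_bound[of _ "\<lambda>t. indicator {-1..1::real} t"])
  show "AE t in lborel. norm (tri t) \<le> norm (indicator {-1..1::real} t :: real)"
    using tri_bounds by (auto simp: abs_of_nonneg)
qed (auto intro!: integrable_real_indicator)

lemma fejer_le_1: "fejer x \<le> 1"
proof -
  have "\<bar>fejer x\<bar> = cmod (\<integral>t. of_real (tri t) * iexp (t * x) \<partial>lborel)" by (simp only: fejer_eq_integral norm_of_real Re_complex_of_real)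
  also have "\<dots> \<le> (\<integral>t. cmod (of_real (tri t) * iexp (t * x)) \<partial>lborel)" by (rule integral_norm_bound)
  also have "\<dots> = 1" by (simp add: norm_mult integral_tri tri_bounds)
  finally show ?thesis by simp
qed

lemma fejer_eq_integral_cos: "(\<integral>t. tri t * cos (t * x) \<partial>lborel) = fejer x"
proof -
  have int: "integrable lborel (\<lambda>t. of_real (tri t) * iexp (t * x))"
    by (rule integrable_tri_times[of _ 1]) auto
  have "fejer x = Re (\<integral>t. of_real (tri t) * iexp (t * x) \<partial>lborel)" by (simp only: fejer_eq_integral norm_of_real Re_complex_of_real)
  also have "\<dots> = (\<integral>t. Re (of_real (tri t) * iexp (t * x)) \<partial>lborel)" by (rule integral_Re[OF int, symmetric])
  also have "\<dots> = (\<integral>t. tri t * cos (t * x) \<partial>lborel)" by (simp add: Re_exp)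
  finally show ?thesis by simp
qed

text \<open>The kernel is the average of cos (t x) with weight \<open>tri\<close>, and |t x| \<le> 1
  there. The resulting positive constant lets an indicator be dominated by the kernel, and lets the
  kernel be divided out on a bounded window.\<close>

lemma fejer_ge_cos_1: 
  assumes "\<bar>x\<bar> \<le> 1" shows "fejer x \<ge> cos 1"
proof -
  have i: "integrable lborel (\<lambda>t. tri t * cos (t * x))"
    by (rule Bochner_Integration.integrable_bound[OF integrable_tri])
       (auto simp: abs_mult intro!: AE_I2 mult_left_le)
  have "cos 1 = (\<integral>t. tri t * cos 1 \<partial>lborel)" by (simp add: integral_tri)
  also have "\<dots> \<le> (\<integral>t. tri t * cos (t * x) \<partial>lborel)"
  proof (rule integral_mono)
    fix t
    show "tri t * cos 1 \<le> tri t * cos (t * x)"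
    proof (cases "t \<in> {-1..1}")
      case True
      then have "\<bar>t * x\<bar> \<le> 1 * 1" unfolding abs_mult using assms by (intro mult_mono) auto
      then have "cos 1 \<le> cos \<bar>t * x\<bar>" by (intro cos_monotone_0_pi_le) (use pi_gt3 in auto)
      then have "cos 1 \<le> cos (t * x)" by (simp add: abs_if split: if_splits)
      then show ?thesis using tri_bounds by (intro mult_left_mono) auto
    qed (simp add: tri_outside)
  qed (use i integrable_tri in auto)
  finally show ?thesis by (simp add: fejer_eq_integral_cos)
qed

lemma cos_1_pos: "cos 1 > (0::real)"
  by (rule cos_gt_zero) (use pi_gt3 in auto)

text \<open>Fubini moves the kernel to the Fourier side. As \<open>tri\<close> has compact support,
  only frequencies within |a| of \<theta> matter; a sets the window width and \<theta> is a
  modulation.\<close>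

lemma fejer_char:
  assumes "real_distribution \<mu>"
  shows "(\<integral>x. of_real (fejer (a * x)) * iexp (\<theta> * x) \<partial>\<mu>) = (\<integral>t. of_real (tri t) * char \<mu> (a * t + \<theta>) \<partial>lborel)"
proof -
  interpret \<mu>: real_distribution \<mu> by fact
  interpret P: pair_sigma_finite \<mu> lborel ..
  let ?f = "\<lambda>x t. of_real (tri t) * iexp ((a * t + \<theta>) * x)"
  have m [measurable]: "(\<lambda>(x, t). ?f x t) \<in> borel_measurable (\<mu> \<Otimes>\<^sub>M lborel)" by measurable
  have int: "integrable (\<mu> \<Otimes>\<^sub>M lborel) (\<lambda>(x, t). ?f x t)"
  proof (rule P.Fubini_integrable)
    have "(\<lambda>x. \<integral>t. cmod (?f x t) \<partial>lborel) = (\<lambda>_. 1)" by (simp add: norm_mult integral_tri tri_bounds)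
    then show "integrable \<mu> (\<lambda>x. \<integral>t. norm (case (x, t) of (x, t) \<Rightarrow> ?f x t) \<partial>lborel)" by simp
    show "AE x in \<mu>. integrable lborel (\<lambda>t. case (x, t) of (x, t) \<Rightarrow> ?f x t)"
      by (auto intro!: AE_I2 integrable_tri_times[of _ 1])
  qed (rule m)
  have "(\<integral>x. of_real (fejer (a * x)) * iexp (\<theta> * x) \<partial>\<mu>) = (\<integral>x. (\<integral>t. ?f x t \<partial>lborel) \<partial>\<mu>)"
  proof (intro Bochner_Integration.integral_cong refl)
    fix x
    have "of_real (fejer (a * x)) * iexp (\<theta> * x) = (\<integral>t. of_real (tri t) * iexp (t * (a * x)) \<partial>lborel) * iexp (\<theta> * x)"
      by (simp only: fejer_eq_integral)
    also have "\<dots> = (\<integral>t. of_real (tri t) * iexp (t * (a * x)) * iexp (\<theta> * x) \<partial>lborel)" by simp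
    also have "\<dots> = (\<integral>t. ?f x t \<partial>lborel)"
      by (intro Bochner_Integration.integral_cong refl) (simp add: mult.assoc exp_add[symmetric] algebra_simps)
    finally show "of_real (fejer (a * x)) * iexp (\<theta> * x) = (\<integral>t. ?f x t \<partial>lborel)" .
  qed
  also have "\<dots> = (\<integral>t. (\<integral>x. ?f x t \<partial>\<mu>) \<partial>lborel)"
    by (rule P.Fubini_integral[OF int, symmetric])
  also have "\<dots> = (\<integral>t. of_real (tri t) * char \<mu> (a * t + \<theta>) \<partial>lborel)" by (simp add: char_def)
  finally show ?thesis .
qed

lemma integrable_inverse_1_plus_square_lborel: "integrable lborel (\<lambda>x::real. 1 / (1 + x\<^sup>2))"
  using integrable_inverse_1_plus_square by (simp add: set_integrable_def inverse_eq_divide)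

lemma fejer_le: "fejer x \<le> 8 / (1 + x\<^sup>2)"
proof (cases "x\<^sup>2 \<le> 1")
  case True
  then have "1 \<le> 8 / (1 + x\<^sup>2)" by (simp add: pos_le_divide_eq add_pos_nonneg)
  then show ?thesis using fejer_le_1[of x] by linarith
next
  case False
  then have x: "x \<noteq> 0" by auto
  have "fejer x \<le> 4 / x\<^sup>2"
  proof -
    have "2 * (1 - cos x) \<le> 2 * (1 - (- 1))" by (intro mult_left_mono diff_left_mono cos_ge_minus_one) simp
    then have "2 * (1 - cos x) \<le> 4" by simp
    then show ?thesis unfolding fejer_def using x by (auto simp del: right_diff_distrib_numeral intro!: divide_right_mono)
  qed
  also have "\<dots> \<le> 8 / (1 + x\<^sup>2)" using False x by (simp add: field_simps add_pos_nonneg)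
  finally show ?thesis .
qed

lemma integrable_fejer: "integrable lborel fejer"
  by (rule Bochner_Integration.integrable_bound[OF integrable_mult_right[OF integrable_inverse_1_plus_square_lborel, of 8]])
     (auto simp: fejer_nonneg intro!: AE_I2 order_trans[OF fejer_le])

text \<open>The Fourier transform of the Fejer kernel is found by testing the previous identity on centred
  Gaussians of variance tending to infinity, which also determines the constant \<open>2 * pi\<close>.\<close>

lemma fourier_fejer: "(\<integral>x. of_real (fejer x) * iexp (\<theta> * x) \<partial>lborel) = of_real (2 * pi * tri \<theta>)"
proof -
  let ?g = "std_normal_density"
  have ne: "real (Suc k) \<noteq> 0" for k by simp
  \<comment> \<open>This is \<open>fejer_char\<close> for the standard normal law with scale a = k +
    1 and frequency a \<theta>, after the substitutions v = a x on the left and w = a (t + \<theta>)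
    on the right.\<close>
  have scaled: "(\<integral>v. of_real (fejer v) * iexp (\<theta> * v) * of_real (exp (- (v / real (Suc k))\<^sup>2 / 2)) \<partial>lborel)
    = of_real (sqrt (2 * pi)) * (\<integral>w. of_real (tri (w / real (Suc k) - \<theta>) * exp (- w\<^sup>2 / 2)) \<partial>lborel)" (is "?L k = _ * ?R k") for k
  proof -
    let ?a = "real (Suc k)"
    have "(\<integral>x. of_real (fejer (?a * x)) * iexp ((?a * \<theta>) * x) \<partial>std_normal_distribution)
      = (\<integral>t. of_real (tri t) * char std_normal_distribution (?a * t + ?a * \<theta>) \<partial>lborel)"
      by (rule fejer_char[OF real_dist_normal_dist])
    also have "(\<integral>x. of_real (fejer (?a * x)) * iexp ((?a * \<theta>) * x) \<partial>std_normal_distribution)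
      = (\<integral>x. ?g x *\<^sub>R (of_real (fejer (?a * x)) * iexp ((?a * \<theta>) * x)) \<partial>lborel)"
      by (rule integral_density) auto
    also have "\<dots> = \<bar>1 / ?a\<bar> *\<^sub>R (\<integral>v. ?g (0 + (1 / ?a) * v) *\<^sub>R (of_real (fejer (?a * (0 + (1 / ?a) * v))) * iexp ((?a * \<theta>) * (0 + (1 / ?a) * v))) \<partial>lborel)"
      by (rule lborel_integral_real_affine) simp
    also have "(\<integral>v. ?g (0 + (1 / ?a) * v) *\<^sub>R (of_real (fejer (?a * (0 + (1 / ?a) * v))) * iexp ((?a * \<theta>) * (0 + (1 / ?a) * v))) \<partial>lborel)
       = (\<integral>v. of_real (1 / sqrt (2 * pi)) * (of_real (fejer v) * iexp (\<theta> * v) * of_real (exp (- (v / ?a)\<^sup>2 / 2))) \<partial>lborel)"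
      by (intro Bochner_Integration.integral_cong refl) (simp add: std_normal_density_def scaleR_conv_of_real field_simps del: of_nat_Suc)
    also have "\<dots> = of_real (1 / sqrt (2 * pi)) * ?L k" by (rule integral_mult_right_zero)
    also have "(\<integral>t. of_real (tri t) * char std_normal_distribution (?a * t + ?a * \<theta>) \<partial>lborel)
       = (\<integral>t. of_real (tri t * exp (- (?a * (t + \<theta>))\<^sup>2 / 2)) \<partial>lborel)"
      by (simp add: char_std_normal_distribution distrib_left del: of_nat_Suc)
    also have "\<dots> = \<bar>1 / ?a\<bar> *\<^sub>R (\<integral>w. of_real (tri (- \<theta> + (1 / ?a) * w) * exp (- (?a * ((- \<theta> + (1 / ?a) * w) + \<theta>))\<^sup>2 / 2)) \<partial>lborel)"
      by (rule lborel_integral_real_affine) simp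
    also have "(\<integral>w. of_real (tri (- \<theta> + (1 / ?a) * w) * exp (- (?a * ((- \<theta> + (1 / ?a) * w) + \<theta>))\<^sup>2 / 2)) \<partial>lborel) = complex_of_real (\<integral>w. tri (w / ?a - \<theta>) * exp (- w\<^sup>2 / 2) \<partial>lborel)"
      by (subst integral_complex_of_real[symmetric]) (intro Bochner_Integration.integral_cong refl, simp add: field_simps del: of_nat_Suc)
    finally have "of_real (1 / sqrt (2 * pi)) * ?L k = ?R k"
      by (simp add: integral_complex_of_real del: of_nat_Suc of_real_mult)
    then show ?thesis by (simp add: field_simps)
  qed
  have inv: "(\<lambda>k. v / real (Suc k)) \<longlonglongrightarrow> 0" for v
    using tendsto_mult_right_zero[OF LIMSEQ_inverse_real_of_nat, of v] by (simp add: field_simps)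
  have L: "?L \<longlonglongrightarrow> (\<integral>x. of_real (fejer x) * iexp (\<theta> * x) \<partial>lborel)"
  proof (rule integral_dominated_convergence[OF _ _ integrable_fejer])
    show "AE v in lborel. (\<lambda>k. of_real (fejer v) * iexp (\<theta> * v) * of_real (exp (- (v / real (Suc k))\<^sup>2 / 2))) \<longlonglongrightarrow> of_real (fejer v) * iexp (\<theta> * v)"
    proof (rule AE_I2)
      fix v
      have "(\<lambda>k. of_real (fejer v) * iexp (\<theta> * v) * of_real (exp (- (v / real (Suc k))\<^sup>2 / 2))) \<longlonglongrightarrow> of_real (fejer v) * iexp (\<theta> * v) * of_real (exp (- (0::real)\<^sup>2 / 2))"
        by (intro tendsto_intros inv) auto
      then show "(\<lambda>k. of_real (fejer v) * iexp (\<theta> * v) * of_real (exp (- (v / real (Suc k))\<^sup>2 / 2))) \<longlonglongrightarrow> of_real (fejer v) * iexp (\<theta> * v)" by simp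
    qed
    show "AE v in lborel. norm (of_real (fejer v) * iexp (\<theta> * v) * of_real (exp (- (v / real (Suc k))\<^sup>2 / 2))) \<le> fejer v" for k
      by (intro AE_I2) (simp add: norm_mult fejer_nonneg mult_left_le del: of_nat_Suc)
  qed auto
  have gi: "integrable lborel (\<lambda>w::real. exp (- w\<^sup>2 / 2))"
    using integrable_mult_right[OF integrable_normal_density[of 1 0], of "sqrt (2 * pi)"] by (simp add: std_normal_density_def)
  have gv: "(\<integral>w. exp (- (w::real)\<^sup>2 / 2) \<partial>lborel) = sqrt (2 * pi)"
    using integral_normal_density[of 1 0] by (simp add: std_normal_density_def field_simps)
  \<comment> \<open>The argument of \<open>tri\<close> collapses to - \<theta> while the Gaussian
    weight stays fixed, so its total mass sqrt (2 \<pi>) factors out.\<close>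
  have "(\<lambda>k. \<integral>w. tri (w / real (Suc k) - \<theta>) * exp (- w\<^sup>2 / 2) \<partial>lborel) \<longlonglongrightarrow> (\<integral>w. tri (- \<theta>) * exp (- w\<^sup>2 / 2) \<partial>lborel)"
  proof (rule integral_dominated_convergence[OF _ _ gi])
    show "AE w in lborel. (\<lambda>k. tri (w / real (Suc k) - \<theta>) * exp (- w\<^sup>2 / 2)) \<longlonglongrightarrow> tri (- \<theta>) * exp (- w\<^sup>2 / 2)"
    proof (rule AE_I2)
      fix w
      have "(\<lambda>k. w / real (Suc k) - \<theta>) \<longlonglongrightarrow> 0 - \<theta>" by (intro tendsto_intros inv)
      then have "(\<lambda>k. tri (w / real (Suc k) - \<theta>)) \<longlonglongrightarrow> tri (0 - \<theta>)" by (rule isCont_tendsto_compose[OF isCont_tri])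
      then show "(\<lambda>k. tri (w / real (Suc k) - \<theta>) * exp (- w\<^sup>2 / 2)) \<longlonglongrightarrow> tri (- \<theta>) * exp (- w\<^sup>2 / 2)"
        by (intro tendsto_mult_right) simp
    qed
    show "AE w in lborel. norm (tri (w / real (Suc k) - \<theta>) * exp (- w\<^sup>2 / 2)) \<le> exp (- w\<^sup>2 / 2)" for k
      by (intro AE_I2) (simp add: abs_mult mult_left_le_one_le tri_bounds)
  qed auto
  then have R: "(\<lambda>k. of_real (sqrt (2 * pi)) * ?R k) \<longlonglongrightarrow> of_real (sqrt (2 * pi)) * complex_of_real (tri (- \<theta>) * sqrt (2 * pi))"
    unfolding integral_complex_of_real by (intro tendsto_intros) (simp add: gv[simplified])
  have "(\<integral>x. of_real (fejer x) * iexp (\<theta> * x) \<partial>lborel) = of_real (sqrt (2 * pi)) * complex_of_real (tri (- \<theta>) * sqrt (2 * pi))"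
    using L R unfolding scaled by (rule LIMSEQ_unique)
  also have "\<dots> = of_real (2 * pi * tri \<theta>)"
    by (simp add: tri_def of_real_mult[symmetric] del: of_real_mult)
  finally show ?thesis .
qed

section \<open>Non-lattice laws and densities\<close>

text \<open>Modulus 1 at s forces s X - \<gamma> into the multiples of 2 \<pi> almost surely, hence
  X into a lattice of span 2 \<pi> / |s|.\<close>

lemma char_norm_less_1:
  assumes F: "real_distribution F" and nl: "\<not> lattice_distribution F" and s: "s \<noteq> 0"
  shows "cmod (char F s) < 1"
proof (rule ccontr)
  interpret real_distribution F by (rule F)
  assume "\<not> cmod (char F s) < 1"
  then have one: "cmod (char F s) = 1" using cmod_char_le_1[of s] by linarith
  then obtain \<gamma> where \<gamma>: "char F s = iexp \<gamma>"
    using complex_norm_eq_1_exp by (metis mult.commute)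
  have int: "integrable F (\<lambda>x. iexp (s * x) * iexp (- \<gamma>))" by (rule integrable_mult_left) (rule integrable_iexp, auto)
  have cos_eq: "cos (s * x - \<gamma>) = Re (iexp (s * x) * iexp (- \<gamma>))" for x
    by (simp add: exp_add[symmetric] Re_exp algebra_simps del: of_real_minus)
  have "(\<integral>x. cos (s * x - \<gamma>) \<partial>F) = Re (\<integral>x. iexp (s * x) * iexp (- \<gamma>) \<partial>F)"
    unfolding cos_eq by (rule integral_Re[OF int])
  also have "(\<integral>x. iexp (s * x) * iexp (- \<gamma>) \<partial>F) = char F s * iexp (- \<gamma>)"
    by (simp add: char_def)
  also have "\<dots> = 1" unfolding \<gamma> by (simp add: exp_add[symmetric] exp_minus)
  finally have c1: "(\<integral>x. cos (s * x - \<gamma>) \<partial>F) = 1" by simp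
  have ic: "integrable F (\<lambda>x. cos (s * x - \<gamma>))" by (rule integrable_const_bound[of _ 1]) auto
  have "(\<integral>x. 1 - cos (s * x - \<gamma>) \<partial>F) = 0"
    using ic c1 prob_space by simp
  then have "AE x in F. 1 - cos (s * x - \<gamma>) = 0"
    using ic by (subst (asm) integral_nonneg_eq_0_iff_AE) auto
  then have ae: "AE x in F. cos (s * x - \<gamma>) = 1" by eventually_elim simp
  \<comment> \<open>The almost sure statement has to be carried to the support, which is defined by
    open neighbourhoods: the exceptional set is open and null, so it misses the support.\<close>
  define U where "U = {x. cos (s * x - \<gamma>) \<noteq> 1}"
  have "open U" unfolding U_def by (intro open_Collect_neq continuous_intros)
  have "emeasure F U = 0"
  proof -
    have "U \<in> sets F" using borel_open[OF \<open>open U\<close>] by simp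
    then show ?thesis using ae unfolding U_def by (subst (asm) AE_iff_measurable[OF _ refl]) auto
  qed
  then have supp: "cos (s * x - \<gamma>) = 1" if "x \<in> measure_support F" for x
  proof -
    have "x \<notin> U" using that \<open>open U\<close> \<open>emeasure F U = 0\<close> unfolding measure_support_def by force
    then show ?thesis by (simp add: U_def)
  qed
  define h where "h = 2 * pi / \<bar>s\<bar>"
  have h: "h > 0" using s by (simp add: h_def)
  \<comment> \<open>The representative of \<gamma> / s modulo h in [0, h), as the definition of a
    lattice law demands.\<close>
  define a where "a = \<gamma> / s - of_int \<lfloor>\<gamma> / s / h\<rfloor> * h"
  have "a \<in> {0..<h}"
  proof -
    have "of_int \<lfloor>\<gamma> / s / h\<rfloor> \<le> \<gamma> / s / h" "\<gamma> / s / h < of_int \<lfloor>\<gamma> / s / h\<rfloor> + 1" by linarith+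
    then have "of_int \<lfloor>\<gamma> / s / h\<rfloor> * h \<le> \<gamma> / s" "\<gamma> / s < (of_int \<lfloor>\<gamma> / s / h\<rfloor> + 1) * h"
      using h by (simp_all only: pos_le_divide_eq pos_divide_less_eq)
    then show ?thesis by (simp add: a_def distrib_right)
  qed
  moreover have "measure_support F \<subseteq> {a + of_int k * h | k. True}"
  proof
    fix x assume "x \<in> measure_support F"
    then obtain n :: int where n: "s * x - \<gamma> = of_int n * (2 * pi)"
      using supp cos_one_2pi_int by (metis mult.assoc)
    have "x = \<gamma> / s + of_int n * (2 * pi / s)" using n s by (simp add: field_simps)
    \<comment> \<open>The span h is positive for either sign of s; \<sigma> transfers the sign of s
      to the integer coefficient.\<close>
    define \<sigma> :: int where "\<sigma> = (if s > 0 then 1 else -1)"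
    have "2 * pi / s = of_int \<sigma> * h" using s by (simp add: h_def \<sigma>_def)
    then have "x = \<gamma> / s + of_int n * (of_int \<sigma> * h)" using \<open>x = \<gamma> / s + of_int n * (2 * pi / s)\<close> by simp
    then have "x = a + of_int (\<lfloor>\<gamma> / s / h\<rfloor> + n * \<sigma>) * h"
      by (simp add: a_def algebra_simps)
    then show "x \<in> {a + of_int k * h | k. True}" by blast
  qed
  ultimately show False using nl h unfolding lattice_distribution_def by blast
qed

lemma char_norm_bound_compact:
  assumes F: "real_distribution F" and lt: "\<And>s. s \<noteq> 0 \<Longrightarrow> cmod (char F s) < 1" and "s0 > 0"
  shows "\<exists>q. 0 < q \<and> q < 1 \<and> (\<forall>s. s0 \<le> \<bar>s\<bar> \<longrightarrow> \<bar>s\<bar> \<le> B \<longrightarrow> cmod (char F s) \<le> q)"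
proof -
  let ?S = "{s. s0 \<le> \<bar>s\<bar>} \<inter> cball 0 B"
  have "compact ?S" by (intro closed_Int_compact closed_Collect_le continuous_intros) auto
  moreover have "continuous_on ?S (\<lambda>s. cmod (char F s))"
    by (intro continuous_at_imp_continuous_on ballI isCont_norm real_distribution.isCont_char[OF F])
  ultimately have ex: "?S \<noteq> {} \<Longrightarrow> \<exists>x\<in>?S. \<forall>y\<in>?S. cmod (char F y) \<le> cmod (char F x)"
    by (intro continuous_attains_sup)
  have "\<exists>q<1. \<forall>s\<in>?S. cmod (char F s) \<le> q"
  proof (cases "?S = {}")
    case True
    then show ?thesis by (intro exI[of _ 0]) simp
  next
    case False
    then obtain x where x: "x \<in> ?S" "\<forall>y\<in>?S. cmod (char F y) \<le> cmod (char F x)" using ex by blast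
    then have "x \<noteq> 0" using \<open>s0 > 0\<close> by auto
    then show ?thesis using lt x(2) by (intro exI[of _ "cmod (char F x)"] conjI) simp_all
  qed
  then obtain q where q: "q < 1" "\<And>s. s \<in> ?S \<Longrightarrow> cmod (char F s) \<le> q" by blast
  show ?thesis
  \<comment> \<open>The maximum may be 0, or the frequency set empty; comparison with 1/2 keeps the
    bound strictly positive.\<close>
  proof (intro exI[of _ "max q (1/2)"] conjI allI impI)
    fix s assume "s0 \<le> \<bar>s\<bar>" "\<bar>s\<bar> \<le> B"
    then have "s \<in> ?S" by (simp add: dist_real_def)
    then show "cmod (char F s) \<le> max q (1/2)" using q(2) by (simp add: le_max_iff_disj)
  qed (use q in auto)
qed

lemma measure_density_near_0:
  fixes g :: "real \<Rightarrow> real"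
  assumes L: "real_distribution L" and g: "is_continuous_density L g"
  shows "(\<lambda>k. measure L {0<..1 / real (Suc k)} * real (Suc k)) \<longlonglongrightarrow> g 0"
proof (rule LIMSEQ_I)
  fix e :: real assume "e > 0"
  interpret real_distribution L by (rule L)
  have gc: "continuous_on UNIV g" and gn: "\<And>y. g y \<ge> 0" and Lg: "L = density lborel (\<lambda>y. ennreal (g y))"
    using g by (auto simp: is_continuous_density_def)
  have [measurable]: "g \<in> borel_measurable borel" by (rule borel_measurable_continuous_onI[OF gc])
  have gi: "integrable lborel g"
  proof -
    have "(\<integral>\<^sup>+x. ennreal (g x) \<partial>lborel) = emeasure L UNIV" unfolding Lg by (subst emeasure_density) auto
    then show ?thesis using emeasure_space_1 gn by (intro integrableI_nonneg) auto
  qed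
  have "isCont g 0" using gc by (simp add: continuous_on_eq_continuous_at)
  then obtain d where d: "d > 0" "\<And>x. \<bar>x\<bar> < d \<Longrightarrow> \<bar>g x - g 0\<bar> < e / 2"
    using \<open>e > 0\<close> unfolding continuous_at_eps_delta by (metis dist_real_def diff_zero half_gt_zero)
  obtain k0 where k0: "1 / real (Suc k0) < d" using d reals_Archimedean by (metis inverse_eq_divide)
  have "norm (measure L {0<..1 / real (Suc k)} * real (Suc k) - g 0) < e" if "k \<ge> k0" for k
  proof -
    let ?b = "1 / real (Suc k)"
    have "?b \<le> 1 / real (Suc k0)" using that by (intro divide_left_mono) auto
    then have bd: "?b < d" using k0 by linarith
    have ii: "integrable lborel (\<lambda>x. indicator {0<..?b} x * g x)" 
      using integrable_real_mult_indicator[OF _ gi, of "{0<..?b}"] by (simp add: mult.commute)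
    have m: "measure L {0<..?b} = (\<integral>x. indicator {0<..?b} x * g x \<partial>lborel)"
    proof -
      have "emeasure L {0<..?b} = (\<integral>\<^sup>+x. ennreal (g x) * indicator {0<..?b} x \<partial>lborel)"
        unfolding Lg by (rule emeasure_density) auto
      also have "\<dots> = (\<integral>\<^sup>+x. ennreal (indicator {0<..?b} x * g x) \<partial>lborel)"
        by (intro nn_integral_cong) (auto simp: indicator_def)
      also have "\<dots> = ennreal (\<integral>x. indicator {0<..?b} x * g x \<partial>lborel)"
        by (rule nn_integral_eq_integral[OF ii]) (simp add: gn)
      finally show ?thesis using gn by (simp add: measure_def integral_nonneg_AE)
    qed
    have i1: "(\<integral>x. indicator {0<..?b} x * r \<partial>lborel) = ?b * r" for r :: real by simp
    have i2: "integrable lborel (\<lambda>x. indicator {0<..?b} x * r)" for r :: real by (intro integrable_mult_left integrable_real_indicator) auto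
    have "measure L {0<..?b} - ?b * g 0 = (\<integral>x. indicator {0<..?b} x * g x - indicator {0<..?b} x * g 0 \<partial>lborel)"
      unfolding m i1[of "g 0", symmetric] by (rule Bochner_Integration.integral_diff[symmetric, OF ii i2])
    also have "norm \<dots> \<le> (\<integral>x. indicator {0<..?b} x * (e / 2) \<partial>lborel)"
    proof (rule order_trans[OF Bochner_Integration.integral_norm_bound Bochner_Integration.integral_mono])
      fix x :: real
      show "norm (indicator {0<..?b} x * g x - indicator {0<..?b} x * g 0) \<le> indicator {0<..?b} x * (e / 2)"
        using d(2)[of x] bd by (auto simp: indicator_def intro: less_imp_le)
    qed (intro Bochner_Integration.integrable_norm Bochner_Integration.integrable_diff ii i2)+
    also have "\<dots> = ?b * (e / 2)" by (rule i1)
    finally have "\<bar>measure L {0<..?b} - ?b * g 0\<bar> * real (Suc k) \<le> ?b * (e / 2) * real (Suc k)"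
      by (intro mult_right_mono) auto
    moreover have "\<bar>measure L {0<..?b} - ?b * g 0\<bar> * real (Suc k) = \<bar>measure L {0<..?b} * real (Suc k) - g 0\<bar>"
      by (subst abs_mult_pos) (simp_all add: left_diff_distrib del: of_nat_Suc)
    ultimately show ?thesis using \<open>e > 0\<close> by (simp del: of_nat_Suc)
  qed
  then show "\<exists>no. \<forall>n\<ge>no. norm (measure L {0<..1 / real (Suc n)} * real (Suc n) - g 0) < e" by blast
qed

text \<open>Levy inversion on the interval from 0 to 1 / (k + 1), multiplied by k + 1. The limit on
  the probability side uses continuity of \<open>g\<close> and so evaluates this particular version
  of the density at 0.\<close>

lemma density_at_0_inversion:
  fixes g :: "real \<Rightarrow> real"
  assumes L: "real_distribution L" and g: "is_continuous_density L g" and int: "integrable lborel (char L)"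
  shows "(\<integral>t. char L t \<partial>lborel) = of_real (2 * pi * g 0)"
proof -
  interpret real_distribution L by (rule L)
  have Lg: "L = density lborel (\<lambda>y. ennreal (g y))" and gc: "continuous_on UNIV g"
    using g by (auto simp: is_continuous_density_def)
  have [measurable]: "g \<in> borel_measurable borel" by (rule borel_measurable_continuous_onI[OF gc])
  have pt: "measure L {a} = 0" for a
  proof -
    have "emeasure L {a} = (\<integral>\<^sup>+x. ennreal (g x) * indicator {a} x \<partial>lborel)"
      unfolding Lg by (rule emeasure_density) auto
    also have "\<dots> = (\<integral>\<^sup>+(x::real). 0 \<partial>lborel)"
    proof (rule nn_integral_cong_AE)
      have "AE x in lborel. x \<noteq> a" by (rule AE_lborel_singleton)
      then show "AE x in lborel. ennreal (g x) * indicator {a} x = 0" by eventually_elim auto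
    qed
    finally show ?thesis by (simp add: measure_def)
  qed
  \<comment> \<open>The Fourier transform of the indicator of (0, b], bounded by b. At t = 0
    division by zero makes it 0 instead of b, which changes no integral.\<close>
  define D where "D b t = (iexp (-(t * 0)) - iexp (-(t * b))) / (\<i> * t)" for b t :: real
  have Dm [measurable]: "D b \<in> borel_measurable borel" for b unfolding D_def[abs_def] by measurable
  have Db: "cmod (D b t) \<le> b" if "b \<ge> 0" for b t
  proof (cases "t = 0")
    case False
    have "cmod ((iexp (t * 0) - iexp (t * (- b))) / (\<i> * t)) \<le> 0 - (- b)"
      by (rule Levy_Inversion_aux2) (use that False in auto)
    then show ?thesis by (simp add: D_def)
  qed (use that in \<open>simp add: D_def\<close>)
  have inv: "(\<integral>t. D b t * char L t \<partial>lborel) = of_real (2 * pi * measure L {0<..b})" if b: "b > 0" for b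
  proof -
    have "(\<lambda>T::nat. 1 / (2 * pi) * (CLBINT t=-real T..real T. D b t * char L t)) \<longlonglongrightarrow> of_real (measure L {0<..b})"
      using Levy_Inversion[of 0 b] pt b unfolding D_def by simp
    moreover have "(\<lambda>T::nat. 1 / (2 * pi) * (CLBINT t=-real T..real T. D b t * char L t)) \<longlonglongrightarrow> 1 / (2 * pi) * (\<integral>t. D b t * char L t \<partial>lborel)"
    proof -
      \<comment> \<open>Inversion provides limits of symmetric truncations only; integrability of
        the characteristic function turns them into the integral over the whole line.\<close>
      have eq: "(CLBINT t=-real T..real T. D b t * char L t) = (\<integral>t. indicator {-real T<..<real T} t *\<^sub>R (D b t * char L t) \<partial>lborel)" for T :: nat
        by (simp add: interval_lebesgue_integral_def set_lebesgue_integral_def)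
      have "(\<lambda>T::nat. \<integral>t. indicator {-real T<..<real T} t *\<^sub>R (D b t * char L t) \<partial>lborel) \<longlonglongrightarrow> (\<integral>t. D b t * char L t \<partial>lborel)"
      proof (rule integral_dominated_convergence[where w = "\<lambda>t. b * cmod (char L t)"])
        show "integrable lborel (\<lambda>t. b * cmod (char L t))" using int by simp
        show "AE t in lborel. (\<lambda>T::nat. indicator {-real T<..<real T} t *\<^sub>R (D b t * char L t)) \<longlonglongrightarrow> D b t * char L t"
        proof (rule AE_I2, rule tendsto_eventually)
          fix t :: real
          obtain T0 where "\<bar>t\<bar> < real T0" using reals_Archimedean2 by blast
          then have "indicator {-real T<..<real T} t *\<^sub>R (D b t * char L t) = D b t * char L t" if "T \<ge> T0" for T
            using that by (auto simp: indicator_def)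
          then show "\<forall>\<^sub>F T in sequentially. indicator {-real T<..<real T} t *\<^sub>R (D b t * char L t) = D b t * char L t"
            by (auto simp: eventually_sequentially)
        qed
        show "AE t in lborel. norm (indicator {-real T<..<real T} t *\<^sub>R (D b t * char L t)) \<le> b * cmod (char L t)" for T
          using Db[of b] b by (intro AE_I2) (auto simp: indicator_def norm_mult intro!: mult_right_mono)
      qed auto
      then have "(\<lambda>T::nat. CLBINT t=-real T..real T. D b t * char L t) \<longlonglongrightarrow> (\<integral>t. D b t * char L t \<partial>lborel)"
        unfolding eq[symmetric] by simp
      then have lim: "(\<lambda>T::nat. CLBINT t=-real T..real T. D b t * char L t) \<longlonglongrightarrow> (\<integral>t. D b t * char L t \<partial>lborel)" .
      show ?thesis by (rule tendsto_mult_left[OF lim])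
    qed
    ultimately have "of_real (measure L {0<..b}) = 1 / (2 * pi) * (\<integral>t. D b t * char L t \<partial>lborel)" by (rule LIMSEQ_unique)
    then show ?thesis by (simp add: field_simps)
  qed
  have A: "(\<lambda>k. \<integral>t. of_real (real (Suc k)) * D (1 / real (Suc k)) t * char L t \<partial>lborel) \<longlonglongrightarrow> (\<integral>t. char L t \<partial>lborel)"
  proof (rule integral_dominated_convergence[where w = "\<lambda>t. cmod (char L t)"])
    show "integrable lborel (\<lambda>t. cmod (char L t))" using int by simp
    show "AE t in lborel. (\<lambda>k. of_real (real (Suc k)) * D (1 / real (Suc k)) t * char L t) \<longlonglongrightarrow> char L t"
    proof -
      have "AE t in lborel. t \<noteq> (0::real)" by (rule AE_lborel_singleton)
      then show ?thesis
      proof eventually_elim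
        fix t :: real assume t: "t \<noteq> 0"
        \<comment> \<open>With this z the rescaled \<open>D\<close> is the difference quotient (exp
          z - 1) / z, which tends to 1.\<close>
        let ?z = "\<lambda>k. - \<i> * of_real (t / real (Suc k))"
        have "(\<lambda>k. t / real (Suc k)) \<longlonglongrightarrow> 0"
          using tendsto_mult_right_zero[OF LIMSEQ_inverse_real_of_nat, of t] by (simp add: field_simps)
        then have "?z \<longlonglongrightarrow> - \<i> * of_real 0" by (intro tendsto_intros)
        then have z: "filterlim ?z (at 0) sequentially"
          using t by (intro filterlim_atI) (simp_all del: of_nat_Suc)
        have "((\<lambda>z::complex. (exp z - 1) / z) \<longlongrightarrow> 1) (at 0)"
          using DERIV_exp[of "0::complex"] by (simp add: DERIV_def)
        then have "(\<lambda>k. (exp (?z k) - 1) / ?z k) \<longlonglongrightarrow> 1" by (rule filterlim_compose[OF _ z])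
        moreover have "(exp (?z k) - 1) / ?z k = of_real (real (Suc k)) * D (1 / real (Suc k)) t" for k
          using t by (simp add: D_def divide_simps del: of_nat_Suc) (simp add: algebra_simps)
        ultimately have "(\<lambda>k. of_real (real (Suc k)) * D (1 / real (Suc k)) t) \<longlonglongrightarrow> 1" by simp
        then have "(\<lambda>k. of_real (real (Suc k)) * D (1 / real (Suc k)) t * char L t) \<longlonglongrightarrow> 1 * char L t"
          by (intro tendsto_intros)
        then show "(\<lambda>k. of_real (real (Suc k)) * D (1 / real (Suc k)) t * char L t) \<longlonglongrightarrow> char L t" by simp
      qed
    qed
    show "AE t in lborel. norm (of_real (real (Suc k)) * D (1 / real (Suc k)) t * char L t) \<le> cmod (char L t)" for k
    proof (rule AE_I2)
      fix t
      have "real (Suc k) * cmod (D (1 / real (Suc k)) t) \<le> real (Suc k) * (1 / real (Suc k))"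
        by (intro mult_left_mono Db) auto
      then have "real (Suc k) * cmod (D (1 / real (Suc k)) t) \<le> 1" by simp
      then have "real (Suc k) * cmod (D (1 / real (Suc k)) t) * cmod (char L t) \<le> 1 * cmod (char L t)"
        by (intro mult_right_mono) auto
      then show "norm (of_real (real (Suc k)) * D (1 / real (Suc k)) t * char L t) \<le> cmod (char L t)"
        by (simp only: norm_mult norm_of_real abs_of_nat mult_1)
    qed
  qed (use int in auto)
  have B: "(\<integral>t. of_real (real (Suc k)) * D (1 / real (Suc k)) t * char L t \<partial>lborel)
      = of_real (2 * pi * (measure L {0<..1 / real (Suc k)} * real (Suc k)))" for k
    unfolding mult.assoc integral_mult_right_zero by (subst inv) (simp_all add: mult_ac del: of_nat_Suc)
  have C: "(\<lambda>k. complex_of_real (2 * pi * (measure L {0<..1 / real (Suc k)} * real (Suc k)))) \<longlonglongrightarrow> of_real (2 * pi * g 0)"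
    by (intro tendsto_of_real tendsto_mult_left measure_density_near_0[OF L g])
  show ?thesis using A unfolding B by (rule LIMSEQ_unique) (rule C)
qed

section \<open>Concentration and integrability\<close>

context stable_norming
begin

lemma \<psi>_measurable [measurable]: "\<psi> \<in> borel_measurable borel"
  by (rule borel_measurable_continuous_onI) (simp add: continuous_on_eq_continuous_at \<psi>_cont)

lemma char_conv_pointwise: "(\<lambda>n. char F (t / c n) ^ n) \<longlonglongrightarrow> \<psi> t"
proof (rule LIMSEQ_I)
  fix e :: real assume "e > 0"
  from char_conv[OF this, of "\<bar>t\<bar>"] show "\<exists>N. \<forall>n\<ge>N. norm (char F (t / c n) ^ n - \<psi> t) < e" by blast
qed

text \<open>The bound C / (1 + t^2) for the n-th powers, valid once |t| / c n \<le> s0, passes to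
  the limit.\<close>

lemma integrable_\<psi>: "integrable lborel \<psi>"
proof -
  obtain C N s0 where C: "C > 0" "N \<ge> 1" "s0 > 0" and
    bd: "\<And>n m s. n \<ge> N \<Longrightarrow> n \<le> 2 * m \<Longrightarrow> \<bar>s\<bar> \<le> s0 \<Longrightarrow> cmod (char F s) ^ m \<le> C / (1 + (s * c n)\<^sup>2)"
    using char_power_bound by metis
  have bound: "cmod (\<psi> t) \<le> C * (1 / (1 + t\<^sup>2))" for t
  proof (rule tendsto_upperbound[OF tendsto_norm[OF char_conv_pointwise[of t]]])
    have "\<forall>\<^sub>F n in sequentially. c n > \<bar>t\<bar> / s0" using filterlim_c by (simp add: filterlim_at_top_dense)
    then show "\<forall>\<^sub>F n in sequentially. cmod (char F (t / c n) ^ n) \<le> C * (1 / (1 + t\<^sup>2))"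
      using eventually_ge_at_top[of N]
    proof eventually_elim
      case (elim n)
      have cn: "c n > 0" using c_pos[of n] elim C by simp
      have "\<bar>t / c n\<bar> \<le> s0" using elim cn C by (simp add: field_simps)
      from bd[OF elim(2) _ this, of n] show ?case using cn by (simp add: norm_power)
    qed
  qed simp
  show ?thesis
    by (rule Bochner_Integration.integrable_bound[OF integrable_mult_right[OF integrable_inverse_1_plus_square_lborel, of C]])
       (use C(1) in \<open>auto intro!: AE_I2 order_trans[OF bound]\<close>)
qed

lemma char_distr_shift:
  assumes "real_distribution \<mu>"
  shows "real_distribution (distr \<mu> borel (\<lambda>x. x - y))" and "char (distr \<mu> borel (\<lambda>x. x - y)) t = char \<mu> t * iexp (- (t * y))"
proof -
  interpret \<mu>: real_distribution \<mu> by fact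
  show "real_distribution (distr \<mu> borel (\<lambda>x. x - y))" by (rule \<mu>.real_distribution_distr) simp
  have "char (distr \<mu> borel (\<lambda>x. x - y)) t = (\<integral>x. iexp (t * x) * iexp (- (t * y)) \<partial>\<mu>)"
    unfolding char_def by (subst integral_distr) (auto simp: exp_add[symmetric] algebra_simps)
  then show "char (distr \<mu> borel (\<lambda>x. x - y)) t = char \<mu> t * iexp (- (t * y))" by (simp add: char_def)
qed

text \<open>Esseen's inequality: the mass of an interval of length \<open>h\<close> is controlled by the characteristic
  function on \<open>[-1/h, 1/h]\<close>.\<close>

lemma concentration:
  "\<exists>C>0. \<forall>n\<ge>1. \<forall>\<mu> y h. real_distribution \<mu> \<longrightarrow> (\<forall>t. char \<mu> t = char F t ^ n) \<longrightarrow> h > 0 \<longrightarrow>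
     measure \<mu> {y..<y + h} \<le> C * (1 + h) / c n"
proof -
  obtain C N s0 where C: "C > 0" "N \<ge> 1" "s0 > 0" and
    bd: "\<And>n m s. n \<ge> N \<Longrightarrow> n \<le> 2 * m \<Longrightarrow> \<bar>s\<bar> \<le> s0 \<Longrightarrow> cmod (char F s) ^ m \<le> C / (1 + (s * c n)\<^sup>2)"
    using char_power_bound by metis
  define D where "D = (\<integral>x. 1 / (1 + (x::real)\<^sup>2) \<partial>lborel)"
  have D: "D \<ge> 0" unfolding D_def by (intro integral_nonneg_AE AE_I2) auto
  \<comment> \<open>For h \<ge> 1 / s0 all frequencies t / h seen by the kernel lie in the range
    where the power bound holds; integrating that bound produces the factor h / c n.\<close>
  have large: "measure \<mu> {y..<y + h} \<le> C * D * h / (cos 1 * c n)"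
    if \<mu>: "real_distribution \<mu>" "\<And>t. char \<mu> t = char F t ^ n" and n: "n \<ge> N" and h: "h \<ge> 1 / s0" for \<mu> y h n
  proof -
    interpret \<mu>: real_distribution \<mu> by fact
    let ?\<nu> = "distr \<mu> borel (\<lambda>x. x - y)"
    interpret \<nu>: real_distribution ?\<nu> by (rule char_distr_shift[OF \<mu>(1)])
    have h0: "h > 0" using h C by (meson less_le_trans zero_less_divide_1_iff)
    have cn: "c n > 0" using c_pos n C by simp
    have fi: "integrable ?\<nu> (\<lambda>x. fejer ((1 / h) * x))"
      by (rule \<nu>.integrable_const_bound[of _ 1]) (auto simp: fejer_nonneg fejer_le_1)
    have "cos 1 * measure \<mu> {y..<y + h} = cos 1 * measure ?\<nu> {0..<h}"
    proof -
      have "(\<lambda>x. x - y) -` {0..<h} \<inter> space \<mu> = {y..<y + h}" by auto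
      then show ?thesis by (subst measure_distr) auto
    qed
    also have "\<dots> = (\<integral>x. cos 1 * indicator {0..<h} x \<partial>?\<nu>)" by simp
    also have "\<dots> \<le> (\<integral>x. fejer ((1 / h) * x) \<partial>?\<nu>)"
    proof (rule integral_mono[OF _ fi])
      show "integrable ?\<nu> (\<lambda>x. cos 1 * indicat_real {0..<h} x)"
        by (rule \<nu>.integrable_const_bound[of _ "cos 1"]) (use cos_1_pos in \<open>auto simp: indicator_def\<close>)
      fix x
      show "cos 1 * indicator {0..<h} x \<le> fejer ((1 / h) * x)"
        using fejer_ge_cos_1[of "(1 / h) * x"] fejer_nonneg[of "(1 / h) * x"] h0 by (auto simp: indicator_def)
    qed
    also have "\<dots> \<le> cmod (\<integral>x. of_real (fejer ((1 / h) * x)) * iexp (0 * x) \<partial>?\<nu>)"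
      by (simp add: integral_complex_of_real)
    also have "\<dots> = cmod (\<integral>t. of_real (tri t) * char ?\<nu> ((1 / h) * t + 0) \<partial>lborel)"
      by (subst fejer_char[OF \<nu>.real_distribution_axioms]) simp
    also have "\<dots> \<le> (\<integral>t. C * (1 / (1 + (0 + (c n / h) * t)\<^sup>2)) \<partial>lborel)"
    proof (rule order_trans[OF integral_norm_bound integral_mono])
      show "integrable lborel (\<lambda>t. cmod (of_real (tri t) * char ?\<nu> ((1 / h) * t + 0)))"
        by (intro integrable_norm integrable_tri_times[of _ 1] \<nu>.cmod_char_le_1) measurable
      show "integrable lborel (\<lambda>t. C * (1 / (1 + (0 + (c n / h) * t)\<^sup>2)))"
        using lborel_integrable_real_affine[OF integrable_inverse_1_plus_square_lborel, of "c n / h" 0] cn h0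
        by (intro integrable_mult_right) simp
      fix t :: real
      show "cmod (of_real (tri t) * char ?\<nu> ((1 / h) * t + 0)) \<le> C * (1 / (1 + (0 + (c n / h) * t)\<^sup>2))"
      proof (cases "t \<in> {-1..1}")
        case True
        have "\<bar>t / h\<bar> \<le> 1 / h" using True h0 by (auto simp: abs_le_iff field_simps)
        also have "\<dots> \<le> s0" using h h0 C by (simp add: field_simps)
        finally have "cmod (char F (t / h)) ^ n \<le> C / (1 + (t / h * c n)\<^sup>2)" by (intro bd n) auto
        moreover have "cmod (of_real (tri t) * char ?\<nu> ((1 / h) * t + 0)) \<le> 1 * cmod (char F (t / h)) ^ n"
          unfolding char_distr_shift(2)[OF \<mu>(1)] norm_mult norm_of_real
          using tri_bounds[of t] by (intro mult_mono) (simp_all add: \<mu>(2) norm_power)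
        ultimately show ?thesis by (simp add: mult.commute)
      next
        case False
        then show ?thesis using C by (simp add: tri_outside add_pos_nonneg)
      qed
    qed
    also have "\<dots> = C * (D * h / c n)"
    proof -
      have "D = \<bar>c n / h\<bar> *\<^sub>R (\<integral>t. 1 / (1 + (0 + (c n / h) * t)\<^sup>2) \<partial>lborel)"
        unfolding D_def using cn h0 by (intro lborel_integral_real_affine) auto
      then have "(\<integral>t. 1 / (1 + (0 + (c n / h) * t)\<^sup>2) \<partial>lborel) = D * h / c n"
        using cn h0 by (simp add: field_simps)
      then show ?thesis by (subst integral_mult_right_zero) simp
    qed
    finally have "cos 1 * measure \<mu> {y..<y + h} \<le> C * (D * h / c n)" .
    then show ?thesis using cos_1_pos cn by (simp add: field_simps)
  qed
  \<comment> \<open>Shorter intervals are enlarged to length 1 / s0, which is why the bound carries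
    1 + h. The summand \<open>c N\<close> makes it trivial for n < N, where the right side exceeds
    1.\<close>
  define E where "E = C * D * (1 + 1 / s0) / cos 1 + c N"
  have cN: "c N > 0" using c_pos C by simp
  have E: "E > 0" using C D cos_1_pos cN by (auto simp: E_def intro!: add_nonneg_pos divide_nonneg_pos mult_nonneg_nonneg add_nonneg_nonneg)
  have "measure \<mu> {y..<y + h} \<le> E * (1 + h) / c n"
    if \<mu>: "real_distribution \<mu>" "\<And>t. char \<mu> t = char F t ^ n" and n: "n \<ge> 1" and h: "h > 0" for \<mu> y h n
  proof -
    interpret \<mu>: real_distribution \<mu> by fact
    have cn: "c n > 0" using c_pos n by simp
    show ?thesis
    proof (cases "n \<ge> N")
      case True
      let ?h = "max h (1 / s0)"
      have "measure \<mu> {y..<y + h} \<le> measure \<mu> {y..<y + ?h}" by (intro \<mu>.finite_measure_mono) auto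
      also have "\<dots> \<le> C * D * ?h / (cos 1 * c n)" by (rule large) (use \<mu> True in auto)
      also have "\<dots> = (C * D / cos 1) * ?h / c n" by simp
      also have "\<dots> \<le> (C * D / cos 1) * ((1 + 1 / s0) * (1 + h)) / c n"
      proof (intro divide_right_mono mult_left_mono)
        show "?h \<le> (1 + 1 / s0) * (1 + h)" using h C by (auto simp: distrib_left distrib_right)
        show "0 \<le> C * D / cos 1" using C D cos_1_pos by simp
      qed (use cn in auto)
      also have "\<dots> \<le> E * (1 + h) / c n"
      proof (intro divide_right_mono)
        have "(C * D / cos 1) * ((1 + 1 / s0) * (1 + h)) = (C * D * (1 + 1 / s0) / cos 1) * (1 + h)" by simp
        also have "\<dots> \<le> E * (1 + h)" using cN h by (intro mult_right_mono) (auto simp: E_def)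
        finally show "(C * D / cos 1) * ((1 + 1 / s0) * (1 + h)) \<le> E * (1 + h)" .
      qed (use cn in auto)
      finally show ?thesis .
    next
      case False
      have "c n \<le> c N" using False n by (intro c_mono) auto
      also have "\<dots> \<le> E * 1" unfolding E_def using C D cos_1_pos by (auto intro!: divide_nonneg_pos mult_nonneg_nonneg add_nonneg_nonneg)
      also have "\<dots> \<le> E * (1 + h)" using E h by (intro mult_left_mono) auto
      finally have "1 \<le> E * (1 + h) / c n" using cn by (simp add: field_simps)
      then show ?thesis using \<mu>.prob_le_1 by (meson order_trans)
    qed
  qed
  then show ?thesis using E by blast
qed

text \<open>For large j the frequency w / c n is rewritten as t / c j with t = w c j / c n, which is
  small by \<open>c_lower\<close>; uniform convergence at index j gives a value near \<psi> 0 = 1.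
  For bounded j the base itself tends to 1.\<close>

lemma char_power_small_ratio:
  assumes n: "filterlim n at_top sequentially" and j: "\<And>k. j k \<le> n k" and r: "(\<lambda>k. real (j k) / real (n k)) \<longlonglongrightarrow> 0"
  shows "(\<lambda>k. char F (w / c (n k)) ^ j k) \<longlonglongrightarrow> 1"
proof (rule LIMSEQ_I)
  fix e :: real assume e: "e > 0"
  obtain C where C: "C \<ge> 1" "\<And>m n. 1 \<le> m \<Longrightarrow> m \<le> n \<Longrightarrow> c m \<le> C * sqrt (real m / real n) * c n" using c_lower by blast
  obtain N0 where N0: "\<And>n t. n \<ge> N0 \<Longrightarrow> \<bar>t\<bar> \<le> \<bar>w\<bar> \<Longrightarrow> cmod (char F (t / c n) ^ n - \<psi> t) < e / 2"
    using char_conv[of "e / 2" "\<bar>w\<bar>"] e by auto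
  have "isCont \<psi> 0" by (rule \<psi>_cont)
  then obtain d where d: "d > 0" "\<And>t. \<bar>t\<bar> < d \<Longrightarrow> cmod (\<psi> t - 1) < e / 2"
    using e \<psi>_0 unfolding continuous_at_eps_delta by (metis dist_norm diff_zero half_gt_zero real_norm_def)
  have cn: "filterlim (\<lambda>k. c (n k)) at_top sequentially" by (rule filterlim_compose[OF filterlim_c n])
  have "(\<lambda>k. w / c (n k)) \<longlonglongrightarrow> 0" by (rule real_tendsto_divide_at_top[OF tendsto_const cn])
  then have "(\<lambda>k. char F (w / c (n k))) \<longlonglongrightarrow> char F 0" by (rule isCont_tendsto_compose[OF isCont_char])
  then have "(\<lambda>k. real (N0 + 1) * cmod (char F (w / c (n k)) - 1)) \<longlonglongrightarrow> real (N0 + 1) * cmod (1 - 1)"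
    unfolding char_zero by (intro tendsto_intros)
  then have ev1: "\<forall>\<^sub>F k in sequentially. real (N0 + 1) * cmod (char F (w / c (n k)) - 1) < e"
    using e by (intro order_tendstoD) auto
  have "(\<lambda>k. \<bar>w\<bar> * (C * sqrt (real (j k) / real (n k)))) \<longlonglongrightarrow> \<bar>w\<bar> * (C * sqrt 0)" by (intro tendsto_intros r)
  then have ev2: "\<forall>\<^sub>F k in sequentially. \<bar>w\<bar> * (C * sqrt (real (j k) / real (n k))) < d"
    using d(1) by (intro order_tendstoD) auto
  have "\<forall>\<^sub>F k in sequentially. norm (char F (w / c (n k)) ^ j k - 1) < e"
    using ev1 ev2
  proof eventually_elim
    case (elim k)
    show ?case
    proof (cases "j k \<ge> N0 + 1")
      case True
      have p: "c (j k) > 0" "c (n k) > 0" using True j[of k] by (auto intro!: c_pos)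
      let ?t = "w * c (j k) / c (n k)"
      have "c (j k) / c (n k) \<le> C * sqrt (real (j k) / real (n k))" using C(2)[of "j k" "n k"] True j[of k] p by (simp add: field_simps)
      then have "\<bar>w\<bar> * (c (j k) / c (n k)) \<le> \<bar>w\<bar> * (C * sqrt (real (j k) / real (n k)))" by (intro mult_left_mono) auto
      then have 1: "\<bar>?t\<bar> < d" using elim p by (simp add: abs_mult)
      have "c (j k) / c (n k) \<le> 1" using c_mono[of "j k" "n k"] True j[of k] p by simp
      then have "\<bar>w\<bar> * (c (j k) / c (n k)) \<le> \<bar>w\<bar> * 1" by (intro mult_left_mono) auto
      then have 2: "\<bar>?t\<bar> \<le> \<bar>w\<bar>" using p by (simp add: abs_mult)
      have "?t / c (j k) = w / c (n k)" using p by simp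
      then have "cmod (char F (w / c (n k)) ^ j k - \<psi> ?t) < e / 2" using N0[of "j k" ?t] 2 True by simp
      moreover have "cmod (\<psi> ?t - 1) < e / 2" by (rule d(2)[OF 1])
      ultimately show ?thesis using norm_triangle_ineq[of "char F (w / c (n k)) ^ j k - \<psi> ?t" "\<psi> ?t - 1"] by simp
    next
      case False
      have "norm (char F (w / c (n k)) ^ j k - 1 ^ j k) \<le> real (j k) * cmod (char F (w / c (n k)) - 1)"
        by (rule norm_power_diff) (auto simp: cmod_char_le_1)
      also have "\<dots> \<le> real (N0 + 1) * cmod (char F (w / c (n k)) - 1)" using False by (intro mult_right_mono) auto
      finally show ?thesis using elim by simp
    qed
  qed
  then show "\<exists>no. \<forall>k\<ge>no. norm (char F (w / c (n k)) ^ j k - 1) < e" by (simp add: eventually_sequentially)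
qed

text \<open>The m-th power is the n-th power divided by the (n - m)-th, and the latter tends to 1.
  This permits sums of m steps to be normed by c n.\<close>

lemma char_power_ratio:
  assumes n: "filterlim n at_top sequentially" and m: "\<And>k. m k \<le> n k" and r: "(\<lambda>k. real (n k - m k) / real (n k)) \<longlonglongrightarrow> 0"
  shows "(\<lambda>k. char F (w / c (n k)) ^ m k) \<longlonglongrightarrow> \<psi> w"
proof -
  have j: "(\<lambda>k. char F (w / c (n k)) ^ (n k - m k)) \<longlonglongrightarrow> 1"
    by (rule char_power_small_ratio[OF n _ r]) simp
  have "(\<lambda>k. char F (w / c (n k)) ^ n k) \<longlonglongrightarrow> \<psi> w"
    by (rule filterlim_compose[OF char_conv_pointwise n])
  then have lim: "(\<lambda>k. char F (w / c (n k)) ^ n k / char F (w / c (n k)) ^ (n k - m k)) \<longlonglongrightarrow> \<psi> w"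
    using tendsto_divide[OF _ j, of _ "\<psi> w"] by simp
  have "\<forall>\<^sub>F k in sequentially. char F (w / c (n k)) ^ (n k - m k) \<noteq> 0"
    by (rule tendsto_imp_eventually_ne[OF j]) simp
  then have "\<forall>\<^sub>F k in sequentially. char F (w / c (n k)) ^ n k / char F (w / c (n k)) ^ (n k - m k) = char F (w / c (n k)) ^ m k"
  proof eventually_elim
    case (elim k)
    have "char F (w / c (n k)) ^ n k = char F (w / c (n k)) ^ m k * char F (w / c (n k)) ^ (n k - m k)"
      using m[of k] by (simp add: power_add[symmetric])
    then show ?case using elim by simp
  qed
  then show ?thesis by (rule Lim_transform_eventually[OF lim])
qed

end

section \<open>The local limit theorem\<close>

lemma real_distribution_density:
  assumes \<mu>: "real_distribution \<mu>" and [measurable]: "f \<in> borel_measurable borel"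
    and f: "\<And>x. 0 \<le> f x" "\<And>x. f x \<le> B" and one: "(\<integral>x. f x \<partial>\<mu>) = 1"
  shows "real_distribution (density \<mu> (\<lambda>x. ennreal (f x)))"
proof -
  interpret \<mu>: real_distribution \<mu> by (rule \<mu>)
  have "integrable \<mu> f" by (rule \<mu>.integrable_const_bound[of _ B]) (use f in auto)
  then have "(\<integral>\<^sup>+x. ennreal (f x) \<partial>\<mu>) = 1"
    using one f by (subst nn_integral_eq_integral) auto
  then have "emeasure (density \<mu> (\<lambda>x. ennreal (f x))) (space (density \<mu> (\<lambda>x. ennreal (f x)))) = 1"
    by (subst emeasure_density) auto
  then show ?thesis
    by (intro real_distribution.intro prob_spaceI real_distribution_axioms.intro) auto
qed

lemma isCont_fejer: "x \<noteq> 0 \<Longrightarrow> isCont fejer x"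
proof -
  assume x: "x \<noteq> 0"
  have "isCont (\<lambda>x. 2 * (1 - cos x) / x\<^sup>2) x" using x by (intro continuous_intros) auto
  moreover have "\<forall>\<^sub>F y in nhds x. fejer y = 2 * (1 - cos y) / y\<^sup>2"
    using t1_space_nhds[OF x] by eventually_elim (simp add: fejer_def)
  ultimately show ?thesis using isCont_cong by fast
qed

text \<open>Normalised by 2 \<pi>, the total mass that \<open>fourier_fejer\<close> gives at
  frequency 0.\<close>

definition fejer_law :: "real \<Rightarrow> real measure" where
  "fejer_law a = density lborel (\<lambda>x. ennreal (a / (2 * pi) * fejer (a * x)))"

lemma integral_fejer_scaled:
  assumes "a > 0"
  shows "(\<integral>x. of_real (a / (2 * pi) * fejer (a * x)) * iexp (\<theta> * x) \<partial>lborel) = complex_of_real (tri (\<theta> / a))"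
proof -
  have "of_real (2 * pi * tri (\<theta> / a)) = (\<integral>x. of_real (fejer x) * iexp (\<theta> / a * x) \<partial>lborel)"
    by (rule fourier_fejer[symmetric])
  also have "\<dots> = \<bar>a\<bar> *\<^sub>R (\<integral>x. of_real (fejer (0 + a * x)) * iexp (\<theta> / a * (0 + a * x)) \<partial>lborel)"
    using assms by (intro lborel_integral_real_affine) auto
  also have "\<dots> = of_real a * (\<integral>x. of_real (fejer (a * x)) * iexp (\<theta> * x) \<partial>lborel)"
    using assms by (simp add: scaleR_conv_of_real)
  also have "\<dots> = of_real (2 * pi) * (\<integral>x. of_real (a / (2 * pi) * fejer (a * x)) * iexp (\<theta> * x) \<partial>lborel)"
    by (subst (1 2) integral_mult_right_zero[symmetric]) (intro Bochner_Integration.integral_cong, auto)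
  finally have "complex_of_real (2 * pi) * of_real (tri (\<theta> / a))
    = of_real (2 * pi) * (\<integral>x. of_real (a / (2 * pi) * fejer (a * x)) * iexp (\<theta> * x) \<partial>lborel)"
    by (simp only: of_real_mult)
  then show ?thesis by (subst (asm) mult_left_cancel) simp_all
qed

lemma integrable_fejer_scaled: "a > 0 \<Longrightarrow> integrable lborel (\<lambda>x. a / (2 * pi) * fejer (a * x))"
  using lborel_integrable_real_affine[OF integrable_fejer, of a 0] by (intro integrable_mult_right) simp

lemma fejer_law:
  assumes "a > 0"
  shows "real_distribution (fejer_law a)" and "char (fejer_law a) \<theta> = of_real (tri (\<theta> / a))"
proof -
  have nn: "0 \<le> a / (2 * pi) * fejer (a * x)" for x using assms fejer_nonneg by simp
  have "complex_of_real (\<integral>x. a / (2 * pi) * fejer (a * x) \<partial>lborel) = 1"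
    using integral_fejer_scaled[OF assms, of 0] by (simp add: tri_def integral_complex_of_real[symmetric] del: integral_complex_of_real)
  then have "(\<integral>x. a / (2 * pi) * fejer (a * x) \<partial>lborel) = 1" using of_real_eq_1_iff by blast
  then have "(\<integral>\<^sup>+x. ennreal (a / (2 * pi) * fejer (a * x)) \<partial>lborel) = 1"
    using integrable_fejer_scaled[OF assms] nn by (subst nn_integral_eq_integral) auto
  then have "emeasure (fejer_law a) (space (fejer_law a)) = 1"
    unfolding fejer_law_def by (subst emeasure_density) auto
  then show "real_distribution (fejer_law a)"
    by (intro real_distribution.intro prob_spaceI real_distribution_axioms.intro) (auto simp: fejer_law_def)
  have "char (fejer_law a) \<theta> = (\<integral>x. (a / (2 * pi) * fejer (a * x)) *\<^sub>R iexp (\<theta> * x) \<partial>lborel)"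
    unfolding char_def fejer_law_def by (rule integral_density) (use nn in auto)
  also have "\<dots> = of_real (tri (\<theta> / a))"
    using integral_fejer_scaled[OF assms, of \<theta>] by (simp add: scaleR_conv_of_real)
  finally show "char (fejer_law a) \<theta> = of_real (tri (\<theta> / a))" .
qed

text \<open>If the Fejer-weighted Fourier transforms of \<open>b k \<cdot> \<mu> k\<close> converge to those of a multiple of Lebesgue
  measure, the Levy continuity theorem for the weighted measures yields the local limit on intervals.\<close>

lemma local_limit_from_fejer:
  fixes b :: "nat \<Rightarrow> real" and \<mu> :: "nat \<Rightarrow> real measure"
  assumes \<mu>: "\<And>k. real_distribution (\<mu> k)" and b: "\<And>k. b k > 0" and "h > 0" and "\<gamma> > 0"
    and lim: "\<And>\<theta>. (\<lambda>k. of_real (b k) * (\<integral>x. of_real (fejer (x / h)) * iexp (\<theta> * x) \<partial>\<mu> k)) \<longlonglongrightarrow> of_real (2 * pi * \<gamma> * h * tri (\<theta> * h))"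
  shows "(\<lambda>k. b k * measure (\<mu> k) {0..<h}) \<longlonglongrightarrow> \<gamma> * h"
proof -
  define a where "a = 1 / h"
  have a: "a > 0" using \<open>h > 0\<close> by (simp add: a_def)
  define Z where "Z k = (\<integral>x. fejer (x / h) \<partial>\<mu> k)" for k
  have fi: "integrable (\<mu> k) (\<lambda>x. fejer (x / h))" for k
  proof -
    interpret real_distribution "\<mu> k" by (rule \<mu>)
    show ?thesis by (rule integrable_const_bound[of _ 1]) (auto simp: fejer_nonneg fejer_le_1)
  qed
  have "(\<lambda>k. complex_of_real (b k * Z k)) \<longlonglongrightarrow> of_real (2 * pi * \<gamma> * h)"
    using lim[of 0] by (simp add: Z_def tri_def)
  then have Zlim: "(\<lambda>k. b k * Z k) \<longlonglongrightarrow> 2 * pi * \<gamma> * h" by (rule tendsto_of_real_iff[THEN iffD1])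
  have "\<forall>\<^sub>F k in sequentially. b k * Z k > 0"
    by (rule order_tendstoD(1)[OF Zlim]) (use \<open>h > 0\<close> \<open>\<gamma> > 0\<close> in simp)
  then have evZ: "\<forall>\<^sub>F k in sequentially. Z k > 0"
    by eventually_elim (use b in \<open>simp add: zero_less_mult_iff less_not_sym\<close>)
  \<comment> \<open>The law reweighted by the kernel. The alternative serves only to make every
    member of the sequence a distribution, since \<open>Z k\<close> is positive eventually.\<close>
  define R where "R k = (if Z k > 0 then density (\<mu> k) (\<lambda>x. ennreal (fejer (x / h) / Z k)) else fejer_law a)" for k
  have R: "real_distribution (R k)" for k
  proof (cases "Z k > 0")
    case True
    have "real_distribution (density (\<mu> k) (\<lambda>x. ennreal (fejer (x / h) / Z k)))"
    proof (rule real_distribution_density[OF \<mu>, where B = "1 / Z k"])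
      show "(\<integral>x. fejer (x / h) / Z k \<partial>\<mu> k) = 1" using True by (simp add: Z_def)
    qed (use True in \<open>auto simp: fejer_nonneg fejer_le_1 intro!: divide_right_mono\<close>)
    then show ?thesis using True by (simp add: R_def)
  qed (simp add: R_def fejer_law[OF a])
  have intR: "(\<integral>x. f x \<partial>R k) = (\<integral>x. (fejer (x / h) / Z k) *\<^sub>R f x \<partial>\<mu> k)"
    if "Z k > 0" and [measurable]: "f \<in> borel_measurable borel" for k and f :: "real \<Rightarrow> 'b::{banach, second_countable_topology}"
  proof -
    interpret real_distribution "\<mu> k" by (rule \<mu>)
    show ?thesis using that unfolding R_def by (simp, intro integral_density) (auto simp: fejer_nonneg)
  qed
  have "weak_conv_m R (fejer_law a)"
  proof (rule levy_continuity[OF R fejer_law(1)[OF a]])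
    fix \<theta>
    have "(\<lambda>k. of_real (b k) * (\<integral>x. of_real (fejer (x / h)) * iexp (\<theta> * x) \<partial>\<mu> k) / of_real (b k * Z k)) \<longlonglongrightarrow> of_real (2 * pi * \<gamma> * h * tri (\<theta> * h)) / complex_of_real (2 * pi * \<gamma> * h)"
      using \<open>h > 0\<close> \<open>\<gamma> > 0\<close> by (intro tendsto_divide lim tendsto_of_real Zlim) auto
    moreover have "of_real (2 * pi * \<gamma> * h * tri (\<theta> * h)) / complex_of_real (2 * pi * \<gamma> * h) = char (fejer_law a) \<theta>"
      unfolding fejer_law(2)[OF a] using \<open>h > 0\<close> \<open>\<gamma> > 0\<close> by (simp add: a_def)
    moreover have "\<forall>\<^sub>F k in sequentially. of_real (b k) * (\<integral>x. of_real (fejer (x / h)) * iexp (\<theta> * x) \<partial>\<mu> k) / of_real (b k * Z k) = char (R k) \<theta>"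
      using evZ
    proof eventually_elim
      case (elim k)
      have "char (R k) \<theta> = (\<integral>x. (fejer (x / h) / Z k) *\<^sub>R iexp (\<theta> * x) \<partial>\<mu> k)"
        unfolding char_def by (rule intR[OF elim]) measurable
      also have "\<dots> = (\<integral>x. of_real (fejer (x / h)) * iexp (\<theta> * x) / of_real (Z k) \<partial>\<mu> k)"
        by (simp add: scaleR_conv_of_real)
      also have "\<dots> = (\<integral>x. of_real (fejer (x / h)) * iexp (\<theta> * x) \<partial>\<mu> k) / of_real (Z k)"
        by (rule integral_divide_zero)
      finally show ?case using b[of k] elim by simp
    qed
    ultimately show "(\<lambda>k. char (R k) \<theta>) \<longlonglongrightarrow> char (fejer_law a) \<theta>"
      by (simp only:) (rule Lim_transform_eventually)
  qed
  \<comment> \<open>Dividing by the kernel undoes the reweighting on the window. The quotient is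
    bounded because the kernel is at least cos 1 there, and it can be discontinuous only at 0 and h,
    which the limit law does not charge.\<close>
  define f where "f x = indicator {0..<h} x / fejer (x / h)" for x
  have [measurable]: "f \<in> borel_measurable borel" unfolding f_def[abs_def] by measurable
  have fej: "fejer (x / h) \<ge> cos 1" if "x \<in> {0..<h}" for x
    using that by (intro fejer_ge_cos_1) (auto simp: abs_le_iff)
  have fbd: "norm (f x) \<le> 1 / cos 1" for x
    using fej[of x] cos_1_pos by (auto simp: f_def indicator_def fejer_nonneg intro!: divide_left_mono mult_pos_pos)
  have cont: "isCont f x" if nz: "x \<notin> {0, h}" for x
  proof -
    consider "x < 0" | "x > h" | "0 < x" "x < h"
      using nz by (cases x "0 :: real" rule: linorder_cases; cases x h rule: linorder_cases) auto
    then show ?thesis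
    proof cases
      case 1
      then have "\<forall>\<^sub>F y in nhds x. y \<in> {..<0}" by (intro eventually_nhds_in_open) auto
      then have "\<forall>\<^sub>F y in nhds x. f y = 0" by eventually_elim (simp add: f_def)
      then show ?thesis using isCont_cong[of f "\<lambda>_. 0" x] by simp
    next
      case 2
      then have "\<forall>\<^sub>F y in nhds x. y \<in> {h<..}" by (intro eventually_nhds_in_open) auto
      then have "\<forall>\<^sub>F y in nhds x. f y = 0" by eventually_elim (simp add: f_def)
      then show ?thesis using isCont_cong[of f "\<lambda>_. 0" x] by simp
    next
      case 3
      then have "\<forall>\<^sub>F y in nhds x. y \<in> {0<..<h}" by (intro eventually_nhds_in_open) auto
      then have ev: "\<forall>\<^sub>F y in nhds x. f y = 1 / fejer (y / h)" by eventually_elim (simp add: f_def)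
      have "isCont (\<lambda>y. fejer (y / h)) x"
      proof (rule isCont_o2[where g = fejer])
        show "isCont (\<lambda>y. y / h) x" using \<open>h > 0\<close> by (intro continuous_intros) auto
        show "isCont fejer (x / h)" using 3 by (intro isCont_fejer) auto
      qed
      moreover have "fejer (x / h) \<noteq> 0" using fej[of x] 3 cos_1_pos by auto
      ultimately have "isCont (\<lambda>y. 1 / fejer (y / h)) x" by (intro continuous_intros)
      then show ?thesis using isCont_cong[OF ev] by simp
    qed
  qed
  have "emeasure (fejer_law a) {x. \<not> isCont f x} = 0"
  proof -
    have "{x. \<not> isCont f x} \<subseteq> {0, h}" using cont by auto
    then have "{x. \<not> isCont f x} \<in> null_sets lborel"
      by (meson countable_imp_null_set_lborel countable_subset uncountable_infinite finite.emptyI finite.insertI countable_finite)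
    then have m: "{x. \<not> isCont f x} \<in> sets borel" and "AE x in lborel. x \<notin> {x. \<not> isCont f x}"
      by (auto simp: null_sets_def AE_not_in[OF \<open>_ \<in> null_sets lborel\<close>, simplified] intro: AE_not_in)
    then have "(\<integral>\<^sup>+x. ennreal (a / (2 * pi) * fejer (a * x)) * indicator {x. \<not> isCont f x} x \<partial>lborel) = (\<integral>\<^sup>+(x::real). 0 \<partial>lborel)"
      by (intro nn_integral_cong_AE) (auto elim!: eventually_mono)
    then show ?thesis unfolding fejer_law_def using m by (subst emeasure_density) auto
  qed
  then have "(\<lambda>k. \<integral>x. f x \<partial>R k) \<longlonglongrightarrow> (\<integral>x. f x \<partial>fejer_law a)"
    using fbd by (intro weak_conv_imp_bdd_ae_continuous_conv[OF R fejer_law(1)[OF a] \<open>weak_conv_m R (fejer_law a)\<close>]) auto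
  then have "(\<lambda>k. b k * Z k * (\<integral>x. f x \<partial>R k)) \<longlonglongrightarrow> 2 * pi * \<gamma> * h * (\<integral>x. f x \<partial>fejer_law a)"
    by (intro tendsto_mult Zlim)
  moreover have "(\<integral>x. f x \<partial>fejer_law a) = 1 / (2 * pi)"
  proof -
    have "(\<integral>x. f x \<partial>fejer_law a) = (\<integral>x. (a / (2 * pi) * fejer (a * x)) *\<^sub>R f x \<partial>lborel)"
      unfolding fejer_law_def using a by (intro integral_density) (auto simp: fejer_nonneg)
    also have "\<dots> = (\<integral>x. a / (2 * pi) * indicator {0..<h} x \<partial>lborel)"
    proof (intro Bochner_Integration.integral_cong refl)
      fix x
      show "(a / (2 * pi) * fejer (a * x)) *\<^sub>R f x = a / (2 * pi) * indicator {0..<h} x"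
        using fej[of x] cos_1_pos by (auto simp: f_def a_def indicator_def)
    qed
    also have "\<dots> = 1 / (2 * pi)" using \<open>h > 0\<close> by (simp add: a_def)
    finally show ?thesis .
  qed
  moreover have "\<forall>\<^sub>F k in sequentially. b k * Z k * (\<integral>x. f x \<partial>R k) = b k * measure (\<mu> k) {0..<h}"
    using evZ
  proof eventually_elim
    case (elim k)
    interpret real_distribution "\<mu> k" by (rule \<mu>)
    have "(\<integral>x. f x \<partial>R k) = (\<integral>x. (fejer (x / h) / Z k) *\<^sub>R f x \<partial>\<mu> k)" by (rule intR[OF elim]) measurable
    also have "\<dots> = (\<integral>x. indicator {0..<h} x / Z k \<partial>\<mu> k)"
    proof (intro Bochner_Integration.integral_cong refl)
      fix x
      show "(fejer (x / h) / Z k) *\<^sub>R f x = indicator {0..<h} x / Z k"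
        using fej[of x] cos_1_pos by (auto simp: f_def indicator_def)
    qed
    also have "\<dots> = measure (\<mu> k) {0..<h} / Z k" by simp
    finally show ?case using elim by simp
  qed
  ultimately have "(\<lambda>k. b k * measure (\<mu> k) {0..<h}) \<longlonglongrightarrow> 2 * pi * \<gamma> * h * (1 / (2 * pi))"
    by (simp only:) (rule Lim_transform_eventually)
  then show ?thesis by simp
qed

context stable_norming
begin

text \<open>Frequencies below s0 are rescaled by c n and converge under the dominating function from
  \<open>char_power_bound\<close>; the remaining bounded frequencies decay geometrically because the
  step law is not lattice, and c n grows only polynomially.\<close>

lemma local_limit_sequence:
  fixes Sm :: "nat \<Rightarrow> real measure"
  assumes nl: "\<And>s. s \<noteq> 0 \<Longrightarrow> cmod (char F s) < 1"
    and Sm: "\<And>m. real_distribution (Sm m)" "\<And>m t. char (Sm m) t = char F t ^ m"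
    and G: "(\<integral>t. \<psi> t \<partial>lborel) = of_real (2 * pi * \<gamma>)" "\<gamma> > 0"
    and bd: "N \<ge> 1" "s0 > 0" "\<And>n m s. n \<ge> N \<Longrightarrow> n \<le> 2 * m \<Longrightarrow> \<bar>s\<bar> \<le> s0 \<Longrightarrow> cmod (char F s) ^ m \<le> C / (1 + (s * c n)\<^sup>2)"
    and n: "filterlim n at_top sequentially" "\<And>k. n k \<ge> N" and m: "\<And>k. m k \<le> n k" "\<And>k. n k \<le> 2 * m k"
    and r: "(\<lambda>k. real (n k - m k) / real (n k)) \<longlonglongrightarrow> 0"
    and y: "(\<lambda>k. y k / c (n k)) \<longlonglongrightarrow> 0" and h: "h > 0"
  shows "(\<lambda>k. c (n k) * measure (Sm (m k)) {y k..<y k + h}) \<longlonglongrightarrow> \<gamma> * h"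
proof -
  have cn: "c (n k) > 0" for k using c_pos n(2)[of k] bd by auto
  define \<mu> where "\<mu> k = distr (Sm (m k)) borel (\<lambda>x. x - y k)" for k
  have \<mu>: "real_distribution (\<mu> k)" for k unfolding \<mu>_def by (rule char_distr_shift[OF Sm(1)])
  have char\<mu>: "char (\<mu> k) t = char F t ^ m k * iexp (- (t * y k))" for k t
    unfolding \<mu>_def by (simp add: char_distr_shift(2)[OF Sm(1)] Sm(2))
  have cnlim: "filterlim (\<lambda>k. c (n k)) at_top sequentially" by (rule filterlim_compose[OF filterlim_c n(1)])
  have "(\<lambda>k. c (n k) * measure (\<mu> k) {0..<h}) \<longlonglongrightarrow> \<gamma> * h"
  proof (rule local_limit_from_fejer[OF \<mu> cn h G(2)])
    fix \<theta> :: real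
    define f where "f k s = char F s ^ m k * iexp (- (s * y k))" for k s
    have [measurable]: "f k \<in> borel_measurable borel" for k unfolding f_def[abs_def] by measurable
    have f1: "cmod (f k s) \<le> 1" for k s
      unfolding f_def norm_mult norm_power by (simp add: power_le_one cmod_char_le_1)
    let ?near = "\<lambda>t. indicator {-s0..s0} (t / h + \<theta>) :: complex"
    let ?far = "\<lambda>t. indicator (- {-s0..s0}) (t / h + \<theta>) :: complex"
    have n1: "cmod (?near t) \<le> 1" "cmod (?far t) \<le> 1" for t by (auto simp: indicator_def)
    have i1: "integrable lborel (\<lambda>t. of_real (tri t) * (?near t * f k (t / h + \<theta>)))" for k
      by (rule integrable_tri_times[of _ 1]) (use n1 f1 in \<open>auto simp: norm_mult intro!: mult_le_one\<close>)
    have i2: "integrable lborel (\<lambda>t. of_real (tri t) * (?far t * f k (t / h + \<theta>)))" for k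
      by (rule integrable_tri_times[of _ 1]) (use n1 f1 in \<open>auto simp: norm_mult intro!: mult_le_one\<close>)
    have split: "(\<integral>x. of_real (fejer (x / h)) * iexp (\<theta> * x) \<partial>\<mu> k)
       = (\<integral>t. of_real (tri t) * (?near t * f k (t / h + \<theta>)) \<partial>lborel) + (\<integral>t. of_real (tri t) * (?far t * f k (t / h + \<theta>)) \<partial>lborel)" for k
    proof -
      have "(\<integral>x. of_real (fejer (x / h)) * iexp (\<theta> * x) \<partial>\<mu> k) = (\<integral>t. of_real (tri t) * f k (t / h + \<theta>) \<partial>lborel)"
        using fejer_char[OF \<mu>[of k], of "1 / h" \<theta>] by (simp add: char\<mu> f_def)
      also have "\<dots> = (\<integral>t. of_real (tri t) * (?near t * f k (t / h + \<theta>)) + of_real (tri t) * (?far t * f k (t / h + \<theta>)) \<partial>lborel)"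
        by (intro Bochner_Integration.integral_cong refl) (simp add: indicator_def)
      also have "\<dots> = (\<integral>t. of_real (tri t) * (?near t * f k (t / h + \<theta>)) \<partial>lborel) + (\<integral>t. of_real (tri t) * (?far t * f k (t / h + \<theta>)) \<partial>lborel)"
        by (rule Bochner_Integration.integral_add[OF i1 i2])
      finally show ?thesis .
    qed
    have near: "(\<lambda>k. of_real (c (n k)) * (\<integral>t. of_real (tri t) * (?near t * f k (t / h + \<theta>)) \<partial>lborel)) \<longlonglongrightarrow> of_real (2 * pi * \<gamma> * h * tri (\<theta> * h))"
    proof -
      \<comment> \<open>The substitution w = c n (t / h + \<theta>). Under it the argument of
        \<open>tri\<close> converges to - \<theta> h, and the factor c n is used up by the change of
        variables.\<close>
      let ?g = "\<lambda>k w. of_real (tri (- (\<theta> * h) + h / c (n k) * w)) * (indicator {-s0..s0} (w / c (n k)) * f k (w / c (n k)))"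
      have eq: "of_real (c (n k)) * (\<integral>t. of_real (tri t) * (?near t * f k (t / h + \<theta>)) \<partial>lborel) = of_real h * (\<integral>w. ?g k w \<partial>lborel)" for k
      proof -
        have "(\<integral>t. of_real (tri t) * (?near t * f k (t / h + \<theta>)) \<partial>lborel)
          = \<bar>h / c (n k)\<bar> *\<^sub>R (\<integral>w. of_real (tri (- (\<theta> * h) + h / c (n k) * w)) * (?near (- (\<theta> * h) + h / c (n k) * w) * f k ((- (\<theta> * h) + h / c (n k) * w) / h + \<theta>)) \<partial>lborel)"
          using h cn[of k] by (intro lborel_integral_real_affine) auto
        also have "(\<lambda>w. (- (\<theta> * h) + h / c (n k) * w) / h + \<theta>) = (\<lambda>w. w / c (n k))"
          using h cn[of k] by (simp add: fun_eq_iff field_simps)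
        finally show ?thesis using h cn[of k] by (simp add: scaleR_conv_of_real)
      qed
      have "(\<lambda>k. \<integral>w. ?g k w \<partial>lborel) \<longlonglongrightarrow> (\<integral>w. of_real (tri (- (\<theta> * h))) * \<psi> w \<partial>lborel)"
      proof (rule integral_dominated_convergence[where w = "\<lambda>w. C * (1 / (1 + w\<^sup>2))"])
        show "integrable lborel (\<lambda>w. C * (1 / (1 + w\<^sup>2)))"
          by (intro integrable_mult_right integrable_inverse_1_plus_square_lborel)
        show "AE w in lborel. (\<lambda>k. ?g k w) \<longlonglongrightarrow> of_real (tri (- (\<theta> * h))) * \<psi> w"
        proof (rule AE_I2)
          fix w :: real
          have w0: "(\<lambda>k. w / c (n k)) \<longlonglongrightarrow> 0" by (rule real_tendsto_divide_at_top[OF tendsto_const cnlim])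
          have "(\<lambda>k. - (\<theta> * h) + h * (w / c (n k))) \<longlonglongrightarrow> - (\<theta> * h) + h * 0" by (intro tendsto_intros w0)
          then have "(\<lambda>k. - (\<theta> * h) + h / c (n k) * w) \<longlonglongrightarrow> - (\<theta> * h)" by simp
          then have 1: "(\<lambda>k. tri (- (\<theta> * h) + h / c (n k) * w)) \<longlonglongrightarrow> tri (- (\<theta> * h))"
            by (rule isCont_tendsto_compose[OF isCont_tri])
          have "\<forall>\<^sub>F k in sequentially. - s0 < w / c (n k)" "\<forall>\<^sub>F k in sequentially. w / c (n k) < s0"
            using order_tendstoD[OF w0] bd(2) by auto
          then have "\<forall>\<^sub>F k in sequentially. (indicator {-s0..s0} (w / c (n k)) :: complex) = 1"
            by eventually_elim simp
          then have 2: "(\<lambda>k. indicator {-s0..s0} (w / c (n k)) :: complex) \<longlonglongrightarrow> 1" by (rule tendsto_eventually)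
          \<comment> \<open>The window position enters only through this phase, which disappears
            because y = o(c n).\<close>
          have "(\<lambda>k. w * (y k / c (n k))) \<longlonglongrightarrow> w * 0" by (intro tendsto_intros y)
          then have "(\<lambda>k. iexp (- (w * (y k / c (n k))))) \<longlonglongrightarrow> iexp (- (w * 0))" by (intro tendsto_intros y)
          then have "(\<lambda>k. iexp (- (w / c (n k) * y k))) \<longlonglongrightarrow> 1" by simp
          then have "(\<lambda>k. f k (w / c (n k))) \<longlonglongrightarrow> \<psi> w * 1"
            unfolding f_def by (intro tendsto_mult char_power_ratio n m r)
          then show "(\<lambda>k. ?g k w) \<longlonglongrightarrow> of_real (tri (- (\<theta> * h))) * \<psi> w"
            using tendsto_mult[OF tendsto_of_real[OF 1] tendsto_mult[OF 2]] by fastforce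
        qed
        show "AE w in lborel. norm (?g k w) \<le> C * (1 / (1 + w\<^sup>2))" for k
        proof (rule AE_I2)
          fix w :: real
          \<comment> \<open>The sign of C is read off from the power bound at frequency 0.\<close>
          have nn: "0 \<le> C * (1 / (1 + w\<^sup>2))"
          proof -
            have "cmod (char F 0) ^ m k \<le> C / (1 + (0 * c (n k))\<^sup>2)" using bd n m by (intro bd(3)) auto
            then show ?thesis by (simp add: char_zero)
          qed
          show "norm (?g k w) \<le> C * (1 / (1 + w\<^sup>2))"
          proof (cases "w / c (n k) \<in> {-s0..s0}")
            case True
            then have "cmod (char F (w / c (n k))) ^ m k \<le> C / (1 + (w / c (n k) * c (n k))\<^sup>2)"
              by (intro bd(3) n m) (auto simp: abs_le_iff)
            also have "w / c (n k) * c (n k) = w" using cn[of k] by simp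
            finally have 1: "cmod (f k (w / c (n k))) \<le> C / (1 + w\<^sup>2)"
              unfolding f_def by (simp add: norm_mult norm_power)
            have "norm (?g k w) = tri (- (\<theta> * h) + h / c (n k) * w) * cmod (f k (w / c (n k)))"
              using True by (simp add: norm_mult tri_bounds)
            also have "\<dots> \<le> 1 * (C / (1 + w\<^sup>2))" using 1 nn by (intro mult_mono tri_bounds) auto
            finally show ?thesis by simp
          qed (use nn in simp)
        qed
      qed measurable
      also have "(\<integral>w. of_real (tri (- (\<theta> * h))) * \<psi> w \<partial>lborel) = of_real (tri (\<theta> * h)) * of_real (2 * pi * \<gamma>)"
        by (simp add: G tri_def)
      finally have "(\<lambda>k. of_real h * (\<integral>w. ?g k w \<partial>lborel)) \<longlonglongrightarrow> of_real h * (of_real (tri (\<theta> * h)) * of_real (2 * pi * \<gamma>))"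
        by (rule tendsto_mult_left)
      then show ?thesis unfolding eq by (simp add: mult_ac)
    qed
    have far: "(\<lambda>k. of_real (c (n k)) * (\<integral>t. of_real (tri t) * (?far t * f k (t / h + \<theta>)) \<partial>lborel)) \<longlonglongrightarrow> 0"
    proof -
      obtain q where q: "0 < q" "q < 1" "\<And>s. s0 \<le> \<bar>s\<bar> \<Longrightarrow> \<bar>s\<bar> \<le> 1 / h + \<bar>\<theta>\<bar> \<Longrightarrow> cmod (char F s) \<le> q"
        using char_norm_bound_compact[OF real_distribution_axioms nl bd(2)] by blast
      obtain A where A: "\<And>m n. 1 \<le> m \<Longrightarrow> m \<le> n \<Longrightarrow> c n \<le> (2 * real n / real m) ^ A * c m" using c_upper by blast
      have J: "norm (\<integral>t. of_real (tri t) * (?far t * f k (t / h + \<theta>)) \<partial>lborel) \<le> q ^ m k" for k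
      proof -
        have "norm (\<integral>t. of_real (tri t) * (?far t * f k (t / h + \<theta>)) \<partial>lborel) \<le> (\<integral>t. tri t * q ^ m k \<partial>lborel)"
        proof (rule order_trans[OF integral_norm_bound integral_mono])
          show "integrable lborel (\<lambda>t. norm (of_real (tri t) * (?far t * f k (t / h + \<theta>))))" by (intro integrable_norm i2)
          show "integrable lborel (\<lambda>t. tri t * q ^ m k)" by (intro integrable_mult_left integrable_tri)
          fix t :: real
          show "norm (of_real (tri t) * (?far t * f k (t / h + \<theta>))) \<le> tri t * q ^ m k"
          proof (cases "t \<in> {-1..1} \<and> t / h + \<theta> \<notin> {-s0..s0}")
            case True
            have "\<bar>t / h + \<theta>\<bar> \<le> \<bar>t\<bar> / h + \<bar>\<theta>\<bar>" using h by (metis abs_divide abs_of_pos abs_triangle_ineq)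
            also have "\<bar>t\<bar> / h \<le> 1 / h" using True h by (intro divide_right_mono) auto
            finally have "cmod (char F (t / h + \<theta>)) \<le> q" using True by (intro q(3)) auto
            then have "cmod (f k (t / h + \<theta>)) \<le> q ^ m k"
              unfolding f_def norm_mult norm_power by (simp add: power_mono)
            then show ?thesis using True tri_bounds[of t] by (simp add: norm_mult mult_left_mono)
          next
            case False
            then show ?thesis using q(1) tri_bounds[of t] by (auto simp: tri_outside)
          qed
        qed
        also have "\<dots> = q ^ m k" by (simp add: integral_tri)
        finally show ?thesis .
      qed
      have "norm (of_real (c (n k)) * (\<integral>t. of_real (tri t) * (?far t * f k (t / h + \<theta>)) \<partial>lborel)) \<le> c 1 * ((4 * (real (m k) + 1)) ^ A * q ^ m k)" for k
      proof -
        have "c (n k) \<le> (2 * real (n k) / real 1) ^ A * c 1" using n(2)[of k] bd(1) by (intro A) auto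
        also have "\<dots> \<le> (4 * (real (m k) + 1)) ^ A * c 1" using m(2)[of k] c_pos[of 1] by (intro mult_right_mono power_mono) auto
        finally have "c (n k) * norm (\<integral>t. of_real (tri t) * (?far t * f k (t / h + \<theta>)) \<partial>lborel) \<le> ((4 * (real (m k) + 1)) ^ A * c 1) * q ^ m k"
          using J[of k] cn[of k] by (intro mult_mono) auto
        then show ?thesis using cn[of k] by (simp add: norm_mult mult_ac)
      qed
      moreover have "(\<lambda>k. c 1 * ((4 * (real (m k) + 1)) ^ A * q ^ m k)) \<longlonglongrightarrow> 0"
      proof -
        \<comment> \<open>Half of the geometric decay, the factor sqrt q per step, pays for the
          polynomial growth; the other half tends to 0.\<close>
        obtain D where D: "D > 0" "\<And>j. sqrt q ^ j * (4 * (real j + 1)) ^ A \<le> D"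
          using geometric_times_power_bounded[of "sqrt q" A] q by auto
        have "filterlim m at_top sequentially"
          unfolding filterlim_at_top
        proof
          fix Z
          have "\<forall>\<^sub>F k in sequentially. 2 * Z \<le> n k" using n(1) by (simp add: filterlim_at_top)
          then show "\<forall>\<^sub>F k in sequentially. Z \<le> m k"
          proof eventually_elim
            case (elim k)
            then show ?case using m(2)[of k] by linarith
          qed
        qed
        moreover have "(\<lambda>j. sqrt q ^ j) \<longlonglongrightarrow> 0" using q by (intro LIMSEQ_realpow_zero) auto
        ultimately have 0: "(\<lambda>k. c 1 * (D * sqrt q ^ m k)) \<longlonglongrightarrow> c 1 * (D * 0)"
          by (intro tendsto_intros) (rule filterlim_compose)
        have le: "(4 * (real j + 1)) ^ A * q ^ j \<le> D * sqrt q ^ j" for j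
        proof -
          have "q ^ j = sqrt q ^ j * sqrt q ^ j" using q by (simp add: power_mult_distrib[symmetric])
          then have "(4 * (real j + 1)) ^ A * q ^ j = (sqrt q ^ j * (4 * (real j + 1)) ^ A) * sqrt q ^ j" by simp
          also have "\<dots> \<le> D * sqrt q ^ j" using D q by (intro mult_right_mono) auto
          finally show ?thesis .
        qed
        show ?thesis
        proof (rule tendsto_sandwich[OF _ _ tendsto_const])
          show "\<forall>\<^sub>F k in sequentially. 0 \<le> c 1 * ((4 * (real (m k) + 1)) ^ A * q ^ m k)"
            using c_pos[of 1] q by (intro always_eventually allI mult_nonneg_nonneg) auto
          show "\<forall>\<^sub>F k in sequentially. c 1 * ((4 * (real (m k) + 1)) ^ A * q ^ m k) \<le> c 1 * (D * sqrt q ^ m k)"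
            using c_pos[of 1] by (intro always_eventually allI mult_left_mono le) auto
        qed (use 0 in simp)
      qed
      ultimately show ?thesis by (rule Lim_null_comparison[OF always_eventually[OF allI]])
    qed
    show "(\<lambda>k. of_real (c (n k)) * (\<integral>x. of_real (fejer (x / h)) * iexp (\<theta> * x) \<partial>\<mu> k)) \<longlonglongrightarrow> of_real (2 * pi * \<gamma> * h * tri (\<theta> * h))"
      using tendsto_add[OF near far] unfolding split distrib_left by simp
  qed
  moreover have "measure (\<mu> k) {0..<h} = measure (Sm (m k)) {y k..<y k + h}" for k
  proof -
    interpret S: real_distribution "Sm (m k)" by (rule Sm)
    have "(\<lambda>x. x - y k) -` {0..<h} \<inter> space (Sm (m k)) = {y k..<y k + h}" by auto
    then show ?thesis unfolding \<mu>_def by (subst measure_distr) auto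
  qed
  ultimately show ?thesis by simp
qed

text \<open>Failure for every \<epsilon> yields sequences of n, m and y to which the sequential
  version applies; the uniformity is therefore obtained without quantitative rates.\<close>

lemma local_limit:
  fixes Sm :: "nat \<Rightarrow> real measure"
  assumes nl: "\<And>s. s \<noteq> 0 \<Longrightarrow> cmod (char F s) < 1"
    and Sm: "\<And>m. real_distribution (Sm m)" "\<And>m t. char (Sm m) t = char F t ^ m"
    and G: "(\<integral>t. \<psi> t \<partial>lborel) = of_real (2 * pi * \<gamma>)" "\<gamma> > 0"
    and h: "h > 0" and \<eta>: "\<eta> > 0"
  shows "\<exists>\<epsilon>>0. \<exists>N. \<forall>n\<ge>N. \<forall>m y. m \<le> n \<longrightarrow> real (n - m) \<le> \<epsilon> * real n \<longrightarrow> \<bar>y\<bar> \<le> \<epsilon> * c n \<longrightarrow>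
    \<bar>c n * measure (Sm m) {y..<y + h} - \<gamma> * h\<bar> < \<eta>"
proof (rule ccontr)
  assume neg: "\<not> ?thesis"
  obtain C N s0 where C: "N \<ge> 1" "s0 > 0" and
    bd: "\<And>n m s. n \<ge> N \<Longrightarrow> n \<le> 2 * m \<Longrightarrow> \<bar>s\<bar> \<le> s0 \<Longrightarrow> cmod (char F s) ^ m \<le> C / (1 + (s * c n)\<^sup>2)"
    using char_power_bound by metis
  \<comment> \<open>The offset 2 keeps this at most 1/2, which gives n \<le> 2 m as the power bound
    requires.\<close>
  let ?e = "\<lambda>k. 1 / (real k + 2)"
  have "\<forall>k. \<exists>n m y. n \<ge> N + k \<and> m \<le> n \<and> real (n - m) \<le> ?e k * real n \<and> \<bar>y\<bar> \<le> ?e k * c n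
      \<and> \<not> \<bar>c n * measure (Sm m) {y..<y + h} - \<gamma> * h\<bar> < \<eta>"
  proof
    fix k
    have "?e k > 0" by simp
    then show "\<exists>n m y. n \<ge> N + k \<and> m \<le> n \<and> real (n - m) \<le> ?e k * real n \<and> \<bar>y\<bar> \<le> ?e k * c n
      \<and> \<not> \<bar>c n * measure (Sm m) {y..<y + h} - \<gamma> * h\<bar> < \<eta>"
      using neg by blast
  qed
  then obtain n m y where nN: "\<And>k. n k \<ge> N + k" and mn: "\<And>k. m k \<le> n k"
    and r: "\<And>k. real (n k - m k) \<le> ?e k * real (n k)" and y: "\<And>k. \<bar>y k\<bar> \<le> ?e k * c (n k)"
    and bad: "\<And>k. \<not> \<bar>c (n k) * measure (Sm (m k)) {y k..<y k + h} - \<gamma> * h\<bar> < \<eta>" by metis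
  have e0: "?e \<longlonglongrightarrow> 0"
    using LIMSEQ_ignore_initial_segment[OF lim_1_over_n[where 'a = real], of 2] by (simp add: add.commute)
  have npos: "real (n k) > 0" "c (n k) > 0" for k using nN[of k] C by (auto intro!: c_pos)
  have "(\<lambda>k. c (n k) * measure (Sm (m k)) {y k..<y k + h}) \<longlonglongrightarrow> \<gamma> * h"
  proof (rule local_limit_sequence[OF nl Sm G C bd])
    show "filterlim n at_top sequentially"
    proof (rule filterlim_at_top_mono[OF filterlim_ident])
      show "\<forall>\<^sub>F k in sequentially. k \<le> n k" using nN by (intro always_eventually allI) (meson add_leD2)
    qed
    show "N \<le> n k" for k using nN[of k] by simp
    show "m k \<le> n k" for k by (rule mn)
    show "n k \<le> 2 * m k" for k
    proof -
      have "real (n k - m k) \<le> (1 / 2) * real (n k)"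
        by (rule order_trans[OF r mult_right_mono]) (auto simp: field_simps)
      then show ?thesis using mn[of k] by linarith
    qed
    show "(\<lambda>k. real (n k - m k) / real (n k)) \<longlonglongrightarrow> 0"
    proof (rule Lim_null_comparison[OF always_eventually[OF allI] e0])
      fix k
      show "norm (real (n k - m k) / real (n k)) \<le> ?e k" using r[of k] npos[of k] by (simp add: divide_le_eq)
    qed
    show "(\<lambda>k. y k / c (n k)) \<longlonglongrightarrow> 0"
    proof (rule Lim_null_comparison[OF always_eventually[OF allI] e0])
      fix k
      show "norm (y k / c (n k)) \<le> ?e k" using y[of k] npos[of k] by (simp add: divide_le_eq)
    qed
  qed (use h in auto)
  then have "\<forall>\<^sub>F k in sequentially. \<bar>c (n k) * measure (Sm (m k)) {y k..<y k + h} - \<gamma> * h\<bar> < \<eta>"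
    unfolding dist_real_def[symmetric] by (rule tendstoD[OF _ \<eta>])
  then show False using bad by (simp add: eventually_sequentially)
qed

end

section \<open>Positivity of stable densities at the origin\<close>

text \<open>Dominates exp (- w t^\<alpha>) as well as its derivative in w on the whole half-plane Re
  w \<ge> \<rho>; the factor 1 + t^\<alpha> covers both.\<close>

definition stretched_dom :: "real \<Rightarrow> real \<Rightarrow> real \<Rightarrow> real" where
  "stretched_dom \<alpha> \<rho> t = indicator {0<..} t * ((1 + t powr \<alpha>) * exp (- \<rho> * t powr \<alpha>))"

lemma integrable_stretched_dom:
  assumes \<alpha>: "\<alpha> > 0" and \<rho>: "\<rho> > 0"
  shows "integrable lborel (stretched_dom \<alpha> \<rho>)"
proof -
  \<comment> \<open>With s = t^\<alpha> one has t^2 = s^(2/\<alpha>), at most (1 + s)^B; exponential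
    decay in s therefore beats 1 + t^2.\<close>
  obtain B :: nat where B: "2 / \<alpha> \<le> real B" using real_arch_simple by blast
  define C where "C = 2 * (exp \<rho> / \<rho> ^ (B + 1)) * fact (B + 1)"
  have C: "C \<ge> 0" using \<rho> by (simp add: C_def)
  have bd: "\<bar>stretched_dom \<alpha> \<rho> t\<bar> \<le> C * (1 / (1 + t\<^sup>2))" for t
  proof (cases "t > 0")
    case True
    define s where "s = t powr \<alpha>"
    have s: "s \<ge> 0" "s > 0" using True by (auto simp: s_def)
    have "t\<^sup>2 = s powr (2 / \<alpha>)" using True \<alpha> by (simp add: s_def powr_powr)
    also have "\<dots> \<le> (1 + s) powr (2 / \<alpha>)" using s \<alpha> by (intro powr_mono2) auto
    also have "\<dots> \<le> (1 + s) powr real B" using B s by (intro powr_mono) auto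
    also have "\<dots> = (1 + s) ^ B" using s by (simp add: powr_realpow)
    finally have t2: "t\<^sup>2 \<le> (1 + s) ^ B" .
    have "1 \<le> (1 + s) ^ B" using s by simp
    with t2 have t3: "1 + t\<^sup>2 \<le> 2 * (1 + s) ^ B" by simp
    have "(\<rho> * (1 + s)) ^ (B + 1) \<le> fact (B + 1) * exp (\<rho> * (1 + s))"
      using s \<rho> by (intro power_le_fact_exp) auto
    then have "exp (- (\<rho> * (1 + s))) * (\<rho> * (1 + s)) ^ (B + 1) \<le> exp (- (\<rho> * (1 + s))) * (fact (B + 1) * exp (\<rho> * (1 + s)))"
      by (intro mult_left_mono) auto
    also have "\<dots> = fact (B + 1)"
      by (simp only: mult.left_commute[of "exp (- (\<rho> * (1 + s)))"] exp_add[symmetric]) simp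
    finally have e: "exp (- (\<rho> * (1 + s))) * (\<rho> * (1 + s)) ^ (B + 1) \<le> fact (B + 1)" .
    have "(1 + s) * exp (- \<rho> * s) * (1 + t\<^sup>2) \<le> (1 + s) * exp (- \<rho> * s) * (2 * (1 + s) ^ B)"
      using s t3 by (intro mult_left_mono) auto
    also have "\<dots> = 2 * (exp \<rho> / \<rho> ^ (B + 1)) * (exp (- (\<rho> * (1 + s))) * (\<rho> * (1 + s)) ^ (B + 1))"
    proof -
      have "exp (- \<rho> * s) = exp \<rho> * exp (- (\<rho> * (1 + s)))" by (simp add: exp_add[symmetric] distrib_left)
      moreover have "(\<rho> * (1 + s)) ^ (B + 1) = \<rho> ^ (B + 1) * ((1 + s) * (1 + s) ^ B)" by (simp only: power_mult_distrib Suc_eq_plus1[symmetric] power_Suc mult_ac)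
      ultimately show ?thesis using \<rho> by (simp del: power_Suc)
    qed
    also have "\<dots> \<le> C" unfolding C_def using e \<rho> by (intro mult_left_mono) auto
    finally have "(1 + s) * exp (- \<rho> * s) * (1 + t\<^sup>2) \<le> C" .
    then have "(1 + s) * exp (- \<rho> * s) \<le> C * (1 / (1 + t\<^sup>2))" by (simp add: pos_le_divide_eq add_pos_nonneg)
    then show ?thesis using True s by (simp add: stretched_dom_def s_def)
  next
    case False
    then show ?thesis using C by (simp add: stretched_dom_def)
  qed
  have m: "stretched_dom \<alpha> \<rho> \<in> borel_measurable lborel"
    unfolding stretched_dom_def[abs_def] by measurable
  show ?thesis
    by (rule Bochner_Integration.integrable_bound[OF integrable_mult_right[OF integrable_inverse_1_plus_square_lborel, of C] m])
       (use bd C in auto)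
qed

text \<open>For Re w > 0 this is Gamma (1 + 1/\<alpha>) w^(-1/\<alpha>). Only positivity of the
  constant is needed, so it is kept as the value at w = 1.\<close>

definition stretched :: "real \<Rightarrow> complex \<Rightarrow> complex" where
  "stretched \<alpha> w = (\<integral>t. indicator {0<..} t *\<^sub>R exp (- w * of_real (t powr \<alpha>)) \<partial>lborel)"

definition stretched' :: "real \<Rightarrow> complex \<Rightarrow> complex" where
  "stretched' \<alpha> w = (\<integral>t. indicator {0<..} t *\<^sub>R (exp (- w * of_real (t powr \<alpha>)) * (- of_real (t powr \<alpha>))) \<partial>lborel)"

lemma norm_exp_neg: "cmod (exp (- w * of_real s)) = exp (- Re w * s)"
  by (simp add: norm_exp_eq_Re)

lemma integrable_stretched:
  assumes "\<alpha> > 0" "Re w > 0"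
  shows "integrable lborel (\<lambda>t. indicator {0<..} t *\<^sub>R exp (- w * of_real (t powr \<alpha>)))"
proof (rule Bochner_Integration.integrable_bound[OF integrable_stretched_dom[OF assms]])
  show "AE t in lborel. norm (indicator {0<..} t *\<^sub>R exp (- w * of_real (t powr \<alpha>))) \<le> norm (stretched_dom \<alpha> (Re w) t)"
    by (rule AE_I2) (simp add: stretched_dom_def indicator_def norm_exp_neg)
qed measurable

lemma stretched_has_derivative:
  assumes \<alpha>: "\<alpha> > 0" and w: "Re w > 0"
  shows "(stretched \<alpha> has_field_derivative stretched' \<alpha> w) (at w)"
  unfolding DERIV_def tendsto_at_iff_sequentially
proof (intro allI impI)
  fix X :: "nat \<Rightarrow> complex"
  assume X: "\<forall>i. X i \<in> UNIV - {0}" "X \<longlonglongrightarrow> 0"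
  \<comment> \<open>Half of Re w: all but finitely many w + X i satisfy Re z \<ge> \<rho>, where one
    dominating function serves. The shift by k discards the others.\<close>
  define \<rho> where "\<rho> = Re w / 2"
  have \<rho>: "\<rho> > 0" "\<rho> < Re w" using w by (auto simp: \<rho>_def)
  have "\<forall>\<^sub>F i in sequentially. dist (X i) 0 < \<rho>" using X(2) \<rho>(1) by (rule tendstoD)
  then obtain k where k: "\<And>i. i \<ge> k \<Longrightarrow> cmod (X i) < \<rho>" by (auto simp: eventually_sequentially)
  let ?Y = "\<lambda>i. X (i + k)"
  have Y: "?Y i \<noteq> 0" "Re (w + ?Y i) \<ge> \<rho>" for i
  proof -
    show "?Y i \<noteq> 0" using X by auto
    have "\<bar>Re (?Y i)\<bar> < \<rho>" using k[of "i + k"] abs_Re_le_cmod[of "?Y i"] by linarith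
    then show "Re (w + ?Y i) \<ge> \<rho>" by (simp add: \<rho>_def)
  qed
  let ?q = "\<lambda>i t. indicator {0<..} t *\<^sub>R ((exp (- (w + ?Y i) * of_real (t powr \<alpha>)) - exp (- w * of_real (t powr \<alpha>))) / ?Y i)"
  have quot: "(stretched \<alpha> (w + ?Y i) - stretched \<alpha> w) / ?Y i = (\<integral>t. ?q i t \<partial>lborel)" for i
  proof -
    have "stretched \<alpha> (w + ?Y i) - stretched \<alpha> w = (\<integral>t. indicator {0<..} t *\<^sub>R exp (- (w + ?Y i) * of_real (t powr \<alpha>)) - indicator {0<..} t *\<^sub>R exp (- w * of_real (t powr \<alpha>)) \<partial>lborel)"
      unfolding stretched_def using Y(2)[of i] \<rho> w \<alpha>
      by (intro Bochner_Integration.integral_diff[symmetric] integrable_stretched) auto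
    then have "(stretched \<alpha> (w + ?Y i) - stretched \<alpha> w) / ?Y i = (\<integral>t. (indicator {0<..} t *\<^sub>R exp (- (w + ?Y i) * of_real (t powr \<alpha>)) - indicator {0<..} t *\<^sub>R exp (- w * of_real (t powr \<alpha>))) / ?Y i \<partial>lborel)"
      by (simp only: integral_divide_zero)
    also have "\<dots> = (\<integral>t. ?q i t \<partial>lborel)"
      by (intro Bochner_Integration.integral_cong refl) (simp add: indicator_def)
    finally show ?thesis .
  qed
  have Y0: "?Y \<longlonglongrightarrow> 0" by (rule LIMSEQ_ignore_initial_segment[OF X(2)])
  have "(\<lambda>i. \<integral>t. ?q i t \<partial>lborel) \<longlonglongrightarrow> stretched' \<alpha> w"
    unfolding stretched'_def
  proof (rule integral_dominated_convergence[OF _ _ integrable_stretched_dom[OF \<alpha> \<rho>(1)]])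
    show "AE t in lborel. (\<lambda>i. ?q i t) \<longlonglongrightarrow> indicator {0<..} t *\<^sub>R (exp (- w * of_real (t powr \<alpha>)) * (- of_real (t powr \<alpha>)))"
    proof (rule AE_I2)
      fix t
      let ?s = "complex_of_real (t powr \<alpha>)"
      have "((\<lambda>z. exp (- z * ?s)) has_field_derivative (exp (- w * ?s) * (- ?s))) (at w)"
        by (auto intro!: derivative_eq_intros)
      then have "((\<lambda>h. (exp (- (w + h) * ?s) - exp (- w * ?s)) / h) \<longlongrightarrow> exp (- w * ?s) * (- ?s)) (at 0)"
        by (simp only: DERIV_def)
      moreover have "filterlim ?Y (at 0) sequentially" using Y0 Y(1) by (intro filterlim_atI) auto
      ultimately have "(\<lambda>i. (exp (- (w + ?Y i) * ?s) - exp (- w * ?s)) / ?Y i) \<longlonglongrightarrow> exp (- w * ?s) * (- ?s)"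
        by (rule filterlim_compose)
      then show "(\<lambda>i. ?q i t) \<longlonglongrightarrow> indicator {0<..} t *\<^sub>R (exp (- w * ?s) * (- ?s))"
        by (intro tendsto_scaleR tendsto_const)
    qed
    show "AE t in lborel. norm (?q i t) \<le> stretched_dom \<alpha> \<rho> t" for i
    proof (rule AE_I2)
      fix t :: real
      show "norm (?q i t) \<le> stretched_dom \<alpha> \<rho> t"
      proof (cases "t > 0")
        case True
        define s where "s = t powr \<alpha>"
        have s: "s > 0" using True by (simp add: s_def)
        \<comment> \<open>The half-plane is convex, so the difference quotient is bounded by the
          supremum of the derivative there.\<close>
        have "norm (exp (- (w + ?Y i) * of_real s) - exp (- w * of_real s)) \<le> (s * exp (- \<rho> * s)) * norm ((w + ?Y i) - w)"
        proof (rule field_differentiable_bound[of "{z. \<rho> \<le> Re z}"])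
          show "convex {z. \<rho> \<le> Re z}" by (rule convex_halfspace_Re_ge)
          fix z assume "z \<in> {z. \<rho> \<le> Re z}"
          then have z: "\<rho> \<le> Re z" by simp
          show "((\<lambda>z. exp (- z * of_real s)) has_field_derivative (exp (- z * of_real s) * (- of_real s))) (at z within {z. \<rho> \<le> Re z})"
            by (auto intro!: derivative_eq_intros)
          show "norm (exp (- z * of_real s) * (- of_real s)) \<le> s * exp (- \<rho> * s)"
            unfolding norm_mult norm_exp_neg using z s by simp
        qed (use Y(2)[of i] \<rho> in auto)
        then have "norm ((exp (- (w + ?Y i) * of_real s) - exp (- w * of_real s)) / ?Y i) \<le> s * exp (- \<rho> * s)"
          using Y(1)[of i] by (simp add: norm_divide divide_le_eq)
        also have "\<dots> \<le> (1 + s) * exp (- \<rho> * s)" by (intro mult_right_mono) auto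
        finally show ?thesis using True by (simp add: stretched_dom_def s_def)
      qed (simp add: stretched_dom_def)
    qed
  qed measurable
  then have "(\<lambda>i. (stretched \<alpha> (w + X (i + k)) - stretched \<alpha> w) / X (i + k)) \<longlonglongrightarrow> stretched' \<alpha> w"
    unfolding quot .
  then have "(\<lambda>i. (stretched \<alpha> (w + X i) - stretched \<alpha> w) / X i) \<longlonglongrightarrow> stretched' \<alpha> w"
    by (rule LIMSEQ_offset[where k = k])
  then show "((\<lambda>h. (stretched \<alpha> (w + h) - stretched \<alpha> w) / h) \<circ> X) \<longlonglongrightarrow> stretched' \<alpha> w"
    by (simp add: o_def)
qed

text \<open>The substitution t = b u with b = r^(-1/\<alpha>), chosen so that r b^\<alpha> =
  1.\<close>

lemma stretched_scale:
  assumes \<alpha>: "\<alpha> > 0" and r: "r > 0"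
  shows "stretched \<alpha> (of_real r * w) = of_real (r powr (- 1 / \<alpha>)) * stretched \<alpha> w"
proof -
  define b where "b = r powr (- 1 / \<alpha>)"
  have b: "b > 0" using r by (simp add: b_def)
  have "b powr \<alpha> = r powr (- 1)" unfolding b_def powr_powr using \<alpha> by simp
  then have br: "b powr \<alpha> * r = 1" using r by (simp add: powr_minus)
  have "stretched \<alpha> (of_real r * w) = \<bar>b\<bar> *\<^sub>R (\<integral>t. indicator {0<..} (0 + b * t) *\<^sub>R exp (- (of_real r * w) * of_real ((0 + b * t) powr \<alpha>)) \<partial>lborel)"
    unfolding stretched_def using b by (intro lborel_integral_real_affine) auto
  also have "(\<integral>t. indicator {0<..} (0 + b * t) *\<^sub>R exp (- (of_real r * w) * of_real ((0 + b * t) powr \<alpha>)) \<partial>lborel)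
     = (\<integral>t. indicator {0<..} t *\<^sub>R exp (- w * of_real (t powr \<alpha>)) \<partial>lborel)"
  proof (intro Bochner_Integration.integral_cong refl)
    fix t :: real
    show "indicator {0<..} (0 + b * t) *\<^sub>R exp (- (of_real r * w) * of_real ((0 + b * t) powr \<alpha>)) = (indicator {0<..} t *\<^sub>R exp (- w * of_real (t powr \<alpha>)) :: complex)"
    proof (cases "t > 0")
      case True
      have "r * (b * t) powr \<alpha> = t powr \<alpha>"
        using br b True by (simp add: powr_mult) (metis mult.commute mult.left_commute mult.right_neutral)
      then have "complex_of_real r * of_real ((b * t) powr \<alpha>) = of_real (t powr \<alpha>)"
        by (simp only: of_real_mult[symmetric])
      then have "- (complex_of_real r * w) * of_real ((0 + b * t) powr \<alpha>) = - w * of_real (t powr \<alpha>)"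
        by (simp add: mult.assoc mult.left_commute)
      then show ?thesis using True b by (simp only:) (simp add: indicator_def)
    next
      case False
      then show ?thesis using b by (simp add: zero_less_mult_iff)
    qed
  qed
  finally show ?thesis using b by (simp add: stretched_def b_def scaleR_conv_of_real)
qed

text \<open>The integral of \<open>exp (- w t\<^sup>\<alpha>)\<close> over \<open>t > 0\<close> is continued analytically from real \<open>w\<close>: homogeneity
  under real scaling gives the derivative in the radial direction, and by complex differentiability in all directions.\<close>

lemma stretched_euler:
  assumes \<alpha>: "\<alpha> > 0" and w: "Re w > 0"
  shows "w * stretched' \<alpha> w = - of_real (1 / \<alpha>) * stretched \<alpha> w"
proof -
  have "((\<lambda>r. stretched \<alpha> (of_real r * w)) has_vector_derivative (of_real 1 * w) * stretched' \<alpha> (of_real 1 * w)) (at 1)"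
  proof -
    have 1: "((\<lambda>r. of_real r * w) has_vector_derivative (of_real 1 * w)) (at 1)"
      by (auto intro!: derivative_eq_intros)
    have 2: "(stretched \<alpha> has_field_derivative stretched' \<alpha> (of_real 1 * w)) (at (of_real 1 * w))"
      using stretched_has_derivative[OF \<alpha> w] by simp
    show ?thesis using field_vector_diff_chain_at[OF 1 2] by (simp add: o_def)
  qed
  then have A: "((\<lambda>r. stretched \<alpha> (of_real r * w)) has_vector_derivative w * stretched' \<alpha> w) (at 1)" by simp
  have "((\<lambda>r. r powr (- 1 / \<alpha>)) has_real_derivative (- 1 / \<alpha>) * 1 powr (- 1 / \<alpha> - 1)) (at 1)"
    by (auto intro!: derivative_eq_intros)
  then have "((\<lambda>r. of_real (r powr (- 1 / \<alpha>)) * stretched \<alpha> w) has_vector_derivative of_real ((- 1 / \<alpha>) * 1 powr (- 1 / \<alpha> - 1)) * stretched \<alpha> w) (at 1)"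
    by (intro has_vector_derivative_mult_left has_vector_derivative_of_real)
  then have B: "((\<lambda>r. of_real (r powr (- 1 / \<alpha>)) * stretched \<alpha> w) has_vector_derivative - of_real (1 / \<alpha>) * stretched \<alpha> w) (at 1)"
    by simp
  have "((\<lambda>r. stretched \<alpha> (of_real r * w)) has_vector_derivative - of_real (1 / \<alpha>) * stretched \<alpha> w) (at 1)"
  proof (rule has_vector_derivative_transform_within_open[OF B])
    show "open ({0<..} :: real set)" "(1::real) \<in> {0<..}" by auto
  qed (simp add: stretched_scale[OF \<alpha>])
  then show ?thesis using A by (rule vector_derivative_unique_at[symmetric])
qed

text \<open>By the Euler relation the product with exp (Ln w / \<alpha>) has derivative 0 on the
  right half-plane. This set is convex, so the product equals its value at 1.\<close>

lemma stretched_eq: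
  assumes \<alpha>: "\<alpha> > 0" and w: "Re w > 0"
  shows "stretched \<alpha> w = stretched \<alpha> 1 * exp (- of_real (1 / \<alpha>) * Ln w)"
proof -
  let ?p = "complex_of_real (1 / \<alpha>)" and ?S = "{z. Re z > 0}"
  have nz: "z \<noteq> 0" "z \<notin> \<real>\<^sub>\<le>\<^sub>0" if "Re z > 0" for z
    using that by (auto simp: complex_nonpos_Reals_iff)
  have "((\<lambda>z. stretched \<alpha> z * exp (?p * Ln z)) has_field_derivative 0) (at z within ?S)" if "z \<in> ?S" for z
  proof -
    have z: "Re z > 0" using that by simp
    have "((\<lambda>z. stretched \<alpha> z * exp (?p * Ln z)) has_field_derivative
       stretched' \<alpha> z * exp (?p * Ln z) + (exp (?p * Ln z) * (?p * inverse z)) * stretched \<alpha> z) (at z)"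
      by (intro DERIV_mult' stretched_has_derivative[OF \<alpha> z, THEN DERIV_cong] DERIV_chain2[where f = exp] derivative_eq_intros has_field_derivative_Ln | use nz[OF z] in simp)+
    moreover have "stretched' \<alpha> z * exp (?p * Ln z) + (exp (?p * Ln z) * (?p * inverse z)) * stretched \<alpha> z = 0"
    proof -
      have "stretched' \<alpha> z = - ?p * stretched \<alpha> z * inverse z"
      proof -
        have "stretched' \<alpha> z = inverse z * (z * stretched' \<alpha> z)" using nz(1)[OF z] by simp
        also have "\<dots> = - ?p * stretched \<alpha> z * inverse z" unfolding stretched_euler[OF \<alpha> z] by (simp only: mult_ac)
        finally show ?thesis .
      qed
      then show ?thesis by simp
    qed
    ultimately have "((\<lambda>z. stretched \<alpha> z * exp (?p * Ln z)) has_field_derivative 0) (at z)" by (simp only:)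
    then show ?thesis by (rule has_field_derivative_at_within)
  qed
  then have "\<exists>k. \<forall>z\<in>?S. stretched \<alpha> z * exp (?p * Ln z) = k"
    by (rule has_field_derivative_zero_constant[OF convex_halfspace_Re_gt[of 0]])
  then obtain k where k: "\<And>z. z \<in> ?S \<Longrightarrow> stretched \<alpha> z * exp (?p * Ln z) = k" by blast
  have "w \<in> ?S" "1 \<in> ?S" using w by simp_all
  then have "stretched \<alpha> w * exp (?p * Ln w) = stretched \<alpha> 1 * exp (?p * Ln 1)"
    using k by metis
  then have "stretched \<alpha> w * exp (?p * Ln w) = stretched \<alpha> 1" by simp
  then have "stretched \<alpha> w * exp (?p * Ln w) * exp (- ?p * Ln w) = stretched \<alpha> 1 * exp (- ?p * Ln w)" by (simp only:)
  moreover have "exp (?p * Ln w) * exp (- ?p * Ln w) = 1" by (simp add: exp_add[symmetric])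
  ultimately show ?thesis by (simp only: mult.assoc mult_1_right)
qed

lemma stretched_1_pos:
  assumes "\<alpha> > 0" shows "\<exists>r>0. stretched \<alpha> 1 = of_real r"
proof -
  let ?f = "\<lambda>t. indicator {0<..} t * exp (- (t powr \<alpha>)) :: real"
  have e: "stretched \<alpha> 1 = (\<integral>t. complex_of_real (?f t) \<partial>lborel)"
    unfolding stretched_def by (intro Bochner_Integration.integral_cong refl) (simp add: scaleR_conv_of_real exp_of_real[symmetric])
  have i: "integrable lborel ?f"
  proof -
    have "integrable lborel (\<lambda>t. complex_of_real (?f t))"
      using integrable_stretched[OF assms, of 1] by (simp add: scaleR_conv_of_real exp_of_real[symmetric])
    then show ?thesis by (simp only: complex_of_real_integrable_eq)
  qed
  have "(\<integral>t. ?f t \<partial>lborel) > 0"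
  proof -
    have "(\<integral>t. ?f t \<partial>lborel) \<noteq> 0"
    proof
      assume "(\<integral>t. ?f t \<partial>lborel) = 0"
      then have "AE t in lborel. ?f t = 0" using integral_nonneg_eq_0_iff_AE[OF i] by auto
      then have "AE t in lborel. t \<notin> {0<..<1::real}" by eventually_elim (auto simp: indicator_def)
      then have "{0<..<1::real} \<in> null_sets lborel" using AE_iff_null_sets[of "{0<..<1::real}" lborel] by simp
      then have "emeasure lborel {0<..<1::real} = 0" by (rule null_setsD1)
      then show False by simp
    qed
    moreover have "(\<integral>t. ?f t \<partial>lborel) \<ge> 0" by (intro integral_nonneg_AE) auto
    ultimately show ?thesis by linarith
  qed
  moreover have "stretched \<alpha> 1 = of_real (\<integral>t. ?f t \<partial>lborel)" unfolding e by (rule integral_complex_of_real)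
  ultimately show ?thesis by blast
qed

text \<open>The parameter set enters here. For \<alpha> < 1 the angle is below \<pi> \<alpha> / 2
  because |\<beta>| < 1; at |\<beta>| = 1, the one-sided laws, it would be equal. For 1 < \<alpha> <
  2 the tangent is minus that of \<pi> - \<pi> \<alpha> / 2, and the angle is at most \<pi> - \<pi>
  \<alpha> / 2, which is smaller than \<pi> \<alpha> / 2.\<close>

lemma stable_angle:
  assumes "(\<alpha>, \<beta>) \<in> stable_params"
  shows "0 < \<alpha>" "\<bar>arctan (\<beta> * tan (pi * \<alpha> / 2))\<bar> < pi * \<alpha> / 2"
proof -
  consider "0 < \<alpha>" "\<alpha> < 1" "\<bar>\<beta>\<bar> < 1" | "1 < \<alpha>" "\<alpha> < 2" "\<bar>\<beta>\<bar> \<le> 1" | "\<beta> = 0" "\<alpha> = 1 \<or> \<alpha> = 2"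
    using assms by (auto simp: stable_params_def)
  then have "0 < \<alpha> \<and> \<bar>arctan (\<beta> * tan (pi * \<alpha> / 2))\<bar> < pi * \<alpha> / 2"
  proof cases
    case 1
    let ?T = "tan (pi * \<alpha> / 2)"
    have a: "0 < pi * \<alpha> / 2" "pi * \<alpha> / 2 < pi / 2" using 1 by auto
    have T: "?T > 0" using a by (intro tan_gt_zero) auto
    have "\<bar>\<beta> * ?T\<bar> < ?T" using 1 T by (simp add: abs_mult)
    then have "arctan \<bar>\<beta> * ?T\<bar> < arctan ?T" by (simp add: arctan_less_iff)
    also have "\<dots> = pi * \<alpha> / 2" using a pi_gt_zero by (intro arctan_tan) linarith+
    finally show ?thesis using 1 by (auto simp: abs_if arctan_minus split: if_splits)
  next
    case 2
    let ?T = "tan (pi - pi * \<alpha> / 2)"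
    have a: "0 < pi - pi * \<alpha> / 2" "pi - pi * \<alpha> / 2 < pi / 2" "pi - pi * \<alpha> / 2 < pi * \<alpha> / 2"
    proof -
      have "pi * 1 < pi * \<alpha>" "pi * \<alpha> < pi * 2" using 2 by (auto intro!: mult_strict_left_mono)
      then show "0 < pi - pi * \<alpha> / 2" "pi - pi * \<alpha> / 2 < pi / 2" "pi - pi * \<alpha> / 2 < pi * \<alpha> / 2" by auto
    qed
    have eq: "tan (pi * \<alpha> / 2) = - ?T"
      using tan_periodic_pi[of "- (pi - pi * \<alpha> / 2)"] tan_minus[of "pi - pi * \<alpha> / 2"] by simp
    have T: "?T > 0" using a by (intro tan_gt_zero) auto
    have "\<bar>\<beta> * tan (pi * \<alpha> / 2)\<bar> \<le> ?T" unfolding eq using 2 T by (simp add: abs_mult)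
    then have "arctan \<bar>\<beta> * tan (pi * \<alpha> / 2)\<bar> \<le> arctan ?T" by (simp add: arctan_le_iff)
    also have "\<dots> = pi - pi * \<alpha> / 2" using a pi_gt_zero by (intro arctan_tan) linarith+
    also have "\<dots> < pi * \<alpha> / 2" by (rule a)
    finally show ?thesis using 2 by (auto simp: abs_if arctan_minus split: if_splits)
  next
    case 3
    then show ?thesis by auto
  qed
  then show "0 < \<alpha>" "\<bar>arctan (\<beta> * tan (pi * \<alpha> / 2))\<bar> < pi * \<alpha> / 2" by auto
qed

text \<open>Negative t contribute the conjugate of positive t, and the half-line integral is
  \<open>stretched\<close> at w = \<kappa> (1 - i \<theta>). Its closed form has argument arctan
  \<theta> / \<alpha>, which \<open>stable_angle\<close> keeps strictly between - \<pi> / 2 and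
  \<pi> / 2.\<close>

lemma stable_cf_integral_pos:
  assumes ab: "(\<alpha>, \<beta>) \<in> stable_params" and \<kappa>: "\<kappa> > 0" and int: "integrable lborel (stable_cf \<alpha> \<beta> \<kappa>)"
  shows "Re (\<integral>t. stable_cf \<alpha> \<beta> \<kappa> t \<partial>lborel) > 0"
proof -
  note \<alpha> = stable_angle[OF ab]
  define \<theta> where "\<theta> = \<beta> * tan (pi * \<alpha> / 2)"
  define w where "w = of_real \<kappa> * (1 - \<i> * of_real \<theta>)"
  have w: "Re w = \<kappa>" "Im w = - (\<kappa> * \<theta>)" by (auto simp: w_def)
  let ?\<psi> = "stable_cf \<alpha> \<beta> \<kappa>"
  let ?X = "\<integral>t. indicator {0<..} t *\<^sub>R ?\<psi> t \<partial>lborel"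
  have i1: "integrable lborel (\<lambda>t. indicator {0<..} t *\<^sub>R ?\<psi> t)"
    by (rule integrable_mult_indicator[OF _ int]) simp
  have i2: "integrable lborel (\<lambda>t. indicator {..<0} t *\<^sub>R ?\<psi> t)"
    by (rule integrable_mult_indicator[OF _ int]) simp
  have "(\<integral>t. ?\<psi> t \<partial>lborel) = (\<integral>t. indicator {0<..} t *\<^sub>R ?\<psi> t + indicator {..<0} t *\<^sub>R ?\<psi> t \<partial>lborel)"
  proof (rule integral_cong_AE)
    have "AE t in lborel. t \<noteq> (0::real)" by (rule AE_lborel_singleton)
    then show "AE t in lborel. ?\<psi> t = indicator {0<..} t *\<^sub>R ?\<psi> t + indicator {..<0} t *\<^sub>R ?\<psi> t"
      by eventually_elim (auto simp: indicator_def)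
  qed (use int i1 i2 in auto)
  also have "\<dots> = ?X + (\<integral>t. indicator {..<0} t *\<^sub>R ?\<psi> t \<partial>lborel)"
    by (rule Bochner_Integration.integral_add[OF i1 i2])
  also have "(\<integral>t. indicator {..<0} t *\<^sub>R ?\<psi> t \<partial>lborel) = \<bar>- 1\<bar> *\<^sub>R (\<integral>t. indicator {..<0} (0 + (- 1) * t) *\<^sub>R ?\<psi> (0 + (- 1) * t) \<partial>lborel)"
    by (rule lborel_integral_real_affine) simp
  also have "\<dots> = (\<integral>t. cnj (indicator {0<..} t *\<^sub>R ?\<psi> t) \<partial>lborel)"
    by (simp del: Bochner_Integration.integral_cnj complex_cnj_scaleR, intro Bochner_Integration.integral_cong refl)
       (auto simp: indicator_def stable_cf_def exp_cnj)
  also have "\<dots> = cnj ?X" by (rule Bochner_Integration.integral_cnj)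
  finally have "Re (\<integral>t. ?\<psi> t \<partial>lborel) = 2 * Re ?X" by simp
  moreover have "?X = stretched \<alpha> w"
    unfolding stretched_def by (intro Bochner_Integration.integral_cong refl) (auto simp: indicator_def stable_cf_def w_def \<theta>_def mult_ac)
  moreover have "Re (stretched \<alpha> w) > 0"
  proof -
    obtain r where r: "r > 0" "stretched \<alpha> 1 = of_real r" using stretched_1_pos[OF \<alpha>(1)] by blast
    have "Im (Ln w) = arctan (Im w / Re w)" using Im_Ln_eq[of w] w \<kappa> by (auto simp: complex_eq_iff)
    also have "\<dots> = - arctan \<theta>" using w \<kappa> by (simp add: arctan_minus)
    finally have "\<bar>Im (Ln w) / \<alpha>\<bar> < pi / 2" using \<alpha> by (simp add: \<theta>_def field_simps)
    then have "cos (Im (Ln w) / \<alpha>) > 0" by (intro cos_gt_zero_pi) linarith+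
    moreover have "Re (stretched \<alpha> w) = r * (exp (- (Re (Ln w) / \<alpha>)) * cos (Im (Ln w) / \<alpha>))"
      using w \<kappa> by (subst stretched_eq[OF \<alpha>(1)]) (simp_all add: r Re_exp)
    ultimately show ?thesis using r by simp
  qed
  ultimately show ?thesis by simp
qed

section \<open>Ladder epochs and time reversal\<close>

definition psum :: "nat \<Rightarrow> (nat \<Rightarrow> real) \<Rightarrow> real" where
  "psum n x = (\<Sum>i<n. x i)"

definition ladder :: "nat \<Rightarrow> (nat \<Rightarrow> real) \<Rightarrow> bool" where
  "ladder n x \<longleftrightarrow> (\<forall>k<n. psum k x < psum n x)"

definition stays_pos :: "nat \<Rightarrow> (nat \<Rightarrow> real) \<Rightarrow> bool" where
  "stays_pos n x \<longleftrightarrow> (\<forall>k\<in>{1..n}. psum k x > 0)"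

definition stays_nonpos :: "nat \<Rightarrow> (nat \<Rightarrow> real) \<Rightarrow> bool" where
  "stays_nonpos n x \<longleftrightarrow> (\<forall>k\<in>{1..n}. psum k x \<le> 0)"

text \<open>Strict inequality before k and weak inequality after it single out the first position of
  the maximum among the sums up to n. The same asymmetry pairs strict ladder epochs with paths that
  stay nonpositive.\<close>

definition first_max :: "nat \<Rightarrow> nat \<Rightarrow> (nat \<Rightarrow> real) \<Rightarrow> bool" where
  "first_max n k x \<longleftrightarrow> ladder k x \<and> (\<forall>i\<in>{k..n}. psum i x \<le> psum k x)"

definition reversed :: "nat \<Rightarrow> (nat \<Rightarrow> real) \<Rightarrow> nat \<Rightarrow> real" where
  "reversed n x i = (if i < n then x (n - 1 - i) else x i)"

lemma psum_0 [simp]: "psum 0 x = 0"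
  by (simp add: psum_def)

lemma ladder_0 [simp]: "ladder 0 x" and stays_nonpos_0 [simp]: "stays_nonpos 0 x"
  and stays_pos_0 [simp]: "stays_pos 0 x"
  by (simp_all add: ladder_def stays_nonpos_def stays_pos_def)

lemma psum_comb_seq_le: "i \<le> k \<Longrightarrow> psum i (comb_seq k x y) = psum i x"
  unfolding psum_def by (intro sum.cong) (auto simp: comb_seq_def)

lemma psum_comb_seq_add: "psum (k + i) (comb_seq k x y) = psum k x + psum i y"
  by (induction i) (auto simp: psum_comb_seq_le psum_def comb_seq_def)

lemma psum_comb_seq_ge: "k \<le> i \<Longrightarrow> psum i (comb_seq k x y) = psum k x + psum (i - k) y"
  using psum_comb_seq_add[of k "i - k"] by simp

lemma ladder_comb_seq: "i \<le> k \<Longrightarrow> ladder i (comb_seq k x y) \<longleftrightarrow> ladder i x"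
  by (simp add: ladder_def psum_comb_seq_le)

lemma stays_pos_comb_seq: "i \<le> k \<Longrightarrow> stays_pos i (comb_seq k x y) \<longleftrightarrow> stays_pos i x"
  by (simp add: stays_pos_def psum_comb_seq_le)

lemma ladder_comb_seq_ge: 
  assumes "ladder n (comb_seq k x y)" "k \<le> n" shows "ladder (n - k) y"
  unfolding ladder_def
proof (intro allI impI)
  fix i assume i: "i < n - k"
  have "psum (k + i) (comb_seq k x y) < psum n (comb_seq k x y)"
    using assms i unfolding ladder_def by auto
  then show "psum i y < psum (n - k) y"
    using assms by (simp add: psum_comb_seq_add psum_comb_seq_ge)
qed

text \<open>The event becomes one condition on the steps before k and one on the steps after k.
  Their independence is the source of the factorisation.\<close>

lemma first_max_comb_seq:
  assumes "k \<le> n"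
  shows "first_max n k (comb_seq k x y) \<longleftrightarrow> ladder k x \<and> stays_nonpos (n - k) y"
proof -
  have "(\<forall>i\<in>{k..n}. psum (i - k) y \<le> 0) \<longleftrightarrow> stays_nonpos (n - k) y"
  proof
    assume a: "\<forall>i\<in>{k..n}. psum (i - k) y \<le> 0"
    show "stays_nonpos (n - k) y" unfolding stays_nonpos_def
    proof
      fix i assume "i \<in> {1..n - k}"
      then show "psum i y \<le> 0" using bspec[OF a, of "i + k"] assms by auto
    qed
  next
    assume a: "stays_nonpos (n - k) y"
    show "\<forall>i\<in>{k..n}. psum (i - k) y \<le> 0"
    proof
      fix i assume "i \<in> {k..n}"
      then show "psum (i - k) y \<le> 0"
        using a \<open>i \<in> {k..n}\<close> by (cases "i = k") (auto simp: stays_nonpos_def Suc_le_eq)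
    qed
  qed
  then show ?thesis
    using assms by (auto simp: first_max_def ladder_comb_seq psum_comb_seq_ge psum_comb_seq_le)
qed

lemma first_max_exists: "\<exists>k\<le>n. first_max n k x"
proof -
  define m where "m = Max ((\<lambda>i. psum i x) ` {..n})"
  have "m \<in> (\<lambda>i. psum i x) ` {..n}" unfolding m_def by (intro Max_in) auto
  then have ex: "\<exists>k. k \<le> n \<and> psum k x = m" by auto
  define k where "k = (LEAST k. k \<le> n \<and> psum k x = m)"
  have k: "k \<le> n" "psum k x = m" using LeastI_ex[OF ex] by (auto simp: k_def)
  have le: "psum i x \<le> m" if "i \<le> n" for i unfolding m_def using that by (intro Max_ge) auto
  have "psum i x < psum k x" if "i < k" for i
  proof -
    have "\<not> (i \<le> n \<and> psum i x = m)"
      using that unfolding k_def by (rule not_less_Least)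
    then show ?thesis using le[of i] that k by linarith
  qed
  then show ?thesis using k le by (intro exI[of _ k]) (auto simp: first_max_def ladder_def)
qed

lemma first_max_unique:
  assumes "first_max n k x" "first_max n l x" "k \<le> n" "l \<le> n" shows "k = l"
proof (rule ccontr)
  assume "k \<noteq> l"
  then consider "k < l" | "l < k" by linarith
  then show False
  proof cases
    case 1
    have "psum k x < psum l x" using assms(2) 1 by (simp add: first_max_def ladder_def)
    moreover have "psum l x \<le> psum k x" using assms(1,4) 1 by (simp add: first_max_def)
    ultimately show False by simp
  next
    case 2
    have "psum l x < psum k x" using assms(1) 2 by (simp add: first_max_def ladder_def)
    moreover have "psum k x \<le> psum l x" using assms(2,3) 2 by (simp add: first_max_def)
    ultimately show False by simp
  qed
qed

text \<open>A partition of unity over the position of the first maximum; the decompositions of the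
  walk law come from integrating against it.\<close>

lemma sum_first_max: "(\<Sum>k\<le>n. of_bool (first_max n k x)) = (1::ennreal)"
proof -
  obtain k where k: "k \<le> n" "first_max n k x" using first_max_exists by blast
  have "first_max n j x \<longleftrightarrow> j = k" if "j \<le> n" for j
    using first_max_unique[OF _ k(2) that k(1)] k(2) by blast
  then have "(\<Sum>k\<le>n. of_bool (first_max n k x)) = (\<Sum>j\<le>n. if j = k then 1 else (0::ennreal))"
    by (intro sum.cong) simp_all
  also have "\<dots> = 1" using k(1) by simp
  finally show ?thesis .
qed

lemma psum_reversed: 
  assumes "i \<le> n" shows "psum i (reversed n x) = psum n x - psum (n - i) x"
proof -
  have "psum i (reversed n x) = (\<Sum>j<i. x (n - 1 - j))"
    unfolding psum_def reversed_def using assms by (intro sum.cong) auto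
  also have "\<dots> = (\<Sum>j\<in>{n-i..<n}. x j)"
    by (rule sum.reindex_bij_witness[of _ "\<lambda>j. n - 1 - j" "\<lambda>j. n - 1 - j"]) (use assms in auto)
  also have "\<dots> = psum n x - psum (n - i) x"
    unfolding psum_def lessThan_atLeast0 using sum.atLeastLessThan_concat[of 0 "n-i" n x] by simp
  finally show ?thesis .
qed

text \<open>Reversal of the first n steps replaces S_k by S_n - S_(n-k), and S_n exceeds this
  exactly when S_(n-k) is positive.\<close>

lemma ladder_reversed: "ladder n (reversed n x) \<longleftrightarrow> stays_pos n x"
proof
  assume l: "ladder n (reversed n x)"
  show "stays_pos n x" unfolding stays_pos_def
  proof
    fix k assume "k \<in> {1..n}"
    then show "psum k x > 0"
      using l[unfolded ladder_def, rule_format, of "n - k"] by (auto simp: psum_reversed)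
  qed
next
  assume p: "stays_pos n x"
  show "ladder n (reversed n x)" unfolding ladder_def
  proof (intro allI impI)
    fix k assume "k < n"
    then show "psum k (reversed n x) < psum n (reversed n x)"
      using bspec[OF p[unfolded stays_pos_def], of "n - k"] by (auto simp: psum_reversed)
  qed
qed

abbreviation seq_borel :: "(nat \<Rightarrow> real) measure" where
  "seq_borel \<equiv> PiM UNIV (\<lambda>_. borel)"

lemma psum_measurable [measurable]: "psum n \<in> borel_measurable seq_borel"
  unfolding psum_def by measurable

lemma ladder_measurable [measurable]: "Measurable.pred seq_borel (ladder n)"
  unfolding ladder_def by measurable

lemma stays_pos_measurable [measurable]: "Measurable.pred seq_borel (stays_pos n)"
  unfolding stays_pos_def by measurable

lemma stays_nonpos_measurable [measurable]: "Measurable.pred seq_borel (stays_nonpos n)"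
  unfolding stays_nonpos_def by measurable

lemma first_max_measurable [measurable]: "Measurable.pred seq_borel (first_max n k)"
  unfolding first_max_def not_less[symmetric] by measurable

lemma reversed_measurable [measurable]: "reversed n \<in> measurable seq_borel seq_borel"
  unfolding reversed_def[abs_def] by (rule measurable_PiM_single') (auto simp: space_PiM)

section \<open>The coordinate walk, its ladder and nonpositive laws, and their factorisation\<close>

locale walk_law = real_distribution F for F :: "real measure"
begin

sublocale sequence_space F ..

abbreviation "Q \<equiv> PiM (UNIV :: nat set) (\<lambda>_. F)"

lemma space_Q [simp]: "space Q = UNIV"
  by (simp add: space_PiM)

lemma sets_Q [measurable_cong]: "sets Q = sets seq_borel"
  by (rule sets_PiM_cong) auto

lemma prob_space_F: "prob_space F"
  by (rule real_distribution.axioms(1)[OF real_distribution_axioms])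

lemma prob_space_Q: "prob_space Q"
  by (rule prob_space_axioms)

text \<open>The Markov property at a fixed time: joining two independent step sequences at k gives
  the law \<open>Q\<close> again.\<close>

lemma nn_integral_split:
  assumes [measurable]: "f \<in> borel_measurable Q"
  shows "(\<integral>\<^sup>+x. f x \<partial>Q) = (\<integral>\<^sup>+x. \<integral>\<^sup>+y. f (comb_seq k x y) \<partial>Q \<partial>Q)"
proof -
  have "(\<integral>\<^sup>+x. f x \<partial>Q) = (\<integral>\<^sup>+x. f x \<partial>distr (Q \<Otimes>\<^sub>M Q) Q (\<lambda>(\<omega>, \<omega>'). comb_seq k \<omega> \<omega>'))"
    by (simp add: PiM_comb_seq)
  also have "\<dots> = (\<integral>\<^sup>+p. f (comb_seq k (fst p) (snd p)) \<partial>(Q \<Otimes>\<^sub>M Q))"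
    by (subst nn_integral_distr) (auto simp: split_beta')
  also have "\<dots> = (\<integral>\<^sup>+x. \<integral>\<^sup>+y. f (comb_seq k x y) \<partial>Q \<partial>Q)"
    by (subst P.nn_integral_fst[symmetric]) auto
  finally show ?thesis .
qed

lemma distr_reversed: "distr Q Q (reversed n) = Q"
proof -
  let ?t = "\<lambda>i. if i < n then n - 1 - i else i"
  have "distr Q (PiM UNIV (\<lambda>_. F)) (\<lambda>\<omega>. \<lambda>i\<in>UNIV. \<omega> (?t i)) = PiM UNIV (\<lambda>_. F)"
    by (rule distr_PiM_reindex) (auto simp: inj_on_def prob_space_F split: if_splits)
  moreover have "(\<lambda>\<omega>. \<lambda>i\<in>UNIV. \<omega> (?t i)) = reversed n"
    by (auto simp: reversed_def fun_eq_iff)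
  ultimately show ?thesis by simp
qed

lemma nn_integral_reversed:
  assumes [measurable]: "f \<in> borel_measurable Q"
  shows "(\<integral>\<^sup>+x. f (reversed n x) \<partial>Q) = (\<integral>\<^sup>+x. f x \<partial>Q)"
  by (subst (2) distr_reversed[of n, symmetric], subst nn_integral_distr) auto

definition sum_law :: "nat \<Rightarrow> real measure" where
  "sum_law n = distr Q borel (psum n)"

text \<open>The measure u_n, encoded through the ladder event because this event appears when a path
  is split at its first maximum; \<open>emeasure_ladder_law_stays_pos\<close> passes to paths that
  stay positive.\<close>

definition ladder_law :: "nat \<Rightarrow> real measure" where
  "ladder_law n = distr (density Q (\<lambda>x. of_bool (ladder n x))) borel (psum n)"

definition nonpos_law :: "nat \<Rightarrow> real measure" where
  "nonpos_law n = distr (density Q (\<lambda>x. of_bool (stays_nonpos n x))) borel (psum n)"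

lemma sets_laws [simp, measurable_cong]:
  "sets (sum_law n) = sets borel" "sets (ladder_law n) = sets borel" "sets (nonpos_law n) = sets borel"
  by (simp_all add: sum_law_def ladder_law_def nonpos_law_def)

lemma space_laws [simp]:
  "space (sum_law n) = UNIV" "space (ladder_law n) = UNIV" "space (nonpos_law n) = UNIV"
  by (simp_all add: sum_law_def ladder_law_def nonpos_law_def)

lemma nn_integral_sum_law:
  assumes [measurable]: "f \<in> borel_measurable borel"
  shows "(\<integral>\<^sup>+s. f s \<partial>sum_law n) = (\<integral>\<^sup>+x. f (psum n x) \<partial>Q)"
  unfolding sum_law_def by (subst nn_integral_distr) auto

lemma nn_integral_ladder_law:
  assumes [measurable]: "f \<in> borel_measurable borel"
  shows "(\<integral>\<^sup>+s. f s \<partial>ladder_law n) = (\<integral>\<^sup>+x. of_bool (ladder n x) * f (psum n x) \<partial>Q)"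
  unfolding ladder_law_def by (subst nn_integral_distr, simp, simp) (subst nn_integral_density, auto)

lemma nn_integral_nonpos_law:
  assumes [measurable]: "f \<in> borel_measurable borel"
  shows "(\<integral>\<^sup>+s. f s \<partial>nonpos_law n) = (\<integral>\<^sup>+x. of_bool (stays_nonpos n x) * f (psum n x) \<partial>Q)"
  unfolding nonpos_law_def by (subst nn_integral_distr, simp, simp) (subst nn_integral_density, auto)

lemma emeasure_sum_law:
  assumes [measurable]: "B \<in> sets borel"
  shows "emeasure (sum_law n) B = emeasure Q {x. psum n x \<in> B}"
  unfolding sum_law_def by (subst emeasure_distr) (auto simp: vimage_def)

lemma emeasure_eq_integral_of_bool:
  assumes [measurable]: "Measurable.pred Q P"
  shows "emeasure Q {x. P x} = (\<integral>\<^sup>+x. of_bool (P x) \<partial>Q)"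
proof -
  have [measurable]: "{x. P x} \<in> sets Q" using assms unfolding pred_def by simp
  have "emeasure Q {x. P x} = (\<integral>\<^sup>+x. indicator {x. P x} x \<partial>Q)"
    by (rule nn_integral_indicator[symmetric]) measurable
  also have "\<dots> = (\<integral>\<^sup>+x. of_bool (P x) \<partial>Q)"
    by (intro nn_integral_cong) (simp add: indicator_def)
  finally show ?thesis .
qed

lemma emeasure_ladder_law:
  assumes [measurable]: "B \<in> sets borel"
  shows "emeasure (ladder_law n) B = emeasure Q {x. ladder n x \<and> psum n x \<in> B}"
proof -
  have "emeasure (ladder_law n) B = (\<integral>\<^sup>+s. indicator B s \<partial>ladder_law n)"
    by (rule nn_integral_indicator[symmetric]) simp
  also have "\<dots> = (\<integral>\<^sup>+x. of_bool (ladder n x) * indicator B (psum n x) \<partial>Q)"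
    by (rule nn_integral_ladder_law) simp
  also have "\<dots> = (\<integral>\<^sup>+x. of_bool (ladder n x \<and> psum n x \<in> B) \<partial>Q)"
    by (intro nn_integral_cong) (auto simp: indicator_def)
  also have "\<dots> = emeasure Q {x. ladder n x \<and> psum n x \<in> B}"
    by (rule emeasure_eq_integral_of_bool[symmetric]) measurable
  finally show ?thesis .
qed

lemma emeasure_nonpos_law:
  assumes [measurable]: "B \<in> sets borel"
  shows "emeasure (nonpos_law n) B = emeasure Q {x. stays_nonpos n x \<and> psum n x \<in> B}"
proof -
  have "emeasure (nonpos_law n) B = (\<integral>\<^sup>+s. indicator B s \<partial>nonpos_law n)"
    by (rule nn_integral_indicator[symmetric]) simp
  also have "\<dots> = (\<integral>\<^sup>+x. of_bool (stays_nonpos n x) * indicator B (psum n x) \<partial>Q)"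
    by (rule nn_integral_nonpos_law) simp
  also have "\<dots> = (\<integral>\<^sup>+x. of_bool (stays_nonpos n x \<and> psum n x \<in> B) \<partial>Q)"
    by (intro nn_integral_cong) (auto simp: indicator_def)
  also have "\<dots> = emeasure Q {x. stays_nonpos n x \<and> psum n x \<in> B}"
    by (rule emeasure_eq_integral_of_bool[symmetric]) measurable
  finally show ?thesis .
qed

lemma emeasure_ladder_law_stays_pos:
  assumes [measurable]: "B \<in> sets borel"
  shows "emeasure (ladder_law n) B = emeasure Q {x. stays_pos n x \<and> psum n x \<in> B}"
proof -
  have eq: "psum n (reversed n x) = psum n x" for x
    by (simp add: psum_reversed)
  have "emeasure (ladder_law n) B = (\<integral>\<^sup>+x. of_bool (ladder n x \<and> psum n x \<in> B) \<partial>Q)"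
    unfolding emeasure_ladder_law[OF assms] by (rule emeasure_eq_integral_of_bool) measurable
  also have "\<dots> = (\<integral>\<^sup>+x. of_bool (ladder n (reversed n x) \<and> psum n (reversed n x) \<in> B) \<partial>Q)"
    by (rule nn_integral_reversed[symmetric]) measurable
  also have "\<dots> = (\<integral>\<^sup>+x. of_bool (stays_pos n x \<and> psum n x \<in> B) \<partial>Q)"
    by (simp add: ladder_reversed eq)
  also have "\<dots> = emeasure Q {x. stays_pos n x \<and> psum n x \<in> B}"
    by (rule emeasure_eq_integral_of_bool[symmetric]) measurable
  finally show ?thesis .
qed

lemma prob_space_sum_law: "prob_space (sum_law n)"
  unfolding sum_law_def by (rule prob_space_distr) simp

lemma finite_ladder_law: "finite_measure (ladder_law n)"
  by standard (simp add: emeasure_ladder_law)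

lemma finite_nonpos_law: "finite_measure (nonpos_law n)"
  by standard (simp add: emeasure_nonpos_law)

lemma finite_sum_law: "finite_measure (sum_law n)"
  by (intro prob_space.finite_measure prob_space_sum_law)

lemma nn_integral_first_max:
  assumes [measurable]: "case_prod f \<in> borel_measurable (borel \<Otimes>\<^sub>M borel)" and "k \<le> n"
  shows "(\<integral>\<^sup>+x. of_bool (first_max n k x) * f (psum k x) (psum n x - psum k x) \<partial>Q)
    = (\<integral>\<^sup>+s. \<integral>\<^sup>+t. f s t \<partial>nonpos_law (n - k) \<partial>ladder_law k)"
proof -
  interpret w: finite_measure "nonpos_law (n - k)" by (rule finite_nonpos_law)
  have "(\<integral>\<^sup>+x. of_bool (first_max n k x) * f (psum k x) (psum n x - psum k x) \<partial>Q)
     = (\<integral>\<^sup>+x. \<integral>\<^sup>+y. of_bool (ladder k x) * (of_bool (stays_nonpos (n - k) y) * f (psum k x) (psum (n - k) y)) \<partial>Q \<partial>Q)"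
    by (subst nn_integral_split[of _ k])
       (auto simp: first_max_comb_seq[OF \<open>k \<le> n\<close>] psum_comb_seq_ge \<open>k \<le> n\<close> of_bool_conj mult.assoc)
  also have "\<dots> = (\<integral>\<^sup>+x. of_bool (ladder k x) * (\<integral>\<^sup>+t. f (psum k x) t \<partial>nonpos_law (n - k)) \<partial>Q)"
    by (subst nn_integral_cmult) (auto simp: nn_integral_nonpos_law)
  also have "\<dots> = (\<integral>\<^sup>+s. \<integral>\<^sup>+t. f s t \<partial>nonpos_law (n - k) \<partial>ladder_law k)"
    by (subst nn_integral_ladder_law) (auto intro!: w.borel_measurable_nn_integral)
  finally show ?thesis .
qed

lemma nn_integral_decomposition:
  assumes [measurable]: "case_prod f \<in> borel_measurable (borel \<Otimes>\<^sub>M borel)"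
  shows "(\<Sum>k\<le>n. \<integral>\<^sup>+s. \<integral>\<^sup>+t. f s t \<partial>nonpos_law (n - k) \<partial>ladder_law k)
    = (\<integral>\<^sup>+x. (\<Sum>k\<le>n. of_bool (first_max n k x) * f (psum k x) (psum n x - psum k x)) \<partial>Q)"
  by (subst nn_integral_sum) (auto simp: nn_integral_first_max intro!: sum.cong)

text \<open>The coefficient of s^n in the Wiener--Hopf factorisation, as an identity of measures: a
  ladder path up to the first maximum, followed by a path that stays nonpositive.\<close>

lemma emeasure_sum_law_decomposition:
  assumes [measurable]: "B \<in> sets borel"
  shows "emeasure (sum_law n) B = (\<Sum>k\<le>n. emeasure (ladder_law k \<star> nonpos_law (n - k)) B)"
proof -
  have "(\<Sum>k\<le>n. emeasure (ladder_law k \<star> nonpos_law (n - k)) B)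
     = (\<Sum>k\<le>n. \<integral>\<^sup>+s. \<integral>\<^sup>+t. indicator B (s + t) \<partial>nonpos_law (n - k) \<partial>ladder_law k)"
    by (intro sum.cong refl convolution_emeasure') (auto simp: finite_ladder_law finite_nonpos_law)
  also have "\<dots> = (\<integral>\<^sup>+x. (\<Sum>k\<le>n. of_bool (first_max n k x) * indicator B (psum k x + (psum n x - psum k x))) \<partial>Q)"
    by (rule nn_integral_decomposition) measurable
  also have "\<dots> = (\<integral>\<^sup>+x. indicator B (psum n x) \<partial>Q)"
    by (simp add: sum_distrib_right[symmetric] sum_first_max)
  also have "\<dots> = emeasure (sum_law n) B"
    by (subst nn_integral_sum_law[symmetric]) auto
  finally show ?thesis by simp
qed

lemma sum_ladder_nonpos: "(\<Sum>k\<le>n. emeasure (ladder_law k) UNIV * emeasure (nonpos_law (n - k)) UNIV) = 1"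
proof -
  have "(\<Sum>k\<le>n. emeasure (ladder_law k) UNIV * emeasure (nonpos_law (n - k)) UNIV)
     = (\<Sum>k\<le>n. \<integral>\<^sup>+s. \<integral>\<^sup>+t. 1 \<partial>nonpos_law (n - k) \<partial>ladder_law k)"
    by (simp add: mult.commute)
  also have "\<dots> = (\<integral>\<^sup>+x. (\<Sum>k\<le>n. of_bool (first_max n k x) * 1) \<partial>Q)"
    by (rule nn_integral_decomposition) measurable
  also have "\<dots> = 1"
    by (simp add: sum_first_max prob_space.emeasure_space_1[OF prob_space_Q, simplified])
  finally show ?thesis .
qed

definition max_below :: "nat \<Rightarrow> real \<Rightarrow> ennreal" where
  "max_below m z = emeasure Q {x. \<forall>i\<le>m. psum i x < z}"

text \<open>The maximum up to m is the value at the first maximum, so the constraint concerns the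
  ladder part alone and the nonpositive part contributes its whole mass.\<close>

lemma max_below_eq:
  "max_below m z = (\<Sum>k\<le>m. emeasure (ladder_law k) {..<z} * emeasure (nonpos_law (m - k)) UNIV)"
proof -
  have *: "(\<forall>i\<le>m. psum i x < z) \<longleftrightarrow> psum k x < z" if "first_max m k x" "k \<le> m" for k x
    using that unfolding first_max_def ladder_def
    by (meson atLeastAtMost_iff le_less_trans less_le_not_le less_trans linorder_le_cases linorder_not_le)
  have "(\<Sum>k\<le>m. emeasure (ladder_law k) {..<z} * emeasure (nonpos_law (m - k)) UNIV)
     = (\<Sum>k\<le>m. \<integral>\<^sup>+s. \<integral>\<^sup>+t. indicator {..<z} s \<partial>nonpos_law (m - k) \<partial>ladder_law k)"
    by (simp add: nn_integral_multc)
  also have "\<dots> = (\<integral>\<^sup>+x. (\<Sum>k\<le>m. of_bool (first_max m k x) * indicator {..<z} (psum k x)) \<partial>Q)"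
    by (rule nn_integral_decomposition) measurable
  also have "\<dots> = (\<integral>\<^sup>+x. (\<Sum>k\<le>m. of_bool (first_max m k x) * of_bool (\<forall>i\<le>m. psum i x < z)) \<partial>Q)"
    by (intro nn_integral_cong sum.cong refl) (use * in \<open>auto simp: indicator_def of_bool_def\<close>)
  also have "\<dots> = (\<integral>\<^sup>+x. of_bool (\<forall>i\<le>m. psum i x < z) \<partial>Q)"
    by (simp add: sum_distrib_right[symmetric] sum_first_max)
  also have "\<dots> = max_below m z"
    unfolding max_below_def by (rule emeasure_eq_integral_of_bool[symmetric]) measurable
  finally show ?thesis by simp
qed

end

lemma suminf_swap_ennreal: "(\<Sum>i. \<Sum>j. f i j) = (\<Sum>j. \<Sum>i. (f i j :: ennreal))"
proof -
  have "(\<Sum>i. \<Sum>j. f i j) = (\<integral>\<^sup>+i. (\<Sum>j. f i j) \<partial>count_space UNIV)"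
    by (simp add: nn_integral_count_space_nat)
  also have "\<dots> = (\<Sum>j. \<integral>\<^sup>+i. f i j \<partial>count_space UNIV)"
    by (rule nn_integral_suminf) simp
  finally show ?thesis by (simp add: nn_integral_count_space_nat)
qed

lemma Cauchy_product_ennreal: "(\<Sum>n. \<Sum>k\<le>n. a k (n - k)) = (\<Sum>k. \<Sum>m. (a k m :: ennreal))"
proof -
  have "(\<Sum>n. \<Sum>k\<le>n. a k (n - k)) = (\<Sum>n. \<Sum>k. if k \<le> n then a k (n - k) else 0)"
    by (intro suminf_cong) (subst suminf_finite[of "{.._}"], auto)
  also have "\<dots> = (\<Sum>k. \<Sum>n. if k \<le> n then a k (n - k) else 0)"
    by (rule suminf_swap_ennreal)
  also have "\<dots> = (\<Sum>k. \<Sum>m. a k m)"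
  proof (rule suminf_cong)
    fix k
    let ?f = "\<lambda>n. if k \<le> n then a k (n - k) else 0"
    have "(\<Sum>i<n + k. ?f i) = (\<Sum>m<n. a k m)" for n
    proof (induction n)
      case 0
      have "(\<Sum>i<0 + k. ?f i) = (\<Sum>i<k. 0)" by (intro sum.cong) auto
      then show ?case by simp
    qed simp
    moreover have "(\<lambda>n. \<Sum>i<n + k. ?f i) \<longlonglongrightarrow> (\<Sum>n. ?f n)"
      by (intro LIMSEQ_ignore_initial_segment[of "\<lambda>n. \<Sum>i<n. ?f i"] summable_LIMSEQ) simp
    moreover have "(\<lambda>n. \<Sum>m<n. a k m) \<longlonglongrightarrow> (\<Sum>m. a k m)"
      by (intro summable_LIMSEQ) simp
    ultimately show "(\<Sum>n. ?f n) = (\<Sum>m. a k m)"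
      using LIMSEQ_unique by simp
  qed
  finally show ?thesis .
qed

lemma of_bool_le_of_bool: "(P \<Longrightarrow> R) \<Longrightarrow> of_bool P \<le> (of_bool R :: ennreal)"
  by (cases P) auto

section \<open>The renewal function and the a priori bound for ladder laws\<close>

context walk_law
begin

text \<open>The expected number of ladder epochs with height below z, summed over times of the walk;
  n = 0 supplies the unit jump at 0. \<open>renewal_function_height_law\<close> matches it with the
  series over numbers of ladder heights.\<close>

definition renewal :: "real \<Rightarrow> ennreal" where
  "renewal z = (\<Sum>n. emeasure (ladder_law n) {..<z})"

lemma ladder_psum_nonneg: "ladder n x \<Longrightarrow> psum n x \<ge> 0"
  unfolding ladder_def by (cases n) force+

lemma emeasure_ladder_law_neg:
  assumes "z \<le> 0" shows "emeasure (ladder_law n) {..<z} = 0"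
proof -
  have eq: "{x. ladder n x \<and> psum n x \<in> {..<z}} = {}"
    using assms ladder_psum_nonneg by force
  have "emeasure (ladder_law n) {..<z} = emeasure Q {x. ladder n x \<and> psum n x \<in> {..<z}}"
    by (rule emeasure_ladder_law) simp
  then show ?thesis unfolding eq by simp
qed

lemma renewal_nonpos [simp]: "z \<le> 0 \<Longrightarrow> renewal z = 0"
  by (simp add: renewal_def emeasure_ladder_law_neg)

lemma renewal_mono: "x \<le> y \<Longrightarrow> renewal x \<le> renewal y"
  unfolding renewal_def by (intro suminf_le emeasure_mono) auto

lemma emeasure_Q_UNIV [simp]: "emeasure Q UNIV = 1"
  using prob_space.emeasure_space_1[OF prob_space_Q] by simp

lemma ladder_law_0: "emeasure (ladder_law 0) {..<z} = of_bool (z > 0)"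
proof (cases "z > 0")
  case True
  then show ?thesis by (simp add: emeasure_ladder_law)
qed (simp add: emeasure_ladder_law_neg)

lemma renewal_ge_1: "z > 0 \<Longrightarrow> renewal z \<ge> 1"
proof -
  assume "z > 0"
  then have "1 = (\<Sum>n<1. emeasure (ladder_law n) {..<z})" by (simp add: ladder_law_0)
  also have "\<dots> \<le> renewal z" unfolding renewal_def by (rule sum_le_suminf) auto
  finally show ?thesis .
qed

lemma borel_measurable_ladder_cdf [measurable]: "(\<lambda>z. emeasure (ladder_law n) {..<z}) \<in> borel_measurable borel"
proof -
  interpret u: finite_measure "ladder_law n" by (rule finite_ladder_law)
  have "(\<lambda>z. emeasure (ladder_law n) {..<z}) = (\<lambda>z. \<integral>\<^sup>+s. indicator {p. snd p < fst p} (z, s) \<partial>ladder_law n)"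
  proof
    fix z
    have "emeasure (ladder_law n) {..<z} = (\<integral>\<^sup>+s. indicator {..<z} s \<partial>ladder_law n)"
      by (rule nn_integral_indicator[symmetric]) simp
    then show "emeasure (ladder_law n) {..<z} = (\<integral>\<^sup>+s. indicator {p. snd p < fst p} (z, s) \<partial>ladder_law n)"
      by (simp add: indicator_def)
  qed
  also have "\<dots> \<in> borel_measurable borel"
  proof (rule u.borel_measurable_nn_integral)
    have "Measurable.pred (borel \<Otimes>\<^sub>M borel) (\<lambda>p :: real \<times> real. snd p < fst p)" by measurable
    then have [measurable]: "{p. snd p < fst p} \<in> sets (borel \<Otimes>\<^sub>M (borel :: real measure))"
      by (simp add: pred_def space_pair_measure)
    show "(\<lambda>(z, s). indicator {p. snd p < fst p} (z, s) :: ennreal) \<in> borel_measurable (borel \<Otimes>\<^sub>M ladder_law n)"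
      by measurable
  qed
  finally show ?thesis .
qed

lemma borel_measurable_renewal [measurable]: "renewal \<in> borel_measurable borel"
  unfolding renewal_def[abs_def] by measurable

lemma ladder_law_UNIV: "emeasure (ladder_law n) UNIV = emeasure Q {x. stays_pos n x}"
  by (simp add: emeasure_ladder_law_stays_pos)

lemma nonpos_law_UNIV: "emeasure (nonpos_law n) UNIV = emeasure Q {x. stays_nonpos n x}"
  by (simp add: emeasure_nonpos_law)

lemma sets_Q_Collect: "Measurable.pred seq_borel P \<Longrightarrow> {x. P x} \<in> sets Q"
  unfolding sets_Q pred_def by (simp add: space_PiM)

lemma ladder_law_UNIV_antimono: "m \<le> n \<Longrightarrow> emeasure (ladder_law n) UNIV \<le> emeasure (ladder_law m) UNIV"
  unfolding ladder_law_UNIV by (intro emeasure_mono sets_Q_Collect) (auto simp: stays_pos_def)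

lemma nonpos_law_UNIV_antimono: "m \<le> n \<Longrightarrow> emeasure (nonpos_law n) UNIV \<le> emeasure (nonpos_law m) UNIV"
  unfolding nonpos_law_UNIV by (intro emeasure_mono sets_Q_Collect) (auto simp: stays_nonpos_def)

lemma max_below_antimono: "m \<le> n \<Longrightarrow> max_below n z \<le> max_below m z"
proof -
  have "Measurable.pred seq_borel (\<lambda>x. \<forall>i\<le>m. psum i x < z)" by measurable
  then show "m \<le> n \<Longrightarrow> max_below n z \<le> max_below m z"
    unfolding max_below_def by (intro emeasure_mono sets_Q_Collect) auto
qed

text \<open>Each ladder mass in \<open>sum_ladder_nonpos\<close> is lowered to the smallest one,
  that of index m.\<close>

lemma ladder_mult_sum_nonpos_le: "emeasure (ladder_law m) UNIV * (\<Sum>k\<le>m. emeasure (nonpos_law k) UNIV) \<le> 1"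
proof -
  have "emeasure (ladder_law m) UNIV * (\<Sum>k\<le>m. emeasure (nonpos_law k) UNIV)
      = (\<Sum>k\<le>m. emeasure (ladder_law m) UNIV * emeasure (nonpos_law (m - k)) UNIV)"
    unfolding sum_distrib_left
    by (rule sum.reindex_bij_witness[of _ "\<lambda>k. m - k" "\<lambda>k. m - k"]) auto
  also have "\<dots> \<le> (\<Sum>k\<le>m. emeasure (ladder_law k) UNIV * emeasure (nonpos_law (m - k)) UNIV)"
    by (intro sum_mono mult_right_mono ladder_law_UNIV_antimono) auto
  finally show ?thesis by (simp add: sum_ladder_nonpos)
qed

lemma nonpos_mult_sum_ladder_le: "emeasure (nonpos_law m) UNIV * (\<Sum>k\<le>m. emeasure (ladder_law k) UNIV) \<le> 1"
proof -
  have "emeasure (nonpos_law m) UNIV * (\<Sum>k\<le>m. emeasure (ladder_law k) UNIV)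
      = (\<Sum>k\<le>m. emeasure (ladder_law k) UNIV * emeasure (nonpos_law m) UNIV)"
    by (simp add: sum_distrib_left mult.commute)
  also have "\<dots> \<le> (\<Sum>k\<le>m. emeasure (ladder_law k) UNIV * emeasure (nonpos_law (m - k)) UNIV)"
    by (intro sum_mono mult_left_mono nonpos_law_UNIV_antimono) auto
  finally show ?thesis by (simp add: sum_ladder_nonpos)
qed

text \<open>Averaging over the horizon: \<open>max_below\<close> decreases in m, so m + 1 copies of
  the last value are at most the sum of all values. After exchanging summations this double sum is
  at most a product of two sums.\<close>

lemma Suc_mult_max_below_le: 
  "of_nat (Suc m) * max_below m z \<le> renewal z * (\<Sum>k\<le>m. emeasure (nonpos_law k) UNIV)"
proof -
  let ?w = "\<lambda>k. emeasure (nonpos_law k) UNIV" and ?u = "\<lambda>k. emeasure (ladder_law k) {..<z}"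
  have "of_nat (Suc m) * max_below m z = (\<Sum>j\<le>m. max_below m z)" by simp
  also have "\<dots> \<le> (\<Sum>j\<le>m. max_below j z)" by (intro sum_mono max_below_antimono) auto
  also have "\<dots> = (\<Sum>j\<le>m. \<Sum>k\<le>j. ?u k * ?w (j - k))" by (simp add: max_below_eq)
  also have "\<dots> = (\<Sum>(j, k)\<in>(SIGMA j:{..m}. {..j}). ?u k * ?w (j - k))" by (subst sum.Sigma) auto
  also have "\<dots> = (\<Sum>(k, i)\<in>(SIGMA k:{..m}. {..m - k}). ?u k * ?w i)"
    by (rule sum.reindex_bij_witness[of _ "\<lambda>(k, i). (k + i, k)" "\<lambda>(j, k). (k, j - k)"]) auto
  also have "\<dots> = (\<Sum>k\<le>m. ?u k * (\<Sum>i\<le>m - k. ?w i))"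
    by (subst sum.Sigma[symmetric]) (auto simp: sum_distrib_left)
  also have "\<dots> \<le> (\<Sum>k\<le>m. ?u k * (\<Sum>i\<le>m. ?w i))"
    by (intro sum_mono mult_left_mono sum_mono2) auto
  also have "\<dots> = (\<Sum>k\<le>m. ?u k) * (\<Sum>i\<le>m. ?w i)" by (simp add: sum_distrib_right)
  also have "(\<Sum>k\<le>m. ?u k) \<le> renewal z"
    unfolding renewal_def by (rule sum_le_suminf) auto
  finally show ?thesis by (simp add: mult_right_mono)
qed

lemma measurable_comb_seq_right: "comb_seq m x \<in> measurable Q Q"
proof -
  have "(\<lambda>y. comb_seq m x y) \<in> measurable Q Q"
    by (rule measurable_comb_seq') simp_all
  then show ?thesis by simp
qed

lemma stays_pos_reversed_part:
  assumes "stays_pos (m + j) x" "psum (m + j) x < z" "z > 0" "i \<le> j" "m \<ge> 1"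
  shows "psum (m + j) x - psum (m + j - i) x < z"
proof -
  have "psum (m + j - i) x > 0" using assms by (auto simp: stays_pos_def)
  then show ?thesis using assms by linarith
qed

text \<open>Seen backwards from time n, the last m steps have partial sums S_n - S_(n-i), and these
  lie below z + h because S_n < z + h and S_(n-i) > 0. After reversal this is the event measured by
  \<open>max_below\<close>. With m \<ge> 1 the index n - i is positive, as the positivity of the sum
  requires.\<close>

lemma ladder_law_interval_le:
  assumes conc: "\<And>y. emeasure (sum_law k) {y..<y + h} \<le> q" and "m \<ge> 1"
  shows "emeasure (ladder_law (m + (k + m))) {z..<z + h} \<le> emeasure (ladder_law m) UNIV * q * max_below m (z + h)"
proof (cases "z + h > 0")
  case False
  have "emeasure (ladder_law (m + (k + m))) {z..<z + h} \<le> emeasure (ladder_law (m + (k + m))) {..<z + h}"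
    by (intro emeasure_mono) auto
  then show ?thesis using False by (simp add: emeasure_ladder_law_neg)
next
  case True
  let ?n = "m + (k + m)"
  define D where "D d \<longleftrightarrow> (\<forall>i\<le>m. psum m d - psum (m - i) d < z + h)" for d
  have [measurable]: "Measurable.pred seq_borel D" unfolding D_def by measurable
  let ?P = "\<lambda>x. of_bool (stays_pos ?n x \<and> psum ?n x \<in> {z..<z + h}) :: ennreal"
  have imp: "?P (comb_seq m x (comb_seq k b d))
    \<le> of_bool (stays_pos m x) * (of_bool (D d) * indicator {z - psum m x - psum m d..<z - psum m x - psum m d + h} (psum k b))"
    for x b d
  proof (cases "stays_pos ?n (comb_seq m x (comb_seq k b d)) \<and> psum ?n (comb_seq m x (comb_seq k b d)) \<in> {z..<z + h}")
    case t: True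
    let ?x = "comb_seq m x (comb_seq k b d)"
    have "stays_pos m ?x" using t by (auto simp: stays_pos_def)
    then have 1: "stays_pos m x" by (simp add: stays_pos_comb_seq)
    have eq: "psum (m + (k + i)) ?x = psum m x + (psum k b + psum i d)" for i
      by (simp add: psum_comb_seq_add)
    have 2: "D d" unfolding D_def
    proof (intro allI impI)
      fix i assume i: "i \<le> m"
      have "psum ?n ?x - psum (m + (k + m) - i) ?x < z + h"
        by (rule stays_pos_reversed_part) (use t i True \<open>m \<ge> 1\<close> in auto)
      moreover have "m + (k + m) - i = m + (k + (m - i))" using i by simp
      ultimately show "psum m d - psum (m - i) d < z + h"
        unfolding eq[of m] \<open>m + (k + m) - i = m + (k + (m - i))\<close> eq by simp
    qed
    have "psum k b \<in> {z - psum m x - psum m d..<z - psum m x - psum m d + h}"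
      using t unfolding eq by auto
    then show ?thesis using 1 2 t by simp
  next
    case False
    then show ?thesis by (simp only: of_bool_eq zero_le)
  qed
  have eD: "(\<integral>\<^sup>+d. of_bool (D d) \<partial>Q) = max_below m (z + h)"
  proof -
    have "max_below m (z + h) = (\<integral>\<^sup>+x. of_bool (\<forall>i\<le>m. psum i x < z + h) \<partial>Q)"
      unfolding max_below_def by (rule emeasure_eq_integral_of_bool) measurable
    also have "\<dots> = (\<integral>\<^sup>+x. of_bool (\<forall>i\<le>m. psum i (reversed m x) < z + h) \<partial>Q)"
      by (rule nn_integral_reversed[symmetric]) measurable
    also have "\<dots> = (\<integral>\<^sup>+d. of_bool (D d) \<partial>Q)"
      by (intro nn_integral_cong) (auto simp: D_def psum_reversed)
    finally show ?thesis by simp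
  qed
  have "emeasure (ladder_law ?n) {z..<z + h} = (\<integral>\<^sup>+x. ?P x \<partial>Q)"
    by (subst emeasure_ladder_law_stays_pos, simp) (rule emeasure_eq_integral_of_bool, measurable)
  also have "\<dots> = (\<integral>\<^sup>+x. \<integral>\<^sup>+y. ?P (comb_seq m x y) \<partial>Q \<partial>Q)"
    by (rule nn_integral_split) measurable
  also have "\<dots> = (\<integral>\<^sup>+x. \<integral>\<^sup>+b. \<integral>\<^sup>+d. ?P (comb_seq m x (comb_seq k b d)) \<partial>Q \<partial>Q \<partial>Q)"
    by (rule nn_integral_cong, rule nn_integral_split, rule measurable_compose[OF measurable_comb_seq_right])
       measurable
  also have "\<dots> \<le> (\<integral>\<^sup>+x. \<integral>\<^sup>+b. \<integral>\<^sup>+d. of_bool (stays_pos m x) * (of_bool (D d) * indicator {z - psum m x - psum m d..<z - psum m x - psum m d + h} (psum k b)) \<partial>Q \<partial>Q \<partial>Q)"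
    by (intro nn_integral_mono imp)
  \<comment> \<open>The middle block is moved innermost, so that with the outer blocks fixed its sum
    must hit one interval of length h.\<close>
  also have "\<dots> = (\<integral>\<^sup>+x. \<integral>\<^sup>+d. \<integral>\<^sup>+b. of_bool (stays_pos m x) * (of_bool (D d) * indicator {z - psum m x - psum m d..<z - psum m x - psum m d + h} (psum k b)) \<partial>Q \<partial>Q \<partial>Q)"
  proof (rule nn_integral_cong)
    fix x
    interpret QQ: pair_sigma_finite Q Q ..
    let ?G = "\<lambda>d b. of_bool (stays_pos m x) * (of_bool (D d) *
      of_bool (z - psum m x - psum m d \<le> psum k b \<and> psum k b < z - psum m x - psum m d + h)) :: ennreal"
    have G: "of_bool (stays_pos m x) * (of_bool (D d) * indicator {z - psum m x - psum m d..<z - psum m x - psum m d + h} (psum k b))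
      = ?G d b" for d b
      by (simp add: indicator_def)
    have "(\<integral>\<^sup>+b. \<integral>\<^sup>+d. ?G d b \<partial>Q \<partial>Q) = (\<integral>\<^sup>+d. \<integral>\<^sup>+b. ?G d b \<partial>Q \<partial>Q)"
      by (rule QQ.Fubini') measurable
    then show "(\<integral>\<^sup>+b. \<integral>\<^sup>+d. of_bool (stays_pos m x) * (of_bool (D d) * indicator {z - psum m x - psum m d..<z - psum m x - psum m d + h} (psum k b)) \<partial>Q \<partial>Q)
      = (\<integral>\<^sup>+d. \<integral>\<^sup>+b. of_bool (stays_pos m x) * (of_bool (D d) * indicator {z - psum m x - psum m d..<z - psum m x - psum m d + h} (psum k b)) \<partial>Q \<partial>Q)"
      unfolding G .
  qed
  also have "\<dots> \<le> (\<integral>\<^sup>+x. \<integral>\<^sup>+d. of_bool (stays_pos m x) * (of_bool (D d) * q) \<partial>Q \<partial>Q)"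
  proof (intro nn_integral_mono)
    fix x d
    let ?I = "{z - psum m x - psum m d..<z - psum m x - psum m d + h}"
    have "(\<integral>\<^sup>+b. of_bool (stays_pos m x) * (of_bool (D d) * indicator ?I (psum k b)) \<partial>Q)
      = of_bool (stays_pos m x) * (of_bool (D d) * (\<integral>\<^sup>+b. indicator ?I (psum k b) \<partial>Q))"
      by (simp add: nn_integral_cmult)
    also have "(\<integral>\<^sup>+b. indicator ?I (psum k b) \<partial>Q) = emeasure (sum_law k) ?I"
      by (subst nn_integral_sum_law[symmetric]) auto
    also have "\<dots> \<le> q" by (rule conc)
    finally show "(\<integral>\<^sup>+b. of_bool (stays_pos m x) * (of_bool (D d) * indicator ?I (psum k b)) \<partial>Q)
      \<le> of_bool (stays_pos m x) * (of_bool (D d) * q)" by (simp add: mult_left_mono)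
  qed
  also have "\<dots> = (\<integral>\<^sup>+x. of_bool (stays_pos m x) \<partial>Q) * q * max_below m (z + h)"
    by (simp add: nn_integral_cmult nn_integral_multc eD mult_ac)
  also have "(\<integral>\<^sup>+x. of_bool (stays_pos m x) \<partial>Q) = emeasure (ladder_law m) UNIV"
    unfolding ladder_law_UNIV by (rule emeasure_eq_integral_of_bool[symmetric]) measurable
  finally show ?thesis .
qed

text \<open>The sum of nonpositive masses introduced by the bound on \<open>max_below\<close> is
  absorbed by the ladder mass of the first block, which leaves the renewal function as the only
  factor besides q.\<close>

lemma Suc_mult_ladder_law_interval_le:
  assumes conc: "\<And>y. emeasure (sum_law k) {y..<y + h} \<le> q" and "m \<ge> 1"
  shows "of_nat (Suc m) * emeasure (ladder_law (m + (k + m))) {z..<z + h} \<le> q * renewal (z + h)"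
proof -
  have "of_nat (Suc m) * emeasure (ladder_law (m + (k + m))) {z..<z + h}
    \<le> of_nat (Suc m) * (emeasure (ladder_law m) UNIV * q * max_below m (z + h))"
    by (intro mult_left_mono ladder_law_interval_le assms) auto
  also have "\<dots> = (emeasure (ladder_law m) UNIV * q) * (of_nat (Suc m) * max_below m (z + h))"
    by (simp add: mult_ac)
  also have "\<dots> \<le> (emeasure (ladder_law m) UNIV * q) * (renewal (z + h) * (\<Sum>k\<le>m. emeasure (nonpos_law k) UNIV))"
    by (intro mult_left_mono Suc_mult_max_below_le) auto
  also have "\<dots> = q * renewal (z + h) * (emeasure (ladder_law m) UNIV * (\<Sum>k\<le>m. emeasure (nonpos_law k) UNIV))"
    by (simp add: mult_ac)
  also have "\<dots> \<le> q * renewal (z + h) * 1"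
    by (intro mult_left_mono ladder_mult_sum_nonpos_le) auto
  finally show ?thesis by simp
qed

section \<open>Subadditivity and finiteness of the renewal function\<close>

definition first_above :: "real \<Rightarrow> nat \<Rightarrow> (nat \<Rightarrow> real) \<Rightarrow> bool" where
  "first_above z k x \<longleftrightarrow> (\<forall>i<k. psum i x < z) \<and> psum k x \<ge> z"

lemma first_above_measurable [measurable]: "Measurable.pred seq_borel (first_above z k)"
  unfolding first_above_def by measurable

lemma first_above_comb_seq: "first_above z k (comb_seq k x y) \<longleftrightarrow> first_above z k x"
  by (simp add: first_above_def psum_comb_seq_le)

lemma first_above_unique: "first_above z k x \<Longrightarrow> first_above z l x \<Longrightarrow> k = l"
  unfolding first_above_def by (meson linorder_neqE_nat not_less)

lemma first_above_exists:
  assumes "psum n x \<ge> z" shows "\<exists>k\<le>n. first_above z k x"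
proof (intro exI conjI)
  let ?k = "LEAST k. psum k x \<ge> z"
  show "?k \<le> n" using assms by (rule Least_le)
  have "psum ?k x \<ge> z" using assms by (rule LeastI)
  moreover have "psum i x < z" if "i < ?k" for i
    using not_less_Least[OF that] by simp
  ultimately show "first_above z ?k x" unfolding first_above_def by blast
qed

lemma suminf_disjoint_le_1:
  assumes meas: "\<And>n. Measurable.pred seq_borel (P n)"
    and disj: "\<And>x m n. P m x \<Longrightarrow> P n x \<Longrightarrow> m = n"
  shows "(\<Sum>n. emeasure Q {x. P n x}) \<le> 1"
proof -
  have "(\<Sum>n. emeasure Q {x. P n x}) = emeasure Q (\<Union>n. {x. P n x})"
  proof (rule suminf_emeasure)
    show "range (\<lambda>n. {x. P n x}) \<subseteq> sets Q"
      using sets_Q_Collect[OF meas] by blast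
    show "disjoint_family (\<lambda>n. {x. P n x})"
      unfolding disjoint_family_on_def using disj by blast
  qed
  also have "\<dots> \<le> 1" by (rule prob_space.measure_le_1[OF prob_space_Q])
  finally show ?thesis .
qed

text \<open>The walk is stopped on first reaching x. A ladder point in [x, x + D) at or after that
  time yields a ladder point of height below D for the remaining walk, and the passage probabilities
  sum to at most 1.\<close>

lemma renewal_add_le:
  assumes "x > 0" shows "renewal (x + D) \<le> renewal x + renewal D"
proof -
  have step: "emeasure (ladder_law n) {x..<x + D} \<le> (\<Sum>k\<le>n. emeasure Q {y. first_above x k y} * emeasure (ladder_law (n - k)) {..<D})" for n
  proof -
    have "emeasure (ladder_law n) {x..<x + D} = (\<integral>\<^sup>+y. of_bool (ladder n y \<and> psum n y \<in> {x..<x + D}) \<partial>Q)"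
      by (subst emeasure_ladder_law, simp) (rule emeasure_eq_integral_of_bool, measurable)
    also have "\<dots> \<le> (\<integral>\<^sup>+y. (\<Sum>k\<le>n. of_bool (first_above x k y \<and> ladder n y \<and> psum n y < x + D)) \<partial>Q)"
    proof (rule nn_integral_mono)
      fix y
      show "of_bool (ladder n y \<and> psum n y \<in> {x..<x + D}) \<le> (\<Sum>k\<le>n. of_bool (first_above x k y \<and> ladder n y \<and> psum n y < x + D) :: ennreal)"
      proof (cases "ladder n y \<and> psum n y \<in> {x..<x + D}")
        case True
        then obtain k where k: "k \<le> n" "first_above x k y" using first_above_exists[of x n y] by auto
        have "of_bool (ladder n y \<and> psum n y \<in> {x..<x + D}) = (of_bool (first_above x k y \<and> ladder n y \<and> psum n y < x + D) :: ennreal)"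
          using True k by auto
        also have "\<dots> \<le> (\<Sum>k\<le>n. of_bool (first_above x k y \<and> ladder n y \<and> psum n y < x + D))"
          using k by (intro member_le_sum) auto
        finally show ?thesis .
      next
        case False
        then show ?thesis by (simp only: of_bool_eq zero_le)
      qed
    qed
    also have "\<dots> = (\<Sum>k\<le>n. \<integral>\<^sup>+y. of_bool (first_above x k y \<and> ladder n y \<and> psum n y < x + D) \<partial>Q)"
      by (rule nn_integral_sum) measurable
    also have "\<dots> \<le> (\<Sum>k\<le>n. emeasure Q {y. first_above x k y} * emeasure (ladder_law (n - k)) {..<D})"
    proof (rule sum_mono)
      fix k assume "k \<in> {..n}"
      then have k: "k \<le> n" by simp
      have "(\<integral>\<^sup>+y. of_bool (first_above x k y \<and> ladder n y \<and> psum n y < x + D) \<partial>Q)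
        = (\<integral>\<^sup>+a. \<integral>\<^sup>+b. of_bool (first_above x k (comb_seq k a b) \<and> ladder n (comb_seq k a b) \<and> psum n (comb_seq k a b) < x + D) \<partial>Q \<partial>Q)"
        by (rule nn_integral_split) measurable
      also have "\<dots> \<le> (\<integral>\<^sup>+a. \<integral>\<^sup>+b. of_bool (first_above x k a) * of_bool (ladder (n - k) b \<and> psum (n - k) b \<in> {..<D}) \<partial>Q \<partial>Q)"
      proof (intro nn_integral_mono)
        fix a b
        have "ladder (n - k) b \<and> psum (n - k) b \<in> {..<D}"
          if "first_above x k a" "ladder n (comb_seq k a b)" "psum n (comb_seq k a b) < x + D"
          using that ladder_comb_seq_ge[OF that(2) k] k by (auto simp: first_above_def psum_comb_seq_ge)
        then show "of_bool (first_above x k (comb_seq k a b) \<and> ladder n (comb_seq k a b) \<and> psum n (comb_seq k a b) < x + D)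
          \<le> (of_bool (first_above x k a) * of_bool (ladder (n - k) b \<and> psum (n - k) b \<in> {..<D}) :: ennreal)"
          unfolding first_above_comb_seq of_bool_conj[symmetric] by (intro of_bool_le_of_bool) blast
      qed
      also have "\<dots> = (\<integral>\<^sup>+a. of_bool (first_above x k a) \<partial>Q) * (\<integral>\<^sup>+b. of_bool (ladder (n - k) b \<and> psum (n - k) b \<in> {..<D}) \<partial>Q)"
        by (simp add: nn_integral_cmult nn_integral_multc)
      also have "(\<integral>\<^sup>+a. of_bool (first_above x k a) \<partial>Q) = emeasure Q {y. first_above x k y}"
        by (rule emeasure_eq_integral_of_bool[symmetric]) measurable
      also have "(\<integral>\<^sup>+b. of_bool (ladder (n - k) b \<and> psum (n - k) b \<in> {..<D}) \<partial>Q) = emeasure (ladder_law (n - k)) {..<D}"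
        by (subst emeasure_ladder_law, simp) (rule emeasure_eq_integral_of_bool[symmetric], measurable)
      finally show "(\<integral>\<^sup>+y. of_bool (first_above x k y \<and> ladder n y \<and> psum n y < x + D) \<partial>Q)
         \<le> emeasure Q {y. first_above x k y} * emeasure (ladder_law (n - k)) {..<D}" .
    qed
    finally show ?thesis .
  qed
  have "renewal (x + D) \<le> (\<Sum>n. emeasure (ladder_law n) {..<x} + emeasure (ladder_law n) {x..<x + D})"
    unfolding renewal_def
  proof (intro suminf_le)
    fix n
    have "emeasure (ladder_law n) {..<x + D} \<le> emeasure (ladder_law n) ({..<x} \<union> {x..<x + D})"
      by (intro emeasure_mono) auto
    also have "\<dots> \<le> emeasure (ladder_law n) {..<x} + emeasure (ladder_law n) {x..<x + D}"
      by (rule emeasure_subadditive) auto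
    finally show "emeasure (ladder_law n) {..<x + D} \<le> emeasure (ladder_law n) {..<x} + emeasure (ladder_law n) {x..<x + D}" .
  qed auto
  also have "\<dots> = renewal x + (\<Sum>n. emeasure (ladder_law n) {x..<x + D})"
    unfolding renewal_def by (rule suminf_add[symmetric]) auto
  also have "(\<Sum>n. emeasure (ladder_law n) {x..<x + D})
     \<le> (\<Sum>n. \<Sum>k\<le>n. emeasure Q {y. first_above x k y} * emeasure (ladder_law (n - k)) {..<D})"
    by (intro suminf_le step) auto
  also have "\<dots> = (\<Sum>k. \<Sum>m. emeasure Q {y. first_above x k y} * emeasure (ladder_law m) {..<D})"
    by (rule Cauchy_product_ennreal)
  also have "\<dots> = (\<Sum>k. emeasure Q {y. first_above x k y}) * renewal D"
    by (simp add: renewal_def)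
  also have "\<dots> \<le> 1 * renewal D"
    by (intro mult_right_mono suminf_disjoint_le_1 first_above_measurable first_above_unique) auto
  finally show ?thesis by (simp add: add_left_mono)
qed

lemma emeasure_step_ge: "emeasure Q {y. psum (Suc 0) y \<ge> a} = emeasure F {a..}"
proof -
  have eq: "distr Q F (\<lambda>y. y 0) = F"
    by (rule distr_PiM_component) (simp_all add: prob_space_F)
  have "emeasure F {a..} = emeasure (distr Q F (\<lambda>y. y 0)) {a..}"
    unfolding eq ..
  also have "\<dots> = emeasure Q ((\<lambda>y. y 0) -` {a..} \<inter> space Q)"
    by (rule emeasure_distr) auto
  also have "(\<lambda>y. y 0) -` {a..} \<inter> space Q = {y. psum (Suc 0) y \<ge> a}"
    by (auto simp: psum_def)
  finally show ?thesis by simp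
qed

text \<open>A ladder epoch of height below a followed by a step of at least a happens at most once:
  afterwards the walk has reached a, and later ladder heights are no smaller. The left side is the
  sum of the probabilities of these disjoint events.\<close>

lemma renewal_mult_le_1:
  "renewal a * emeasure F {a..} \<le> 1"
proof -
  let ?E = "\<lambda>n x. ladder n x \<and> psum n x < a \<and> psum (Suc n) x - psum n x \<ge> a"
  have E: "emeasure Q {x. ?E n x} = emeasure (ladder_law n) {..<a} * emeasure F {a..}" for n
  proof -
    have "emeasure Q {x. ?E n x} = (\<integral>\<^sup>+x. of_bool (?E n x) \<partial>Q)"
      by (rule emeasure_eq_integral_of_bool) measurable
    also have "\<dots> = (\<integral>\<^sup>+x. \<integral>\<^sup>+y. of_bool (?E n (comb_seq n x y)) \<partial>Q \<partial>Q)"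
      by (rule nn_integral_split) measurable
    also have "\<dots> = (\<integral>\<^sup>+x. \<integral>\<^sup>+y. of_bool (ladder n x \<and> psum n x \<in> {..<a}) * of_bool (psum (Suc 0) y \<ge> a) \<partial>Q \<partial>Q)"
      by (intro nn_integral_cong) (auto simp: ladder_comb_seq psum_comb_seq_ge psum_comb_seq_le)
    also have "\<dots> = (\<integral>\<^sup>+x. of_bool (ladder n x \<and> psum n x \<in> {..<a}) \<partial>Q) * (\<integral>\<^sup>+y. of_bool (psum (Suc 0) y \<ge> a) \<partial>Q)"
      by (simp add: nn_integral_cmult nn_integral_multc)
    also have "(\<integral>\<^sup>+x. of_bool (ladder n x \<and> psum n x \<in> {..<a}) \<partial>Q) = emeasure (ladder_law n) {..<a}"
      by (subst emeasure_ladder_law, simp) (rule emeasure_eq_integral_of_bool[symmetric], measurable)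
    also have "(\<integral>\<^sup>+y. of_bool (psum (Suc 0) y \<ge> a) \<partial>Q) = emeasure F {a..}"
      by (subst emeasure_step_ge[symmetric], rule emeasure_eq_integral_of_bool[symmetric]) measurable
    finally show ?thesis .
  qed
  have "(\<Sum>n. emeasure Q {x. ?E n x}) \<le> 1"
  proof (rule suminf_disjoint_le_1)
    have no: False if "?E m x" "?E n x" "m < n" for m n x
    proof -
      have "psum (Suc m) x \<le> psum n x"
        using that by (cases "Suc m = n") (auto simp: ladder_def intro: less_imp_le)
      moreover have "psum m x \<ge> 0" using that ladder_psum_nonneg by blast
      ultimately show False using that by linarith
    qed
    show "m = n" if "?E m x" "?E n x" for m n x
      using no[OF that] no[OF that(2,1)] by (meson linorder_neqE_nat)
  qed measurable
  then show ?thesis by (simp add: E renewal_def)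
qed

text \<open>Finiteness at one reachable level a spreads to its multiples by subadditivity and from
  there by monotonicity.\<close>

lemma renewal_finite:
  assumes "a > 0" "emeasure F {a..} > 0"
  shows "renewal z < \<infinity>"
proof -
  have fa: "renewal a < \<infinity>"
    using renewal_mult_le_1[of a] assms by (auto simp: ennreal_mult_eq_top_iff less_top[symmetric] top_unique)
  have "renewal (real (Suc n) * a) < \<infinity>" for n
  proof (induction n)
    case 0 then show ?case using fa by simp
  next
    case (Suc n)
    have "renewal (real (Suc (Suc n)) * a) = renewal (real (Suc n) * a + a)" by (simp add: algebra_simps)
    also have "\<dots> \<le> renewal (real (Suc n) * a) + renewal a" using assms by (intro renewal_add_le) auto
    finally show ?case using Suc fa by (auto simp: less_top[symmetric] top_unique)
  qed
  moreover obtain n where "z / a < real n" using reals_Archimedean2 by blast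
  then have "z \<le> real (Suc n) * a" using assms by (auto simp: field_simps)
  ultimately show ?thesis using renewal_mono by (meson order_le_less_trans)
qed

end

section \<open>Measures with a Wiener--Hopf factorisation\<close>

definition fin_borel :: "real measure \<Rightarrow> bool" where
  "fin_borel \<mu> \<longleftrightarrow> finite_measure \<mu> \<and> sets \<mu> = sets borel"

lemma fin_borelD: assumes "fin_borel \<mu>" shows "finite_measure \<mu>" "sets \<mu> = sets borel" "space \<mu> = UNIV"
  using assms sets_eq_imp_space_eq[of \<mu> borel] by (auto simp: fin_borel_def)

lemma fin_borel_conv: "fin_borel \<mu> \<Longrightarrow> fin_borel \<nu> \<Longrightarrow> fin_borel (\<mu> \<star> \<nu>)"
  unfolding fin_borel_def by (simp add: convolution_finite)

lemma conv_comm: "fin_borel \<mu> \<Longrightarrow> fin_borel \<nu> \<Longrightarrow> (\<mu> \<star> \<nu>) = (\<nu> \<star> \<mu>)"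
  by (rule convolution_commutative) (auto simp: fin_borel_def)

lemma conv_assoc: "fin_borel \<mu> \<Longrightarrow> fin_borel \<nu> \<Longrightarrow> fin_borel \<rho> \<Longrightarrow> (\<mu> \<star> (\<nu> \<star> \<rho>)) = ((\<mu> \<star> \<nu>) \<star> \<rho>)"
  by (rule convolution_associative) (auto simp: fin_borel_def)

lemma conv_swap_right:
  assumes "fin_borel \<mu>" "fin_borel \<nu>" "fin_borel \<rho>" shows "((\<mu> \<star> \<nu>) \<star> \<rho>) = ((\<mu> \<star> \<rho>) \<star> \<nu>)"
  using assms by (metis conv_assoc conv_comm)

lemma emeasure_conv:
  assumes "fin_borel \<mu>" "fin_borel \<nu>" and "B \<in> sets borel"
  shows "emeasure (\<mu> \<star> \<nu>) B = (\<integral>\<^sup>+x. emeasure \<mu> {a. a + x \<in> B} \<partial>\<nu>)"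
  unfolding conv_comm[OF assms(1,2)]
  by (rule convolution_emeasure) (use assms fin_borelD in auto)

lemma sets_translate:
  assumes [measurable]: "B \<in> sets borel" shows "{a. a + (x::real) \<in> B} \<in> sets borel"
  by measurable

lemma measurable_emeasure_translate:
  assumes \<mu>: "fin_borel \<mu>" and [measurable]: "B \<in> sets borel"
  shows "(\<lambda>x. emeasure \<mu> {a. a + x \<in> B}) \<in> borel_measurable borel"
proof -
  interpret finite_measure \<mu> by (rule fin_borelD[OF \<mu>])
  note [measurable_cong] = fin_borelD(2)[OF \<mu>]
  have "(\<lambda>x. emeasure \<mu> {a. a + x \<in> B}) = (\<lambda>x. \<integral>\<^sup>+a. indicator B (a + x) \<partial>\<mu>)"
  proof
    fix x
    have "{a. a + x \<in> B} \<in> sets \<mu>" using fin_borelD[OF \<mu>] sets_translate[OF assms(2)] by simp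
    then have "emeasure \<mu> {a. a + x \<in> B} = (\<integral>\<^sup>+a. indicator {a. a + x \<in> B} a \<partial>\<mu>)"
      by (rule nn_integral_indicator[symmetric])
    then show "emeasure \<mu> {a. a + x \<in> B} = (\<integral>\<^sup>+a. indicator B (a + x) \<partial>\<mu>)"
      by (simp add: indicator_def)
  qed
  also have "\<dots> \<in> borel_measurable borel" by measurable
  finally show ?thesis .
qed

text \<open>Linear relations between measures survive convolution. The scalar stays outside, so an
  identity for n u_n can be convolved without introducing scaled measures.\<close>

lemma conv_decomp:
  fixes c :: ennreal
  assumes "fin_borel \<mu>" "fin_borel \<nu>" "\<And>i. i \<in> I \<Longrightarrow> fin_borel (f i)"
    and eq: "\<And>B. B \<in> sets borel \<Longrightarrow> c * emeasure \<mu> B = (\<Sum>i\<in>I. emeasure (f i) B)"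
    and [measurable]: "B \<in> sets borel"
  shows "c * emeasure (\<mu> \<star> \<nu>) B = (\<Sum>i\<in>I. emeasure (f i \<star> \<nu>) B)"
proof -
  note [measurable_cong] = fin_borelD(2)[OF assms(2)]
  have "c * emeasure (\<mu> \<star> \<nu>) B = (\<integral>\<^sup>+x. c * emeasure \<mu> {a. a + x \<in> B} \<partial>\<nu>)"
    by (subst emeasure_conv[OF assms(1,2)], simp, rule nn_integral_cmult[symmetric])
       (use measurable_emeasure_translate[OF assms(1), of B] in measurable)
  also have "\<dots> = (\<integral>\<^sup>+x. (\<Sum>i\<in>I. emeasure (f i) {a. a + x \<in> B}) \<partial>\<nu>)"
    by (intro nn_integral_cong eq sets_translate assms)
  also have "\<dots> = (\<Sum>i\<in>I. \<integral>\<^sup>+x. emeasure (f i) {a. a + x \<in> B} \<partial>\<nu>)"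
    by (rule nn_integral_sum) (use measurable_emeasure_translate[OF assms(3), of _ B] in measurable)
  also have "\<dots> = (\<Sum>i\<in>I. emeasure (f i \<star> \<nu>) B)"
    by (intro sum.cong refl emeasure_conv[symmetric] assms)
  finally show ?thesis .
qed

lemma conv_return_0:
  assumes "fin_borel \<mu>" "B \<in> sets borel"
  shows "emeasure (\<mu> \<star> return borel 0) B = emeasure \<mu> B"
proof -
  have "fin_borel (return borel 0)"
    by (auto simp: fin_borel_def intro!: prob_space.finite_measure[OF prob_space_return])
  then have "emeasure (\<mu> \<star> return borel 0) B = (\<integral>\<^sup>+x. emeasure \<mu> {a. a + x \<in> B} \<partial>return borel 0)"
    using assms by (intro emeasure_conv)
  also have "\<dots> = emeasure \<mu> {a. a + 0 \<in> B}"
    by (rule nn_integral_return) (use measurable_emeasure_translate[OF assms] in auto)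
  finally show ?thesis by simp
qed

lemma conv_null_atMost:
  assumes \<mu>: "fin_borel \<mu>" and \<nu>: "fin_borel \<nu>" and "emeasure \<mu> {..<0} = 0" "emeasure \<nu> {..0} = 0"
  shows "emeasure (\<mu> \<star> \<nu>) {..0} = 0"
proof -
  have "emeasure (\<mu> \<star> \<nu>) {..0} = (\<integral>\<^sup>+x. emeasure \<mu> {a. a + x \<in> {..0}} \<partial>\<nu>)"
    by (rule emeasure_conv[OF \<mu> \<nu>]) simp
  also have "\<dots> = (\<integral>\<^sup>+x. 0 \<partial>\<nu>)"
  proof (rule nn_integral_cong_AE)
    have "AE x in \<nu>. x \<notin> {..0}"
      by (rule AE_I[of _ _ "{..0}"]) (use assms fin_borelD(2)[OF \<nu>] in auto)
    then show "AE x in \<nu>. emeasure \<mu> {a. a + x \<in> {..0}} = 0"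
    proof eventually_elim
      case (elim x)
      have "emeasure \<mu> {a. a + x \<in> {..0}} \<le> emeasure \<mu> {..<0}"
        using elim fin_borelD(2)[OF \<mu>] by (intro emeasure_mono) auto
      then show ?case using assms by simp
    qed
  qed
  finally show ?thesis by simp
qed

lemma conv_null_greaterThan:
  assumes \<mu>: "fin_borel \<mu>" and \<nu>: "fin_borel \<nu>" and "emeasure \<mu> {0<..} = 0" "emeasure \<nu> {0<..} = 0"
  shows "emeasure (\<mu> \<star> \<nu>) {0<..} = 0"
proof -
  have "emeasure (\<mu> \<star> \<nu>) {0<..} = (\<integral>\<^sup>+x. emeasure \<mu> {a. a + x \<in> {0<..}} \<partial>\<nu>)"
    by (rule emeasure_conv[OF \<mu> \<nu>]) simp
  also have "\<dots> = (\<integral>\<^sup>+x. 0 \<partial>\<nu>)"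
  proof (rule nn_integral_cong_AE)
    have "AE x in \<nu>. x \<notin> {0<..}"
      by (rule AE_I[of _ _ "{0<..}"]) (use assms fin_borelD(2)[OF \<nu>] in auto)
    then show "AE x in \<nu>. emeasure \<mu> {a. a + x \<in> {0<..}} = 0"
    proof eventually_elim
      case (elim x)
      have "emeasure \<mu> {a. a + x \<in> {0<..}} \<le> emeasure \<mu> {0<..}"
        using elim fin_borelD(2)[OF \<mu>] by (intro emeasure_mono) auto
      then show ?case using assms by simp
    qed
  qed
  finally show ?thesis by simp
qed

text \<open>Sums over triples with total n and j \<ge> 1. Here the second argument of
  \<open>X\<close> becomes the outer index; the primed version does the same for the first.\<close>

lemma sum_triangle_reindex:
  fixes X :: "nat \<Rightarrow> nat \<Rightarrow> nat \<Rightarrow> ennreal"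
  shows "(\<Sum>j\<in>{1..n}. \<Sum>k\<le>n - j. X k (n - j - k) j) = (\<Sum>i<n. \<Sum>j\<in>{1..n - i}. X (n - i - j) i j)"
proof -
  have "(\<Sum>j\<in>{1..n}. \<Sum>k\<le>n - j. X k (n - j - k) j) = (\<Sum>(j, k)\<in>(SIGMA j:{1..n}. {..n - j}). X k (n - j - k) j)"
    by (rule sum.Sigma) auto
  also have "\<dots> = (\<Sum>(i, j)\<in>(SIGMA i:{..<n}. {1..n - i}). X (n - i - j) i j)"
    by (rule sum.reindex_bij_witness[of _ "\<lambda>(i, j). (j, n - i - j)" "\<lambda>(j, k). (n - j - k, j)"]) auto
  also have "\<dots> = (\<Sum>i<n. \<Sum>j\<in>{1..n - i}. X (n - i - j) i j)"
    by (rule sum.Sigma[symmetric]) auto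
  finally show ?thesis .
qed

lemma sum_triangle_reindex':
  fixes X :: "nat \<Rightarrow> nat \<Rightarrow> nat \<Rightarrow> ennreal"
  shows "(\<Sum>j\<in>{1..n}. \<Sum>k\<le>n - j. X k (n - j - k) j) = (\<Sum>k<n. \<Sum>j\<in>{1..n - k}. X k (n - k - j) j)"
proof -
  have "(\<Sum>j\<in>{1..n}. \<Sum>k\<le>n - j. X k (n - j - k) j) = (\<Sum>(j, k)\<in>(SIGMA j:{1..n}. {..n - j}). X k (n - j - k) j)"
    by (rule sum.Sigma) auto
  also have "\<dots> = (\<Sum>(k, j)\<in>(SIGMA k:{..<n}. {1..n - k}). X k (n - k - j) j)"
    by (rule sum.reindex_bij_witness[of _ "\<lambda>(k, j). (j, k)" "\<lambda>(j, k). (k, j)"]) (auto simp: diff_diff_eq add.commute)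
  also have "\<dots> = (\<Sum>k<n. \<Sum>j\<in>{1..n - k}. X k (n - k - j) j)"
    by (rule sum.Sigma[symmetric]) auto
  finally show ?thesis .
qed

lemma emeasure_restrict_support:
  assumes "fin_borel \<mu>" "emeasure \<mu> (- A) = 0" "A \<in> sets borel" "B \<in> sets borel"
  shows "emeasure \<mu> (B \<inter> A) = emeasure \<mu> B"
proof (rule antisym)
  note s = fin_borelD(2)[OF assms(1)]
  show "emeasure \<mu> (B \<inter> A) \<le> emeasure \<mu> B" using assms s by (intro emeasure_mono) auto
  have c: "- A \<in> sets \<mu>" unfolding s using assms(3) borel_comp by blast
  have "emeasure \<mu> B \<le> emeasure \<mu> ((B \<inter> A) \<union> (- A))"
    using assms s c by (intro emeasure_mono) auto
  also have "\<dots> \<le> emeasure \<mu> (B \<inter> A) + emeasure \<mu> (- A)"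
    using assms s c by (intro emeasure_subadditive) auto
  finally show "emeasure \<mu> B \<le> emeasure \<mu> (B \<inter> A)" using assms by simp
qed

text \<open>The algebra of the factorisation in isolation: convolution powers \<open>L\<close> and
  two factors, each starting from the unit mass at 0. The disjoint supports of the later terms are
  what will separate \<open>u\<close> from \<open>w\<close>.\<close>

locale wiener_hopf =
  fixes L u w :: "nat \<Rightarrow> real measure"
  assumes fin_L: "\<And>n. fin_borel (L n)" and fin_u: "\<And>n. fin_borel (u n)" and fin_w: "\<And>n. fin_borel (w n)"
    and L_add: "\<And>i j. L (i + j) = (L i \<star> L j)"
    and factor: "\<And>n B. B \<in> sets borel \<Longrightarrow> emeasure (L n) B = (\<Sum>k\<le>n. emeasure (u k \<star> w (n - k)) B)"
    and u0: "u 0 = return borel 0" and w0: "w 0 = return borel 0"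
    and u_supp: "\<And>n. n > 0 \<Longrightarrow> emeasure (u n) {..0} = 0"
    and w_supp: "\<And>n. n > 0 \<Longrightarrow> emeasure (w n) {0<..} = 0"
begin

definition "f j = density (L j) (indicator {0<..})"
definition "g j = density (L j) (indicator {..0})"

lemma emeasure_f: "B \<in> sets borel \<Longrightarrow> emeasure (f j) B = emeasure (L j) (B \<inter> {0<..})"
  unfolding f_def using fin_borelD(2)[OF fin_L[of j]]
  by (subst emeasure_density) (auto intro!: nn_integral_indicator simp: indicator_inter_arith[symmetric] Int_commute)

lemma emeasure_g: "B \<in> sets borel \<Longrightarrow> emeasure (g j) B = emeasure (L j) (B \<inter> {..0})"
  unfolding g_def using fin_borelD(2)[OF fin_L[of j]]
  by (subst emeasure_density) (auto intro!: nn_integral_indicator simp: indicator_inter_arith[symmetric] Int_commute)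

lemma fin_f: "fin_borel (f j)"
proof -
  interpret finite_measure "L j" by (rule fin_borelD[OF fin_L])
  have s: "sets (f j) = sets borel" "space (f j) = UNIV" using fin_borelD[OF fin_L[of j]] by (auto simp: f_def)
  then show ?thesis unfolding fin_borel_def by (auto intro!: finite_measureI simp: emeasure_f)
qed

lemma fin_g: "fin_borel (g j)"
proof -
  interpret finite_measure "L j" by (rule fin_borelD[OF fin_L])
  have s: "sets (g j) = sets borel" "space (g j) = UNIV" using fin_borelD[OF fin_L[of j]] by (auto simp: g_def)
  then show ?thesis unfolding fin_borel_def by (auto intro!: finite_measureI simp: emeasure_g)
qed

lemma L_split: 
  assumes "B \<in> sets borel" shows "1 * emeasure (L j) B = (\<Sum>b\<in>UNIV. emeasure (if b then f j else g j) B)"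
proof -
  have "emeasure (L j) ((B \<inter> {0<..}) \<union> (B \<inter> {..0})) = emeasure (L j) (B \<inter> {0<..}) + emeasure (L j) (B \<inter> {..0})"
    using assms fin_borelD(2)[OF fin_L[of j]] by (intro plus_emeasure[symmetric]) auto
  moreover have "(B \<inter> {0<..}) \<union> (B \<inter> {..0}) = B" by auto
  ultimately show ?thesis using assms by (simp add: UNIV_bool emeasure_f emeasure_g add.commute)
qed

lemma u_nonneg: "emeasure (u n) {..<0} = 0"
proof (cases "n > 0")
  case True
  have "emeasure (u n) {..<0} \<le> emeasure (u n) {..0}"
    using fin_borelD(2)[OF fin_u[of n]] by (intro emeasure_mono) auto
  then show ?thesis using u_supp[OF True] by simp
qed (simp add: u0)

lemma w_nonpos: "emeasure (w n) {0<..} = 0"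
  by (cases "n > 0") (simp_all add: w_supp w0)

lemma uf_null: "emeasure (u i \<star> f j) {..0} = 0"
proof (rule conv_null_atMost)
  have "{..0} \<inter> {0<..} = ({} :: real set)" by auto
  then show "emeasure (f j) {..0} = 0" by (simp add: emeasure_f)
qed (simp_all add: fin_u fin_f u_nonneg)

lemma wg_null: "emeasure (w i \<star> g j) {0<..} = 0"
proof (rule conv_null_greaterThan)
  have "{0<..} \<inter> {..0} = ({} :: real set)" by auto
  then show "emeasure (g j) {0<..} = 0" by (simp add: emeasure_g)
qed (simp_all add: fin_w fin_g w_nonpos)

text \<open>The factor \<open>L j\<close> is split by sign into \<open>f j\<close> and
  \<open>g j\<close>, and \<open>L m\<close> is factored. Each positive part is grouped with
  \<open>u\<close>, each nonpositive part with \<open>w\<close>, so that the groups keep their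
  half-lines.\<close>

lemma L_conv_L:
  assumes B: "B \<in> sets borel"
  shows "emeasure (L m \<star> L j) B = (\<Sum>k\<le>m. emeasure ((u k \<star> f j) \<star> w (m - k)) B) + (\<Sum>k\<le>m. emeasure ((w (m - k) \<star> g j) \<star> u k) B)"
proof -
  have "emeasure (L m \<star> L j) B = 1 * emeasure (L j \<star> L m) B" by (simp add: conv_comm[OF fin_L fin_L])
  also have "\<dots> = (\<Sum>b\<in>UNIV. emeasure ((if b then f j else g j) \<star> L m) B)"
    by (rule conv_decomp[OF fin_L fin_L _ L_split B]) (simp add: fin_f fin_g)
  also have "\<dots> = 1 * emeasure (L m \<star> f j) B + 1 * emeasure (L m \<star> g j) B"
    by (simp add: UNIV_bool conv_comm[OF fin_L fin_f] conv_comm[OF fin_L fin_g] add.commute)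
  also have "1 * emeasure (L m \<star> f j) B = (\<Sum>k\<le>m. emeasure ((u k \<star> w (m - k)) \<star> f j) B)"
    by (rule conv_decomp[OF fin_L fin_f _ _ B]) (simp_all add: fin_borel_conv fin_u fin_w factor)
  also have "\<dots> = (\<Sum>k\<le>m. emeasure ((u k \<star> f j) \<star> w (m - k)) B)"
    by (intro sum.cong refl arg_cong2[where f = emeasure] conv_swap_right fin_u fin_w fin_f)
  also have "1 * emeasure (L m \<star> g j) B = (\<Sum>k\<le>m. emeasure ((u k \<star> w (m - k)) \<star> g j) B)"
    by (rule conv_decomp[OF fin_L fin_g _ _ B]) (simp_all add: fin_borel_conv fin_u fin_w factor)
  also have "\<dots> = (\<Sum>k\<le>m. emeasure ((w (m - k) \<star> g j) \<star> u k) B)"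
    by (intro sum.cong refl arg_cong2[where f = emeasure])
       (metis conv_comm conv_swap_right fin_u fin_w fin_g)
  finally show ?thesis .
qed

lemma finite_conv: "emeasure (u i \<star> w j) B \<noteq> \<infinity>"
proof -
  interpret finite_measure "u i \<star> w j" by (rule fin_borelD[OF fin_borel_conv[OF fin_u fin_w]])
  show ?thesis by simp
qed

lemma sum_split_first_last:
  fixes h :: "nat \<Rightarrow> ennreal" shows "n > 0 \<Longrightarrow> (\<Sum>k\<le>n. h k) = h 0 + h n + (\<Sum>k\<in>{1..<n}. h k)"
proof -
  assume "n > 0"
  then have "{..n} = insert 0 (insert n {1..<n})" by auto
  then show ?thesis using \<open>n > 0\<close> by (simp add: add.assoc)
qed

lemma sum_split_first:
  fixes h :: "nat \<Rightarrow> ennreal" shows "n > 0 \<Longrightarrow> (\<Sum>k<n. h k) = h 0 + (\<Sum>k\<in>{1..<n}. h k)"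
proof -
  assume "n > 0"
  then have "{..<n} = insert 0 {1..<n}" by auto
  then show ?thesis by simp
qed

text \<open>The derivative of the factorisation is taken coefficientwise. With n L_n written as the
  sum over j of L_(n-j) convolved with L_j, induction identifies all terms in which both factors
  have positive index, and they cancel. What remains is the sum of the two claims, and restriction
  to a half-line separates them. Proving both together is what feeds the induction.\<close>

theorem spitzer_identity:
  "\<forall>B\<in>sets borel. of_nat n * emeasure (u n) B = (\<Sum>j\<in>{1..n}. emeasure (u (n - j) \<star> f j) B) \<and>
     of_nat n * emeasure (w n) B = (\<Sum>j\<in>{1..n}. emeasure (w (n - j) \<star> g j) B)"
proof (induction n rule: less_induct)
  case (less n)
  show ?case
  proof (cases "n = 0")
    case True then show ?thesis by simp
  next
    case False
    then have n: "n > 0" by simp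
    let ?A = "\<lambda>B. \<Sum>j\<in>{1..n}. emeasure (u (n - j) \<star> f j) B"
    let ?A' = "\<lambda>B. \<Sum>j\<in>{1..n}. emeasure (w (n - j) \<star> g j) B"
    let ?R = "\<lambda>B. \<Sum>k\<in>{1..<n}. emeasure (u k \<star> w (n - k)) B"
    have main: "of_nat n * emeasure (u n) B + of_nat n * emeasure (w n) B = ?A B + ?A' B"
      if B: "B \<in> sets borel" for B
    proof -
      have "of_nat n * emeasure (L n) B = (\<Sum>j\<in>{1..n}. emeasure (L (n - j) \<star> L j) B)"
        by (simp add: L_add[symmetric])
      also have "\<dots> = (\<Sum>j\<in>{1..n}. \<Sum>k\<le>n - j. emeasure ((u k \<star> f j) \<star> w (n - j - k)) B)
          + (\<Sum>j\<in>{1..n}. \<Sum>k\<le>n - j. emeasure ((w (n - j - k) \<star> g j) \<star> u k) B)"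
        by (simp add: L_conv_L[OF B] sum.distrib)
      also have "(\<Sum>j\<in>{1..n}. \<Sum>k\<le>n - j. emeasure ((u k \<star> f j) \<star> w (n - j - k)) B)
         = (\<Sum>i<n. \<Sum>j\<in>{1..n - i}. emeasure ((u (n - i - j) \<star> f j) \<star> w i) B)"
        by (rule sum_triangle_reindex)
      also have "\<dots> = ?A B + (\<Sum>i\<in>{1..<n}. \<Sum>j\<in>{1..n - i}. emeasure ((u (n - i - j) \<star> f j) \<star> w i) B)"
        unfolding sum_split_first[OF n] using B by (simp add: w0 conv_return_0 fin_borel_conv fin_u fin_f)
      \<comment> \<open>For 1 \<le> i < n the inner sum is the induction hypothesis at n - i,
        convolved with \<open>w i\<close>.\<close>
      also have "(\<Sum>i\<in>{1..<n}. \<Sum>j\<in>{1..n - i}. emeasure ((u (n - i - j) \<star> f j) \<star> w i) B)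
         = (\<Sum>i\<in>{1..<n}. of_nat (n - i) * emeasure (u (n - i) \<star> w i) B)"
        by (intro sum.cong refl conv_decomp[symmetric]) (use less B in \<open>auto simp: fin_u fin_w fin_f fin_borel_conv\<close>)
      also have "\<dots> = (\<Sum>k\<in>{1..<n}. of_nat k * emeasure (u k \<star> w (n - k)) B)"
        by (rule sum.reindex_bij_witness[of _ "\<lambda>k. n - k" "\<lambda>k. n - k"]) auto
      also have "(\<Sum>j\<in>{1..n}. \<Sum>k\<le>n - j. emeasure ((w (n - j - k) \<star> g j) \<star> u k) B)
         = (\<Sum>k<n. \<Sum>j\<in>{1..n - k}. emeasure ((w (n - k - j) \<star> g j) \<star> u k) B)"
        by (rule sum_triangle_reindex')
      also have "\<dots> = ?A' B + (\<Sum>k\<in>{1..<n}. \<Sum>j\<in>{1..n - k}. emeasure ((w (n - k - j) \<star> g j) \<star> u k) B)"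
        unfolding sum_split_first[OF n] using B by (simp add: u0 conv_return_0 fin_borel_conv fin_w fin_g)
      also have "(\<Sum>k\<in>{1..<n}. \<Sum>j\<in>{1..n - k}. emeasure ((w (n - k - j) \<star> g j) \<star> u k) B)
         = (\<Sum>k\<in>{1..<n}. of_nat (n - k) * emeasure (w (n - k) \<star> u k) B)"
        by (intro sum.cong refl conv_decomp[symmetric]) (use less B in \<open>auto simp: fin_u fin_w fin_g fin_borel_conv\<close>)
      also have "\<dots> = (\<Sum>k\<in>{1..<n}. of_nat (n - k) * emeasure (u k \<star> w (n - k)) B)"
        by (simp add: conv_comm[OF fin_w fin_u])
      also have "?A B + (\<Sum>k\<in>{1..<n}. of_nat k * emeasure (u k \<star> w (n - k)) B) +
            (?A' B + (\<Sum>k\<in>{1..<n}. of_nat (n - k) * emeasure (u k \<star> w (n - k)) B))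
         = ?A B + ?A' B + (\<Sum>k\<in>{1..<n}. (of_nat k + of_nat (n - k)) * emeasure (u k \<star> w (n - k)) B)"
        by (simp add: distrib_right sum.distrib add_ac)
      also have "(\<Sum>k\<in>{1..<n}. (of_nat k + of_nat (n - k)) * emeasure (u k \<star> w (n - k)) B)
         = of_nat n * ?R B"
        unfolding sum_distrib_left by (intro sum.cong refl) (simp add: of_nat_add[symmetric] del: of_nat_add)
      finally have 1: "of_nat n * emeasure (L n) B = ?A B + ?A' B + of_nat n * ?R B" .
      have "emeasure (L n) B = emeasure (u 0 \<star> w n) B + emeasure (u n \<star> w 0) B + ?R B"
        using factor[OF B, of n] sum_split_first_last[OF n, of "\<lambda>k. emeasure (u k \<star> w (n - k)) B"] by simp
      also have "emeasure (u 0 \<star> w n) B = emeasure (w n) B"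
        using conv_return_0[OF fin_w B, of n] conv_comm[OF fin_u fin_w, of 0 n] by (simp add: u0)
      also have "emeasure (u n \<star> w 0) B = emeasure (u n) B"
        using conv_return_0[OF fin_u B, of n] by (simp add: w0)
      finally have 2: "of_nat n * emeasure (L n) B = of_nat n * emeasure (u n) B + of_nat n * emeasure (w n) B + of_nat n * ?R B"
        by (simp add: distrib_left add_ac)
      \<comment> \<open>Cancellation in \<open>ennreal\<close> needs the common summand to be
        finite.\<close>
      have "of_nat n * ?R B \<noteq> \<infinity>" using finite_conv by (simp add: ennreal_mult_eq_top_iff)
      moreover have "of_nat n * ?R B + (of_nat n * emeasure (u n) B + of_nat n * emeasure (w n) B) = of_nat n * ?R B + (?A B + ?A' B)"
        using 1 2 by (simp add: add.commute)
      ultimately show ?thesis by (simp only: ennreal_add_left_cancel) simp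
    qed
    have c1: "- {0<..} = {..0::real}" and c2: "- {..0} = {0<..(0::real)} \<union> {0<..}" by auto
    then have c2: "- {..0} = {0<..(0::real)} \<union> {0<..}" and c2': "- {..0::real} = {0<..}" by auto
    show ?thesis
    proof (intro ballI conjI)
      fix B :: "real set" assume B: "B \<in> sets borel"
      \<comment> \<open>On the positive half-line \<open>w n\<close> and all its companion terms
        vanish, which leaves the claim for \<open>u\<close>. The other half-line is used for
        \<open>w\<close> below.\<close>
      let ?B = "B \<inter> {0<..}"
      have B': "?B \<in> sets borel" using B by auto
      have "emeasure (w n) ?B \<le> emeasure (w n) {0<..}"
        using fin_borelD(2)[OF fin_w[of n]] by (intro emeasure_mono) auto
      then have w: "emeasure (w n) ?B = 0" using w_nonpos by simp
      have A': "emeasure (w (n - j) \<star> g j) ?B = 0" for j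
      proof -
        have "emeasure (w (n - j) \<star> g j) ?B \<le> emeasure (w (n - j) \<star> g j) {0<..}" by (intro emeasure_mono) auto
        then show ?thesis using wg_null by simp
      qed
      have "of_nat n * emeasure (u n) B = of_nat n * emeasure (u n) ?B"
        by (subst emeasure_restrict_support) (use u_supp[OF n] B fin_u c1 in auto)
      also have "\<dots> = ?A ?B" using main[OF B'] w A' by simp
      also have "\<dots> = ?A B"
        by (intro sum.cong refl emeasure_restrict_support fin_borel_conv fin_u fin_f) (use uf_null B c1 in auto)
      finally show "of_nat n * emeasure (u n) B = ?A B" .
    next
      fix B :: "real set" assume B: "B \<in> sets borel"
      let ?B = "B \<inter> {..0}"
      have B': "?B \<in> sets borel" using B by auto
      have "emeasure (u n) ?B \<le> emeasure (u n) {..0}"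
        using fin_borelD(2)[OF fin_u[of n]] by (intro emeasure_mono) auto
      then have u: "emeasure (u n) ?B = 0" using u_supp[OF n] by simp
      have A: "emeasure (u (n - j) \<star> f j) ?B = 0" for j
      proof -
        have "emeasure (u (n - j) \<star> f j) ?B \<le> emeasure (u (n - j) \<star> f j) {..0}" by (intro emeasure_mono) auto
        then show ?thesis using uf_null by simp
      qed
      have "of_nat n * emeasure (w n) B = of_nat n * emeasure (w n) ?B"
        by (subst emeasure_restrict_support) (use w_nonpos B fin_w c2' in auto)
      also have "\<dots> = ?A' ?B" using main[OF B'] u A by simp
      also have "\<dots> = ?A' B"
        by (intro sum.cong refl emeasure_restrict_support fin_borel_conv fin_w fin_g) (use wg_null B c2' in auto)
      finally show "of_nat n * emeasure (w n) B = ?A' B" .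
    qed
  qed
qed

end

section \<open>The first ladder height\<close>

context walk_law
begin

lemma nn_integral_sum_law_add:
  assumes [measurable]: "f \<in> borel_measurable borel"
  shows "(\<integral>\<^sup>+s. f s \<partial>sum_law (i + j)) = (\<integral>\<^sup>+s. \<integral>\<^sup>+t. f (s + t) \<partial>sum_law j \<partial>sum_law i)"
proof -
  interpret j: prob_space "sum_law j" by (rule prob_space_sum_law)
  have "(\<integral>\<^sup>+s. f s \<partial>sum_law (i + j)) = (\<integral>\<^sup>+x. f (psum (i + j) x) \<partial>Q)"
    by (rule nn_integral_sum_law) measurable
  also have "\<dots> = (\<integral>\<^sup>+x. \<integral>\<^sup>+y. f (psum (i + j) (comb_seq i x y)) \<partial>Q \<partial>Q)"
    by (rule nn_integral_split) measurable
  also have "\<dots> = (\<integral>\<^sup>+x. \<integral>\<^sup>+y. f (psum i x + psum j y) \<partial>Q \<partial>Q)"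
    by (simp add: psum_comb_seq_add)
  also have "\<dots> = (\<integral>\<^sup>+x. \<integral>\<^sup>+t. f (psum i x + t) \<partial>sum_law j \<partial>Q)"
    by (simp add: nn_integral_sum_law)
  also have "\<dots> = (\<integral>\<^sup>+s. \<integral>\<^sup>+t. f (s + t) \<partial>sum_law j \<partial>sum_law i)"
    by (rule nn_integral_sum_law[symmetric]) measurable
  finally show ?thesis .
qed

lemma fin_borel_laws: "fin_borel (sum_law n)" "fin_borel (ladder_law n)" "fin_borel (nonpos_law n)"
  by (auto simp: fin_borel_def finite_sum_law finite_ladder_law finite_nonpos_law)

lemma sum_law_add: "sum_law (i + j) = (sum_law i \<star> sum_law j)"
proof (rule measure_eqI)
  fix B assume "B \<in> sets (sum_law (i + j))"
  then have [measurable]: "B \<in> sets borel" by simp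
  have "emeasure (sum_law (i + j)) B = (\<integral>\<^sup>+s. indicator B s \<partial>sum_law (i + j))"
    by (rule nn_integral_indicator[symmetric]) simp
  also have "\<dots> = (\<integral>\<^sup>+s. \<integral>\<^sup>+t. indicator B (s + t) \<partial>sum_law j \<partial>sum_law i)"
    by (rule nn_integral_sum_law_add) simp
  also have "\<dots> = emeasure (sum_law i \<star> sum_law j) B"
    by (rule convolution_emeasure'[symmetric]) (auto simp: finite_sum_law)
  finally show "emeasure (sum_law (i + j)) B = emeasure (sum_law i \<star> sum_law j) B" .
qed simp

lemma law_0: "ladder_law 0 = return borel 0" "nonpos_law 0 = return borel 0" "sum_law 0 = return borel 0"
proof -
  have e: "emeasure Q {x. (0::real) \<in> B} = indicator B 0" for B :: "real set"
    by (cases "0 \<in> B") auto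
  show "ladder_law 0 = return borel 0"
    by (rule measure_eqI) (simp_all add: emeasure_ladder_law e)
  show "nonpos_law 0 = return borel 0"
    by (rule measure_eqI) (simp_all add: emeasure_nonpos_law e)
  show "sum_law 0 = return borel 0"
    by (rule measure_eqI) (simp_all add: emeasure_sum_law e)
qed

lemma ladder_psum_pos: "ladder n x \<Longrightarrow> n > 0 \<Longrightarrow> psum n x > 0"
  unfolding ladder_def by force

lemma ladder_law_atMost_0: 
  assumes "n > 0" shows "emeasure (ladder_law n) {..0} = 0"
proof -
  have eq: "{x. ladder n x \<and> psum n x \<in> {..0}} = {}"
    using assms ladder_psum_pos by force
  have "emeasure (ladder_law n) {..0} = emeasure Q {x. ladder n x \<and> psum n x \<in> {..0}}"
    by (rule emeasure_ladder_law) simp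
  then show ?thesis unfolding eq by simp
qed

lemma nonpos_law_greaterThan_0: 
  assumes "n > 0" shows "emeasure (nonpos_law n) {0<..} = 0"
proof -
  have eq: "{x. stays_nonpos n x \<and> psum n x \<in> {0<..}} = {}"
  proof -
    have "psum n x \<le> 0" if "stays_nonpos n x" for x
      using that assms unfolding stays_nonpos_def by simp
    then show ?thesis by fastforce
  qed
  have "emeasure (nonpos_law n) {0<..} = emeasure Q {x. stays_nonpos n x \<and> psum n x \<in> {0<..}}"
    by (rule emeasure_nonpos_law) simp
  then show ?thesis unfolding eq by simp
qed

sublocale WH: wiener_hopf sum_law ladder_law nonpos_law
  by unfold_locales
     (simp_all add: fin_borel_laws sum_law_add emeasure_sum_law_decomposition law_0 ladder_law_atMost_0 nonpos_law_greaterThan_0)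

lemma of_nat_mult_ladder_law:
  assumes B: "B \<in> sets borel"
  shows "of_nat n * emeasure (ladder_law n) B
    = (\<Sum>j<n. \<integral>\<^sup>+y. emeasure (sum_law (n - j)) ({s. y + s \<in> B} \<inter> {0<..}) \<partial>ladder_law j)"
proof -
  have "of_nat n * emeasure (ladder_law n) B = (\<Sum>j\<in>{1..n}. emeasure (ladder_law (n - j) \<star> WH.f j) B)"
    using WH.spitzer_identity B by blast
  also have "\<dots> = (\<Sum>j<n. emeasure (ladder_law j \<star> WH.f (n - j)) B)"
    by (rule sum.reindex_bij_witness[of _ "\<lambda>j. n - j" "\<lambda>j. n - j"]) auto
  also have "\<dots> = (\<Sum>j<n. \<integral>\<^sup>+y. emeasure (sum_law (n - j)) ({s. y + s \<in> B} \<inter> {0<..}) \<partial>ladder_law j)"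
  proof (intro sum.cong refl)
    fix j
    have "emeasure (ladder_law j \<star> WH.f (n - j)) B = (\<integral>\<^sup>+y. emeasure (WH.f (n - j)) {s. s + y \<in> B} \<partial>ladder_law j)"
      unfolding conv_comm[OF fin_borel_laws(2) WH.fin_f] by (rule emeasure_conv[OF WH.fin_f fin_borel_laws(2) B])
    also have "\<dots> = (\<integral>\<^sup>+y. emeasure (sum_law (n - j)) ({s. s + y \<in> B} \<inter> {0<..}) \<partial>ladder_law j)"
      using B by (intro nn_integral_cong WH.emeasure_f sets_translate)
    finally show "emeasure (ladder_law j \<star> WH.f (n - j)) B = (\<integral>\<^sup>+y. emeasure (sum_law (n - j)) ({s. y + s \<in> B} \<inter> {0<..}) \<partial>ladder_law j)"
      by (simp add: add.commute)
  qed
  finally show ?thesis .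
qed

section \<open>The renewal equation at the first positive sum\<close>

definition first_pos :: "nat \<Rightarrow> (nat \<Rightarrow> real) \<Rightarrow> bool" where
  "first_pos k x \<longleftrightarrow> (\<forall>i<k. psum i x \<le> 0) \<and> psum k x > 0"

text \<open>On a path that never becomes positive \<open>LEAST\<close> is an unspecified index;
  under the hypothesis of \<open>AE_exists_pos\<close> such paths form a null set.\<close>

definition height :: "(nat \<Rightarrow> real) \<Rightarrow> real" where
  "height x = psum (LEAST k. psum k x > 0) x"

lemma first_pos_measurable [measurable]: "Measurable.pred seq_borel (first_pos k)"
  unfolding first_pos_def not_less[symmetric] by measurable

lemma height_measurable [measurable]: "height \<in> borel_measurable seq_borel"
  unfolding height_def[abs_def] by measurable

lemma first_pos_comb_seq: "first_pos k (comb_seq k x y) \<longleftrightarrow> first_pos k x"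
  by (simp add: first_pos_def psum_comb_seq_le)

lemma first_pos_unique: "first_pos k x \<Longrightarrow> first_pos l x \<Longrightarrow> k = l"
  unfolding first_pos_def by (meson linorder_neqE_nat not_less)

lemma first_pos_Least: "first_pos k x \<Longrightarrow> (LEAST k. psum k x > 0) = k"
  unfolding first_pos_def by (intro Least_equality) (auto simp: not_less[symmetric])

lemma first_pos_exists:
  assumes "psum n x > 0" shows "\<exists>k\<le>n. first_pos k x"
proof (intro exI conjI)
  let ?k = "LEAST k. psum k x > 0"
  show "?k \<le> n" using assms by (rule Least_le)
  have "psum ?k x > 0" using assms by (rule LeastI)
  moreover have "psum i x \<le> 0" if "i < ?k" for i
    using not_less_Least[OF that] by simp
  ultimately show "first_pos ?k x" unfolding first_pos_def by blast
qed

lemma suminf_first_pos: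
  assumes "\<exists>k. psum k x > 0"
  shows "(\<Sum>k. of_bool (first_pos k x) * f (psum k x)) = (f (height x) :: ennreal)"
proof -
  obtain k where k: "first_pos k x" using assms first_pos_exists by blast
  then have "first_pos j x \<longleftrightarrow> j = k" for j using first_pos_unique by blast
  then have "(\<Sum>j. of_bool (first_pos j x) * f (psum j x)) = (\<Sum>j\<in>{k}. of_bool (first_pos j x) * f (psum j x))"
    by (intro suminf_finite) auto
  also have "\<dots> = f (height x)" using k by (simp add: height_def first_pos_Least)
  finally show ?thesis .
qed

text \<open>Sums before the first positive one are at most 0, hence below every later sum reached by
  a ladder path; only the remaining walk decides.\<close>

lemma ladder_first_pos_comb_seq:
  assumes "k \<le> n" "first_pos k x"
  shows "ladder n (comb_seq k x y) \<longleftrightarrow> ladder (n - k) y"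
proof
  assume l: "ladder (n - k) y"
  show "ladder n (comb_seq k x y)" unfolding ladder_def
  proof (intro allI impI)
    fix i assume i: "i < n"
    have eq: "psum n (comb_seq k x y) = psum k x + psum (n - k) y" using assms by (simp add: psum_comb_seq_ge)
    show "psum i (comb_seq k x y) < psum n (comb_seq k x y)"
    proof (cases "i < k")
      case True
      then show ?thesis using assms ladder_psum_nonneg[OF l] unfolding eq
        by (auto simp: psum_comb_seq_le first_pos_def add_strict_increasing intro: le_less_trans)
    next
      case False
      then have "psum (i - k) y < psum (n - k) y" using l i assms(1) unfolding ladder_def by auto
      then show ?thesis unfolding eq using False by (simp add: psum_comb_seq_ge)
    qed
  qed
qed (use assms ladder_comb_seq_ge in blast)

lemma ladder_law_first_pos:
  assumes "n > 0"
  shows "emeasure (ladder_law n) {..<u} = (\<Sum>k\<le>n. \<integral>\<^sup>+x. of_bool (first_pos k x) * emeasure (ladder_law (n - k)) {..<u - psum k x} \<partial>Q)"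
proof -
  have pt: "of_bool (ladder n x \<and> psum n x \<in> {..<u}) = (\<Sum>k\<le>n. of_bool (first_pos k x \<and> ladder n x \<and> psum n x < u) :: ennreal)" for x
  proof (cases "ladder n x \<and> psum n x < u")
    case True
    obtain k where k: "k \<le> n" "first_pos k x"
      using first_pos_exists ladder_psum_pos assms True by blast
    then have "first_pos j x \<longleftrightarrow> j = k" for j using first_pos_unique by blast
    then have "(\<Sum>k\<le>n. of_bool (first_pos k x \<and> ladder n x \<and> psum n x < u)) = (\<Sum>j\<le>n. if j = k then 1 else (0::ennreal))"
      using True by (intro sum.cong) auto
    then show ?thesis using k True by simp
  qed auto
  have "emeasure (ladder_law n) {..<u} = (\<integral>\<^sup>+x. of_bool (ladder n x \<and> psum n x \<in> {..<u}) \<partial>Q)"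
    by (subst emeasure_ladder_law, simp) (rule emeasure_eq_integral_of_bool, measurable)
  also have "\<dots> = (\<Sum>k\<le>n. \<integral>\<^sup>+x. of_bool (first_pos k x \<and> ladder n x \<and> psum n x < u) \<partial>Q)"
    unfolding pt by (rule nn_integral_sum) measurable
  also have "\<dots> = (\<Sum>k\<le>n. \<integral>\<^sup>+x. of_bool (first_pos k x) * emeasure (ladder_law (n - k)) {..<u - psum k x} \<partial>Q)"
  proof (intro sum.cong refl)
    fix k assume "k \<in> {..n}"
    then have k: "k \<le> n" by simp
    have "(\<integral>\<^sup>+x. of_bool (first_pos k x \<and> ladder n x \<and> psum n x < u) \<partial>Q)
      = (\<integral>\<^sup>+x. \<integral>\<^sup>+y. of_bool (first_pos k (comb_seq k x y) \<and> ladder n (comb_seq k x y) \<and> psum n (comb_seq k x y) < u) \<partial>Q \<partial>Q)"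
      by (rule nn_integral_split) measurable
    also have "\<dots> = (\<integral>\<^sup>+x. \<integral>\<^sup>+y. of_bool (first_pos k x) * of_bool (ladder (n - k) y \<and> psum (n - k) y \<in> {..<u - psum k x}) \<partial>Q \<partial>Q)"
      by (intro nn_integral_cong) (auto simp: first_pos_comb_seq ladder_first_pos_comb_seq[OF k] psum_comb_seq_ge[OF k])
    also have "\<dots> = (\<integral>\<^sup>+x. of_bool (first_pos k x) * (\<integral>\<^sup>+y. of_bool (ladder (n - k) y \<and> psum (n - k) y \<in> {..<u - psum k x}) \<partial>Q) \<partial>Q)"
      by (intro nn_integral_cong nn_integral_cmult) measurable
    also have "\<dots> = (\<integral>\<^sup>+x. of_bool (first_pos k x) * emeasure (ladder_law (n - k)) {..<u - psum k x} \<partial>Q)"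
      by (intro nn_integral_cong arg_cong2[where f = times] refl, subst emeasure_ladder_law, simp)
         (rule emeasure_eq_integral_of_bool[symmetric], measurable)
    finally show "(\<integral>\<^sup>+x. of_bool (first_pos k x \<and> ladder n x \<and> psum n x < u) \<partial>Q)
      = (\<integral>\<^sup>+x. of_bool (first_pos k x) * emeasure (ladder_law (n - k)) {..<u - psum k x} \<partial>Q)" .
  qed
  finally show ?thesis .
qed

text \<open>Decomposition at the first ladder epoch, summed over n: a Cauchy product of the time of
  that epoch with the ladder laws of the remaining walk.\<close>

lemma renewal_equation_Q:
  assumes ae: "AE x in Q. \<exists>k. psum k x > 0"
  shows "renewal u = of_bool (u > 0) + (\<integral>\<^sup>+x. renewal (u - height x) \<partial>Q)"
proof -
  let ?a = "\<lambda>k m. \<integral>\<^sup>+x. of_bool (first_pos k x) * emeasure (ladder_law m) {..<u - psum k x} \<partial>Q"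
  have [measurable]: "(\<lambda>x. emeasure (ladder_law m) {..<u - psum k x}) \<in> borel_measurable seq_borel" for m k
    by (rule measurable_compose[OF _ borel_measurable_ladder_cdf]) measurable
  have [measurable]: "(\<lambda>x. renewal (u - psum k x)) \<in> borel_measurable seq_borel" for k
    by (rule measurable_compose[OF _ borel_measurable_renewal]) measurable
  have "(\<integral>\<^sup>+x. renewal (u - height x) \<partial>Q) = (\<integral>\<^sup>+x. (\<Sum>k. of_bool (first_pos k x) * renewal (u - psum k x)) \<partial>Q)"
    by (rule nn_integral_cong_AE, use ae in eventually_elim) (simp add: suminf_first_pos[where f = "\<lambda>s. renewal (u - s)"])
  also have "\<dots> = (\<Sum>k. \<integral>\<^sup>+x. of_bool (first_pos k x) * renewal (u - psum k x) \<partial>Q)"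
    by (rule nn_integral_suminf) measurable
  also have "\<dots> = (\<Sum>k. \<integral>\<^sup>+x. (\<Sum>m. of_bool (first_pos k x) * emeasure (ladder_law m) {..<u - psum k x}) \<partial>Q)"
    by (simp add: renewal_def)
  also have "\<dots> = (\<Sum>k. \<Sum>m. ?a k m)"
    by (intro suminf_cong nn_integral_suminf) measurable
  also have "\<dots> = (\<Sum>n. \<Sum>k\<le>n. ?a k (n - k))"
    by (rule Cauchy_product_ennreal[symmetric])
  also have "\<dots> = (\<Sum>n. emeasure (ladder_law (Suc n)) {..<u})"
  proof -
    let ?b = "\<lambda>n. \<Sum>k\<le>n. ?a k (n - k)"
    \<comment> \<open>The sum at time 0 is 0, hence not positive, so the epoch n = 0 contributes
      only the separate unit term.\<close>
    have "?b 0 = 0" by (simp add: first_pos_def)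
    then have "(\<Sum>n. ?b n) = (\<Sum>n. ?b (Suc n))"
      using suminf_offset[of ?b 1] by simp
    also have "\<dots> = (\<Sum>n. emeasure (ladder_law (Suc n)) {..<u})"
      by (rule suminf_cong, rule ladder_law_first_pos[symmetric]) simp
    finally show ?thesis .
  qed
  finally have 1: "(\<integral>\<^sup>+x. renewal (u - height x) \<partial>Q) = (\<Sum>n. emeasure (ladder_law (Suc n)) {..<u})" .
  have "renewal u = emeasure (ladder_law 0) {..<u} + (\<Sum>n. emeasure (ladder_law (Suc n)) {..<u})"
    unfolding renewal_def using suminf_offset[of "\<lambda>n. emeasure (ladder_law n) {..<u}" 1] by (simp add: add.commute)
  then show ?thesis unfolding 1 ladder_law_0 .
qed

end

lemma suminf_ennreal_finite_tendsto_0: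
  fixes f :: "nat \<Rightarrow> ennreal"
  assumes "(\<Sum>n. f n) < \<infinity>" shows "f \<longlonglongrightarrow> 0"
proof -
  have fin: "f n < \<infinity>" for n
    using ennreal_suminf_lessD[OF assms] .
  have eq: "f n = ennreal (enn2real (f n))" for n using fin[of n] by (simp add: less_top[symmetric])
  have "(\<Sum>n. ennreal (enn2real (f n))) \<noteq> top" using assms eq by simp
  then have "summable (\<lambda>n. enn2real (f n))" by (intro summable_suminf_not_top) auto
  then have "(\<lambda>n. enn2real (f n)) \<longlonglongrightarrow> 0" by (rule summable_LIMSEQ_zero)
  then have "(\<lambda>n. ennreal (enn2real (f n))) \<longlonglongrightarrow> ennreal 0" by (rule tendsto_ennrealI)
  then show ?thesis using eq by simp
qed

section \<open>Reaching positive values, and the renewal series in ladder heights\<close>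

context walk_law
begin

text \<open>The first time at which the walk exceeds z is a strict ladder epoch.\<close>

lemma emeasure_sum_law_greaterThan_le:
  "emeasure (sum_law n) {z<..} \<le> (\<Sum>k\<le>n. emeasure (ladder_law k) {z<..})"
proof -
  have pt: "of_bool (psum n x \<in> {z<..}) \<le> (\<Sum>k\<le>n. of_bool (ladder k x \<and> psum k x \<in> {z<..}) :: ennreal)" for x
  proof (cases "psum n x > z")
    case True
    obtain k where k: "k \<le> n" "psum k x > z" "ladder k x"
    proof
      let ?k = "LEAST k. psum k x > z"
      show "?k \<le> n" using True by (rule Least_le)
      show 2: "psum ?k x > z" using True by (rule LeastI)
      have "psum i x \<le> z" if "i < ?k" for i
        using not_less_Least[OF that] by simp
      then show "ladder ?k x" using 2 unfolding ladder_def by (meson le_less_trans)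
    qed
    have "of_bool (psum n x \<in> {z<..}) = (of_bool (ladder k x \<and> psum k x \<in> {z<..}) :: ennreal)"
      using True k by simp
    also have "\<dots> \<le> (\<Sum>k\<le>n. of_bool (ladder k x \<and> psum k x \<in> {z<..}))"
      using k by (intro member_le_sum) auto
    finally show ?thesis .
  qed auto
  have "emeasure (sum_law n) {z<..} = (\<integral>\<^sup>+x. of_bool (psum n x \<in> {z<..}) \<partial>Q)"
    by (subst emeasure_sum_law, simp) (rule emeasure_eq_integral_of_bool, measurable)
  also have "\<dots> \<le> (\<integral>\<^sup>+x. (\<Sum>k\<le>n. of_bool (ladder k x \<and> psum k x \<in> {z<..})) \<partial>Q)"
    by (intro nn_integral_mono pt)
  also have "\<dots> = (\<Sum>k\<le>n. \<integral>\<^sup>+x. of_bool (ladder k x \<and> psum k x \<in> {z<..}) \<partial>Q)"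
    by (rule nn_integral_sum) measurable
  also have "\<dots> = (\<Sum>k\<le>n. emeasure (ladder_law k) {z<..})"
    by (intro sum.cong refl, subst emeasure_ladder_law, simp) (rule emeasure_eq_integral_of_bool[symmetric], measurable)
  finally show ?thesis .
qed

lemma emeasure_ladder_law_tail:
  assumes "filterlim r at_top sequentially"
  shows "(\<lambda>i. emeasure (ladder_law k) {r i<..}) \<longlonglongrightarrow> 0"
proof -
  interpret u: finite_borel_measure "ladder_law k"
    by (intro finite_borel_measure.intro finite_borel_measure_axioms.intro finite_ladder_law) simp
  have "((\<lambda>z. cdf (ladder_law k) z) \<longlongrightarrow> measure (ladder_law k) (space (ladder_law k))) at_top"
    by (rule u.cdf_lim_at_top)
  then have "(\<lambda>i. cdf (ladder_law k) (r i)) \<longlonglongrightarrow> measure (ladder_law k) (space (ladder_law k))"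
    by (rule filterlim_compose[OF _ assms])
  then have "(\<lambda>i. measure (ladder_law k) (space (ladder_law k)) - cdf (ladder_law k) (r i)) \<longlonglongrightarrow> 0"
    by (auto intro: tendsto_eq_intros)
  moreover have "measure (ladder_law k) (space (ladder_law k)) - cdf (ladder_law k) z = measure (ladder_law k) {z<..}" for z
  proof -
    have "space (ladder_law k) - {..z} = {z<..}" by auto
    then show ?thesis unfolding cdf_def by (subst u.finite_measure_compl[symmetric]) auto
  qed
  ultimately have "(\<lambda>i. measure (ladder_law k) {r i<..}) \<longlonglongrightarrow> 0" by simp
  then have "(\<lambda>i. ennreal (measure (ladder_law k) {r i<..})) \<longlonglongrightarrow> ennreal 0" by (rule tendsto_ennrealI)
  then show ?thesis by (simp add: u.emeasure_eq_measure)
qed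

text \<open>If the walk stayed nonpositive forever with positive probability, the ladder epochs would form a
  transient renewal process, and the maximum of the walk would be finite.\<close>

lemma nonpos_law_tendsto_0:
  assumes r: "filterlim r at_top sequentially" and "\<epsilon> > 0"
    and ev: "\<forall>\<^sub>F n in sequentially. emeasure (sum_law n) {r n<..} \<ge> \<epsilon>"
  shows "(\<lambda>n. emeasure (nonpos_law n) UNIV) \<longlonglongrightarrow> 0"
proof (rule ccontr)
  let ?w = "\<lambda>n. emeasure (nonpos_law n) UNIV" and ?u = "\<lambda>n. emeasure (ladder_law n) UNIV"
  assume "\<not> ?w \<longlonglongrightarrow> 0"
  moreover have "?w \<longlonglongrightarrow> (INF n. ?w n)"
    by (rule LIMSEQ_INF) (auto simp: decseq_def nonpos_law_UNIV_antimono)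
  ultimately have p: "(INF n. ?w n) > 0" by (metis not_gr_zero)
  let ?p = "INF n. ?w n"
  have "?p * (\<Sum>k<m. ?u k) \<le> 1" for m
  proof -
    have "?p * (\<Sum>k<m. ?u k) \<le> ?w m * (\<Sum>k\<le>m. ?u k)"
      by (intro mult_mono sum_mono2 INF_lower) auto
    also have "\<dots> \<le> 1" by (rule nonpos_mult_sum_ladder_le)
    finally show ?thesis .
  qed
  then have "(\<Sum>k<m. ?p * ?u k) \<le> 1" for m by (simp add: sum_distrib_left)
  then have "(\<Sum>k. ?p * ?u k) \<le> 1" by (intro suminf_le_const) auto
  then have "?p * (\<Sum>k. ?u k) \<le> 1" by simp
  then have fin: "(\<Sum>k. ?u k) < \<infinity>"
    using p by (auto simp: less_top[symmetric] ennreal_mult_eq_top_iff top_unique)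
  \<comment> \<open>Summable ladder masses permit dominated convergence over k, so the tails beyond
    r i vanish jointly. Their sum bounds P(S_i > r i) from above, which is at least \<epsilon>
    eventually.\<close>
  have "(\<lambda>i. \<integral>\<^sup>+k. emeasure (ladder_law k) {r i<..} \<partial>count_space UNIV) \<longlonglongrightarrow> (\<integral>\<^sup>+k. 0 \<partial>count_space (UNIV :: nat set))"
  proof (rule nn_integral_dominated_convergence[where w = ?u])
    show "(\<integral>\<^sup>+k. ?u k \<partial>count_space UNIV) < \<infinity>" using fin by (simp add: nn_integral_count_space_nat)
    show "AE k in count_space UNIV. emeasure (ladder_law k) {r i<..} \<le> ?u k" for i
      by (intro AE_I2 emeasure_mono) auto
    show "AE k in count_space UNIV. (\<lambda>i. emeasure (ladder_law k) {r i<..}) \<longlonglongrightarrow> 0"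
      by (intro AE_I2 emeasure_ladder_law_tail r)
  qed auto
  then have T: "(\<lambda>i. \<Sum>k. emeasure (ladder_law k) {r i<..}) \<longlonglongrightarrow> 0"
    by (simp add: nn_integral_count_space_nat)
  have "\<forall>\<^sub>F i in sequentially. \<epsilon> \<le> (\<Sum>k. emeasure (ladder_law k) {r i<..})"
    using ev
  proof eventually_elim
    case (elim i)
    note elim
    also have "emeasure (sum_law i) {r i<..} \<le> (\<Sum>k\<le>i. emeasure (ladder_law k) {r i<..})"
      by (rule emeasure_sum_law_greaterThan_le)
    also have "\<dots> \<le> (\<Sum>k. emeasure (ladder_law k) {r i<..})"
      by (rule sum_le_suminf) auto
    finally show ?case .
  qed
  then have "\<epsilon> \<le> 0" by (rule tendsto_lowerbound[OF T]) simp
  then show False using \<open>\<epsilon> > 0\<close> by simp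
qed

lemma AE_exists_pos:
  assumes "(\<lambda>n. emeasure (nonpos_law n) UNIV) \<longlonglongrightarrow> 0"
  shows "AE x in Q. \<exists>k. psum k x > 0"
proof (rule AE_I')
  have m: "{x. \<not> (\<exists>k. psum k x > 0)} \<in> sets Q" by (rule sets_Q_Collect) measurable
  have le: "emeasure Q {x. \<not> (\<exists>k. psum k x > 0)} \<le> emeasure (nonpos_law n) UNIV" for n
    unfolding nonpos_law_UNIV by (intro emeasure_mono sets_Q_Collect) (auto simp: stays_nonpos_def not_less)
  have "emeasure Q {x. \<not> (\<exists>k. psum k x > 0)} \<le> 0"
    by (rule tendsto_lowerbound[OF assms always_eventually]) (use le in blast, simp)
  then show "{x. \<not> (\<exists>k. psum k x > 0)} \<in> null_sets Q" using m by (simp add: null_sets_def)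
  show "{x \<in> space Q. \<not> (\<exists>k. 0 < psum k x)} \<subseteq> {x. \<not> (\<exists>k. 0 < psum k x)}" by auto
qed

lemma sum_law_1: "sum_law (Suc 0) = F"
proof -
  have "sum_law (Suc 0) = distr Q F (\<lambda>x. x 0)"
    unfolding sum_law_def by (intro distr_cong) (auto simp: psum_def)
  also have "\<dots> = F"
    by (rule distr_PiM_component) (simp_all add: prob_space_F)
  finally show ?thesis .
qed

text \<open>The renewal function is defined with coordinates 1 to k + 1, the coordinate walk with 0
  to k; reindexing of the product measure connects them.\<close>

lemma prob_PiM_sum_less:
  "measure (PiM {1..Suc k} (\<lambda>_. F)) {y \<in> space (PiM {1..Suc k} (\<lambda>_. F)). (\<Sum>i = 1..Suc k. y i) < u} = measure (sum_law (Suc k)) {..<u}"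
proof -
  let ?P = "PiM {1..Suc k} (\<lambda>_. F)" and ?g = "\<lambda>\<omega>. \<lambda>i\<in>{1..Suc k}. \<omega> (i - 1)"
  have d: "distr Q ?P ?g = ?P"
    by (rule distr_PiM_reindex) (auto simp: inj_on_def prob_space_F)
  have [measurable_cong]: "sets ?P = sets (PiM {1..Suc k} (\<lambda>_. borel))" by (rule sets_PiM_cong) auto
  have g: "?g \<in> measurable Q ?P" by measurable
  have "measure ?P {y \<in> space ?P. (\<Sum>i = 1..Suc k. y i) < u} = measure (distr Q ?P ?g) {y \<in> space ?P. (\<Sum>i = 1..Suc k. y i) < u}"
    by (simp only: d)
  also have "\<dots> = measure Q (?g -` {y \<in> space ?P. (\<Sum>i = 1..Suc k. y i) < u} \<inter> space Q)"
    by (rule measure_distr[OF g]) measurable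
  also have "?g -` {y \<in> space ?P. (\<Sum>i = 1..Suc k. y i) < u} \<inter> space Q = {x. psum (Suc k) x \<in> {..<u}}"
  proof -
    have "(\<Sum>i = 1..Suc k. ?g x i) = psum (Suc k) x" for x
      unfolding psum_def
      by (rule sum.reindex_bij_witness[of _ Suc "\<lambda>i. i - 1"]) auto
    moreover have "?g x \<in> space ?P" for x by (auto simp: space_PiM)
    ultimately show ?thesis by auto
  qed
  also have "measure Q \<dots> = measure (sum_law (Suc k)) {..<u}"
    by (simp only: measure_def emeasure_sum_law lessThan_iff sets_lborel lessThan_borel)
  finally show ?thesis .
qed

definition height_law :: "real measure" where
  "height_law = distr Q borel height"

lemma real_distribution_height: "real_distribution height_law"
  unfolding height_law_def
  by (intro real_distribution.intro prob_space_distr real_distribution_axioms.intro) auto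

lemma nn_integral_height_law:
  assumes [measurable]: "f \<in> borel_measurable borel"
  shows "(\<integral>\<^sup>+s. f s \<partial>height_law) = (\<integral>\<^sup>+x. f (height x) \<partial>Q)"
  unfolding height_law_def by (subst nn_integral_distr) auto

text \<open>After R iterations of the renewal equation the remainder is the mean of the renewal
  function at u minus a sum of R ladder heights. As heights are nonnegative it is at most H(u) times
  the probability that this sum is below u, and these probabilities are summable because the partial
  series never exceeds the finite H(u).\<close>

lemma renewal_eq_suminf:
  assumes ae: "AE x in Q. \<exists>k. psum k x > 0" and fin: "renewal u < \<infinity>"
  shows "renewal u = (\<Sum>r. emeasure (walk_law.sum_law height_law r) {..<u})"
proof -
  interpret N: walk_law height_law by (intro walk_law.intro real_distribution_height)
  have eqn: "renewal u = of_bool (u > 0) + (\<integral>\<^sup>+s. renewal (u - s) \<partial>height_law)" for u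
    using renewal_equation_Q[OF ae, of u]
    by (subst nn_integral_height_law) auto
  have m: "(\<lambda>s. renewal (u - s)) \<in> borel_measurable borel" by measurable
  have it: "renewal u = (\<Sum>r<R. emeasure (N.sum_law r) {..<u}) + (\<integral>\<^sup>+s. renewal (u - s) \<partial>N.sum_law R)" for R
  proof (induction R)
    case 0
    show ?case by (simp add: N.law_0 nn_integral_return)
  next
    case (Suc R)
    have "(\<integral>\<^sup>+s. renewal (u - s) \<partial>N.sum_law R)
      = (\<integral>\<^sup>+s. indicator {..<u} s + (\<integral>\<^sup>+t. renewal (u - (s + t)) \<partial>height_law) \<partial>N.sum_law R)"
    proof (rule nn_integral_cong)
      fix s
      have "renewal (u - s) = of_bool (u - s > 0) + (\<integral>\<^sup>+t. renewal (u - s - t) \<partial>height_law)" by (rule eqn)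
      also have "of_bool (u - s > 0) = (indicator {..<u} s :: ennreal)" by (simp add: indicator_def)
      finally show "renewal (u - s) = indicator {..<u} s + (\<integral>\<^sup>+t. renewal (u - (s + t)) \<partial>height_law)"
        by (simp only: diff_diff_eq)
    qed
    also have "\<dots> = emeasure (N.sum_law R) {..<u} + (\<integral>\<^sup>+s. \<integral>\<^sup>+t. renewal (u - (s + t)) \<partial>height_law \<partial>N.sum_law R)"
    proof -
      have "(\<lambda>s. \<integral>\<^sup>+t. renewal (u - (s + t)) \<partial>height_law) \<in> borel_measurable (N.sum_law R)"
        by measurable
      then have "(\<integral>\<^sup>+s. indicator {..<u} s + (\<integral>\<^sup>+t. renewal (u - (s + t)) \<partial>height_law) \<partial>N.sum_law R)
        = (\<integral>\<^sup>+s. indicator {..<u} s \<partial>N.sum_law R) + (\<integral>\<^sup>+s. \<integral>\<^sup>+t. renewal (u - (s + t)) \<partial>height_law \<partial>N.sum_law R)"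
        by (intro nn_integral_add) simp_all
      also have "(\<integral>\<^sup>+s. indicator {..<u} s \<partial>N.sum_law R) = emeasure (N.sum_law R) {..<u}"
        by (rule nn_integral_indicator) simp
      finally show ?thesis .
    qed
    also have "(\<integral>\<^sup>+s. \<integral>\<^sup>+t. renewal (u - (s + t)) \<partial>height_law \<partial>N.sum_law R) = (\<integral>\<^sup>+s. renewal (u - s) \<partial>N.sum_law (R + Suc 0))"
      using N.nn_integral_sum_law_add[OF m, of R "Suc 0"] unfolding N.sum_law_1 by (rule sym)
    finally have step: "(\<integral>\<^sup>+s. renewal (u - s) \<partial>N.sum_law R)
      = emeasure (N.sum_law R) {..<u} + (\<integral>\<^sup>+s. renewal (u - s) \<partial>N.sum_law (Suc R))" by (simp only: add_Suc_right add_0_right)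
    show ?case by (rule trans[OF Suc]) (simp only: step sum.lessThan_Suc add.assoc)
  qed
  have pos: "AE s in height_law. s \<ge> 0"
    unfolding height_law_def
  proof (subst AE_distr_iff)
    show "AE x in Q. 0 \<le> height x"
    proof (use ae in eventually_elim)
      fix x :: "nat \<Rightarrow> real" assume "\<exists>k. psum k x > 0"
      then have "psum (LEAST k. psum k x > 0) x > 0" by (rule LeastI_ex)
      then show "0 \<le> height x" unfolding height_def by (rule less_imp_le)
    qed
  qed measurable
  have pos': "AE s in N.sum_law R. s \<ge> 0" for R
  proof (induction R)
    case 0 show ?case unfolding N.law_0(3) by (subst AE_return) (simp_all add: pred_def)
  next
    case (Suc R)
    have "(\<integral>\<^sup>+s. indicator {..<0} s \<partial>N.sum_law (R + Suc 0)) = (\<integral>\<^sup>+s. \<integral>\<^sup>+t. indicator {..<0} (s + t) \<partial>N.sum_law (Suc 0) \<partial>N.sum_law R)"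
      by (rule N.nn_integral_sum_law_add) simp
    also have "\<dots> = (\<integral>\<^sup>+s. 0 \<partial>N.sum_law R)"
    proof (rule nn_integral_cong_AE, use Suc in eventually_elim)
      fix s :: real assume "s \<ge> 0"
      have "AE t in height_law. indicator {..<0} (s + t) = (0::ennreal)"
        using pos by eventually_elim (use \<open>s \<ge> 0\<close> in auto)
      then show "(\<integral>\<^sup>+t. indicator {..<0} (s + t) \<partial>N.sum_law (Suc 0)) = 0"
        unfolding N.sum_law_1 by (subst nn_integral_0_iff_AE) auto
    qed
    finally have "emeasure (N.sum_law (Suc R)) {..<0} = 0" by simp
    then show ?case by (intro AE_I[of _ _ "{..<0}"]) auto
  qed
  have rem: "(\<integral>\<^sup>+s. renewal (u - s) \<partial>N.sum_law R) \<le> renewal u * emeasure (N.sum_law R) {..<u}" for R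
  proof -
    have "(\<integral>\<^sup>+s. renewal (u - s) \<partial>N.sum_law R) \<le> (\<integral>\<^sup>+s. renewal u * indicator {..<u} s \<partial>N.sum_law R)"
    proof (rule nn_integral_mono_AE, use pos' in eventually_elim)
      fix s :: real assume "s \<ge> 0"
      then show "renewal (u - s) \<le> renewal u * indicator {..<u} s"
        using renewal_mono[of "u - s" u] by (auto simp: indicator_def)
    qed
    also have "\<dots> = renewal u * emeasure (N.sum_law R) {..<u}"
      by (subst nn_integral_cmult) auto
    finally show ?thesis .
  qed
  have le: "(\<Sum>r<R. emeasure (N.sum_law r) {..<u}) \<le> renewal u" for R
  proof -
    have "(\<Sum>r<R. emeasure (N.sum_law r) {..<u})
      \<le> (\<Sum>r<R. emeasure (N.sum_law r) {..<u}) + (\<integral>\<^sup>+s. renewal (u - s) \<partial>N.sum_law R)"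
      by (rule add_increasing2[OF zero_le order_refl])
    then show ?thesis unfolding it[of R, symmetric] .
  qed
  have "(\<Sum>r. emeasure (N.sum_law r) {..<u}) \<le> renewal u"
    by (rule suminf_le_const[OF summableI le])
  then have "(\<Sum>r. emeasure (N.sum_law r) {..<u}) < \<infinity>" using fin by (rule le_less_trans)
  then have "(\<lambda>r. emeasure (N.sum_law r) {..<u}) \<longlonglongrightarrow> 0" by (rule suminf_ennreal_finite_tendsto_0)
  then have lim0: "(\<lambda>R. renewal u * emeasure (N.sum_law R) {..<u}) \<longlonglongrightarrow> renewal u * 0"
    by (rule ennreal_tendsto_cmult[OF fin[unfolded infinity_ennreal_def]])
  have "(\<lambda>R. \<integral>\<^sup>+s. renewal (u - s) \<partial>N.sum_law R) \<longlonglongrightarrow> 0"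
  proof (rule tendsto_sandwich)
    show "\<forall>\<^sub>F R in sequentially. 0 \<le> (\<integral>\<^sup>+s. renewal (u - s) \<partial>N.sum_law R)"
      by (intro always_eventually allI zero_le)
    show "\<forall>\<^sub>F R in sequentially. (\<integral>\<^sup>+s. renewal (u - s) \<partial>N.sum_law R) \<le> renewal u * emeasure (N.sum_law R) {..<u}"
      by (intro always_eventually allI rem)
    show "(\<lambda>R. renewal u * emeasure (N.sum_law R) {..<u}) \<longlonglongrightarrow> 0"
      using lim0 unfolding mult_zero_right .
  qed (rule tendsto_const)
  then have "(\<lambda>R. (\<Sum>r<R. emeasure (N.sum_law r) {..<u}) + (\<integral>\<^sup>+s. renewal (u - s) \<partial>N.sum_law R))
      \<longlonglongrightarrow> (\<Sum>r. emeasure (N.sum_law r) {..<u}) + 0"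
    by (rule tendsto_add[OF summable_LIMSEQ[OF summableI]])
  then have "(\<lambda>R::nat. renewal u) \<longlonglongrightarrow> (\<Sum>r. emeasure (N.sum_law r) {..<u}) + 0"
    unfolding it[symmetric] .
  then show ?thesis unfolding LIMSEQ_const_iff add_0_right .
qed

text \<open>The definition uses a series of reals, which has its intended value only if it is
  summable; finiteness of \<open>renewal u\<close> provides this.\<close>

lemma renewal_function_height_law:
  assumes ae: "AE x in Q. \<exists>k. psum k x > 0" and fin: "renewal u < \<infinity>"
  shows "ennreal (renewal_function height_law u) = renewal u" "renewal_function height_law u \<ge> 0"
proof -
  interpret N: walk_law height_law by (intro walk_law.intro real_distribution_height)
  let ?e = "\<lambda>k. measure (N.sum_law (Suc k)) {..<u}"
  have e: "emeasure (N.sum_law k) {..<u} = ennreal (measure (N.sum_law k) {..<u})" for k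
    by (rule finite_measure.emeasure_eq_measure[OF N.finite_sum_law])
  have 1: "renewal u = of_bool (u > 0) + (\<Sum>k. ennreal (?e k))"
  proof -
    have "renewal u = (\<Sum>r. emeasure (N.sum_law r) {..<u})" by (rule renewal_eq_suminf[OF assms])
    also have "\<dots> = emeasure (N.sum_law 0) {..<u} + (\<Sum>r. emeasure (N.sum_law (Suc r)) {..<u})"
      using suminf_offset[of "\<lambda>n. emeasure (N.sum_law n) {..<u}" 1] by (simp add: add.commute)
    also have "emeasure (N.sum_law 0) {..<u} = of_bool (u > 0)"
      by (simp add: N.law_0 indicator_def)
    finally show ?thesis by (simp add: e)
  qed
  then have nt: "(\<Sum>k. ennreal (?e k)) \<noteq> top" using fin by (auto simp: less_top)
  then have s: "summable ?e" by (intro summable_suminf_not_top) auto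
  have H: "renewal_function height_law u = of_bool (u > 0) + (\<Sum>k. ?e k)"
    unfolding renewal_function_def N.prob_PiM_sum_less by simp
  have nn: "(\<Sum>k. ?e k) \<ge> 0" by (rule suminf_nonneg[OF s]) simp
  then show "renewal_function height_law u \<ge> 0" unfolding H by simp
  have "ennreal (\<Sum>k. ?e k) = (\<Sum>k. ennreal (?e k))"
    using s by (intro suminf_ennreal2[symmetric]) auto
  then show "ennreal (renewal_function height_law u) = renewal u"
    unfolding H 1 using nn by (subst ennreal_plus) (auto simp: of_bool_def)
qed

end

section \<open>Uniform bounds for the killed walk\<close>

text \<open>Telescoping, with a generous constant. The exponent 3/2 is that of 1 / (j c j) when c
  has square-root growth.\<close>

lemma sum_inverse_three_halves_tail:
  assumes "1 \<le> a"
  shows "(\<Sum>j\<in>{a..<b}. 1 / (real j * sqrt (real j))) \<le> 4 / sqrt (real a)"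
proof -
  have step: "1 / (real j * sqrt (real j)) \<le> 4 * (1 / sqrt (real j) - 1 / sqrt (real (Suc j)))" if "j \<ge> 1" for j
  proof -
    define p q where "p = sqrt (real j)" and "q = sqrt (real (Suc j))"
    have pq: "p > 0" "q > 0" "p\<^sup>2 = real j" "q\<^sup>2 = real j + 1" using that by (auto simp: p_def q_def)
    have "q \<le> (3 / 2) * p"
    proof (rule power2_le_imp_le)
      show "q\<^sup>2 \<le> ((3 / 2) * p)\<^sup>2" using pq that by (simp add: power_mult_distrib power_divide)
    qed (use pq in auto)
    then have "q * (p + q) \<le> (3 / 2 * p) * (p + 3 / 2 * p)" using pq by (intro mult_mono add_left_mono) auto
    also have "\<dots> \<le> 4 * p\<^sup>2" using pq by (simp add: power2_eq_square)
    finally have le: "q * (p + q) \<le> 4 * p\<^sup>2" .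
    have "(q - p) * (q + p) = 1" using pq by (simp add: power2_eq_square algebra_simps)
    then have "q - p = 1 / (p + q)" using pq by (simp add: field_simps)
    have "1 / p - 1 / q = (q - p) / (p * q)" using pq by (simp add: divide_simps)
    also have "\<dots> = (1 / (p + q)) / (p * q)" using \<open>q - p = 1 / (p + q)\<close> by simp
    finally have eq: "1 / p - 1 / q = 1 / (p * (q * (p + q)))" by (simp add: mult_ac)
    have "1 / (p\<^sup>2 * p) = 4 / (p * (4 * p\<^sup>2))" using pq by (simp add: field_simps)
    also have "\<dots> \<le> 4 / (p * (q * (p + q)))" using pq le that by (intro divide_left_mono mult_left_mono mult_pos_pos) auto
    finally have "1 / (p\<^sup>2 * p) \<le> 4 * (1 / p - 1 / q)" unfolding eq by simp
    then show ?thesis unfolding pq(3) by (simp add: p_def q_def)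
  qed
  \<comment> \<open>The second conjunct carries the induction but fails to make sense for b < a; the
    first is the claim and covers the empty range.\<close>
  have "(\<Sum>j\<in>{a..<b}. 1 / (real j * sqrt (real j))) \<le> 4 / sqrt (real a) \<and>
     (a \<le> b \<longrightarrow> (\<Sum>j\<in>{a..<b}. 1 / (real j * sqrt (real j))) \<le> 4 / sqrt (real a) - 4 / sqrt (real b))"
  proof (induction b)
    case 0
    then show ?case using assms by simp
  next
    case (Suc b)
    show ?case
    proof (cases "a \<le> b")
      case True
      then have "(\<Sum>j\<in>{a..<Suc b}. 1 / (real j * sqrt (real j))) = (\<Sum>j\<in>{a..<b}. 1 / (real j * sqrt (real j))) + 1 / (real b * sqrt (real b))" by simp
      also have "\<dots> \<le> (4 / sqrt (real a) - 4 / sqrt (real b)) + 4 * (1 / sqrt (real b) - 1 / sqrt (real (Suc b)))"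
        using Suc True step[of b] assms by (intro add_mono) auto
      finally have 1: "(\<Sum>j\<in>{a..<Suc b}. 1 / (real j * sqrt (real j))) \<le> 4 / sqrt (real a) - 4 / sqrt (real (Suc b))" by simp
      moreover have "0 \<le> 4 / sqrt (real (Suc b))" by simp
      ultimately show ?thesis by linarith
    next
      case False
      then have e: "{a..<Suc b} = {}" by auto
      show ?thesis
      proof (cases "a = Suc b")
        case True then show ?thesis using e by simp
      next
        case f: False
        then show ?thesis using e False by simp
      qed
    qed
  qed
  then show ?thesis by blast
qed

text \<open>\<open>\<gamma>\<close> stands for g 0, recovered from the integral of \<psi>. The level
  \<open>a\<close>, reached by a single step with positive probability, makes the renewal function
  finite.\<close>

locale walk_limit = walk_law F + stable_norming F c \<psi> \<kappa> \<alpha> for F c \<psi> \<kappa> \<alpha> +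
  fixes \<gamma> a :: real
  assumes char_sum_law: "\<And>n t. char (sum_law n) t = char F t ^ n"
    and char_less_1: "\<And>s. s \<noteq> 0 \<Longrightarrow> cmod (char F s) < 1"
    and integral_\<psi>: "(\<integral>t. \<psi> t \<partial>lborel) = of_real (2 * pi * \<gamma>)" and \<gamma>_pos: "\<gamma> > 0"
    and a_pos: "a > 0" and up_prob: "emeasure F {a..} > 0"
begin

lemma real_distribution_sum_law: "real_distribution (sum_law n)"
  by (intro real_distribution.intro prob_space_sum_law real_distribution_axioms.intro) auto

definition H :: "real \<Rightarrow> real" where
  "H z = enn2real (renewal z)"

definition U :: "nat \<Rightarrow> real \<Rightarrow> real" where
  "U j z = measure (ladder_law j) {..<z}"

lemma renewal_eq_H: "renewal z = ennreal (H z)"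
  using renewal_finite[OF a_pos up_prob, of z] by (simp add: H_def less_top)

lemma H_nonneg: "H z \<ge> 0" by (simp add: H_def)

lemma H_mono: "x \<le> y \<Longrightarrow> H x \<le> H y"
  using renewal_mono[of x y] by (simp add: renewal_eq_H H_nonneg)

lemma H_ge_1: "z > 0 \<Longrightarrow> H z \<ge> 1"
  using renewal_ge_1[of z] by (simp add: renewal_eq_H)

lemma H_add_le: 
  assumes "x > 0" shows "H (x + D) \<le> H x + H D"
proof -
  have "ennreal (H (x + D)) \<le> ennreal (H x + H D)"
    using renewal_add_le[OF assms, of D] by (simp add: renewal_eq_H H_nonneg)
  then show ?thesis by (subst (asm) ennreal_le_iff) (auto simp: H_nonneg)
qed

text \<open>As H x \<ge> 1, additive growth becomes multiplicative; an error measured by H (x + D)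
  can then be compared with H x.\<close>

lemma H_add_le_mult:
  assumes "x > 0" shows "H (x + D) \<le> (1 + H D) * H x"
proof -
  have "H D * 1 \<le> H D * H x" using H_ge_1[OF assms] H_nonneg by (intro mult_left_mono) auto
  then show ?thesis using H_add_le[OF assms, of D] by (simp add: distrib_right)
qed

lemma H_measurable [measurable]: "H \<in> borel_measurable borel"
  unfolding H_def[abs_def] by measurable

lemma emeasure_ladder_law_eq: "emeasure (ladder_law j) B = ennreal (measure (ladder_law j) B)"
  by (rule finite_measure.emeasure_eq_measure[OF finite_ladder_law])

lemma emeasure_sum_law_eq: "emeasure (sum_law j) B = ennreal (measure (sum_law j) B)"
  by (rule finite_measure.emeasure_eq_measure[OF finite_sum_law])

lemma U_nonneg: "U j z \<ge> 0" by (simp add: U_def)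

lemma U_sums: "(\<lambda>j. U j z) sums H z"
proof -
  have eq: "(\<Sum>j. ennreal (U j z)) = ennreal (H z)"
    using renewal_eq_H[of z] by (simp add: renewal_def emeasure_ladder_law_eq U_def)
  then have "summable (\<lambda>j. U j z)" by (intro summable_suminf_not_top) (auto simp: U_nonneg)
  then have s: "(\<lambda>j. U j z) sums (\<Sum>j. U j z)" by (rule summable_sums)
  have nn: "(\<Sum>j. U j z) \<ge> 0" by (rule suminf_nonneg[OF \<open>summable _\<close> U_nonneg])
  have "ennreal (\<Sum>j. U j z) = ennreal (H z)"
    using eq \<open>summable (\<lambda>j. U j z)\<close> by (subst suminf_ennreal2[symmetric]) (auto simp: U_nonneg)
  then have "(\<Sum>j. U j z) = H z" using nn H_nonneg by (subst (asm) ennreal_inj) auto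
  then show ?thesis using s by simp
qed

lemma sum_U_le: "finite A \<Longrightarrow> (\<Sum>j\<in>A. U j z) \<le> H z"
  using sum_le_suminf[OF sums_summable[OF U_sums], of A z] sums_unique[OF U_sums, of z] U_nonneg by simp

lemma U_eq_interval: "U j z = measure (ladder_law j) {0..<z}"
proof -
  interpret u: finite_measure "ladder_law j" by (rule finite_ladder_law)
  have "emeasure (ladder_law j) {..<0} = 0" by (rule emeasure_ladder_law_neg) simp
  then have n: "measure (ladder_law j) {..<0} = 0" by (simp add: measure_def)
  have "measure (ladder_law j) {..<z} \<le> measure (ladder_law j) ({..<0} \<union> {0..<z})"
    by (intro u.finite_measure_mono) auto
  also have "\<dots> \<le> measure (ladder_law j) {..<0} + measure (ladder_law j) {0..<z}"
    by (intro measure_Un_le) auto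
  finally have "U j z \<le> measure (ladder_law j) {0..<z}" using n by (simp add: U_def)
  moreover have "measure (ladder_law j) {0..<z} \<le> U j z" unfolding U_def by (intro u.finite_measure_mono) auto
  ultimately show ?thesis by linarith
qed

lemma sum_law_concentration:
  "\<exists>C>0. \<forall>n\<ge>1. \<forall>y h. h > 0 \<longrightarrow> measure (sum_law n) {y..<y + h} \<le> C * (1 + h) / c n"
  using concentration real_distribution_sum_law char_sum_law by meson

text \<open>The outer blocks have length n div 3, and the middle one has at least a third of the
  steps. \<open>c_upper\<close> replaces its norming constant by c n at the price of 6^A.\<close>

lemma ladder_law_interval_bound:
  "\<exists>C>0. \<forall>n\<ge>1. \<forall>z h. h > 0 \<longrightarrow> measure (ladder_law n) {z..<z + h} \<le> C * (1 + h) * H (z + h) / (real n * c n)"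
proof -
  obtain C where C: "C > 0" "\<And>n y h. n \<ge> 1 \<Longrightarrow> h > 0 \<Longrightarrow> measure (sum_law n) {y..<y + h} \<le> C * (1 + h) / c n"
    using sum_law_concentration by meson
  obtain A where A: "\<And>m n. 1 \<le> m \<Longrightarrow> m \<le> n \<Longrightarrow> c n \<le> (2 * real n / real m) ^ A * c m" using c_upper by blast
  have c2: "c 1 > 0" "c 2 > 0" by (auto intro: c_pos)
  have large: "measure (ladder_law n) {z..<z + h} \<le> (3 * C * 6 ^ A) * (1 + h) * H (z + h) / (real n * c n)"
    if n: "n \<ge> 3" and h: "h > 0" for n z h
  proof -
    define m where "m = n div 3"
    define k where "k = n - 2 * m"
    have mk: "m \<ge> 1" "k \<ge> 1" "n = m + (k + m)" "n \<le> 3 * k" "n \<le> 3 * Suc m"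
      using n by (auto simp: m_def k_def)
    have ck: "c k > 0" "c n > 0" using mk n by (auto intro: c_pos)
    define q where "q = C * (1 + h) / c k"
    have q: "q \<ge> 0" using C h ck by (simp add: q_def)
    have "of_nat (Suc m) * emeasure (ladder_law (m + (k + m))) {z..<z + h} \<le> ennreal q * renewal (z + h)"
    proof (rule Suc_mult_ladder_law_interval_le)
      fix y show "emeasure (sum_law k) {y..<y + h} \<le> ennreal q"
        using C(2)[OF mk(2) h, of y] q by (simp add: emeasure_sum_law_eq q_def)
    qed (rule mk)
    then have "ennreal (real (Suc m) * measure (ladder_law n) {z..<z + h}) \<le> ennreal (q * H (z + h))"
      unfolding mk(3)[symmetric] emeasure_ladder_law_eq renewal_eq_H ennreal_of_nat_eq_real_of_nat
      by (simp only: ennreal_mult[symmetric] q H_nonneg of_nat_0_le_iff measure_nonneg)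
    then have 1: "real (Suc m) * measure (ladder_law n) {z..<z + h} \<le> q * H (z + h)"
      using q H_nonneg by (subst (asm) ennreal_le_iff) auto
    have "c n \<le> (2 * real n / real k) ^ A * c k" using mk by (intro A) auto
    also have "\<dots> \<le> 6 ^ A * c k"
    proof (intro mult_right_mono power_mono)
      have "real n \<le> real (3 * k)" using mk(4) by (rule of_nat_mono)
      then show "2 * real n / real k \<le> 6" using mk by (simp add: field_simps)
    qed (use ck in auto)
    finally have "1 / c k \<le> 6 ^ A / c n" using ck by (simp add: field_simps)
    then have qle: "q \<le> C * (1 + h) * (6 ^ A / c n)"
      unfolding q_def using C h mult_left_mono[of "1 / c k" "6 ^ A / c n" "C * (1 + h)"] by simp
    have "real n * measure (ladder_law n) {z..<z + h} \<le> real (3 * Suc m) * measure (ladder_law n) {z..<z + h}"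
      using mk(5) by (intro mult_right_mono of_nat_mono) auto
    also have "\<dots> = 3 * (real (Suc m) * measure (ladder_law n) {z..<z + h})" by (simp only: of_nat_mult of_nat_numeral mult.assoc)
    also have "\<dots> \<le> 3 * (q * H (z + h))" using 1 by (intro mult_left_mono) auto
    also have "\<dots> \<le> 3 * (C * (1 + h) * (6 ^ A / c n) * H (z + h))"
      using qle H_nonneg by (intro mult_left_mono mult_right_mono) auto
    finally show ?thesis using n ck by (simp add: field_simps)
  qed
  \<comment> \<open>The summand c 1 + 2 c 2 makes the bound at least 1 for n = 1 and n = 2 when z +
    h > 0; these n are too short for three nonempty blocks.\<close>
  define D where "D = 3 * C * 6 ^ A + (c 1 + 2 * c 2)"
  have D: "D > 0" using C c2 by (auto simp: D_def intro!: add_pos_pos)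
  have "measure (ladder_law n) {z..<z + h} \<le> D * (1 + h) * H (z + h) / (real n * c n)"
    if n: "n \<ge> 1" and h: "h > 0" for n z h
  proof (cases "n \<ge> 3")
    case True
    have cn: "c n > 0" using n by (rule c_pos)
    have "(3 * C * 6 ^ A) * (1 + h) * H (z + h) / (real n * c n) \<le> D * (1 + h) * H (z + h) / (real n * c n)"
      using c2 cn H_nonneg h by (intro divide_right_mono mult_right_mono) (auto simp: D_def)
    then show ?thesis using large[OF True h, of z] by linarith
  next
    case False
    then have n12: "n = 1 \<or> n = 2" using n by auto
    have cn: "c n > 0" using n by (rule c_pos)
    interpret u: finite_measure "ladder_law n" by (rule finite_ladder_law)
    show ?thesis
    proof (cases "z + h > 0")
      case True
      have "emeasure (ladder_law n) {z..<z + h} \<le> 1"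
        by (simp add: emeasure_ladder_law prob_space.measure_le_1[OF prob_space_Q])
      then have 1: "measure (ladder_law n) {z..<z + h} \<le> 1" by (simp add: emeasure_ladder_law_eq)
      have "real n * c n \<le> D"
      proof -
        have "0 \<le> 3 * C * 6 ^ A" using C by simp
        then show ?thesis using n12 c2 unfolding D_def by auto
      qed
      also have "D = D * 1 * 1" by simp
      also have "\<dots> \<le> D * (1 + h) * H (z + h)" using D h H_ge_1[OF True] by (intro mult_mono) auto
      finally have "1 \<le> D * (1 + h) * H (z + h) / (real n * c n)" using cn n by (simp add: le_divide_eq)
      then show ?thesis using 1 by linarith
    next
      case False
      have "measure (ladder_law n) {z..<z + h} \<le> U n (z + h)" unfolding U_def by (intro u.finite_measure_mono) auto
      also have "\<dots> = 0" using emeasure_ladder_law_neg[of "z + h" n] False by (simp add: U_def measure_def)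
      finally show ?thesis using D h cn H_nonneg by (smt (verit) divide_nonneg_nonneg mult_nonneg_nonneg of_nat_0_le_iff)
    qed
  qed
  then show ?thesis using D by blast
qed

end

section \<open>The asymptotics of the conditioned walk\<close>

context walk_limit
begin

definition win :: "real \<Rightarrow> real \<Rightarrow> real \<Rightarrow> real set" where
  "win x D y = {s. y + s \<in> {x..<x + D}} \<inter> {0<..}"

definition p :: "nat \<Rightarrow> real \<Rightarrow> real \<Rightarrow> real \<Rightarrow> real" where
  "p m x D y = measure (sum_law m) (win x D y)"

definition T :: "nat \<Rightarrow> nat \<Rightarrow> real \<Rightarrow> real \<Rightarrow> real" where
  "T n j x D = (\<integral>y. p (n - j) x D y \<partial>ladder_law j)"

text \<open>The Lebesgue measure of \<open>win x D y\<close>, to which the local limit theorem makes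
  c n times the probability of that window proportional.\<close>

definition len :: "real \<Rightarrow> real \<Rightarrow> real \<Rightarrow> real" where
  "len x D y = max 0 (x + D - max x y)"

lemma win_sets [measurable]: "win x D y \<in> sets borel"
  unfolding win_def by measurable

lemma emeasure_f_win: "emeasure (WH.f m) {s. s + y \<in> {x..<x + D}} = ennreal (p m x D y)"
proof -
  have "emeasure (WH.f m) {s. s + y \<in> {x..<x + D}} = emeasure (sum_law m) ({s. s + y \<in> {x..<x + D}} \<inter> {0<..})"
    by (rule WH.emeasure_f) (intro sets_translate, simp)
  also have "{s. s + y \<in> {x..<x + D}} \<inter> {0<..} = win x D y" by (simp add: win_def add.commute)
  finally show ?thesis by (simp add: emeasure_sum_law_eq p_def)
qed

lemma p_bounds: "0 \<le> p m x D y" "p m x D y \<le> 1"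
  unfolding p_def by (auto intro: prob_space.prob_le_1[OF prob_space_sum_law])

lemma p_measurable [measurable]: "p m x D \<in> borel_measurable borel"
proof -
  have "(\<lambda>y. enn2real (emeasure (WH.f m) {s. s + y \<in> {x..<x + D}})) \<in> borel_measurable borel"
    using measurable_emeasure_translate[OF WH.fin_f, of "{x..<x + D}" m] by measurable
  moreover have "p m x D = (\<lambda>y. enn2real (emeasure (WH.f m) {s. s + y \<in> {x..<x + D}}))"
    by (rule ext) (simp only: emeasure_f_win enn2real_ennreal p_bounds)
  ultimately show ?thesis by (simp only:)
qed

lemma integrable_ladder_law:
  assumes [measurable]: "f \<in> borel_measurable borel" and "\<And>y. \<bar>f y\<bar> \<le> (B :: real)"
  shows "integrable (ladder_law j) f"
proof -
  interpret u: finite_measure "ladder_law j" by (rule finite_ladder_law)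
  show ?thesis by (rule u.integrable_const_bound[of _ B]) (use assms(2) in auto)
qed

lemma T_nn_integral: "(\<integral>\<^sup>+y. ennreal (p (n - j) x D y) \<partial>ladder_law j) = ennreal (T n j x D)"
  unfolding T_def
  by (intro nn_integral_eq_integral integrable_ladder_law[of _ 1] AE_I2) (simp_all add: p_bounds)

lemma T_nonneg: "T n j x D \<ge> 0"
  unfolding T_def by (intro integral_nonneg_AE AE_I2 p_bounds)

lemma ladder_law_identity:
  "real n * measure (ladder_law n) {x..<x + D} = (\<Sum>j<n. T n j x D)"
proof -
  have "of_nat n * emeasure (ladder_law n) {x..<x + D}
      = (\<Sum>j<n. \<integral>\<^sup>+y. emeasure (sum_law (n - j)) (win x D y) \<partial>ladder_law j)"
    unfolding win_def by (rule of_nat_mult_ladder_law) simp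
  also have "\<dots> = (\<Sum>j<n. ennreal (T n j x D))"
    unfolding T_nn_integral[symmetric] by (simp add: emeasure_sum_law_eq p_def)
  also have "\<dots> = ennreal (\<Sum>j<n. T n j x D)" by (rule sum_ennreal) (rule T_nonneg)
  finally have "ennreal (real n * measure (ladder_law n) {x..<x + D}) = ennreal (\<Sum>j<n. T n j x D)"
    by (simp add: emeasure_ladder_law_eq ennreal_mult ennreal_of_nat_eq_real_of_nat)
  then show ?thesis by (subst (asm) ennreal_inj) (auto intro!: sum_nonneg T_nonneg)
qed

text \<open>The order of the convolution is exchanged: for a fixed increment s > 0 the ladder height
  must fall into an interval of length D starting at x - s. Heights are nonnegative, so only s < x +
  D contributes.\<close>

lemma T_le:
  assumes K: "K \<ge> 0" "\<And>z. z \<le> x \<Longrightarrow> measure (ladder_law j) {z..<z + D} \<le> K"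
  shows "T n j x D \<le> K * measure (sum_law (n - j)) {0<..<x + D}"
proof -
  let ?B = "{x..<x + D}" and ?m = "n - j"
  note fb = fin_borel_laws(2)[of j] WH.fin_f[of ?m]
  have "ennreal (T n j x D) = (\<integral>\<^sup>+y. emeasure (WH.f ?m) {s. s + y \<in> ?B} \<partial>ladder_law j)"
    unfolding emeasure_f_win T_nn_integral ..
  also have "\<dots> = emeasure (WH.f ?m \<star> ladder_law j) ?B"
    by (rule emeasure_conv[symmetric]) (use fb in auto)
  also have "\<dots> = emeasure (ladder_law j \<star> WH.f ?m) ?B"
    by (simp only: conv_comm[OF fb])
  also have "\<dots> = (\<integral>\<^sup>+s. emeasure (ladder_law j) {y. y + s \<in> ?B} \<partial>WH.f ?m)"
    by (rule emeasure_conv) (use fb in auto)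
  also have "\<dots> \<le> (\<integral>\<^sup>+s. ennreal K * indicator {..<x + D} s \<partial>WH.f ?m)"
  proof (rule nn_integral_mono_AE)
    have "emeasure (WH.f ?m) {..0} = 0"
    proof -
      have "{..0} \<inter> {0<..} = ({} :: real set)" by auto
      then show ?thesis by (simp add: WH.emeasure_f)
    qed
    then have "AE s in WH.f ?m. s \<notin> {..0}"
      using fin_borelD(2)[OF fb(2)] by (intro AE_I[of _ _ "{..0}"]) auto
    then show "AE s in WH.f ?m. emeasure (ladder_law j) {y. y + s \<in> ?B} \<le> ennreal K * indicator {..<x + D} s"
    proof eventually_elim
      case (elim s)
      have eq: "{y. y + s \<in> ?B} = {x - s..<(x - s) + D}" by auto
      show ?case
      proof (cases "s < x + D")
        case True
        have "measure (ladder_law j) {x - s..<(x - s) + D} \<le> K" using elim by (intro K) auto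
        then show ?thesis using True K unfolding eq emeasure_ladder_law_eq by simp
      next
        case False
        have "emeasure (ladder_law j) {x - s..<(x - s) + D} \<le> emeasure (ladder_law j) {..<0}"
          using False by (intro emeasure_mono) auto
        then show ?thesis unfolding eq using emeasure_ladder_law_neg[of 0 j] by simp
      qed
    qed
  qed
  also have "\<dots> = ennreal K * emeasure (WH.f ?m) {..<x + D}"
    using fin_borelD(2)[OF fb(2)] by (subst nn_integral_cmult) auto
  also have "emeasure (WH.f ?m) {..<x + D} = ennreal (measure (sum_law ?m) {0<..<x + D})"
  proof -
    have "{..<x + D} \<inter> {0<..} = {0<..<x + D}" by auto
    then show ?thesis by (simp add: WH.emeasure_f emeasure_sum_law_eq)
  qed
  finally have "ennreal (T n j x D) \<le> ennreal (K * measure (sum_law ?m) {0<..<x + D})"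
    using K by (simp add: ennreal_mult)
  then show ?thesis using K by (subst (asm) ennreal_le_iff) auto
qed

text \<open>Window lengths become arbitrarily small when y approaches x + D. Monotonicity in the
  length reduces them to a finite grid.\<close>

lemma local_limit_uniform_length:
  assumes D: "D > 0" and \<eta>: "\<eta> > 0"
  shows "\<exists>\<epsilon>>0. \<exists>N. \<forall>n\<ge>N. \<forall>m h. m \<le> n \<longrightarrow> real (n - m) \<le> \<epsilon> * real n \<longrightarrow> 0 < h \<longrightarrow> h \<le> D \<longrightarrow>
    \<bar>c n * measure (sum_law m) {0<..<h} - \<gamma> * h\<bar> < \<eta>"
proof -
  \<comment> \<open>The mesh d = D / J satisfies \<gamma> d < \<eta> / 4; passing to the successor
    keeps J positive.\<close>
  obtain J0 :: nat where J0: "4 * \<gamma> * D / \<eta> < real J0" using reals_Archimedean2 by blast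
  define J where "J = Suc J0"
  define d where "d = D / real J"
  have d: "d > 0" using D by (simp add: d_def J_def)
  have dJ: "real J * d = D" by (simp add: d_def J_def)
  have dsmall: "\<gamma> * d < \<eta> / 4"
  proof -
    have "4 * \<gamma> * D / \<eta> < real J" using J0 by (simp add: J_def)
    then show ?thesis using \<eta> by (simp add: d_def J_def field_simps)
  qed
  have "\<forall>i\<in>{1..J}. \<exists>\<epsilon>>0. \<exists>N. \<forall>n\<ge>N. \<forall>m y. m \<le> n \<longrightarrow> real (n - m) \<le> \<epsilon> * real n \<longrightarrow> \<bar>y\<bar> \<le> \<epsilon> * c n \<longrightarrow>
    \<bar>c n * measure (sum_law m) {y..<y + real i * d} - \<gamma> * (real i * d)\<bar> < \<eta> / 4"
    using d \<eta> by (intro ballI local_limit char_less_1 real_distribution_sum_law char_sum_law integral_\<psi> \<gamma>_pos) auto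
  then obtain e N where e: "\<And>i. i \<in> {1..J} \<Longrightarrow> e i > 0" and
    lim: "\<And>i n m y. i \<in> {1..J} \<Longrightarrow> n \<ge> N i \<Longrightarrow> m \<le> n \<Longrightarrow> real (n - m) \<le> e i * real n \<Longrightarrow> \<bar>y\<bar> \<le> e i * c n \<Longrightarrow>
      \<bar>c n * measure (sum_law m) {y..<y + real i * d} - \<gamma> * (real i * d)\<bar> < \<eta> / 4"
    by metis
  define \<epsilon> where "\<epsilon> = Min (e ` {1..J})"
  define M where "M = max 1 (Max (N ` {1..J}))"
  have \<epsilon>: "\<epsilon> > 0" "\<And>i. i \<in> {1..J} \<Longrightarrow> \<epsilon> \<le> e i"
    unfolding \<epsilon>_def using e by (auto simp: J_def)
  have M: "M \<ge> 1" "\<And>i. i \<in> {1..J} \<Longrightarrow> N i \<le> M"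
    unfolding M_def by (auto simp: le_max_iff_disj)
  have "\<bar>c n * measure (sum_law m) {0<..<h} - \<gamma> * h\<bar> < \<eta>"
    if n: "n \<ge> M" "m \<le> n" "real (n - m) \<le> \<epsilon> * real n" and h: "0 < h" "h \<le> D" for n m h
  proof -
    interpret L: prob_space "sum_law m" by (rule prob_space_sum_law)
    have cn: "c n > 0" using n M by (intro c_pos) auto
    let ?g = "\<lambda>i. c n * measure (sum_law m) {0..<real i * d}"
    have g: "\<bar>?g i - \<gamma> * (real i * d)\<bar> < \<eta> / 4" if "i \<le> J" for i
    proof (cases "i = 0")
      case False
      then have i: "i \<in> {1..J}" using that by auto
      have "real (n - m) \<le> e i * real n" using n(3) mult_right_mono[OF \<epsilon>(2)[OF i], of "real n"] by simp
      moreover have "\<bar>0\<bar> \<le> e i * c n" using e[OF i] cn by simp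
      ultimately show ?thesis using lim[OF i, of n m 0] n M(2)[OF i] by simp
    qed (use \<eta> in simp)
    define i where "i = nat \<lceil>h / d\<rceil>"
    have "h / d > 0" using h d by simp
    then have i1: "i \<ge> 1" "real i \<ge> h / d" "real i < h / d + 1" unfolding i_def by linarith+
    have iJ: "i \<le> J"
    proof -
      have "h / d \<le> real J" using h d dJ by (simp add: divide_le_eq)
      then show ?thesis unfolding i_def by linarith
    qed
    have hi: "h \<le> real i * d" "(real i - 1) * d < h" using i1 d by (simp_all add: field_simps)
    have up: "c n * measure (sum_law m) {0<..<h} \<le> ?g i"
      using hi cn by (intro mult_left_mono L.finite_measure_mono) auto
    \<comment> \<open>The open window omits 0, which may carry mass of the sum law. The interval [0,
      d) is given up to account for it, at a further cost of about \<gamma> d.\<close>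
    have "{0..<real (i - 1) * d} \<subseteq> {0<..<h} \<union> {0..<real 1 * d}"
      using hi i1 d by (auto simp: of_nat_diff)
    then have "measure (sum_law m) {0..<real (i - 1) * d} \<le> measure (sum_law m) ({0<..<h} \<union> {0..<real 1 * d})"
      by (intro L.finite_measure_mono) auto
    also have "\<dots> \<le> measure (sum_law m) {0<..<h} + measure (sum_law m) {0..<real 1 * d}"
      by (intro measure_Un_le) auto
    finally have "?g (i - 1) \<le> c n * (measure (sum_law m) {0<..<h} + measure (sum_law m) {0..<real 1 * d})"
      using cn by (intro mult_left_mono) auto
    then have lo: "?g (i - 1) - ?g 1 \<le> c n * measure (sum_law m) {0<..<h}" by (simp add: distrib_left)
    have "\<bar>?g i - \<gamma> * (real i * d)\<bar> < \<eta> / 4" "\<bar>?g (i - 1) - \<gamma> * (real (i - 1) * d)\<bar> < \<eta> / 4" "\<bar>?g 1 - \<gamma> * (real 1 * d)\<bar> < \<eta> / 4"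
      using iJ i1 by (intro g; auto simp: J_def)+
    moreover have "\<gamma> * (real i * d) \<le> \<gamma> * h + \<gamma> * d"
      using mult_left_mono[of "real i * d" "h + d" \<gamma>] \<gamma>_pos hi by (simp add: algebra_simps)
    moreover have "\<gamma> * h - \<gamma> * d \<le> \<gamma> * (real (i - 1) * d)"
      using mult_left_mono[of "h - d" "real (i - 1) * d" \<gamma>] \<gamma>_pos hi i1 by (simp add: algebra_simps of_nat_diff)
    moreover have "\<gamma> * (real 1 * d) = \<gamma> * d" by simp
    ultimately show ?thesis using up lo dsmall unfolding abs_less_iff by linarith
  qed
  then show ?thesis using \<epsilon>(1) by blast
qed

text \<open>For y < x the window is a translate of [0, D) starting at x - y, which is at most x as y
  \<ge> 0; for x \<le> y < x + D it is cut off at 0 and has length x + D - y.\<close>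

lemma window_limit:
  assumes D: "D > 0" and \<eta>: "\<eta> > 0"
  shows "\<exists>\<epsilon>>0. \<exists>N. \<forall>n\<ge>N. \<forall>m x y. m \<le> n \<longrightarrow> real (n - m) \<le> \<epsilon> * real n \<longrightarrow> 0 < x \<longrightarrow> x \<le> \<epsilon> * c n \<longrightarrow>
    0 \<le> y \<longrightarrow> \<bar>c n * p m x D y - \<gamma> * len x D y\<bar> \<le> \<eta> * indicator {..<x + D} y"
proof -
  obtain e1 N1 where e1: "e1 > 0" and l1: "\<And>n m h. n \<ge> N1 \<Longrightarrow> m \<le> n \<Longrightarrow> real (n - m) \<le> e1 * real n \<Longrightarrow> 0 < h \<Longrightarrow> h \<le> D \<Longrightarrow>
    \<bar>c n * measure (sum_law m) {0<..<h} - \<gamma> * h\<bar> < \<eta>"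
    using local_limit_uniform_length[OF assms] by metis
  have "\<exists>\<epsilon>>0. \<exists>N. \<forall>n\<ge>N. \<forall>m y. m \<le> n \<longrightarrow> real (n - m) \<le> \<epsilon> * real n \<longrightarrow> \<bar>y\<bar> \<le> \<epsilon> * c n \<longrightarrow>
    \<bar>c n * measure (sum_law m) {y..<y + D} - \<gamma> * D\<bar> < \<eta>"
    by (rule local_limit) (use assms char_less_1 real_distribution_sum_law char_sum_law integral_\<psi> \<gamma>_pos in auto)
  then obtain e2 N2 where e2: "e2 > 0" and l2: "\<And>n m y. n \<ge> N2 \<Longrightarrow> m \<le> n \<Longrightarrow> real (n - m) \<le> e2 * real n \<Longrightarrow> \<bar>y\<bar> \<le> e2 * c n \<Longrightarrow>
    \<bar>c n * measure (sum_law m) {y..<y + D} - \<gamma> * D\<bar> < \<eta>"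
    by metis
  define \<epsilon> where "\<epsilon> = min e1 e2"
  have "\<bar>c n * p m x D y - \<gamma> * len x D y\<bar> \<le> \<eta> * indicator {..<x + D} y"
    if n: "n \<ge> max 1 (max N1 N2)" "m \<le> n" "real (n - m) \<le> \<epsilon> * real n" and x: "0 < x" "x \<le> \<epsilon> * c n" and y: "0 \<le> y" for n m x y
  proof -
    have cn: "c n > 0" using n by (intro c_pos) auto
    have le: "real (n - m) \<le> e1 * real n" "real (n - m) \<le> e2 * real n"
      using n(3) mult_right_mono[of \<epsilon> e1 "real n"] mult_right_mono[of \<epsilon> e2 "real n"] by (auto simp: \<epsilon>_def)
    consider "y < x" | "x \<le> y" "y < x + D" | "x + D \<le> y" by linarith
    then show ?thesis
    proof cases
      case 1
      then have w: "win x D y = {x - y..<(x - y) + D}" by (auto simp: win_def)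
      have "\<epsilon> * c n \<le> e2 * c n" using cn by (intro mult_right_mono) (auto simp: \<epsilon>_def)
      then have "x - y \<le> e2 * c n" using x y by linarith
      then have "\<bar>c n * measure (sum_law m) {x - y..<(x - y) + D} - \<gamma> * D\<bar> < \<eta>"
        using n le 1 by (intro l2) auto
      then show ?thesis using 1 D unfolding p_def w by (simp add: len_def max_def)
    next
      case 2
      then have w: "win x D y = {0<..<x + D - y}" using x by (auto simp: win_def)
      have "\<bar>c n * measure (sum_law m) {0<..<x + D - y} - \<gamma> * (x + D - y)\<bar> < \<eta>"
        using n le 2 by (intro l1) auto
      then show ?thesis using 2 unfolding p_def w by (simp add: len_def max_def)
    next
      case 3
      then have w: "win x D y = {}" by (auto simp: win_def)
      show ?thesis using 3 D unfolding p_def w by (simp add: len_def max_def)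
    qed
  qed
  moreover have "\<epsilon> > 0" using e1 e2 by (simp add: \<epsilon>_def)
  ultimately show ?thesis by blast
qed

lemma len_measurable [measurable]: "len x D \<in> borel_measurable borel"
  unfolding len_def[abs_def] by measurable

lemma len_bounds: "D > 0 \<Longrightarrow> 0 \<le> len x D y" "D > 0 \<Longrightarrow> len x D y \<le> D * indicator {..<x + D} y" "D > 0 \<Longrightarrow> \<bar>len x D y\<bar> \<le> D"
  by (auto simp: len_def indicator_def max_def)

definition E :: "nat \<Rightarrow> real \<Rightarrow> real \<Rightarrow> real" where
  "E j x D = (\<integral>y. len x D y \<partial>ladder_law j)"

lemma E_bounds:
  assumes "D > 0" shows "0 \<le> E j x D" "E j x D \<le> D * U j (x + D)"
proof -
  interpret u: finite_measure "ladder_law j" by (rule finite_ladder_law)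
  show "0 \<le> E j x D" unfolding E_def by (intro integral_nonneg_AE AE_I2 len_bounds assms)
  have "E j x D \<le> (\<integral>y. D * indicator {..<x + D} y \<partial>ladder_law j)"
    unfolding E_def
    by (intro integral_mono integrable_ladder_law[of _ D] len_bounds assms) (use assms in \<open>auto simp: indicator_def\<close>)
  then show "E j x D \<le> D * U j (x + D)" by (simp add: U_def)
qed

lemma T_limit:
  assumes D: "D > 0" and \<eta>: "\<eta> > 0"
  shows "\<exists>\<epsilon>>0. \<exists>N. \<forall>n\<ge>N. \<forall>j x. j \<le> n \<longrightarrow> real j \<le> \<epsilon> * real n \<longrightarrow> 0 < x \<longrightarrow> x \<le> \<epsilon> * c n \<longrightarrow>
    \<bar>c n * T n j x D - \<gamma> * E j x D\<bar> \<le> \<eta> * U j (x + D)"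
proof -
  obtain \<epsilon> N where \<epsilon>: "\<epsilon> > 0" and lim: "\<And>n m x y. n \<ge> N \<Longrightarrow> m \<le> n \<Longrightarrow> real (n - m) \<le> \<epsilon> * real n \<Longrightarrow> 0 < x \<Longrightarrow> x \<le> \<epsilon> * c n \<Longrightarrow>
    0 \<le> y \<Longrightarrow> \<bar>c n * p m x D y - \<gamma> * len x D y\<bar> \<le> \<eta> * indicator {..<x + D} y"
    using window_limit[OF assms] by metis
  have "\<bar>c n * T n j x D - \<gamma> * E j x D\<bar> \<le> \<eta> * U j (x + D)"
    if n: "n \<ge> N" "j \<le> n" "real j \<le> \<epsilon> * real n" and x: "0 < x" "x \<le> \<epsilon> * c n" for n j x
  proof -
    interpret u: finite_measure "ladder_law j" by (rule finite_ladder_law)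
    have i1: "integrable (ladder_law j) (\<lambda>y. c n * p (n - j) x D y)"
      by (intro integrable_mult_right integrable_ladder_law[of _ 1]) (simp_all add: p_bounds)
    have i2: "integrable (ladder_law j) (\<lambda>y. \<gamma> * len x D y)"
      by (intro integrable_mult_right integrable_ladder_law[of _ D] len_bounds D) simp
    have "AE y in ladder_law j. y \<ge> 0"
      by (rule AE_I[of _ _ "{..<0}"]) (use emeasure_ladder_law_neg[of 0 j] in auto)
    then have ae: "AE y in ladder_law j. norm (c n * p (n - j) x D y - \<gamma> * len x D y) \<le> \<eta> * indicator {..<x + D} y"
    proof eventually_elim
      case (elim y)
      then show ?case using lim[of n "n - j" x y] n x by simp
    qed
    have "c n * T n j x D - \<gamma> * E j x D = (\<integral>y. c n * p (n - j) x D y - \<gamma> * len x D y \<partial>ladder_law j)"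
      unfolding T_def E_def by (subst Bochner_Integration.integral_diff[OF i1 i2]) simp
    also have "norm \<dots> \<le> (\<integral>y. \<eta> * indicator {..<x + D} y \<partial>ladder_law j)"
    proof (rule order_trans[OF Bochner_Integration.integral_norm_bound integral_mono_AE[OF _ _ ae]])
      show "integrable (ladder_law j) (\<lambda>y. \<eta> * indicator {..<x + D} y)"
        by (rule integrable_ladder_law[of _ \<eta>]) (use \<eta> in \<open>auto simp: indicator_def\<close>)
    qed (intro integrable_norm Bochner_Integration.integrable_diff i1 i2)
    also have "\<dots> = \<eta> * U j (x + D)" by (simp add: U_def)
    finally show ?thesis by simp
  qed
  then show ?thesis using \<epsilon> by blast
qed

section \<open>Late ladder epochs and averages of the sum laws\<close>

lemma c_lower_fraction:
  "\<exists>A. \<forall>\<epsilon>>0. \<forall>m n. 1 \<le> m \<longrightarrow> m \<le> n \<longrightarrow> \<epsilon> * real n \<le> real m \<longrightarrow> 1 / c m \<le> (2 / \<epsilon>) ^ A / c n"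
proof -
  obtain A where A: "\<And>m n. 1 \<le> m \<Longrightarrow> m \<le> n \<Longrightarrow> c n \<le> (2 * real n / real m) ^ A * c m" using c_upper by blast
  have "1 / c m \<le> (2 / \<epsilon>) ^ A / c n" if "\<epsilon> > 0" "1 \<le> m" "m \<le> n" "\<epsilon> * real n \<le> real m" for \<epsilon> m n
  proof -
    have cp: "c m > 0" "c n > 0" using that by (auto intro: c_pos)
    have "c n \<le> (2 * real n / real m) ^ A * c m" using that by (intro A)
    also have "\<dots> \<le> (2 / \<epsilon>) ^ A * c m"
      using that cp by (intro mult_right_mono power_mono) (auto simp: field_simps)
    finally have "c n / c m \<le> (2 / \<epsilon>) ^ A" using cp by (subst pos_divide_le_eq) auto
    then have "(c n / c m) / c n \<le> (2 / \<epsilon>) ^ A / c n" using cp by (intro divide_right_mono) auto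
    then show ?thesis using cp by simp
  qed
  then show ?thesis by blast
qed

text \<open>The a priori bound on [0, z) has order (1 + z) H z / (j c j). Comparing c j with c J by
  square-root growth gives a sum of j^(-3/2), whose tail returns the order 1 / c J, comparable with
  1 / c n.\<close>

lemma U_tail_bound:
  assumes "\<epsilon> > 0"
  shows "\<exists>K>0. \<forall>n J N z. 1 \<le> J \<longrightarrow> J \<le> n \<longrightarrow> \<epsilon> * real n \<le> real J \<longrightarrow> z > 0 \<longrightarrow>
    (\<Sum>j\<in>{J..<N}. U j z) \<le> K * ((1 + z) / c n) * H z"
proof -
  obtain C where C: "C > 0" "\<And>n z h. n \<ge> 1 \<Longrightarrow> h > 0 \<Longrightarrow> measure (ladder_law n) {z..<z + h} \<le> C * (1 + h) * H (z + h) / (real n * c n)"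
    using ladder_law_interval_bound by meson
  obtain C1 where C1: "C1 \<ge> 1" "\<And>m n. 1 \<le> m \<Longrightarrow> m \<le> n \<Longrightarrow> c m \<le> C1 * sqrt (real m / real n) * c n" using c_lower by blast
  obtain A where A: "\<And>m n. 1 \<le> m \<Longrightarrow> m \<le> n \<Longrightarrow> \<epsilon> * real n \<le> real m \<Longrightarrow> 1 / c m \<le> (2 / \<epsilon>) ^ A / c n"
    using c_lower_fraction assms by blast
  define K where "K = 4 * C * C1 * (2 / \<epsilon>) ^ A"
  have "(\<Sum>j\<in>{J..<N}. U j z) \<le> K * ((1 + z) / c n) * H z"
    if J: "1 \<le> J" "J \<le> n" "\<epsilon> * real n \<le> real J" and z: "z > 0" for n J N z
  proof -
    have cJ: "c J > 0" using J by (intro c_pos)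
    define B where "B = C * (1 + z) * H z"
    have B: "B \<ge> 0" using C z H_nonneg by (simp add: B_def)
    have "U j z \<le> (B * C1 * sqrt (real J) / c J) * (1 / (real j * sqrt (real j)))" if j: "j \<in> {J..<N}" for j
    proof -
      have j1: "1 \<le> j" "J \<le> j" using j J by auto
      have cj: "c j > 0" using j1 by (intro c_pos)
      have "U j z \<le> B / (real j * c j)"
        using C(2)[OF j1(1) z, of 0] by (simp add: U_eq_interval B_def)
      moreover have "1 / c j \<le> C1 * sqrt (real J) / (c J * sqrt (real j))"
        using C1(2)[OF J(1) j1(2)] cj cJ j1 by (simp add: real_sqrt_divide field_simps)
      then have "(B / real j) * (1 / c j) \<le> (B / real j) * (C1 * sqrt (real J) / (c J * sqrt (real j)))"
        using B by (intro mult_left_mono) auto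
      ultimately show ?thesis by (simp add: mult_ac)
    qed
    then have "(\<Sum>j\<in>{J..<N}. U j z) \<le> (\<Sum>j\<in>{J..<N}. (B * C1 * sqrt (real J) / c J) * (1 / (real j * sqrt (real j))))"
      by (rule sum_mono)
    also have "\<dots> = (B * C1 * sqrt (real J) / c J) * (\<Sum>j\<in>{J..<N}. 1 / (real j * sqrt (real j)))"
      by (rule sum_distrib_left[symmetric])
    also have "\<dots> \<le> (B * C1 * sqrt (real J) / c J) * (4 / sqrt (real J))"
      using B C1 cJ J by (intro mult_left_mono sum_inverse_three_halves_tail) auto
    also have "\<dots> = (4 * B * C1) * (1 / c J)" using J by (simp add: field_simps)
    also have "\<dots> \<le> (4 * B * C1) * ((2 / \<epsilon>) ^ A / c n)"
      using B C1 by (intro mult_left_mono A J) auto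
    also have "\<dots> = K * ((1 + z) / c n) * H z" by (simp add: K_def B_def mult_ac)
    finally show ?thesis .
  qed
  moreover have "K > 0" using C C1 assms by (simp add: K_def)
  ultimately show ?thesis by blast
qed

text \<open>Fewer than \<eta> n indices are bounded trivially by 1. For the others the concentration
  bound applies with c k comparable to c n, at the cost of a constant depending on \<eta>.\<close>

lemma sum_law_average_bound:
  assumes "\<eta> > 0"
  shows "\<exists>K>0. \<forall>n\<ge>1. \<forall>z>0. (\<Sum>k\<in>{1..n}. measure (sum_law k) {0<..<z}) \<le> real n * (\<eta> + K * ((1 + z) / c n))"
proof -
  obtain C where C: "C > 0" "\<And>n y h. n \<ge> 1 \<Longrightarrow> h > 0 \<Longrightarrow> measure (sum_law n) {y..<y + h} \<le> C * (1 + h) / c n"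
    using sum_law_concentration by meson
  obtain A where A: "\<And>m n. 1 \<le> m \<Longrightarrow> m \<le> n \<Longrightarrow> \<eta> * real n \<le> real m \<Longrightarrow> 1 / c m \<le> (2 / \<eta>) ^ A / c n"
    using c_lower_fraction assms by blast
  define K where "K = C * (2 / \<eta>) ^ A"
  have K: "K > 0" using C assms by (simp add: K_def)
  have "(\<Sum>k\<in>{1..n}. measure (sum_law k) {0<..<z}) \<le> real n * (\<eta> + K * ((1 + z) / c n))"
    if n: "n \<ge> 1" and z: "z > 0" for n z
  proof -
    have cn: "c n > 0" using n by (rule c_pos)
    let ?b = "K * ((1 + z) / c n)"
    have b: "?b \<ge> 0" using K z cn by simp
    have summand: "measure (sum_law k) {0<..<z} \<le> indicator {k. real k < \<eta> * real n} k + ?b" if k: "k \<in> {1..n}" for k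
    proof -
      interpret L: prob_space "sum_law k" by (rule prob_space_sum_law)
      show ?thesis
      proof (cases "real k < \<eta> * real n")
        case True
        then show ?thesis using L.prob_le_1[of "{0<..<z}"] b by (simp add: add_increasing2)
      next
        case False
        have "measure (sum_law k) {0<..<z} \<le> measure (sum_law k) {0..<0 + z}" by (intro L.finite_measure_mono) auto
        also have "\<dots> \<le> C * (1 + z) / c k" using k z by (intro C) auto
        also have "\<dots> = C * (1 + z) * (1 / c k)" by simp
        also have "\<dots> \<le> C * (1 + z) * ((2 / \<eta>) ^ A / c n)"
          using C z k False by (intro mult_left_mono A) auto
        also have "\<dots> = ?b" by (simp add: K_def mult_ac)
        finally show ?thesis using False by simp
      qed
    qed
    have "(\<Sum>k\<in>{1..n}. measure (sum_law k) {0<..<z}) \<le> (\<Sum>k\<in>{1..n}. indicator {k. real k < \<eta> * real n} k + ?b)"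
      by (rule sum_mono[OF summand])
    also have "\<dots> = (\<Sum>k\<in>{1..n}. indicator {k. real k < \<eta> * real n} k) + real n * ?b"
      by (simp add: sum.distrib)
    also have "(\<Sum>k\<in>{1..n}. indicator {k. real k < \<eta> * real n} k) \<le> \<eta> * real n"
    proof -
      have "(\<Sum>k\<in>{1..n}. indicator {k. real k < \<eta> * real n} k :: real) = real (card ({1..n} \<inter> {k. real k < \<eta> * real n}))"
        by (simp add: indicator_def sum_of_bool_eq del: sum_of_bool_mult_eq)
      also have "card ({1..n} \<inter> {k. real k < \<eta> * real n}) \<le> card {1..nat \<lfloor>\<eta> * real n\<rfloor>}"
      proof (intro card_mono)
        show "{1..n} \<inter> {k. real k < \<eta> * real n} \<subseteq> {1..nat \<lfloor>\<eta> * real n\<rfloor>}"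
        proof
          fix k assume "k \<in> {1..n} \<inter> {k. real k < \<eta> * real n}"
          then have "1 \<le> k" "real k < \<eta> * real n" by auto
          then show "k \<in> {1..nat \<lfloor>\<eta> * real n\<rfloor>}" by (simp add: le_nat_floor)
        qed
      qed simp
      also have "real (card {1..nat \<lfloor>\<eta> * real n\<rfloor>}) \<le> \<eta> * real n" using assms by simp
      finally show ?thesis by simp
    qed
    finally show ?thesis by (simp add: algebra_simps)
  qed
  then show ?thesis using K by blast
qed

text \<open>The sum over j is cut at J, the ceiling of \<epsilon> n. Of the budget \<xi> H (x + D),
  a quarter goes to the early terms, a quarter to the tail of the series of \<open>E\<close>, and
  one half to the late terms. The sum \<open>I\<close> stays abstract until
  \<open>E_sums_integral\<close> identifies it.\<close>

theorem main_estimate: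
  assumes D: "D > 0" and \<xi>: "\<xi> > 0" and I: "\<And>x. (\<lambda>j. E j x D) sums I x"
  shows "\<exists>\<delta>>0. \<exists>N\<ge>1. \<forall>n\<ge>N. \<forall>x. 0 < x \<longrightarrow> x \<le> \<delta> * c n \<longrightarrow>
    \<bar>c n * (real n * measure (ladder_law n) {x..<x + D}) - \<gamma> * I x\<bar> \<le> \<xi> * H (x + D)"
proof -
  obtain e N1 where e: "e > 0" and N1: "\<And>n j x. n \<ge> N1 \<Longrightarrow> j \<le> n \<Longrightarrow> real j \<le> e * real n \<Longrightarrow> 0 < x \<Longrightarrow> x \<le> e * c n \<Longrightarrow>
    \<bar>c n * T n j x D - \<gamma> * E j x D\<bar> \<le> (\<xi> / 4) * U j (x + D)"
    using T_limit[OF D, of "\<xi> / 4"] \<xi> by (metis zero_less_divide_iff zero_less_numeral)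
  define \<epsilon> where "\<epsilon> = min e 1"
  have \<epsilon>: "\<epsilon> > 0" "\<epsilon> \<le> e" "\<epsilon> \<le> 1" using e by (auto simp: \<epsilon>_def)
  obtain C where C: "C > 0" "\<And>n z h. n \<ge> 1 \<Longrightarrow> h > 0 \<Longrightarrow> measure (ladder_law n) {z..<z + h} \<le> C * (1 + h) * H (z + h) / (real n * c n)"
    using ladder_law_interval_bound by meson
  obtain A where A: "\<And>m n. 1 \<le> m \<Longrightarrow> m \<le> n \<Longrightarrow> \<epsilon> * real n \<le> real m \<Longrightarrow> 1 / c m \<le> (2 / \<epsilon>) ^ A / c n"
    using c_lower_fraction \<epsilon>(1) by blast
  obtain K1 where K1: "K1 > 0" "\<And>n J N z. 1 \<le> J \<Longrightarrow> J \<le> n \<Longrightarrow> \<epsilon> * real n \<le> real J \<Longrightarrow> z > 0 \<Longrightarrow>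
    (\<Sum>j\<in>{J..<N}. U j z) \<le> K1 * ((1 + z) / c n) * H z"
    using U_tail_bound[OF \<epsilon>(1)] by meson
  define K2 where "K2 = C * (1 + D) * ((2 / \<epsilon>) ^ A / \<epsilon>)"
  have K2: "K2 > 0" using C D \<epsilon> by (simp add: K2_def)
  \<comment> \<open>\<open>K2\<close> will bound B n c n / H z for the late terms. Since
    \<open>K3\<close> depends on \<eta>, the smallness \<zeta> of (1 + z) / c n can be fixed only
    afterwards.\<close>
  define \<eta> where "\<eta> = \<xi> / (4 * K2)"
  have \<eta>: "\<eta> > 0" "K2 * \<eta> = \<xi> / 4" using \<xi> K2 by (auto simp: \<eta>_def)
  obtain K3 where K3: "K3 > 0" "\<And>n z. n \<ge> 1 \<Longrightarrow> z > 0 \<Longrightarrow>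
     (\<Sum>k\<in>{1..n}. measure (sum_law k) {0<..<z}) \<le> real n * (\<eta> + K3 * ((1 + z) / c n))"
    using sum_law_average_bound[OF \<eta>(1)] by meson
  define \<zeta> where "\<zeta> = min (\<xi> / (4 * (K2 * K3))) (\<xi> / (4 * (\<gamma> * D * K1)))"
  have \<zeta>: "\<zeta> > 0" "K2 * K3 * \<zeta> \<le> \<xi> / 4" "\<gamma> * D * K1 * \<zeta> \<le> \<xi> / 4"
  proof -
    show "\<zeta> > 0" using \<xi> K1 K2 K3 D \<gamma>_pos by (simp add: \<zeta>_def)
    have "K2 * K3 * \<zeta> \<le> K2 * K3 * (\<xi> / (4 * (K2 * K3)))" using K2 K3 by (intro mult_left_mono) (auto simp: \<zeta>_def)
    then show "K2 * K3 * \<zeta> \<le> \<xi> / 4" using K2 K3 by simp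
    have "\<gamma> * D * K1 * \<zeta> \<le> \<gamma> * D * K1 * (\<xi> / (4 * (\<gamma> * D * K1)))" using K1 D \<gamma>_pos by (intro mult_left_mono) (auto simp: \<zeta>_def)
    then show "\<gamma> * D * K1 * \<zeta> \<le> \<xi> / 4" using K1 D \<gamma>_pos by simp
  qed
  have "\<forall>\<^sub>F n in sequentially. c n > 2 * (1 + D) / \<zeta>" using filterlim_c by (simp add: filterlim_at_top_dense)
  then obtain N2 where N2: "\<And>n. n \<ge> N2 \<Longrightarrow> c n > 2 * (1 + D) / \<zeta>" by (auto simp: eventually_sequentially)
  define N where "N = max 1 (max N1 N2)"
  \<comment> \<open>One half of \<zeta> is for x and the other, through \<open>N2\<close>, for 1 +
    D; together they give (1 + z) / c n \<le> \<zeta>.\<close>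
  define \<delta> where "\<delta> = min \<epsilon> (\<zeta> / 2)"
  have \<delta>: "\<delta> > 0" using \<epsilon> \<zeta> by (simp add: \<delta>_def)
  have "\<bar>c n * (real n * measure (ladder_law n) {x..<x + D}) - \<gamma> * I x\<bar> \<le> \<xi> * H (x + D)"
    if n: "n \<ge> N" and x: "0 < x" "x \<le> \<delta> * c n" for n x
  proof -
    have n1: "n \<ge> 1" "n \<ge> N1" "n \<ge> N2" using n by (auto simp: N_def)
    have cn: "c n > 0" using n1 by (intro c_pos)
    define z where "z = x + D"
    have z: "z > 0" using x D by (simp add: z_def)
    have Hz: "H z \<ge> 0" by (rule H_nonneg)
    have xe: "x \<le> e * c n" "x \<le> (\<zeta> / 2) * c n"
    proof -
      have "\<delta> * c n \<le> e * c n" "\<delta> * c n \<le> (\<zeta> / 2) * c n" using cn \<epsilon> by (auto intro!: mult_right_mono simp: \<delta>_def)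
      then show "x \<le> e * c n" "x \<le> (\<zeta> / 2) * c n" using x by linarith+
    qed
    have small: "(1 + z) / c n \<le> \<zeta>"
    proof -
      have "1 + D \<le> (\<zeta> / 2) * c n" using N2[OF n1(3)] \<zeta>(1) by (simp add: field_simps)
      then show ?thesis using xe cn by (simp add: z_def divide_le_eq field_simps)
    qed
    define J where "J = nat \<lceil>\<epsilon> * real n\<rceil>"
    have Jpos: "\<epsilon> * real n > 0" using \<epsilon> n1 by simp
    have J: "1 \<le> J" "J \<le> n" "\<epsilon> * real n \<le> real J"
    proof -
      show "1 \<le> J" "\<epsilon> * real n \<le> real J" using Jpos unfolding J_def by linarith+
      have "\<epsilon> * real n \<le> real n" using \<epsilon> by (simp add: mult_left_le_one_le)
      then show "J \<le> n" unfolding J_def by linarith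
    qed
    have Jlt: "real j \<le> \<epsilon> * real n" if "j < J" for j using that unfolding J_def by linarith
    have cJ: "c J > 0" using J by (intro c_pos)
    have head: "\<bar>\<Sum>j<J. (c n * T n j x D - \<gamma> * E j x D)\<bar> \<le> (\<xi> / 4) * H z"
    proof -
      have "\<bar>\<Sum>j<J. (c n * T n j x D - \<gamma> * E j x D)\<bar> \<le> (\<Sum>j<J. \<bar>c n * T n j x D - \<gamma> * E j x D\<bar>)" by (rule sum_abs)
      also have "\<dots> \<le> (\<Sum>j<J. (\<xi> / 4) * U j z)"
      proof (rule sum_mono)
        fix j assume "j \<in> {..<J}"
        then have j: "j < J" by simp
        have "real j \<le> e * real n" using Jlt[OF j] mult_right_mono[OF \<epsilon>(2), of "real n"] by simp
        then show "\<bar>c n * T n j x D - \<gamma> * E j x D\<bar> \<le> (\<xi> / 4) * U j z"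
          unfolding z_def using j J x xe n1 by (intro N1) auto
      qed
      also have "\<dots> = (\<xi> / 4) * (\<Sum>j<J. U j z)" by (rule sum_distrib_left[symmetric])
      also have "\<dots> \<le> (\<xi> / 4) * H z" using \<xi> by (intro mult_left_mono sum_U_le) auto
      finally show ?thesis .
    qed
    have Etail: "0 \<le> I x - (\<Sum>j<J. E j x D)" "I x - (\<Sum>j<J. E j x D) \<le> D * (K1 * ((1 + z) / c n) * H z)"
    proof -
      have s: "summable (\<lambda>j. E j x D)" "I x = (\<Sum>j. E j x D)" using I[of x] by (auto simp: sums_iff)
      show "0 \<le> I x - (\<Sum>j<J. E j x D)"
        using sum_le_suminf[OF s(1), of "{..<J}"] s(2) E_bounds(1)[OF D] by simp
      have "(\<Sum>j. E j x D) \<le> (\<Sum>j<J. E j x D) + D * (K1 * ((1 + z) / c n) * H z)"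
      proof (rule suminf_le_const[OF s(1)])
        fix m
        have "(\<Sum>j<m. E j x D) \<le> (\<Sum>j\<in>{..<J} \<union> {J..<m}. E j x D)"
          using E_bounds(1)[OF D] by (intro sum_mono2) auto
        also have "\<dots> = (\<Sum>j<J. E j x D) + (\<Sum>j\<in>{J..<m}. E j x D)" by (rule sum.union_disjoint) auto
        also have "(\<Sum>j\<in>{J..<m}. E j x D) \<le> (\<Sum>j\<in>{J..<m}. D * U j z)"
          unfolding z_def by (intro sum_mono E_bounds D)
        also have "\<dots> = D * (\<Sum>j\<in>{J..<m}. U j z)" by (rule sum_distrib_left[symmetric])
        also have "\<dots> \<le> D * (K1 * ((1 + z) / c n) * H z)" using D J z by (intro mult_left_mono K1) auto
        finally show "(\<Sum>j<m. E j x D) \<le> (\<Sum>j<J. E j x D) + D * (K1 * ((1 + z) / c n) * H z)" by simp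
      qed
      then show "I x - (\<Sum>j<J. E j x D) \<le> D * (K1 * ((1 + z) / c n) * H z)" using s(2) by simp
    qed
    have Etail2: "\<gamma> * (I x - (\<Sum>j<J. E j x D)) \<le> (\<xi> / 4) * H z"
    proof -
      have "\<gamma> * (I x - (\<Sum>j<J. E j x D)) \<le> \<gamma> * (D * (K1 * ((1 + z) / c n) * H z))"
        using Etail \<gamma>_pos by (intro mult_left_mono) auto
      also have "\<dots> = (\<gamma> * D * K1) * ((1 + z) / c n) * H z" by (simp add: mult_ac)
      also have "\<dots> \<le> (\<gamma> * D * K1) * \<zeta> * H z" using small \<gamma>_pos D K1 Hz by (intro mult_right_mono mult_left_mono) auto
      also have "\<dots> \<le> (\<xi> / 4) * H z" using \<zeta> Hz by (intro mult_right_mono) auto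
      finally show ?thesis .
    qed
    have Ttail: "c n * (\<Sum>j\<in>{J..<n}. T n j x D) \<le> (\<xi> / 2) * H z"
    proof -
      \<comment> \<open>As c is nondecreasing, the a priori bound at J serves all later j, uniformly
        over windows that end before z.\<close>
      define B where "B = C * (1 + D) * H z / (real J * c J)"
      have B: "B \<ge> 0" using C D Hz cJ by (simp add: B_def)
      have "T n j x D \<le> B * measure (sum_law (n - j)) {0<..<x + D}" if j: "j \<in> {J..<n}" for j
      proof (rule T_le[OF B])
        fix w assume w: "w \<le> x"
        have j1: "j \<ge> 1" "J \<le> j" using j J by auto
        have "measure (ladder_law j) {w..<w + D} \<le> C * (1 + D) * H (w + D) / (real j * c j)"
          by (rule C(2)[OF j1(1) D])
        also have "\<dots> \<le> C * (1 + D) * H z / (real j * c j)"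
          using w C D c_pos[OF j1(1)] by (intro divide_right_mono mult_left_mono H_mono) (auto simp: z_def)
        also have "\<dots> \<le> B" unfolding B_def
          using C D Hz cJ J j1 c_mono[of J j] by (intro divide_left_mono mult_mono mult_pos_pos) (auto intro: c_pos)
        finally show "measure (ladder_law j) {w..<w + D} \<le> B" .
      qed
      then have "(\<Sum>j\<in>{J..<n}. T n j x D) \<le> (\<Sum>j\<in>{J..<n}. B * measure (sum_law (n - j)) {0<..<x + D})" by (rule sum_mono)
      also have "\<dots> = B * (\<Sum>j\<in>{J..<n}. measure (sum_law (n - j)) {0<..<z})" by (simp add: sum_distrib_left z_def)
      also have "(\<Sum>j\<in>{J..<n}. measure (sum_law (n - j)) {0<..<z}) = (\<Sum>k\<in>{1..n - J}. measure (sum_law k) {0<..<z})"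
        by (rule sum.reindex_bij_witness[of _ "\<lambda>k. n - k" "\<lambda>j. n - j"]) auto
      also have "\<dots> \<le> (\<Sum>k\<in>{1..n}. measure (sum_law k) {0<..<z})" by (intro sum_mono2) auto
      also have "\<dots> \<le> real n * (\<eta> + K3 * ((1 + z) / c n))" by (rule K3(2)[OF n1(1) z])
      also have "\<dots> \<le> real n * (\<eta> + K3 * \<zeta>)" using small K3 by (intro mult_left_mono add_left_mono) auto
      finally have S: "(\<Sum>j\<in>{J..<n}. T n j x D) \<le> B * (real n * (\<eta> + K3 * \<zeta>))"
        using B by (simp add: mult_left_mono)
      have BB: "B * real n * c n \<le> K2 * H z"
      proof -
        have "real n / real J \<le> 1 / \<epsilon>" using J \<epsilon> by (simp add: field_simps)
        moreover have "c n * (1 / c J) \<le> (2 / \<epsilon>) ^ A"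
          using mult_left_mono[OF A[OF J], of "c n"] cn by simp
        ultimately have "(real n / real J) * (c n * (1 / c J)) \<le> (1 / \<epsilon>) * (2 / \<epsilon>) ^ A"
          using \<epsilon> cn cJ by (intro mult_mono) auto
        then have "(C * (1 + D) * H z) * ((real n / real J) * (c n * (1 / c J))) \<le> (C * (1 + D) * H z) * ((1 / \<epsilon>) * (2 / \<epsilon>) ^ A)"
          using C D Hz by (intro mult_left_mono) auto
        then show ?thesis by (simp add: B_def K2_def mult_ac)
      qed
      have "c n * (\<Sum>j\<in>{J..<n}. T n j x D) \<le> c n * (B * (real n * (\<eta> + K3 * \<zeta>)))"
        using S cn by (intro mult_left_mono) auto
      also have "\<dots> = (B * real n * c n) * (\<eta> + K3 * \<zeta>)" by (simp add: mult_ac)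
      also have "\<dots> \<le> (K2 * H z) * (\<eta> + K3 * \<zeta>)" using BB \<eta> K3 \<zeta> by (intro mult_right_mono) auto
      also have "\<dots> = (K2 * \<eta> + K2 * K3 * \<zeta>) * H z" by (simp add: algebra_simps)
      also have "\<dots> \<le> (\<xi> / 4 + \<xi> / 4) * H z" using \<eta> \<zeta> Hz by (intro mult_right_mono add_mono) auto
      finally show ?thesis by simp
    qed
    have Tnn: "0 \<le> c n * (\<Sum>j\<in>{J..<n}. T n j x D)" using cn by (intro mult_nonneg_nonneg sum_nonneg T_nonneg) auto
    have "(\<Sum>j<n. T n j x D) = (\<Sum>j<J. T n j x D) + (\<Sum>j\<in>{J..<n}. T n j x D)"
    proof -
      have "{..<n} = {..<J} \<union> {J..<n}" using J by auto
      moreover have "(\<Sum>j\<in>{..<J} \<union> {J..<n}. T n j x D) = (\<Sum>j<J. T n j x D) + (\<Sum>j\<in>{J..<n}. T n j x D)"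
        by (rule sum.union_disjoint) auto
      ultimately show ?thesis by metis
    qed
    moreover have "(\<Sum>j<J. (c n * T n j x D - \<gamma> * E j x D)) = c n * (\<Sum>j<J. T n j x D) - \<gamma> * (\<Sum>j<J. E j x D)"
      by (simp only: sum_subtractf sum_distrib_left)
    ultimately have "c n * (real n * measure (ladder_law n) {x..<x + D}) - \<gamma> * I x
      = (\<Sum>j<J. (c n * T n j x D - \<gamma> * E j x D)) + c n * (\<Sum>j\<in>{J..<n}. T n j x D) - \<gamma> * (I x - (\<Sum>j<J. E j x D))"
      unfolding ladder_law_identity by (simp only: distrib_left right_diff_distrib)
    moreover have "0 \<le> \<gamma> * (I x - (\<Sum>j<J. E j x D))" using Etail(1) \<gamma>_pos by simp
    moreover have "(\<xi> / 4) * H z + (\<xi> / 2) * H z + (\<xi> / 4) * H z = \<xi> * H z" by (simp add: algebra_simps)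
    ultimately show ?thesis using head Etail2 Ttail Tnn unfolding z_def[symmetric] abs_le_iff by linarith
  qed
  then show ?thesis using \<delta> by (intro exI[of _ \<delta>] conjI exI[of _ N]) (auto simp: N_def)
qed

text \<open>The length \<open>len x D y\<close> is the integral over u in [x, x + D] of the
  indicator of y < u. Fubini turns \<open>E j\<close> into an integral of the ladder distribution
  function at u, and summation over j yields \<open>H\<close>.\<close>

lemma E_sums_integral:
  assumes D: "D > 0"
  shows "(\<lambda>j. E j x D) sums integral {x..x + D} H" and "H x * D \<le> integral {x..x + D} H"
proof -
  have setint: "set_integrable lborel {x..x + D} H"
    unfolding set_integrable_def real_scaleR_def
  proof (rule Bochner_Integration.integrable_bound[of _ "\<lambda>u. H (x + D) * indicator {x..x + D} u"])
    show "integrable lborel (\<lambda>u. H (x + D) * indicator {x..x + D} u)" using D by (intro integrable_mult_right integrable_real_indicator) auto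
    show "AE u in lborel. norm (indicator {x..x + D} u * H u) \<le> norm (H (x + D) * indicator {x..x + D} u)"
      using H_mono H_nonneg by (auto simp: indicator_def)
  qed measurable
  have I: "integral {x..x + D} H = (\<integral>u. indicator {x..x + D} u * H u \<partial>lborel)"
    using set_borel_integral_eq_integral(2)[OF setint] by (simp add: set_lebesgue_integral_def)
  have int: "integrable lborel (\<lambda>u. indicator {x..x + D} u * H u)" using setint by (simp add: set_integrable_def)
  have Ej: "(\<integral>\<^sup>+u. indicator {x..x + D} u * emeasure (ladder_law j) {..<u} \<partial>lborel) = ennreal (E j x D)" for j
  proof -
    interpret u: finite_measure "ladder_law j" by (rule finite_ladder_law)
    interpret P: pair_sigma_finite lborel "ladder_law j" ..
    have "(\<integral>\<^sup>+u. indicator {x..x + D} u * emeasure (ladder_law j) {..<u} \<partial>lborel)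
      = (\<integral>\<^sup>+u. \<integral>\<^sup>+y. of_bool (x \<le> u \<and> u \<le> x + D \<and> y < u) \<partial>ladder_law j \<partial>lborel)"
    proof (intro nn_integral_cong)
      fix u
      have "emeasure (ladder_law j) {..<u} = (\<integral>\<^sup>+y. indicator {..<u} y \<partial>ladder_law j)"
        by (rule nn_integral_indicator[symmetric]) simp
      then have "indicator {x..x + D} u * emeasure (ladder_law j) {..<u} = (\<integral>\<^sup>+y. indicator {x..x + D} u * indicator {..<u} y \<partial>ladder_law j)"
        by (subst nn_integral_cmult) auto
      also have "\<dots> = (\<integral>\<^sup>+y. of_bool (x \<le> u \<and> u \<le> x + D \<and> y < u) \<partial>ladder_law j)"
        by (intro nn_integral_cong) (auto simp: indicator_def)
      finally show "indicator {x..x + D} u * emeasure (ladder_law j) {..<u} = (\<integral>\<^sup>+y. of_bool (x \<le> u \<and> u \<le> x + D \<and> y < u) \<partial>ladder_law j)" .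
    qed
    also have "\<dots> = (\<integral>\<^sup>+y. \<integral>\<^sup>+u. of_bool (x \<le> u \<and> u \<le> x + D \<and> y < u) \<partial>lborel \<partial>ladder_law j)"
      by (rule P.Fubini'[symmetric]) measurable
    also have "\<dots> = (\<integral>\<^sup>+y. ennreal (len x D y) \<partial>ladder_law j)"
    proof (intro nn_integral_cong)
      fix y
      have "(\<integral>\<^sup>+u. of_bool (x \<le> u \<and> u \<le> x + D \<and> y < u) \<partial>lborel) = (\<integral>\<^sup>+u. indicator (if y < x then {x..x + D} else {y<..x + D}) u \<partial>lborel)"
        by (intro nn_integral_cong) (auto simp: indicator_def)
      also have "\<dots> = emeasure lborel (if y < x then {x..x + D} else {y<..x + D})"
        by (rule nn_integral_indicator) auto
      also have "\<dots> = ennreal (len x D y)"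
        using D by (auto simp: len_def max_def)
      finally show "(\<integral>\<^sup>+u. of_bool (x \<le> u \<and> u \<le> x + D \<and> y < u) \<partial>lborel) = ennreal (len x D y)" .
    qed
    also have "\<dots> = ennreal (E j x D)"
      unfolding E_def using len_bounds[OF D] by (intro nn_integral_eq_integral integrable_ladder_law[of _ D] AE_I2) auto
    finally show ?thesis .
  qed
  have "(\<Sum>j. ennreal (E j x D)) = (\<integral>\<^sup>+u. (\<Sum>j. indicator {x..x + D} u * emeasure (ladder_law j) {..<u}) \<partial>lborel)"
    unfolding Ej[symmetric] by (rule nn_integral_suminf[symmetric]) measurable
  also have "\<dots> = (\<integral>\<^sup>+u. ennreal (indicator {x..x + D} u * H u) \<partial>lborel)"
    by (intro nn_integral_cong) (simp add: renewal_def[symmetric] renewal_eq_H indicator_def)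
  also have "\<dots> = ennreal (integral {x..x + D} H)"
    unfolding I by (rule nn_integral_eq_integral[OF int]) (simp add: H_nonneg)
  finally have eq: "(\<Sum>j. ennreal (E j x D)) = ennreal (integral {x..x + D} H)" .
  have Inn: "0 \<le> integral {x..x + D} H" unfolding I by (intro integral_nonneg_AE AE_I2) (simp add: H_nonneg)
  have s: "summable (\<lambda>j. E j x D)"
    using eq by (intro summable_suminf_not_top E_bounds D) auto
  have "ennreal (\<Sum>j. E j x D) = ennreal (integral {x..x + D} H)"
    using eq s E_bounds(1)[OF D] by (subst suminf_ennreal2[symmetric]) auto
  then have "(\<Sum>j. E j x D) = integral {x..x + D} H"
    using Inn suminf_nonneg[OF s E_bounds(1)[OF D]] by (subst (asm) ennreal_inj) auto
  then show "(\<lambda>j. E j x D) sums integral {x..x + D} H" using s by (simp add: sums_iff)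
  have "H x * D = (\<integral>u. H x * indicator {x..x + D} u \<partial>lborel)" using D by simp
  also have "\<dots> \<le> integral {x..x + D} H"
    unfolding I
  proof (rule integral_mono[OF _ int])
    show "integrable lborel (\<lambda>u. H x * indicator {x..x + D} u)" using D by (intro integrable_mult_right integrable_real_indicator) auto
    fix u show "H x * indicator {x..x + D} u \<le> indicator {x..x + D} u * H u"
      using H_mono[of x u] by (auto simp: indicator_def)
  qed
  finally show "H x * D \<le> integral {x..x + D} H" .
qed

text \<open>The absolute error, proportional to H (x + D), becomes relative through H (x + D) \<le>
  (1 + H D) H x and D H x \<le> integral of \<open>H\<close>; the choice of \<xi>' cancels these
  constants.\<close>

theorem ratio_estimate:
  assumes D: "D > 0" and \<xi>: "\<xi> > 0"
  shows "\<exists>\<delta>>0. \<exists>N\<ge>1. \<forall>n\<ge>N. \<forall>x. 0 < x \<longrightarrow> x \<le> \<delta> * c n \<longrightarrow>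
    0 < integral {x..x + D} H \<and> \<bar>c n * (real n * measure (ladder_law n) {x..<x + D}) / (\<gamma> * integral {x..x + D} H) - 1\<bar> \<le> \<xi>"
proof -
  define \<xi>' where "\<xi>' = \<xi> * \<gamma> * D / (1 + H D)"
  have HD: "1 + H D > 0" using H_nonneg[of D] by linarith
  have \<xi>': "\<xi>' > 0" using \<xi> \<gamma>_pos D HD by (simp add: \<xi>'_def)
  obtain \<delta> N where \<delta>: "\<delta> > 0" "N \<ge> 1" and est: "\<And>n x. n \<ge> N \<Longrightarrow> 0 < x \<Longrightarrow> x \<le> \<delta> * c n \<Longrightarrow>
    \<bar>c n * (real n * measure (ladder_law n) {x..<x + D}) - \<gamma> * integral {x..x + D} H\<bar> \<le> \<xi>' * H (x + D)"
    using main_estimate[OF D \<xi>' E_sums_integral(1)[OF D]] by metis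
  have "0 < integral {x..x + D} H \<and> \<bar>c n * (real n * measure (ladder_law n) {x..<x + D}) / (\<gamma> * integral {x..x + D} H) - 1\<bar> \<le> \<xi>"
    if n: "n \<ge> N" and x: "0 < x" "x \<le> \<delta> * c n" for n x
  proof
    let ?I = "integral {x..x + D} H" and ?L = "c n * (real n * measure (ladder_law n) {x..<x + D})"
    have "1 * D \<le> H x * D" using H_ge_1[OF x(1)] D by (intro mult_right_mono) auto
    then show I: "0 < ?I" using E_sums_integral(2)[OF D, of x] D by linarith
    have "\<bar>?L - \<gamma> * ?I\<bar> \<le> \<xi>' * H (x + D)" by (rule est[OF n x])
    also have "\<dots> \<le> \<xi>' * ((1 + H D) * H x)" using \<xi>' by (intro mult_left_mono H_add_le_mult x) auto
    also have "\<dots> = \<xi> * \<gamma> * (H x * D)" using HD by (simp add: \<xi>'_def)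
    also have "\<dots> \<le> \<xi> * \<gamma> * ?I" using \<xi> \<gamma>_pos by (intro mult_left_mono E_sums_integral(2) D) auto
    finally have le: "\<bar>?L - \<gamma> * ?I\<bar> \<le> \<xi> * (\<gamma> * ?I)" by simp
    have gI: "\<gamma> * ?I > 0" using I \<gamma>_pos by simp
    have "\<bar>?L / (\<gamma> * ?I) - 1\<bar> = \<bar>?L - \<gamma> * ?I\<bar> / (\<gamma> * ?I)"
    proof -
      have "?L / (\<gamma> * ?I) - 1 = (?L - \<gamma> * ?I) / (\<gamma> * ?I)" using I \<gamma>_pos by (simp add: diff_divide_distrib)
      then show ?thesis using gI by (simp only: abs_divide abs_of_pos)
    qed
    also have "\<dots> \<le> \<xi>" using le gI by (simp only: pos_divide_le_eq)
    finally show "\<bar>?L / (\<gamma> * ?I) - 1\<bar> \<le> \<xi>" .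
  qed
  then show ?thesis using \<delta> by blast
qed

end

section \<open>Random walks on a probability space\<close>

locale iid_walk = prob_space M for M :: "'a measure" +
  fixes X :: "nat \<Rightarrow> 'a \<Rightarrow> real"
  assumes indep: "indep_vars (\<lambda>_. borel) X UNIV"
    and ident: "\<And>i. distr M borel (X i) = distr M borel (X 0)"
begin

lemma X_measurable [measurable]: "X i \<in> borel_measurable M"
  using indep by (simp add: indep_vars_def)

lemma walk_measurable [measurable]: "walk X n \<in> borel_measurable M"
  unfolding walk_def[abs_def] by measurable

lemma real_distribution_step: "real_distribution (distr M borel (X 0))"
  by simp

sublocale W: walk_law "distr M borel (X 0)"
  by (intro walk_law.intro real_distribution_step)

text \<open>The generic variable \<open>X 0\<close> is not a step of the walk, so coordinate i of
  the sequence space is \<open>X (Suc i)\<close>.\<close>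

definition steps :: "'a \<Rightarrow> nat \<Rightarrow> real" where
  "steps \<omega> i = X (Suc i) \<omega>"

lemma steps_measurable [measurable]: "steps \<in> measurable M seq_borel"
  unfolding steps_def[abs_def] by (rule measurable_PiM_single') auto

lemma walk_eq_psum: "walk X n \<omega> = psum n (steps \<omega>)"
  unfolding walk_def psum_def steps_def
  by (rule sum.reindex_bij_witness[of _ Suc "\<lambda>i. i - 1"]) auto

lemma distr_steps: "distr M seq_borel steps = W.Q"
proof -
  have "indep_vars (\<lambda>i. borel) (\<lambda>i. X (Suc i)) UNIV"
    unfolding indep_vars_def2
  proof
    show "indep_sets (\<lambda>i. {X (Suc i) -` A \<inter> space M |A. A \<in> sets borel}) UNIV"
      unfolding indep_sets_def
    proof (intro conjI ballI allI impI)
      fix i show "{X (Suc i) -` A \<inter> space M |A. A \<in> sets borel} \<subseteq> events" by auto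
    next
      fix J and A :: "nat \<Rightarrow> 'a set"
      assume J: "J \<subseteq> UNIV" "J \<noteq> {}" "finite J"
        and A: "A \<in> (\<Pi> i\<in>J. {X (Suc i) -` A \<inter> space M |A. A \<in> sets borel})"
      have "indep_sets (\<lambda>i. {X i -` A \<inter> space M |A. A \<in> sets borel}) UNIV"
        using indep by (simp add: indep_vars_def2)
      then have "prob (\<Inter>j\<in>Suc ` J. A (j - 1)) = (\<Prod>j\<in>Suc ` J. prob (A (j - 1)))"
        using J A by (intro indep_setsD) auto
      then show "prob (\<Inter>j\<in>J. A j) = (\<Prod>j\<in>J. prob (A j))"
        by (simp add: prod.reindex)
    qed
  qed auto
  then have "distr M seq_borel (\<lambda>\<omega>. \<lambda>i\<in>UNIV. X (Suc i) \<omega>) = PiM UNIV (\<lambda>i. distr M borel (X (Suc i)))"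
    by (subst (asm) indep_vars_iff_distr_eq_PiM) auto
  moreover have "PiM UNIV (\<lambda>i. distr M borel (X (Suc i))) = W.Q" by (intro PiM_cong refl ident)
  ultimately show ?thesis by (simp add: steps_def[abs_def] restrict_def)
qed

lemma emeasure_steps:
  assumes [measurable]: "Measurable.pred seq_borel P"
  shows "emeasure M {\<omega> \<in> space M. P (steps \<omega>)} = emeasure W.Q {x. P x}"
proof -
  have "{x. P x} \<in> sets seq_borel" using assms by (simp add: pred_def space_PiM)
  then have "emeasure (distr M seq_borel steps) {x. P x} = emeasure M (steps -` {x. P x} \<inter> space M)"
    by (intro emeasure_distr) auto
  also have "steps -` {x. P x} \<inter> space M = {\<omega> \<in> space M. P (steps \<omega>)}" by auto
  finally show ?thesis by (simp add: distr_steps)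
qed

lemma distr_walk: "distr M borel (walk X n) = W.sum_law n"
proof -
  have "W.sum_law n = distr (distr M seq_borel steps) borel (psum n)"
    by (simp add: W.sum_law_def distr_steps)
  also have "\<dots> = distr M borel (walk X n)"
    by (subst distr_distr) (auto simp: comp_def walk_eq_psum intro!: distr_cong)
  finally show ?thesis by simp
qed

lemma char_sum_law: "char (W.sum_law n) t = char (distr M borel (X 0)) t ^ n"
proof -
  have "char (W.sum_law n) t = char (distr M borel (\<lambda>\<omega>. \<Sum>i\<in>{1..n}. X i \<omega>)) t"
    by (simp add: distr_walk[symmetric] walk_def[abs_def])
  also have "\<dots> = (\<Prod>i\<in>{1..n}. char (distr M borel (X i)) t)"
    by (intro char_distr_sum indep_vars_subset[OF indep]) auto
  also have "\<dots> = (\<Prod>i\<in>{1..n}. char (distr M borel (X 0)) t)"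
    by (intro prod.cong refl arg_cong2[where f = char] ident)
  also have "\<dots> = char (distr M borel (X 0)) t ^ n" by simp
  finally show ?thesis .
qed

lemma char_walk_scaled: "char (distr M borel (\<lambda>\<omega>. walk X n \<omega> / r)) t = char (distr M borel (X 0)) (t / r) ^ n"
proof -
  have "char (distr M borel (\<lambda>\<omega>. walk X n \<omega> / r)) t = char (distr M borel (walk X n)) (t / r)"
    by (simp add: char_def integral_distr)
  then show ?thesis by (simp add: distr_walk char_sum_law)
qed

lemma tau_minus_gt_iff: "tau_minus X \<omega> > enat n \<longleftrightarrow> stays_pos n (steps \<omega>)"
proof -
  let ?A = "{k. 1 \<le> k \<and> walk X k \<omega> \<le> 0}"
  have "tau_minus X \<omega> \<le> enat n \<longleftrightarrow> (\<exists>k\<in>?A. k \<le> n)"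
  proof
    assume le: "tau_minus X \<omega> \<le> enat n"
    have "?A \<noteq> {}"
    proof
      assume "?A = {}"
      then have "tau_minus X \<omega> = Inf {}" unfolding tau_minus_def by (simp only: image_empty)
      then show False using le by (simp add: Inf_enat_def)
    qed
    then obtain k where "k \<in> ?A" by blast
    then have "tau_minus X \<omega> \<in> enat ` ?A"
      unfolding tau_minus_def by (intro wellorder_InfI[of "enat k"] imageI)
    then show "\<exists>k\<in>?A. k \<le> n" using le by auto
  next
    assume "\<exists>k\<in>?A. k \<le> n"
    then obtain k where k: "k \<in> ?A" "k \<le> n" by blast
    then have "tau_minus X \<omega> \<le> enat k" unfolding tau_minus_def by (intro Inf_lower) auto
    then show "tau_minus X \<omega> \<le> enat n" using k by (meson enat_ord_simps(1) order_trans)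
  qed
  then show ?thesis unfolding stays_pos_def by (auto simp: not_le[symmetric] walk_eq_psum)
qed

lemma chi_plus_eq_height:
  assumes "\<exists>k. psum k (steps \<omega>) > 0" shows "chi_plus X \<omega> = W.height (steps \<omega>)"
proof -
  let ?k = "LEAST k. psum k (steps \<omega>) > 0"
  have k: "psum ?k (steps \<omega>) > 0" using assms by (rule LeastI_ex)
  then have k1: "1 \<le> ?k" by (metis less_irrefl not_one_le_zero not_less_eq_eq One_nat_def le_zero_eq psum_0 not_less_eq_eq)
  have "tau_plus X \<omega> = enat ?k"
    unfolding tau_plus_def
  proof (rule antisym)
    show "Inf (enat ` {n. 1 \<le> n \<and> walk X n \<omega> > 0}) \<le> enat ?k"
      using k k1 by (intro Inf_lower) (auto simp: walk_eq_psum)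
    show "enat ?k \<le> Inf (enat ` {n. 1 \<le> n \<and> walk X n \<omega> > 0})"
      by (intro Inf_greatest) (auto simp: walk_eq_psum intro: Least_le)
  qed
  then show ?thesis by (simp add: chi_plus_def W.height_def walk_eq_psum)
qed

lemma chi_plus_measurable [measurable]: "chi_plus X \<in> borel_measurable M"
proof -
  \<comment> \<open>Off the event that some sum is positive, the arbitrary value is the walk at one
    fixed index, so measurability holds everywhere and not only almost everywhere.\<close>
  have "chi_plus X \<omega> = (if \<exists>k. psum k (steps \<omega>) > 0 then W.height (steps \<omega>) else walk X (the_enat \<infinity>) \<omega>)" for \<omega>
  proof (cases "\<exists>k. psum k (steps \<omega>) > 0")
    case False
    then have "{n. 1 \<le> n \<and> walk X n \<omega> > 0} = {}" by (auto simp: walk_eq_psum)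
    then have "tau_plus X \<omega> = \<infinity>" unfolding tau_plus_def by (simp only: image_empty) (simp add: Inf_enat_def)
    then show ?thesis using False by (simp add: chi_plus_def)
  qed (simp add: chi_plus_eq_height)
  then show ?thesis by (subst measurable_cong) (assumption, measurable)
qed

lemma distr_chi_plus:
  assumes ae: "AE x in W.Q. \<exists>k. psum k x > 0"
  shows "distr M borel (chi_plus X) = W.height_law"
proof -
  have "AE x in distr M seq_borel steps. \<exists>k. psum k x > 0" using ae unfolding distr_steps .
  then have "AE \<omega> in M. \<exists>k. psum k (steps \<omega>) > 0"
    by (subst (asm) AE_distr_iff) auto
  then have "AE \<omega> in M. chi_plus X \<omega> = W.height (steps \<omega>)"
    by eventually_elim (rule chi_plus_eq_height)
  then have "distr M borel (chi_plus X) = distr M borel (\<lambda>\<omega>. W.height (steps \<omega>))"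
    by (intro distr_cong_AE) auto
  also have "\<dots> = distr (distr M seq_borel steps) borel W.height"
    by (subst distr_distr) (auto simp: comp_def)
  finally show ?thesis by (simp add: W.height_law_def distr_steps)
qed

lemma prob_walk_tau_minus:
  assumes [measurable]: "B \<in> sets borel"
  shows "\<P>(\<omega> in M. walk X n \<omega> \<in> B \<and> tau_minus X \<omega> > enat n) = measure (W.ladder_law n) B"
proof -
  have "emeasure M {\<omega> \<in> space M. walk X n \<omega> \<in> B \<and> tau_minus X \<omega> > enat n} = emeasure (W.ladder_law n) B"
    using emeasure_steps[of "\<lambda>x. stays_pos n x \<and> psum n x \<in> B"]
    by (simp add: W.emeasure_ladder_law_stays_pos tau_minus_gt_iff walk_eq_psum conj_commute)
  then show ?thesis by (simp add: measure_def)
qed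

lemma prob_tau_minus: "\<P>(\<omega> in M. tau_minus X \<omega> > enat n) = measure (W.ladder_law n) UNIV"
  using prob_walk_tau_minus[of UNIV n] by simp

end

section \<open>Verification of the analytic hypotheses for the given walk\<close>

lemma AE_zero_if_truncated_moments_zero:
  assumes F: "real_distribution F" and z: "\<And>u. u > 0 \<Longrightarrow> truncated_moment F u \<le> 0"
  shows "AE x in F. x = 0"
proof -
  interpret real_distribution F by (rule F)
  have "AE x in F. \<bar>x\<bar> \<le> real (Suc k) \<longrightarrow> x = 0" for k
  proof -
    let ?u = "real (Suc k)"
    let ?f = "\<lambda>x. indicator {-?u..?u} x * x\<^sup>2 :: real"
    have "\<bar>?f x\<bar> \<le> ?u\<^sup>2" for x
      using abs_le_square_iff[of x ?u] by (auto simp: indicator_def abs_le_iff)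
    then have int: "integrable F ?f" by (intro integrable_const_bound[where B = "?u\<^sup>2"]) auto
    have "truncated_moment F ?u = integral\<^sup>L F ?f / ?u\<^sup>2"
      by (simp add: truncated_moment_def set_lebesgue_integral_def)
    then have "integral\<^sup>L F ?f / ?u\<^sup>2 \<le> 0" using z[of ?u] by simp
    then have "integral\<^sup>L F ?f \<le> 0" by (simp add: divide_le_0_iff)
    moreover have "integral\<^sup>L F ?f \<ge> 0" by (intro integral_nonneg_AE) auto
    ultimately have "integral\<^sup>L F ?f = 0" by linarith
    then have "AE x in F. ?f x = 0" by (subst (asm) integral_nonneg_eq_0_iff_AE[OF int]) auto
    then show ?thesis by eventually_elim (auto simp: indicator_def abs_le_iff split: if_splits)
  qed
  then have "AE x in F. \<forall>k. \<bar>x\<bar> \<le> real (Suc k) \<longrightarrow> x = 0" unfolding AE_all_countable by blast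
  then show ?thesis
  proof eventually_elim
    case (elim x)
    obtain k where "\<bar>x\<bar> \<le> real k" using real_arch_simple by blast
    then have "\<bar>x\<bar> \<le> real (Suc k)" by simp
    then show ?case using elim by blast
  qed
qed

lemma emeasure_greaterThan_0_witness:
  fixes \<nu> :: "real measure"
  assumes [simp]: "sets \<nu> = sets borel" and pos: "emeasure \<nu> {0<..} > 0"
  shows "\<exists>b>0. emeasure \<nu> {b<..} > 0"
proof (rule ccontr)
  assume "\<not> ?thesis"
  then have 0: "emeasure \<nu> {b<..} = 0" if "b > 0" for b using that by (metis not_gr_zero)
  have "{0<..} = (\<Union>k. {1 / real (Suc k)<..})"
  proof (intro equalityI subsetI)
    fix x :: real assume "x \<in> {0<..}"
    then obtain k where "1 / real (Suc k) < x" using nat_approx_posE[of x] by auto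
    then show "x \<in> (\<Union>k. {1 / real (Suc k)<..})" by blast
  next
    fix x :: real assume "x \<in> (\<Union>k. {1 / real (Suc k)<..})"
    then obtain k where "1 / real (Suc k) < x" by blast
    moreover have "0 < 1 / real (Suc k)" by simp
    ultimately show "x \<in> {0<..}" by (simp only: greaterThan_iff order.strict_trans)
  qed
  moreover have "emeasure \<nu> (\<Union>k. {1 / real (Suc k)<..}) = 0"
    by (rule emeasure_UN_eq_0) (auto simp: 0)
  ultimately show False using pos by simp
qed

lemma density_greaterThan_0:
  assumes L: "real_distribution L" and g: "is_continuous_density L g" and g0: "g 0 > 0"
  shows "emeasure L {0<..} > 0"
proof -
  interpret real_distribution L by (rule L)
  have "\<forall>\<^sub>F k in sequentially. measure L {0<..1 / real (Suc k)} * real (Suc k) > 0"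
    by (rule order_tendstoD(1)[OF measure_density_near_0[OF L g] g0])
  then obtain k where "measure L {0<..1 / real (Suc k)} * real (Suc k) > 0"
    by (auto dest: eventually_happens)
  then have "measure L {0<..1 / real (Suc k)} > 0" by (simp add: zero_less_mult_iff)
  also have "\<dots> \<le> measure L {0<..}" by (intro finite_measure_mono) auto
  finally show ?thesis by (simp add: emeasure_eq_measure)
qed

lemma norm_stable_cf: "cmod (stable_cf \<alpha> \<beta> \<kappa> t) = exp (- \<kappa> * \<bar>t\<bar> powr \<alpha>)"
  by (simp add: stable_cf_def)

context iid_walk
begin

lemma weak_limit_greaterThan:
  assumes w: "weak_conv_m (\<lambda>n. distr M borel (\<lambda>\<omega>. walk X n \<omega> / c n)) L"
    and L: "real_distribution L" and g: "is_continuous_density L g"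
    and c: "\<And>n. n \<ge> 1 \<Longrightarrow> c n > 0" and p: "measure L {b<..} > p"
  shows "\<forall>\<^sub>F n in sequentially. emeasure (W.sum_law n) {b * c n<..} \<ge> ennreal p"
proof -
  interpret L: real_distribution L by (rule L)
  have Lg: "L = density lborel (\<lambda>y. ennreal (g y))" and "continuous_on UNIV g"
    using g by (auto simp: is_continuous_density_def)
  then have "g \<in> borel_measurable borel" by (simp add: borel_measurable_continuous_onI)
  then have "emeasure L {b} = 0"
    by (subst Lg, subst emeasure_density) (auto intro!: nn_integral_null_set)
  then have "isCont (cdf L) b" by (simp add: L.isCont_cdf measure_def)
  then have "(\<lambda>n. 1 - cdf (distr M borel (\<lambda>\<omega>. walk X n \<omega> / c n)) b) \<longlonglongrightarrow> 1 - cdf L b"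
    using w by (intro tendsto_intros) (simp add: weak_conv_m_def weak_conv_def)
  moreover have "1 - cdf L b = measure L {b<..}"
    using L.prob_compl[of "{..b}"] by (simp add: cdf_def Compl_eq_Diff_UNIV[symmetric])
  ultimately have "\<forall>\<^sub>F n in sequentially. 1 - cdf (distr M borel (\<lambda>\<omega>. walk X n \<omega> / c n)) b > p"
    using p by (intro order_tendstoD(1)) auto
  then show ?thesis
    using eventually_ge_at_top[of 1]
  proof eventually_elim
    case (elim n)
    have cn: "c n > 0" using c elim by simp
    interpret D: real_distribution "distr M borel (\<lambda>\<omega>. walk X n \<omega> / c n)" by simp
    have "p < measure (distr M borel (\<lambda>\<omega>. walk X n \<omega> / c n)) {b<..}"
      using elim D.prob_compl[of "{..b}"] by (simp add: cdf_def Compl_eq_Diff_UNIV[symmetric])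
    also have "\<dots> = measure (distr M borel (walk X n)) {b * c n<..}"
      using cn by (simp add: measure_distr vimage_def less_divide_eq)
    also have "\<dots> = measure (W.sum_law n) {b * c n<..}" by (simp add: distr_walk)
    finally show ?case
      using finite_measure.emeasure_eq_measure[OF prob_space.finite_measure[OF W.prob_space_sum_law]]
      by (simp add: ennreal_leI)
  qed
qed

lemma step_greaterThan_0:
  assumes "emeasure (W.sum_law n) {b<..} > 0" "b \<ge> 0"
  shows "emeasure (distr M borel (X 0)) {0<..} > 0"
proof (rule ccontr)
  assume "\<not> ?thesis"
  then have 0: "emeasure (distr M borel (X i)) {0<..} = 0" for i by (subst ident) (simp add: not_less)
  have "AE \<omega> in M. X i \<omega> \<le> 0" for i
  proof -
    have "AE x in distr M borel (X i). \<not> x \<in> {0<..}"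
      using 0[of i] by (intro AE_not_in) (auto simp: null_sets_def)
    then show ?thesis by (subst (asm) AE_distr_iff) (auto simp: not_less)
  qed
  then have "AE \<omega> in M. \<forall>i. X i \<omega> \<le> 0" by (simp add: AE_all_countable)
  then have "AE \<omega> in M. \<not> walk X n \<omega> \<in> {b<..}"
  proof eventually_elim
    case (elim \<omega>)
    then have "walk X n \<omega> \<le> 0" unfolding walk_def by (intro sum_nonpos) auto
    then show ?case using \<open>b \<ge> 0\<close> by auto
  qed
  then have "AE s in distr M borel (walk X n). \<not> s \<in> {b<..}" by (subst AE_distr_iff) auto
  then have "emeasure (distr M borel (walk X n)) {b<..} = 0"
    by (subst (asm) AE_iff_measurable[where N = "{b<..}"]) auto
  then show False using assms by (simp add: distr_walk)
qed

text \<open>Positivity of g 0 gives the limit law mass beyond some b > 0. Hence P(S_n > b c n) stays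
  bounded away from 0, which makes the walk positive almost surely at some time and also yields a
  level reached by one step.\<close>

theorem walk_limit_data:
  assumes ab: "(\<alpha>, \<beta>) \<in> stable_params" and norm: "norming_sequence (distr M borel (X 0)) c"
    and D: "in_class_D M X c \<alpha> \<beta> \<kappa> L" and g: "is_continuous_density L g"
    and nl: "\<not> lattice_distribution (distr M borel (X 0))"
  shows "\<exists>a. walk_limit (distr M borel (X 0)) c (stable_cf \<alpha> \<beta> \<kappa>) \<kappa> \<alpha> (g 0) a"
    and "AE x in W.Q. \<exists>k. psum k x > 0"
proof -
  let ?F = "distr M borel (X 0)" and ?\<psi> = "stable_cf \<alpha> \<beta> \<kappa>"
  have L: "real_distribution L" and cL: "char L = ?\<psi>" and \<kappa>: "\<kappa> > 0"
    and w: "weak_conv_m (\<lambda>n. distr M borel (\<lambda>\<omega>. walk X n \<omega> / c n)) L"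
    using D by (auto simp: in_class_D_def is_stable_law_def)
  interpret L: real_distribution L by (rule L)
  have c_pos: "c n > 0" if "n \<ge> 1" for n using norm that by (simp add: norming_sequence_def)
  have less_1: "cmod (char ?F s) < 1" if "s \<noteq> 0" for s
    using char_norm_less_1[OF real_distribution_step nl that] .
  \<comment> \<open>If all truncated moments vanished, the step law would be the unit mass at 0,
    with characteristic function 1 at 1, against \<open>less_1\<close>.\<close>
  have nz: "\<exists>u>0. truncated_moment ?F u > 0"
  proof (rule ccontr)
    assume "\<not> ?thesis"
    then have "AE x in ?F. x = 0"
      by (intro AE_zero_if_truncated_moments_zero real_distribution_step) (meson not_less)
    then have "char ?F 1 = (\<integral>x. 1 \<partial>?F)" unfolding char_def by (intro integral_cong_AE) auto
    then show False using less_1[of 1] prob_space.prob_space[OF W.prob_space_F] by simp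
  qed
  interpret S: stable_norming ?F c ?\<psi> \<kappa> \<alpha>
  proof (intro stable_norming.intro stable_norming_axioms.intro real_distribution_step)
    show "\<exists>N. \<forall>m\<ge>N. \<forall>n\<ge>m. c m * sqrt (real n) \<le> c n * sqrt (real m)"
      by (rule norming_sequence_growth[OF real_distribution_step norm nz])
    show "\<exists>N. \<forall>n\<ge>N. \<forall>t. \<bar>t\<bar> \<le> T \<longrightarrow> cmod (char ?F (t / c n) ^ n - ?\<psi> t) < \<epsilon>" if "\<epsilon> > 0" for T \<epsilon>
      using char_uniform_convergence[OF _ L w that, of T] by (simp add: char_walk_scaled cL)
    show "c m \<le> c n" if "1 \<le> m" "m \<le> n" for m n
      using norm that by (auto simp: norming_sequence_def mono_on_def)
    show "isCont ?\<psi> t" for t using L.isCont_char[of t] by (simp add: cL)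
    show "?\<psi> 0 = 1" using L.char_zero by (simp add: cL)
  qed (use c_pos \<kappa> stable_angle[OF ab] in \<open>auto simp: norm_stable_cf\<close>)
  have int: "integrable lborel ?\<psi>" by (rule S.integrable_\<psi>)
  then have inv: "(\<integral>t. ?\<psi> t \<partial>lborel) = of_real (2 * pi * g 0)"
    using density_at_0_inversion[OF L g] by (simp add: cL)
  then have g0: "g 0 > 0"
    using stable_cf_integral_pos[OF ab \<kappa> int] by (simp add: zero_less_mult_iff)
  obtain b where b: "b > 0" "emeasure L {b<..} > 0"
    using emeasure_greaterThan_0_witness[of L] density_greaterThan_0[OF L g g0] by auto
  define p where "p = measure L {b<..} / 2"
  have p: "p > 0" "measure L {b<..} > p" using b by (auto simp: p_def L.emeasure_eq_measure)
  have ev: "\<forall>\<^sub>F n in sequentially. emeasure (W.sum_law n) {b * c n<..} \<ge> ennreal p"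
    by (rule weak_limit_greaterThan[OF w L g c_pos p(2)])
  have "filterlim (\<lambda>n. b * c n) at_top sequentially"
    by (rule filterlim_tendsto_pos_mult_at_top[OF tendsto_const b(1) S.filterlim_c])
  then show "AE x in W.Q. \<exists>k. psum k x > 0"
    using ev p by (intro W.AE_exists_pos W.nonpos_law_tendsto_0[where \<epsilon> = "ennreal p"]) auto
  have "\<forall>\<^sub>F n in sequentially. emeasure (W.sum_law n) {b * c n<..} \<ge> ennreal p \<and> n \<ge> 1"
    using ev eventually_ge_at_top[of 1] by eventually_elim simp
  then obtain n where n: "emeasure (W.sum_law n) {b * c n<..} \<ge> ennreal p" "n \<ge> 1"
    by (auto dest: eventually_happens)
  have "emeasure ?F {0<..} > 0"
  proof (rule step_greaterThan_0)
    show "0 < emeasure (W.sum_law n) {b * c n<..}" using n p by (auto intro: less_le_trans[of _ "ennreal p"])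
    show "b * c n \<ge> 0" using b c_pos[OF n(2)] by simp
  qed
  then obtain a where a: "a > 0" "emeasure ?F {a<..} > 0"
    using emeasure_greaterThan_0_witness[of ?F] by auto
  have "emeasure ?F {a<..} \<le> emeasure ?F {a..}" by (intro emeasure_mono) auto
  then have "emeasure ?F {a..} > 0" using a by (auto intro: less_le_trans)
  then show "\<exists>a. walk_limit ?F c ?\<psi> \<kappa> \<alpha> (g 0) a"
    using a less_1 inv g0
    by (intro exI[of _ a] walk_limit.intro W.walk_law_axioms S.stable_norming_axioms walk_limit_axioms.intro char_sum_law)
qed

end

text \<open>The probability of \<tau>^- > n cancels between the conditional probability and the
  right side, so the quotient is the one in \<open>ratio_estimate\<close>. Uniformity over x \<le>
  \<delta>0 c n then suffices, because \<delta> n < \<delta>0 eventually.\<close>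

theorem theorem3:
  fixes M :: "'a measure" and X :: "nat \<Rightarrow> 'a \<Rightarrow> real"
    and c \<delta> :: "nat \<Rightarrow> real" and \<alpha> \<beta> \<kappa> \<Delta> :: real
    and L :: "real measure" and g :: "real \<Rightarrow> real"
  assumes "prob_space M"
    and "prob_space.indep_vars M (\<lambda>_. borel) X UNIV"
    and "\<And>i. distr M borel (X i) = distr M borel (X 0)"
    and "(\<alpha>, \<beta>) \<in> stable_params"
    and "norming_sequence (distr M borel (X 0)) c"
    and "in_class_D M X c \<alpha> \<beta> \<kappa> L"
    and "is_continuous_density L g"
    and "\<not> lattice_distribution (distr M borel (X 0))"
    and "\<Delta> > 0"
    and "\<And>n. n \<ge> 1 \<Longrightarrow> \<delta> n > 0"
    and "\<delta> \<longlonglongrightarrow> 0"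
  shows "(\<lambda>n. SUP x\<in>{0<..\<delta> n * c n}.
            ereal \<bar>(c n * \<P>(\<omega> in M. walk X n \<omega> \<in> {x..<x + \<Delta>} \<bar> tau_minus X \<omega> > enat n))
                   / (g 0 * (integral {x..x + \<Delta>} (renewal_function (distr M borel (chi_plus X)))
                             / (n * \<P>(\<omega> in M. tau_minus X \<omega> > enat n))))
                   - 1\<bar>) \<longlonglongrightarrow> 0"
    (is "?S \<longlonglongrightarrow> 0")
proof -
  interpret iid_walk M X
    using assms(1-3) by (intro iid_walk.intro iid_walk_axioms.intro)
  note data = walk_limit_data[OF assms(4-8)]
  obtain a where "walk_limit (distr M borel (X 0)) c (stable_cf \<alpha> \<beta> \<kappa>) \<kappa> \<alpha> (g 0) a"
    using data(1) by blast
  then interpret A: walk_limit "distr M borel (X 0)" c "stable_cf \<alpha> \<beta> \<kappa>" \<kappa> \<alpha> "g 0" a .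
  have H: "renewal_function (distr M borel (chi_plus X)) = A.H"
  proof
    fix u
    have "renewal_function W.height_law u \<ge> 0" "ennreal (renewal_function W.height_law u) = W.renewal u"
      using W.renewal_function_height_law[OF data(2) W.renewal_finite[OF A.a_pos A.up_prob]] by auto
    then have "renewal_function W.height_law u = enn2real (W.renewal u)" by (metis enn2real_ennreal)
    then show "renewal_function (distr M borel (chi_plus X)) u = A.H u"
      by (simp add: distr_chi_plus[OF data(2)] A.H_def)
  qed
  let ?e = "\<lambda>n x. \<bar>(c n * \<P>(\<omega> in M. walk X n \<omega> \<in> {x..<x + \<Delta>} \<bar> tau_minus X \<omega> > enat n))
                   / (g 0 * (integral {x..x + \<Delta>} (renewal_function (distr M borel (chi_plus X)))
                             / (n * \<P>(\<omega> in M. tau_minus X \<omega> > enat n))))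
                   - 1\<bar>"
  have e: "\<exists>\<delta>0>0. \<exists>N\<ge>1. \<forall>n\<ge>N. \<forall>x. 0 < x \<longrightarrow> x \<le> \<delta>0 * c n \<longrightarrow> ?e n x \<le> \<xi>" if \<xi>: "0 < \<xi>" "\<xi> < 1" for \<xi>
  proof -
    obtain \<delta>0 N where d: "\<delta>0 > 0" "N \<ge> 1" and est: "\<And>n x. n \<ge> N \<Longrightarrow> 0 < x \<Longrightarrow> x \<le> \<delta>0 * c n \<Longrightarrow>
      0 < integral {x..x + \<Delta>} A.H \<and> \<bar>c n * (real n * measure (W.ladder_law n) {x..<x + \<Delta>}) / (g 0 * integral {x..x + \<Delta>} A.H) - 1\<bar> \<le> \<xi>"
      using A.ratio_estimate[OF \<open>\<Delta> > 0\<close> \<xi>(1)] by blast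
    have "?e n x \<le> \<xi>" if n: "n \<ge> N" and x: "0 < x" "x \<le> \<delta>0 * c n" for n x
    proof -
      interpret u: finite_measure "W.ladder_law n" by (rule W.finite_ladder_law)
      let ?A = "measure (W.ladder_law n) {x..<x + \<Delta>}" and ?B = "measure (W.ladder_law n) UNIV"
        and ?I = "integral {x..x + \<Delta>} A.H"
      have bound: "0 < ?I" "\<bar>c n * (real n * ?A) / (g 0 * ?I) - 1\<bar> \<le> \<xi>" using est[OF n x] by auto
      \<comment> \<open>If it were 0, the quotient in \<open>bound\<close> would be 0 and its
        distance from 1 would exceed \<xi> < 1. Hence the conditioning event has positive
        probability and its cancellation is legitimate.\<close>
      have "?A \<noteq> 0" using bound(2) \<xi>(2) by auto
      then have "?A > 0" by (simp add: zero_less_measure_iff)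
      also have "?A \<le> ?B" by (intro u.finite_measure_mono) auto
      finally have B: "?B > 0" .
      have "n > 0" using n d by simp
      have "(c n * (?A / ?B)) / (g 0 * (?I / (real n * ?B))) = c n * (real n * ?A) / (g 0 * ?I)"
        using B bound(1) A.\<gamma>_pos \<open>n > 0\<close> by (simp add: field_simps)
      then have "?e n x = \<bar>c n * (real n * ?A) / (g 0 * ?I) - 1\<bar>"
        unfolding cond_prob_def by (simp only: prob_tau_minus prob_walk_tau_minus[OF atLeastLessThan_borel] H)
      then show ?thesis using bound(2) by (rule ord_eq_le_trans)
    qed
    then show ?thesis using d by blast
  qed
  show ?thesis
  proof (rule order_tendstoI)
    fix y :: ereal assume y: "y < 0"
    show "\<forall>\<^sub>F n in sequentially. y < ?S n"
      using eventually_ge_at_top[of 1]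
    proof eventually_elim
      case (elim n)
      \<comment> \<open>The range of x is nonempty, so the supremum is that of a nonempty set of
        nonnegative values and not the bottom of \<open>ereal\<close>.\<close>
      have "\<delta> n * c n \<in> {0<..\<delta> n * c n}" using assms(10)[OF elim] A.c_pos[OF elim] by simp
      then have "ereal (?e n (\<delta> n * c n)) \<le> ?S n" by (rule SUP_upper)
      then show ?case using y by (meson abs_ge_zero ereal_less_eq(5) less_le_trans)
    qed
  next
    fix y :: ereal assume "0 < y"
    \<comment> \<open>Capping y at 1 supplies the condition \<xi> < 1 of \<open>e\<close>.\<close>
    then obtain \<xi> where "0 < ereal \<xi>" "ereal \<xi> < min y 1" using ereal_dense2[of 0 "min y 1"] by auto
    then have \<xi>: "0 < \<xi>" "\<xi> < 1" "ereal \<xi> < y" by auto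
    obtain \<delta>0 N where d: "\<delta>0 > 0" "N \<ge> 1" and est: "\<And>n x. n \<ge> N \<Longrightarrow> 0 < x \<Longrightarrow> x \<le> \<delta>0 * c n \<Longrightarrow> ?e n x \<le> \<xi>"
      using e[OF \<xi>(1,2)] by blast
    have "\<forall>\<^sub>F n in sequentially. \<delta> n < \<delta>0" by (rule order_tendstoD(2)[OF assms(11) d(1)])
    then show "\<forall>\<^sub>F n in sequentially. ?S n < y"
      using eventually_ge_at_top[of N]
    proof eventually_elim
      case (elim n)
      have cn: "c n > 0" using elim d by (intro A.c_pos) simp
      have "?S n \<le> ereal \<xi>"
      proof (rule SUP_least)
        fix x assume "x \<in> {0<..\<delta> n * c n}"
        moreover have "\<delta> n * c n \<le> \<delta>0 * c n" using elim cn by (intro mult_right_mono) auto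
        ultimately show "ereal (?e n x) \<le> ereal \<xi>" using est[of n x] elim by simp
      qed
      then show ?case using \<xi>(3) by (rule le_less_trans)
    qed
  qed
qed

end
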